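(* Let $N\in(U_7)$ be a stratified submanifold (germ) of a symplectic space $(\mathbb R^{2n},\omega)$, with associated subspaces $W,\ell_1,\ell_2,V$ and invariants $Lt,L_2$. Then $N$ belongs to the class $(U_7)^i$ if and only if $(N,\omega)$ satisfies the corresponding condition: - $(U_7)^0$: $\omega|_V\ne0$; more precisely, for the part of the class given by $[\theta_1+c_1\theta_2+c_2\theta_3]_{U_7}$ with $c_1\neq0$: $\omega|_V\ne0$ and $\omega|_{\ell_1+\ell_2}\ne0$; for the part given by $[\theta_1+c_2\theta_3]_{U_7}$: $\omega|_V\neq0$ and $\omega|_{\ell_1+\ell_2}=0$. - $(U_7)^1$: $\omega|_W\neq 0$, $\omega|_V=0$ but $\ker\omega\ne\ell_2$. - $(U_7)^2$: $\omega|_V=0$ and $\ker\omega=\ell_2$. - $(U_7)^3$: $\omega|_W=0$ and $Lt=L_2=7$. - $(U_7)^4$: $\omega|_W=0$ and $Lt=L_2=8$. - $(U_7)^5$: $\omega|_W=0$, $Lt=10$ and $L_2=\infty$. - $(U_7)^6$: $\omega|_W=0$, $Lt=11$ and $L_2=\infty$. - $(U_7)^7$: $\omega|_W=0$ and $N$ is contained in a smooth Lagrangian submanifold.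
   Context: $U_7=\{x\in\mathbb R^{2n}: x_1^2+x_2x_3=x_1x_2+x_3^3=x_{\ge4}=0\}$, $2n\ge4$; $(U_7)$ is the class of germs at $0$ of subsets of the symplectic space that are images of $U_7$ under a germ of a diffeomorphism. Such $N$ is a union of a smooth branch $B_1$ and a singular branch $B_2$. Subspaces: $W$ is the tangent space at $0$ to a nonsingular $3$-manifold containing $N$; $\ell_1$ is the tangent line at $0$ to $B_1$; $\ell_2$ the tangent line at $0$ to $B_2$; $V$ the $2$-space tangent at $0$ to $B_2$. For $N=U_7$: $W=\mathrm{span}(\partial_{x_1},\partial_{x_2},\partial_{x_3})$, $\ell_1=\mathrm{span}(\partial_{x_2})$, $\ell_2=\mathrm{span}(\partial_{x_3})$, $V=\mathrm{span}(\partial_{x_1},\partial_{x_3})$ (for general $N$, transport by the differential of a diffeomorphism taking $U_7$ to $N$). $\ker\omega$ denotes the kernel of $\omega|_W$. Algebraic restrictions: two germs of $2$-forms $\omega,\tilde\omega$ have the same algebraic restriction to $N$, $[\omega]_N=[\tilde\omega]_N$, if $\omega-\tilde\omega=\alpha+d\beta$ with $\alpha$ a $2$-form and $\beta$ a $1$-form both vanishing at every point of $N$. $[\omega]_N$ and $[\tilde\omega]_{\tilde N}$ are diffeomorphic if there is a germ of a diffeomorphism $\Phi$ with $\Phi(\tilde N)=N$ and $[\Phi^*\omega]_{\tilde N}=[\tilde\omega]_{\tilde N}$. Forms: $\theta_1=dx_1\wedge dx_3$, $\theta_2=dx_2\wedge dx_3$, $\theta_3=dx_1\wedge dx_2$,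 $\theta_4=x_3dx_1\wedge dx_3$, $\theta_5=x_1dx_1\wedge dx_3$, $\theta_6=x_3^2dx_1\wedge dx_3$, $\theta_7=x_1x_3dx_1\wedge dx_3$. The class $(U_7)^i$ consists of those $N\in(U_7)$ such that $[\omega]_N$ is diffeomorphic to some member (for some real parameters and sign) of the normal form $[U_7]^i$: $[U_7]^0=[\theta_1+c_1\theta_2+c_2\theta_3]_{U_7}$; $[U_7]^1=[\pm\theta_2+c_1\theta_3+c_2\theta_4]_{U_7}$; $[U_7]^2=[\theta_3+c_1\theta_4+c_2\theta_5]_{U_7}$; $[U_7]^3=[\pm\theta_4+c\theta_5]_{U_7}$; $[U_7]^4=[\theta_5+c\theta_6]_{U_7}$; $[U_7]^5=[\theta_6+c\theta_7]_{U_7}$; $[U_7]^6=[\pm\theta_7]_{U_7}$; $[U_7]^7=[0]_{U_7}$. Lagrangian tangency orders: for a smooth Lagrangian submanifold germ $L$ with regular equations $H_1=\dots=H_n=0$, $t(f,L)$ is the minimum of the orders of vanishing at $0$ of $H_j\circ f$; $Lt=\max_L\min\{t(B_1,L),t(B_2,L)\}$, $L_2=\max_Lt(B_2,L)$, maxima over all smooth Lagrangian $L$. *)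

theory Defs
  imports "HOL-Analysis.Analysis" "HOL-Library.Extended_Nat" "HOL-Library.Numeral_Type"
begin

text \<open>
  The space \<open>\<real>\<^sup>2\<^sup>n\<close> is the type \<open>real ^ 'n bit0\<close> with \<open>n = CARD('n)\<close>. The index type
  \<open>'n bit0\<close> consists of the residues modulo \<open>2n\<close>, so \<open>x $ 1\<close>, \<open>x $ 2\<close>, \<open>x $ 3\<close> are the
  first three coordinates, and these are distinct when \<open>n \<ge> 2\<close>.

  Germs at \<open>0\<close> are represented by total functions or by sets; only their behaviour on
  some neighbourhood of \<open>0\<close> is constrained or used.
\<close>

type_synonym 'a form1 = "'a \<Rightarrow> 'a \<Rightarrow> real"
type_synonym 'a form2 = "'a \<Rightarrow> 'a \<Rightarrow> 'a \<Rightarrow> real"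


section \<open>Smooth maps and diffeomorphism germs\<close>

text \<open>\<open>C_k_on k S f\<close> is meant for open \<open>S\<close>.\<close>

primrec C_k_on ::
  "nat \<Rightarrow> 'a::euclidean_space set \<Rightarrow> ('a \<Rightarrow> 'b::real_normed_vector) \<Rightarrow> bool"
where
  "C_k_on 0 S f \<longleftrightarrow> continuous_on S f"
| "C_k_on (Suc k) S f \<longleftrightarrow>
     (\<forall>x\<in>S. f differentiable (at x)) \<and>
     (\<forall>v. C_k_on k S (\<lambda>x. frechet_derivative f (at x) v))"

definition smooth_on :: "'a::euclidean_space set \<Rightarrow> ('a \<Rightarrow> 'b::real_normed_vector) \<Rightarrow> bool" where
  "smooth_on S f \<longleftrightarrow> (\<forall>k. C_k_on k S f)"

definition diffeo_on :: "'a::euclidean_space set \<Rightarrow> ('a \<Rightarrow> 'a) \<Rightarrow> bool" where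
  "diffeo_on U \<Phi> \<longleftrightarrow> open U \<and> open (\<Phi> ` U) \<and> smooth_on U \<Phi> \<and>
     (\<exists>\<Psi>. smooth_on (\<Phi> ` U) \<Psi> \<and> (\<forall>x\<in>U. \<Psi> (\<Phi> x) = x))"

text \<open>
  \<open>\<Phi>\<close> is a diffeomorphism germ at \<open>0\<close> with \<open>\<Phi>(A) = B\<close> as set germs. The same \<open>U\<close> must
  serve both purposes, since \<open>\<Phi>\<close> is arbitrary away from \<open>0\<close>.
\<close>

definition diffeo_germ_onto ::
  "('a::euclidean_space \<Rightarrow> 'a) \<Rightarrow> 'a set \<Rightarrow> 'a set \<Rightarrow> bool" where
  "diffeo_germ_onto \<Phi> A B \<longleftrightarrow> \<Phi> 0 = 0 \<and>
     (\<exists>U. 0 \<in> U \<and> diffeo_on U \<Phi> \<and> \<Phi> ` (A \<inter> U) = B \<inter> \<Phi> ` U)"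


section \<open>Germs of differential forms\<close>

definition form1_germ :: "'a::euclidean_space form1 \<Rightarrow> bool" where
  "form1_germ \<beta> \<longleftrightarrow> (\<exists>U. open U \<and> 0 \<in> U \<and>
     (\<forall>x\<in>U. linear (\<beta> x)) \<and> (\<forall>u. smooth_on U (\<lambda>x. \<beta> x u)))"

definition form2_germ :: "'a::euclidean_space form2 \<Rightarrow> bool" where
  "form2_germ \<omega> \<longleftrightarrow> (\<exists>U. open U \<and> 0 \<in> U \<and>
     (\<forall>x\<in>U. bilinear (\<omega> x) \<and> (\<forall>u. \<omega> x u u = 0)) \<and>
     (\<forall>u v. smooth_on U (\<lambda>x. \<omega> x u v)))"

definition ext_d1 :: "'a::euclidean_space form1 \<Rightarrow> 'a form2" where
  "ext_d1 \<beta> x u v =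
     frechet_derivative (\<lambda>y. \<beta> y v) (at x) u - frechet_derivative (\<lambda>y. \<beta> y u) (at x) v"

definition ext_d2 :: "'a::euclidean_space form2 \<Rightarrow> 'a \<Rightarrow> 'a \<Rightarrow> 'a \<Rightarrow> 'a \<Rightarrow> real" where
  "ext_d2 \<omega> x u v w =
     frechet_derivative (\<lambda>y. \<omega> y v w) (at x) u
     - frechet_derivative (\<lambda>y. \<omega> y u w) (at x) v
     + frechet_derivative (\<lambda>y. \<omega> y u v) (at x) w"

definition pullback :: "('a::euclidean_space \<Rightarrow> 'a) \<Rightarrow> 'a form2 \<Rightarrow> 'a form2" where
  "pullback \<Phi> \<omega> x u v =
     \<omega> (\<Phi> x) (frechet_derivative \<Phi> (at x) u) (frechet_derivative \<Phi> (at x) v)"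

definition symplectic_germ :: "'a::euclidean_space form2 \<Rightarrow> bool" where
  "symplectic_germ \<omega> \<longleftrightarrow> form2_germ \<omega> \<and>
     (\<forall>\<^sub>F x in nhds 0. (\<forall>u v w. ext_d2 \<omega> x u v w = 0) \<and>
                     (\<forall>u. u \<noteq> 0 \<longrightarrow> (\<exists>v. \<omega> x u v \<noteq> 0)))"


section \<open>Algebraic restrictions\<close>

definition same_alg_restr ::
  "'a::euclidean_space set \<Rightarrow> 'a form2 \<Rightarrow> 'a form2 \<Rightarrow> bool" where
  "same_alg_restr N \<omega> \<omega>' \<longleftrightarrow> (\<exists>\<alpha> \<beta>. form2_germ \<alpha> \<and> form1_germ \<beta> \<and>
     (\<forall>\<^sub>F x in nhds 0.
        (x \<in> N \<longrightarrow> (\<forall>u v. \<alpha> x u v = 0) \<and> (\<forall>u. \<beta> x u = 0)) \<and>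
        (\<forall>u v. \<omega> x u v - \<omega>' x u v = \<alpha> x u v + ext_d1 \<beta> x u v)))"

definition diffeo_alg_restr ::
  "'a::euclidean_space form2 \<Rightarrow> 'a set \<Rightarrow> 'a form2 \<Rightarrow> 'a set \<Rightarrow> bool" where
  "diffeo_alg_restr \<omega> N \<omega>' N' \<longleftrightarrow>
     (\<exists>\<Phi>. diffeo_germ_onto \<Phi> N' N \<and> same_alg_restr N' (pullback \<Phi> \<omega>) \<omega>')"


section \<open>The singularity \<open>U\<^sub>7\<close> and its branches\<close>

definition U7 :: "(real ^ 'n::finite bit0) set" where
  "U7 = {x. (x $ 1)\<^sup>2 + x $ 2 * x $ 3 = 0 \<and> x $ 1 * x $ 2 + (x $ 3)^3 = 0 \<and>
            (\<forall>i. i \<notin> {1, 2, 3} \<longrightarrow> x $ i = 0)}"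

definition U7_germs :: "(real ^ 'n::finite bit0) set set" where
  "U7_germs = {N. \<exists>\<Phi>. diffeo_germ_onto \<Phi> U7 N}"

definition branch1 :: "real \<Rightarrow> real ^ 'n::finite bit0" where
  "branch1 t = (\<chi> i. if i = 2 then t else 0)"

definition branch2 :: "real \<Rightarrow> real ^ 'n::finite bit0" where
  "branch2 t = (\<chi> i. if i = 1 then t^4 else if i = 2 then - (t^5) else if i = 3 then t^3 else 0)"

lemma bit0_distinct_123:
  assumes "CARD('n::finite) \<ge> 2"
  shows "(1 :: 'n bit0) \<noteq> 2" "(1 :: 'n bit0) \<noteq> 3" "(2 :: 'n bit0) \<noteq> 3"
proof -
  have r: "Rep_bit0 (1::'n bit0) = 1" "Rep_bit0 (numeral k :: 'n bit0) = numeral k mod (2 * int CARD('n))" for k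
    using assms by (simp_all add: bit0.Rep_1 bit0.Rep_numeral)
  have m: "(2::int) mod (2 * int CARD('n)) = 2" "(3::int) mod (2 * int CARD('n)) = 3"
    using assms by (auto intro!: mod_pos_pos_trivial)
  show "(1 :: 'n bit0) \<noteq> 2" "(1 :: 'n bit0) \<noteq> 3" "(2 :: 'n bit0) \<noteq> 3"
    by (auto dest!: arg_cong[where f=Rep_bit0] simp: r m)
qed

lemma U7_eq_branches:
  assumes "CARD('n::finite) \<ge> 2"
  shows "(U7 :: (real ^ 'n bit0) set) = range branch1 \<union> range branch2"
proof -
  note d = bit0_distinct_123[OF assms] bit0_distinct_123[OF assms, symmetric]
  have "x \<in> range branch1 \<union> range branch2" if x: "x \<in> U7" for x :: "real ^ 'n bit0"
  proof -
    define a b c where "a = x $ 1" and "b = x $ 2" and "c = x $ 3"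
    have e: "a^2 + b*c = 0" "a*b + c^3 = 0" and z: "\<And>i. i \<noteq> 1 \<Longrightarrow> i \<noteq> 2 \<Longrightarrow> i \<noteq> 3 \<Longrightarrow> x $ i = 0"
      using x by (auto simp: U7_def a_def b_def c_def)
    show ?thesis
    proof (cases "c = 0")
      case True
      then have "a = 0" using e by simp
      then have "x = branch1 b"
        using True z by (auto simp: branch1_def vec_eq_iff a_def b_def c_def d) metis
      then show ?thesis by blast
    next
      case False
      have "a \<noteq> 0" using e False by auto
      define t where "t = a / c"
      have "a * a^2 = c^4" using e by algebra
      then have c: "t^3 = c" using False by (simp add: t_def field_simps power_numeral_reduce)
      have a: "t^4 = a" using c False by (simp add: t_def power_numeral_reduce)
      have "b * c = - (t^5) * c"
        using e(1) unfolding a[symmetric] c[symmetric] by algebra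
      then have b: "b = - (t^5)" using False mult_right_cancel[of c b "- (t^5)"] by blast
      have "x = branch2 t"
        using z by (auto simp: branch2_def vec_eq_iff d a c b[symmetric] a_def b_def c_def)
      then show ?thesis by blast
    qed
  qed
  moreover have "branch1 t \<in> (U7 :: (real ^ 'n bit0) set)" "branch2 t \<in> (U7 :: (real ^ 'n bit0) set)" for t
    using assms by (auto simp: U7_def branch1_def branch2_def d power_numeral_reduce)
  ultimately show ?thesis by blast
qed

text \<open>
  The subspaces \<open>W, \<ell>\<^sub>1, \<ell>\<^sub>2, V\<close> of \<open>N\<close> together with parametrizations \<open>f\<^sub>1, f\<^sub>2\<close> of its
  branches, transported from \<open>U\<^sub>7\<close> by a diffeomorphism germ.
\<close>

definition U7_data ::
  "(real ^ 'n::finite bit0) set \<Rightarrow> (real ^ 'n bit0) set \<Rightarrow> (real ^ 'n bit0) set \<Rightarrow>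
   (real ^ 'n bit0) set \<Rightarrow> (real ^ 'n bit0) set \<Rightarrow>
   (real \<Rightarrow> real ^ 'n bit0) \<Rightarrow> (real \<Rightarrow> real ^ 'n bit0) \<Rightarrow> bool" where
  "U7_data N W l1 l2 V f1 f2 \<longleftrightarrow> (\<exists>\<Phi>. diffeo_germ_onto \<Phi> U7 N \<and>
     W = frechet_derivative \<Phi> (at 0) ` span {axis 1 1, axis 2 1, axis 3 1} \<and>
     l1 = frechet_derivative \<Phi> (at 0) ` span {axis 2 1} \<and>
     l2 = frechet_derivative \<Phi> (at 0) ` span {axis 3 1} \<and>
     V = frechet_derivative \<Phi> (at 0) ` span {axis 1 1, axis 3 1} \<and>
     f1 = \<Phi> \<circ> branch1 \<and> f2 = \<Phi> \<circ> branch2)"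

definition zero_on :: "'a::euclidean_space form2 \<Rightarrow> 'a set \<Rightarrow> bool" where
  "zero_on \<omega> S \<longleftrightarrow> (\<forall>u\<in>S. \<forall>v\<in>S. \<omega> 0 u v = 0)"

definition kernel_on :: "'a::euclidean_space form2 \<Rightarrow> 'a set \<Rightarrow> 'a set" where
  "kernel_on \<omega> S = {u\<in>S. \<forall>v\<in>S. \<omega> 0 u v = 0}"


section \<open>Normal forms and the classes \<open>(U\<^sub>7)\<^sup>i\<close>\<close>

definition dxdx :: "'n bit0 \<Rightarrow> 'n bit0 \<Rightarrow> (real ^ 'n::finite bit0) \<Rightarrow> real ^ 'n bit0 \<Rightarrow> real" where
  "dxdx i j u v = u $ i * v $ j - u $ j * v $ i"

definition \<theta>1 :: "(real ^ 'n::finite bit0) form2" where "\<theta>1 x = dxdx 1 3"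
definition \<theta>2 :: "(real ^ 'n::finite bit0) form2" where "\<theta>2 x = dxdx 2 3"
definition \<theta>3 :: "(real ^ 'n::finite bit0) form2" where "\<theta>3 x = dxdx 1 2"
definition \<theta>4 :: "(real ^ 'n::finite bit0) form2" where "\<theta>4 x u v = x $ 3 * dxdx 1 3 u v"
definition \<theta>5 :: "(real ^ 'n::finite bit0) form2" where "\<theta>5 x u v = x $ 1 * dxdx 1 3 u v"
definition \<theta>6 :: "(real ^ 'n::finite bit0) form2" where "\<theta>6 x u v = (x $ 3)\<^sup>2 * dxdx 1 3 u v"
definition \<theta>7 :: "(real ^ 'n::finite bit0) form2" where "\<theta>7 x u v = x $ 1 * x $ 3 * dxdx 1 3 u v"

definition U7_germs_of ::
  "(real ^ 'n::finite bit0) form2 \<Rightarrow> (real ^ 'n bit0) form2 set \<Rightarrow> (real ^ 'n bit0) set set" where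
  "U7_germs_of \<omega> F = {N \<in> U7_germs. \<exists>\<theta>\<in>F. diffeo_alg_restr \<omega> N \<theta> U7}"

definition nf0 :: "real \<Rightarrow> real \<Rightarrow> (real ^ 'n::finite bit0) form2" where
  "nf0 c1 c2 x u v = \<theta>1 x u v + c1 * \<theta>2 x u v + c2 * \<theta>3 x u v"

definition normal_forms :: "(real ^ 'n::finite bit0) form2 set list" where
  "normal_forms =
    [{nf0 c1 c2 | c1 c2. True},
     {\<lambda>x u v. s * \<theta>2 x u v + c1 * \<theta>3 x u v + c2 * \<theta>4 x u v | s c1 c2. s \<in> {1, -1}},
     {\<lambda>x u v. \<theta>3 x u v + c1 * \<theta>4 x u v + c2 * \<theta>5 x u v | c1 c2. True},
     {\<lambda>x u v. s * \<theta>4 x u v + c * \<theta>5 x u v | s c. s \<in> {1, -1}},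
     {\<lambda>x u v. \<theta>5 x u v + c * \<theta>6 x u v | c. True},
     {\<lambda>x u v. \<theta>6 x u v + c * \<theta>7 x u v | c. True},
     {\<lambda>x u v. s * \<theta>7 x u v | s. s \<in> {1, -1}},
     {\<lambda>x u v. 0}]"

definition U7_class ::
  "(real ^ 'n::finite bit0) form2 \<Rightarrow> nat \<Rightarrow> (real ^ 'n bit0) set set" where
  "U7_class \<omega> i = U7_germs_of \<omega> (normal_forms ! i)"


section \<open>Lagrangian tangency orders\<close>

text \<open>
  \<open>H = (H\<^sub>1, \<dots>, H\<^sub>n)\<close> is a system of regular equations of the Lagrangian submanifold germ
  \<open>L = {H = 0}\<close>, whose tangent space at \<open>x \<in> L\<close> is the kernel of \<open>dH\<close> at \<open>x\<close>.
\<close>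

definition lagrangian_eqs ::
  "(real ^ 'n::finite bit0) form2 \<Rightarrow> (real ^ 'n bit0 \<Rightarrow> real ^ 'n) \<Rightarrow> bool" where
  "lagrangian_eqs \<omega> H \<longleftrightarrow> H 0 = 0 \<and>
     (\<exists>U. open U \<and> 0 \<in> U \<and> smooth_on U H \<and>
       (\<forall>x\<in>U. H x = 0 \<longrightarrow> surj (frechet_derivative H (at x)) \<and>
          (\<forall>u v. frechet_derivative H (at x) u = 0 \<longrightarrow> frechet_derivative H (at x) v = 0 \<longrightarrow>
             \<omega> x u v = 0)))"

definition in_lagrangian ::
  "(real ^ 'n::finite bit0) form2 \<Rightarrow> (real ^ 'n bit0) set \<Rightarrow> bool" where
  "in_lagrangian \<omega> N \<longleftrightarrow>
     (\<exists>H. lagrangian_eqs \<omega> H \<and> (\<forall>\<^sub>F x in nhds 0. x \<in> N \<longrightarrow> H x = 0))"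

text \<open>The order is \<open>\<infinity>\<close> (the infimum of the empty set) if all derivatives vanish at \<open>0\<close>.\<close>

definition vanishing_order :: "(real \<Rightarrow> real) \<Rightarrow> enat" where
  "vanishing_order g = Inf {enat k | k. (deriv ^^ k) g 0 \<noteq> 0}"

text \<open>\<open>t(f, L)\<close> for \<open>L = {H = 0}\<close>.\<close>

definition tangency_order ::
  "(real \<Rightarrow> real ^ 'n::finite bit0) \<Rightarrow> (real ^ 'n bit0 \<Rightarrow> real ^ 'n) \<Rightarrow> enat" where
  "tangency_order f H = Min (range (\<lambda>j. vanishing_order (\<lambda>t. H (f t) $ j)))"

definition is_max :: "'a::order set \<Rightarrow> 'a \<Rightarrow> bool" where
  "is_max S k \<longleftrightarrow> k \<in> S \<and> (\<forall>s\<in>S. s \<le> k)"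

text \<open>
  \<open>Lt_eq \<omega> f1 f2 k\<close> means \<open>Lt = k\<close> and \<open>L2_eq \<omega> f2 k\<close> means \<open>L\<^sub>2 = k\<close>. They are relations
  so that the maximum, also when it is \<open>\<infinity>\<close>, is required to be attained.
\<close>

definition Lt_eq ::
  "(real ^ 'n::finite bit0) form2 \<Rightarrow> (real \<Rightarrow> real ^ 'n bit0) \<Rightarrow> (real \<Rightarrow> real ^ 'n bit0) \<Rightarrow>
   enat \<Rightarrow> bool" where
  "Lt_eq \<omega> f1 f2 =
     is_max {min (tangency_order f1 H) (tangency_order f2 H) | H. lagrangian_eqs \<omega> H}"

definition L2_eq ::
  "(real ^ 'n::finite bit0) form2 \<Rightarrow> (real \<Rightarrow> real ^ 'n bit0) \<Rightarrow> enat \<Rightarrow> bool" where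
  "L2_eq \<omega> f2 = is_max {tangency_order f2 H | H. lagrangian_eqs \<omega> H}"

end

theory Submission
  imports Defs "HOL-Analysis.Analysis"
begin

text \<open>
 The relations \<open>df \<and> dx\<^sub>i\<close>, \<open>dg \<and> dx\<^sub>i\<close> given by the equations \<open>f = g = 0\<close> of \<open>U\<^sub>7\<close> reduce every closed two-form to a combination
 \<open>\<Theta>\<close> of \<open>\<theta>\<^sub>1, \<dots>, \<theta>\<^sub>7\<close>; rescaling the quasi-homogeneous coordinates by nonvanishing functions brings \<open>\<Theta>\<close> to normal form, and
 only the position of its first nonzero coefficient matters. That position is invariant: \<open>\<theta>\<^sub>1, \<theta>\<^sub>2, \<theta>\<^sub>3\<close> are seen by \<open>\<omega>\<close> at \<open>0\<close>,
 the rest by tangency orders. For upper bounds, \<open>\<omega>\<close> has a primitive of the order of \<open>H\<close> along a Lagrangian germ \<open>H = 0\<close>, and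
 one compares Taylor coefficients along \<open>t \<mapsto> (t\<^sup>4, - t\<^sup>5, t\<^sup>3)\<close>. For lower bounds, the Darboux--Givental theorem allows one to
 replace \<open>\<omega>\<close> by an explicit model.
\<close>

text \<open>The weights 4, 5, 3 of x1, x2, x3 make f and g quasi-homogeneous of degrees 8 and 9 and
  give \<theta>1, ..., \<theta>7 the weights 7, 8, 9, 10, 11, 13, 14. Most numerical constants are
  multiples of these weights, and their parity decides which signs can be scaled away. The orders 7,
  8, 10, 11 are those of x1 x3, x1^2, x1 x3^2, x1^2 x3 along B2, up to factors the x1-integrals of
  the coefficients of \<theta>4, ..., \<theta>7. As germs are only smooth, power series are replaced
  by Hadamard's lemma and truncation modulo an ideal, and Moser's method needs flows depending
  smoothly on the initial value. The symmetries of U7 are not determined. It suffices that they map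
  each branch to itself with a parameter change |s| <= K |t|, chosen pointwise, and that the
  existence of Lagrangian germs with given growth along the branches detects which coefficients
  vanish. Along B2 alone \<theta>6 and \<theta>7 are invisible, having primitives whose coefficients
  vanish on B2; hence L2 is infinite there, and the upper bounds for these coefficients use contact
  of order 3 with B1.\<close>

type_synonym 'n R2n = "real ^ 'n bit0"

abbreviation near0 :: "('a::{topological_space,zero} => bool) => bool" (binder "NEAR " 10)
 where "near0 P \<equiv> eventually P (nhds 0)"

abbreviation dd :: "('a::euclidean_space => 'b::real_normed_vector) => 'a => 'a => 'b" where
 "dd f x \<equiv> frechet_derivative f (at x)"

section \<open>Calculus of smooth functions\<close>

lemma C_k_on_continuous: "C_k_on k S f ==> continuous_on S f"
 by (cases k) (auto intro!: continuous_at_imp_continuous_on differentiable_imp_continuous_within)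

lemma C_k_on_has_derivative: "C_k_on (Suc k) S f ==> x \<in> S ==> (f has_derivative dd f x) (at x)"
 using frechet_derivative_works by auto

lemma C_k_on_Suc: "C_k_on (Suc k) S f ==> C_k_on k S f"
proof (induction k arbitrary: f)
 case 0
 then show ?case using C_k_on_continuous by (metis C_k_on.simps(1))
next
 case (Suc k)
 then show ?case by (subst C_k_on.simps(2)) auto
qed

lemma C_k_on_subset: "C_k_on k S f ==> T \<subseteq> S ==> C_k_on k T f"
 by (induction k arbitrary: f) (auto intro: continuous_on_subset)

lemma C_k_on_cong:
 assumes "open S" "!!x. x \<in> S ==> f x = g x" "C_k_on k S f"
 shows "C_k_on k S g"
 using assms(2,3)
proof (induction k arbitrary: f g)
 case 0
 then show ?case by (simp cong: continuous_on_cong)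
next
 case (Suc k)
 have d: "(g has_derivative dd f x) (at x)" if "x \<in> S" for x
  by (rule has_derivative_transform_within_open[OF C_k_on_has_derivative[OF Suc.prems(2) that]])
    (use that assms(1) Suc.prems in auto)
 then have e: "dd f x = dd g x" if "x \<in> S" for x
  using that frechet_derivative_at by metis
 have "C_k_on k S (%x. dd g x v)" for v
  by (rule Suc.IH[of "%x. dd f x v"]) (use Suc.prems e in auto)
 then show ?case using d by (auto simp: differentiable_def)
qed

text \<open>\<open>C_k_on\<close> speaks about the derivative selected by
  \<open>frechet_derivative\<close>; by uniqueness any derivative found by the calculus rules may
  take its place.\<close>

lemma C_k_on_SucI:
 assumes "open S" and d: "!!x. x \<in> S ==> (f has_derivative f' x) (at x)"
  and "!!v. C_k_on k S (%x. f' x v)"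
 shows "C_k_on (Suc k) S f"
proof -
 have "C_k_on k S (%x. dd f x v)" for v
  by (rule C_k_on_cong[OF assms(1) _ assms(3)[of v]]) (use frechet_derivative_at[OF d] in auto)
 then show ?thesis using d by (auto simp: differentiable_def)
qed

lemma C_k_on_const: "C_k_on k S (%x. c)"
 by (induction k arbitrary: c) (auto simp: frechet_derivative_const)

lemma C_k_on_bounded_linear:
 assumes "bounded_linear L" "open S" shows "C_k_on k S f ==> C_k_on k S (%x. L (f x))"
proof (induction k arbitrary: f)
 case 0
 then show ?case using bounded_linear.continuous_on[OF assms(1)] by auto
next
 case (Suc k)
 show ?case
  by (rule C_k_on_SucI[OF assms(2) bounded_linear.has_derivative[OF assms(1) C_k_on_has_derivative[OF Suc.prems]]])
    (use Suc in auto)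
qed

lemma C_k_on_ident: "open S ==> C_k_on k S (%x. x)"
 by (cases k) (auto intro!: C_k_on_SucI[where f'="%_ v. v"] C_k_on_const)

lemma C_k_on_add:
 assumes "open S" "C_k_on k S f" "C_k_on k S g"
 shows "C_k_on k S (%x. f x + g x)"
 using assms(2,3)
proof (induction k arbitrary: f g)
 case 0
 then show ?case by (auto intro: continuous_on_add)
next
 case (Suc k)
 show ?case
  by (rule C_k_on_SucI[OF assms(1) has_derivative_add[OF C_k_on_has_derivative[OF Suc.prems(1)] C_k_on_has_derivative[OF Suc.prems(2)]]])
    (use Suc in auto)
qed

lemma C_k_on_bilinear:
 assumes "bounded_bilinear h" "open S"
 shows "C_k_on k S f ==> C_k_on k S g ==> C_k_on k S (%x. h (f x) (g x))"
proof (induction k arbitrary: f g)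
 case 0
 then show ?case by (auto intro: bounded_bilinear.continuous_on[OF assms(1)])
next
 case (Suc k)
 note d = C_k_on_has_derivative[OF Suc.prems(1)] C_k_on_has_derivative[OF Suc.prems(2)]
 have "C_k_on k S (%x. dd f x v)" "C_k_on k S (%x. dd g x v)" for v
  using Suc.prems by auto
 then show ?case
  by (intro C_k_on_SucI[OF assms(2) bounded_bilinear.FDERIV[OF assms(1) d]] C_k_on_add[OF assms(2)]
    Suc.IH C_k_on_Suc[OF Suc.prems(1)] C_k_on_Suc[OF Suc.prems(2)])
qed

lemma C_k_on_sum:
 assumes "open S" "!!i. i \<in> I ==> C_k_on k S (f i)"
 shows "C_k_on k S (%x. \<Sum>i\<in>I. f i x)"
 using assms(2) by (induction I rule: infinite_finite_induct) (auto intro: C_k_on_add C_k_on_const assms(1))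

text \<open>The induction hypothesis concerns \<open>dd g\<close> in one fixed direction, whereas
  the chain rule evaluates it in the moving direction \<open>dd f x v\<close>. Expanding that
  direction in \<open>Basis\<close> turns the derivative into a sum of products to which the
  hypothesis applies.\<close>

lemma C_k_on_compose:
 fixes f :: "'a::euclidean_space => 'b::euclidean_space" and g :: "'b => 'c::real_normed_vector"
 assumes "open S" "open T" "C_k_on k S f" "C_k_on k T g" "!!x. x \<in> S ==> f x \<in> T"
 shows "C_k_on k S (%x. g (f x))"
 using assms(3,4)
proof (induction k arbitrary: g)
 case 0
 then show ?case using assms(5)
  by (auto intro!: continuous_on_compose2[of T g S f])
next
 case (Suc k)
 have d: "((%x. g (f x)) has_derivative (%v. \<Sum>b\<in>Basis. (dd f x v \<bullet> b) *\<^sub>R dd g (f x) b)) (at x)"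
  if x: "x \<in> S" for x
 proof -
  have 1: "(f has_derivative dd f x) (at x)" "(g has_derivative dd g (f x)) (at (f x))"
   using C_k_on_has_derivative Suc.prems assms(5) x by blast+
  have "linear (dd g (f x))" using 1(2) has_derivative_linear by blast
  then have "dd g (f x) (dd f x v) = (\<Sum>b\<in>Basis. (dd f x v \<bullet> b) *\<^sub>R dd g (f x) b)" for v
   by (subst euclidean_representation[of "dd f x v", symmetric]) (simp add: linear_sum linear_cmul)
  then show ?thesis using has_derivative_compose[OF 1] by simp
 qed
 show ?case
  using Suc.prems C_k_on_Suc[OF Suc.prems(1)]
  by (intro C_k_on_SucI[OF assms(1) d] C_k_on_sum assms(1)
     C_k_on_bilinear[OF bounded_bilinear_scaleR assms(1)] C_k_on_bounded_linear[OF bounded_linear_inner_left assms(1)]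
     Suc.IH[of "%y. dd g y _"])
    auto
qed

lemma smooth_on_imp_has_derivative: "smooth_on S f ==> x \<in> S ==> (f has_derivative dd f x) (at x)"
 unfolding smooth_on_def using C_k_on_has_derivative by blast

lemma smooth_on_imp_continuous: "smooth_on S f ==> continuous_on S f"
 unfolding smooth_on_def using C_k_on_continuous by blast

lemma smooth_on_dd: "smooth_on S f ==> smooth_on S (%x. dd f x v)"
 unfolding smooth_on_def using C_k_on.simps(2) by blast

lemma smooth_on_subset: "smooth_on S f ==> T \<subseteq> S ==> smooth_on T f"
 unfolding smooth_on_def using C_k_on_subset by blast

lemma smooth_on_cong: "open S ==> (!!x. x \<in> S ==> f x = g x) ==> smooth_on S f ==> smooth_on S g"
 unfolding smooth_on_def using C_k_on_cong by blast

lemma smooth_on_const: "smooth_on S (%x. c)"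
 by (simp add: smooth_on_def C_k_on_const)

lemma smooth_on_ident: "open S ==> smooth_on S (%x. x)"
 by (simp add: smooth_on_def C_k_on_ident)

lemma smooth_on_bounded_linear:
 "bounded_linear L ==> open S ==> smooth_on S f ==> smooth_on S (%x. L (f x))"
 by (simp add: smooth_on_def C_k_on_bounded_linear)

lemma smooth_on_linear: "linear (L :: 'a::euclidean_space => 'b::real_normed_vector) ==> open S ==> smooth_on S L"
 using smooth_on_bounded_linear[OF linear_conv_bounded_linear[THEN iffD1] _ smooth_on_ident] by blast

lemma smooth_on_bilinear:
 "bounded_bilinear h ==> open S ==> smooth_on S f ==> smooth_on S g ==> smooth_on S (%x. h (f x) (g x))"
 by (simp add: smooth_on_def C_k_on_bilinear)

lemma smooth_on_add: "open S ==> smooth_on S f ==> smooth_on S g ==> smooth_on S (%x. f x + g x)"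
 by (simp add: smooth_on_def C_k_on_add)

lemma smooth_on_minus: "open S ==> smooth_on S f ==> smooth_on S (%x. - f x)"
 using smooth_on_bounded_linear[OF bounded_linear_minus[OF bounded_linear_ident]] .

lemma smooth_on_sum: "open S ==> (!!i. i \<in> I ==> smooth_on S (f i)) ==> smooth_on S (%x. \<Sum>i\<in>I. f i x)"
 by (simp add: smooth_on_def C_k_on_sum)

lemmas smooth_on_mult = smooth_on_bilinear[OF bounded_bilinear_mult]
lemmas smooth_on_scaleR = smooth_on_bilinear[OF bounded_bilinear_scaleR]
lemmas smooth_on_inner = smooth_on_bilinear[OF bounded_bilinear_inner]

lemma smooth_on_power:
 fixes f :: "'a::euclidean_space => real"
 shows "open S ==> smooth_on S f ==> smooth_on S (%x. f x ^ n)"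
 by (induction n) (auto intro: smooth_on_mult smooth_on_const)

lemma smooth_on_compose:
 fixes f :: "'a::euclidean_space => 'b::euclidean_space"
 shows "open S ==> open T ==> smooth_on S f ==> smooth_on T g ==> (!!x. x \<in> S ==> f x \<in> T)
  ==> smooth_on S (%x. g (f x))"
 unfolding smooth_on_def using C_k_on_compose by blast

lemma smooth_on_componentwise:
 fixes f :: "'a::euclidean_space => 'b::euclidean_space"
 assumes "open S" "!!b. b \<in> Basis ==> smooth_on S (%x. f x \<bullet> b)"
 shows "smooth_on S f"
proof -
 have "smooth_on S (%x. \<Sum>b\<in>Basis. (f x \<bullet> b) *\<^sub>R b)"
  by (intro smooth_on_sum smooth_on_scaleR smooth_on_const assms)
 then show ?thesis by (simp add: euclidean_representation)
qed

text \<open>Clairaut: both mixed derivatives are limits of the same second difference quotient.\<close>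

lemma second_difference_mvt:
 fixes f :: "'a::euclidean_space => real"
 assumes S: "C_k_on 2 (ball x r) f" and s: "0 < s" "s * (norm u + norm v) < r"
 obtains y where "norm (y - x) \<le> s * (norm u + norm v)"
  "f (x + s *\<^sub>R u + s *\<^sub>R v) - f (x + s *\<^sub>R u) - f (x + s *\<^sub>R v) + f x = s * s * dd (%z. dd f z u) y v"
proof -
 have near: "norm (a *\<^sub>R u + b *\<^sub>R v) \<le> s * (norm u + norm v)" if "0 \<le> a" "a \<le> s" "0 \<le> b" "b \<le> s" for a b
 proof -
  have "norm (a *\<^sub>R u + b *\<^sub>R v) \<le> a * norm u + b * norm v"
   using norm_triangle_ineq[of "a *\<^sub>R u" "b *\<^sub>R v"] that by simp
  also have "\<dots> \<le> s * norm u + s * norm v" using that by (intro add_mono mult_right_mono) auto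
  finally show ?thesis by (simp add: algebra_simps)
 qed
 have inb: "x + a *\<^sub>R u + b *\<^sub>R v \<in> ball x r" if "0 \<le> a" "a \<le> s" "0 \<le> b" "b \<le> s" for a b
 proof -
  have "dist x (x + a *\<^sub>R u + b *\<^sub>R v) = norm (a *\<^sub>R u + b *\<^sub>R v)"
   by (metis add.assoc add_diff_cancel_left' dist_commute dist_norm)
  then show ?thesis using near[OF that] s by simp
 qed
 have S2: "C_k_on (Suc (Suc 0)) (ball x r) f" using S by (simp only: numeral_2_eq_2)
 have S1: "C_k_on (Suc 0) (ball x r) (%z. dd f z u)" using S2 by (metis C_k_on.simps(2))
 \<comment> \<open>Mean values are taken twice: of \<open>p\<close>, the increment in the direction
   v, as a function of the step along u, and of \<open>q\<close>, the derivative along u, as a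
   function of the step along v.\<close>
 define p where "p a = f (x + a *\<^sub>R u + s *\<^sub>R v) - f (x + a *\<^sub>R u)" for a
 have fd: "(f has_derivative dd f z) (at z)" if "z \<in> ball x r" for z
  using C_k_on_has_derivative[OF S2 that] .
 have gd: "((%z. dd f z u) has_derivative dd (%z. dd f z u) z) (at z)" if "z \<in> ball x r" for z
  using C_k_on_has_derivative[OF S1 that] .
 have dp: "(p has_real_derivative dd f (x + a *\<^sub>R u + s *\<^sub>R v) u - dd f (x + a *\<^sub>R u) u) (at a)"
  if "0 \<le> a" "a \<le> s" for a
 proof -
  have in1: "x + a *\<^sub>R u + s *\<^sub>R v \<in> ball x r" "x + a *\<^sub>R u \<in> ball x r"
   using inb[of a s] inb[of a 0] that s by auto
  have c: "((%a. x + a *\<^sub>R u + w) has_derivative (%h. h *\<^sub>R u)) (at a)" for w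
   by (auto intro!: derivative_eq_intros)
  have "(p has_derivative (%h. dd f (x + a *\<^sub>R u + s *\<^sub>R v) (h *\<^sub>R u) - dd f (x + a *\<^sub>R u) (h *\<^sub>R u))) (at a)"
   unfolding p_def using has_derivative_compose[OF c fd[OF in1(1)]] has_derivative_compose[OF c[of 0]] fd[OF in1(2)]
   by (intro has_derivative_diff) auto
  moreover have lin: "dd f z (h *\<^sub>R u) = h * dd f z u" if "z \<in> ball x r" for z h
   using linear_cmul[OF has_derivative_linear[OF fd[OF that]]] by simp
  have "(%h. dd f (x + a *\<^sub>R u + s *\<^sub>R v) (h *\<^sub>R u) - dd f (x + a *\<^sub>R u) (h *\<^sub>R u))
    = (*) (dd f (x + a *\<^sub>R u + s *\<^sub>R v) u - dd f (x + a *\<^sub>R u) u)"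
   by (rule ext) (simp only: lin[OF in1(1)] lin[OF in1(2)], simp add: algebra_simps)
  ultimately show ?thesis
   by (simp add: has_field_derivative_def)
 qed
 obtain a where a: "0 < a" "a < s" "p s - p 0 = (s - 0) * (dd f (x + a *\<^sub>R u + s *\<^sub>R v) u - dd f (x + a *\<^sub>R u) u)"
  using MVT2[of 0 s p "%a. dd f (x + a *\<^sub>R u + s *\<^sub>R v) u - dd f (x + a *\<^sub>R u) u"] dp s by auto
 define q where "q b = dd f (x + a *\<^sub>R u + b *\<^sub>R v) u" for b
 have dq: "(q has_real_derivative dd (%z. dd f z u) (x + a *\<^sub>R u + b *\<^sub>R v) v) (at b)" if "0 \<le> b" "b \<le> s" for b
 proof -
  have in1: "x + a *\<^sub>R u + b *\<^sub>R v \<in> ball x r" using inb[of a b] that a by auto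
  have c: "((%b. x + a *\<^sub>R u + b *\<^sub>R v) has_derivative (%h. h *\<^sub>R v)) (at b)"
   by (auto intro!: derivative_eq_intros)
  have "(%h. dd (%z. dd f z u) (x + a *\<^sub>R u + b *\<^sub>R v) (h *\<^sub>R v)) = (*) (dd (%z. dd f z u) (x + a *\<^sub>R u + b *\<^sub>R v) v)"
   using linear_cmul[OF has_derivative_linear[OF gd[OF in1]]] by (auto simp: fun_eq_iff)
  then show ?thesis
   using has_derivative_compose[OF c gd[OF in1]] by (simp add: has_field_derivative_def q_def[abs_def])
 qed
 obtain b where b: "0 < b" "b < s" "q s - q 0 = (s - 0) * dd (%z. dd f z u) (x + a *\<^sub>R u + b *\<^sub>R v) v"
  using MVT2[of 0 s q "%b. dd (%z. dd f z u) (x + a *\<^sub>R u + b *\<^sub>R v) v"] dq s by auto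
 show ?thesis
 proof
  show "norm (x + a *\<^sub>R u + b *\<^sub>R v - x) \<le> s * (norm u + norm v)"
   using near[of a b] a b by (simp add: algebra_simps)
  show "f (x + s *\<^sub>R u + s *\<^sub>R v) - f (x + s *\<^sub>R u) - f (x + s *\<^sub>R v) + f x
   = s * s * dd (%z. dd f z u) (x + a *\<^sub>R u + b *\<^sub>R v) v"
   using a(3) b(3) by (simp add: p_def q_def)
 qed
qed

lemma C_k_on_dd_commute:
 fixes f :: "'a::euclidean_space => real"
 assumes "open S" "C_k_on 2 S f" "x \<in> S"
 shows "dd (%z. dd f z u) x v = dd (%z. dd f z v) x u"
proof -
 obtain r where r: "r > 0" "ball x r \<subseteq> S" using assms openE by blast
 have S: "C_k_on 2 (ball x r) f" using C_k_on_subset assms(2) r(2) by blast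
 define Q where "Q u v s = (f (x + s *\<^sub>R u + s *\<^sub>R v) - f (x + s *\<^sub>R u) - f (x + s *\<^sub>R v) + f x) / (s * s)" for u v s
 have lim: "(Q u v \<longlongrightarrow> dd (%z. dd f z u) x v) (at_right 0)" for u v
 proof (rule tendstoI)
  fix e :: real assume "e > 0"
  define K where "K = norm u + norm v + 1"
  have K: "K > 0" "norm u + norm v \<le> K" by (auto simp: K_def intro: add_nonneg_pos)
  have "isCont (%y. dd (%z. dd f z u) y v) x"
   using S r(1) by (auto simp: numeral_2_eq_2 continuous_on_eq_continuous_at)
  then obtain d where d: "d > 0" "!!y. dist y x < d ==> dist (dd (%z. dd f z u) y v) (dd (%z. dd f z u) x v) < e"
   using \<open>e > 0\<close> unfolding continuous_at_eps_delta by blast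
  have ev: "eventually (%s. s < min d r / K) (at_right 0)"
   using d(1) r(1) K(1) by (intro eventually_at_right_less order_tendstoD(2)[OF tendsto_ident_at]) auto
  have "eventually (%s::real. 0 < s) (at_right 0)"
   by (simp add: eventually_at_right_less)
  with ev show "eventually (%s. dist (Q u v s) (dd (%z. dd f z u) x v) < e) (at_right 0)"
  proof eventually_elim
   case (elim s)
   have sK: "s * (norm u + norm v) \<le> s * K" using elim K by (simp add: mult_left_mono)
   have "s * K < r" "s * K < d" using elim K by (auto simp: pos_less_divide_eq)
   then have sr: "s * (norm u + norm v) < r" "s * (norm u + norm v) < d" using sK by auto
   obtain y where y: "norm (y - x) \<le> s * (norm u + norm v)"
    "f (x + s *\<^sub>R u + s *\<^sub>R v) - f (x + s *\<^sub>R u) - f (x + s *\<^sub>R v) + f x = s * s * dd (%z. dd f z u) y v"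
    using second_difference_mvt[OF S elim(2) sr(1)] by metis
   then have "Q u v s = dd (%z. dd f z u) y v" using elim by (simp add: Q_def)
   then show ?case using d(2)[of y] y(1) sr(2) by (simp add: dist_norm)
  qed
 qed
 have "Q v u = Q u v" by (simp add: Q_def fun_eq_iff add_ac)
 then show ?thesis using tendsto_unique[OF _ lim[of u v]] lim[of v u] trivial_limit_at_right_real by metis
qed

section \<open>Parameter integrals, inverses and smooth germs\<close>

text \<open>The open set T around [0, 1] is there because \<open>C_k_on\<close> is meant for open
  sets. The Leibniz rule wants the derivative as a continuous family of bounded linear maps,
  \<open>fx\<close>, whose continuity is tested on basis vectors.\<close>

lemma integral_has_derivative:
 fixes f :: "real \<times> 'a::euclidean_space => 'b::euclidean_space"
 assumes T: "open T" "{0..1} \<subseteq> T" and S: "open S" and f: "C_k_on (Suc k) (T \<times> S) f" and x: "x \<in> S"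
 shows "((%x. integral {0..1} (%s. f (s, x))) has_derivative (%v. integral {0..1} (%s. dd f (s, x) (0, v)))) (at x)"
proof -
 define fx where "fx x s = Blinfun (%v. dd f (s, x) (0, v))" for x s
 have d: "(f has_derivative dd f p) (at p)" if "p \<in> T \<times> S" for p
  using C_k_on_has_derivative[OF f that] .
 have bl: "bounded_linear (%v. dd f (s, x) (0, v))" if "s \<in> T" "x \<in> S" for s x
 proof -
  have "bounded_linear (%v::'a. (0::real, v))"
   by (intro bounded_linear_Pair bounded_linear_ident bounded_linear_zero)
  then show ?thesis
   using bounded_linear_compose[OF has_derivative_bounded_linear[OF d[of "(s, x)"]]] that by blast
 qed
 have fx: "blinfun_apply (fx x s) v = dd f (s, x) (0, v)" if "s \<in> T" "x \<in> S" for s x v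
  unfolding fx_def using bounded_linear_Blinfun_apply[OF bl[OF that]] by simp
 have cd: "continuous_on (T \<times> S) (%p. dd f p q)" for q
  using f C_k_on_continuous by (metis C_k_on.simps(2))
 have cfx: "continuous_on (S \<times> cbox 0 1) (%(x, s). fx x s)"
  unfolding split_beta
 proof (rule continuous_on_blinfun_componentwise)
  fix i :: 'a assume "i \<in> Basis"
  have "continuous_on (S \<times> cbox 0 1) (%p. dd f (snd p, fst p) (0, i))"
   by (rule continuous_on_compose2[OF cd, of _ "%p. (snd p, fst p)"]) (use T(2) in \<open>auto intro!: continuous_intros\<close>)
  then show "continuous_on (S \<times> cbox 0 1) (%p. blinfun_apply (fx (fst p) (snd p)) i)"
   by (rule continuous_on_eq) (use T(2) in \<open>auto simp: fx subset_eq\<close>)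
 qed
 obtain r where r: "r > 0" "ball x r \<subseteq> S" using S x openE by blast
 have "((%y. integral (cbox 0 1) (%s. f (s, y))) has_derivative integral (cbox 0 1) (fx x)) (at x within ball x r)"
 proof (rule leibniz_rule)
  fix y s assume y: "y \<in> ball x r" and s: "s \<in> cbox (0::real) 1"
  have 1: "((%y. (s, y)) has_derivative (%v. (0, v))) (at y within ball x r)"
   by (auto intro!: derivative_eq_intros)
  have m: "s \<in> T" "y \<in> S" using y s r T(2) by (auto simp: subset_iff)
  then have "((%y. f (s, y)) has_derivative (%v. dd f (s, y) (0, v))) (at y within ball x r)"
   by (intro has_derivative_compose[OF 1 d]) auto
  moreover have "blinfun_apply (fx y s) = (%v. dd f (s, y) (0, v))"
   using fx m by (auto simp: fun_eq_iff)
  ultimately show "((%y. f (s, y)) has_derivative blinfun_apply (fx y s)) (at y within ball x r)" by simp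
 next
  fix y assume y: "y \<in> ball x r"
  have "continuous_on {0..1} (%s. f (s, y))"
   by (rule continuous_on_compose2[OF C_k_on_continuous[OF f], of _ "%s. (s, y)"])
     (use y r T(2) in \<open>auto intro!: continuous_intros\<close>)
  then show "(%s. f (s, y)) integrable_on cbox 0 1" by (simp add: integrable_continuous_real)
 next
  show "continuous_on (ball x r \<times> cbox 0 1) (%(x, s). fx x s)"
   using continuous_on_subset[OF cfx] r(2) by (simp add: Sigma_mono)
 qed (use r in auto)
 then have 1: "((%y. integral {0..1} (%s. f (s, y))) has_derivative integral {0..1} (fx x)) (at x)"
  using r(1) at_within_open[of x "ball x r"] by simp
 have "continuous_on {0..1} (fx x)"
 proof -
  have "continuous_on {0..1} (%s. (x, s))" by (intro continuous_intros)
  then show ?thesis using continuous_on_compose2[OF cfx, of "{0..1}" "%s. (x, s)"] x by auto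
 qed
 then have int: "fx x integrable_on {0..1}" by (rule integrable_continuous_real)
 have "blinfun_apply (integral {0..1} (fx x)) v = integral {0..1} (%s. dd f (s, x) (0, v))" for v
 proof -
  have "blinfun_apply (integral {0..1} (fx x)) v = integral {0..1} (%s. blinfun_apply (fx x s) v)"
   using integral_linear[OF int blinfun.bounded_linear_left[of v]] by (simp add: o_def)
  also have "\<dots> = integral {0..1} (%s. dd f (s, x) (0, v))"
   by (rule integral_cong) (use fx x T(2) in auto)
  finally show ?thesis .
 qed
 then show ?thesis using 1 by presburger
qed

lemma C_k_on_integral:
 fixes f :: "real \<times> 'a::euclidean_space => 'b::euclidean_space"
 assumes T: "open T" "{0..1} \<subseteq> T" and S: "open S"
 shows "C_k_on k (T \<times> S) f ==> C_k_on k S (%x. integral {0..1} (%s. f (s, x)))"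
proof (induction k arbitrary: f)
 case 0
 have "continuous_on (S \<times> cbox 0 1) (%(x, s). f (s, x))"
  unfolding split_beta
  by (rule continuous_on_compose2[of "T \<times> S" f _ "%p. (snd p, fst p)"])
    (use 0 T(2) in \<open>auto intro!: continuous_intros\<close>)
 from integral_continuous_on_param[OF this] show ?case by simp
next
 case (Suc k)
 show ?case
 proof (rule C_k_on_SucI[OF S integral_has_derivative[OF T S Suc.prems]])
  show "C_k_on k S (%x. integral {0..1} (%s. dd f (s, x) (0, v)))" for v
   using Suc.IH[of "%p. dd f p (0, v)"] Suc.prems by simp
 qed
qed

lemma smooth_on_integral:
 fixes f :: "real \<times> 'a::euclidean_space => 'b::euclidean_space"
 assumes "open T" "{0..1} \<subseteq> T" "open S" "smooth_on (T \<times> S) f"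
 shows "smooth_on S (%x. integral {0..1} (%s. f (s, x)))"
 using assms C_k_on_integral unfolding smooth_on_def by blast

text \<open>At a zero of one factor the product rule asks only for continuity of the other. This
  differentiates families of inverse maps, whose differentiability is not yet known.\<close>

lemma has_derivative_scaleR_continuous:
 fixes \<phi> :: "'a::euclidean_space => real" and \<psi> :: "'a => 'b::real_normed_vector"
 assumes d: "(\<phi> has_derivative \<phi>') (at x)" and "\<phi> x = 0" and c: "isCont \<psi> x"
 shows "((%y. \<phi> y *\<^sub>R \<psi> y) has_derivative (%h. \<phi>' h *\<^sub>R \<psi> x)) (at x)"
proof -
 obtain K where K: "!!h. norm (\<phi>' h) \<le> norm h * K" using bounded_linear.bounded[OF has_derivative_bounded_linear[OF d]] by blast
 have l: "((%h. norm (\<phi> (x + h) - \<phi> x - \<phi>' h) / norm h) \<longlongrightarrow> 0) (at 0)"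
  using d by (simp add: has_derivative_at)
 have c0: "((%h. \<psi> (x + h)) \<longlongrightarrow> \<psi> x) (at 0)"
  using c by (simp add: isCont_def LIM_offset_zero_iff)
 then have c1: "((%h. norm (\<psi> (x + h) - \<psi> x)) \<longlongrightarrow> 0) (at 0)"
  using tendsto_norm_zero[OF LIM_zero] by blast
 have l2: "((%h. norm (\<phi> (x + h) - \<phi> x - \<phi>' h) / norm h * norm (\<psi> (x + h)) + K * norm (\<psi> (x + h) - \<psi> x)) \<longlongrightarrow> 0 * norm (\<psi> x) + K * 0) (at 0)"
  by (intro tendsto_intros l c0 c1)
 have "((%h. norm (\<phi> (x + h) *\<^sub>R \<psi> (x + h) - \<phi> x *\<^sub>R \<psi> x - \<phi>' h *\<^sub>R \<psi> x) / norm h) \<longlongrightarrow> 0) (at 0)"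
 proof (rule Lim_null_comparison)
  show "((%h. norm (\<phi> (x + h) - \<phi> x - \<phi>' h) / norm h * norm (\<psi> (x + h)) + K * norm (\<psi> (x + h) - \<psi> x)) \<longlongrightarrow> 0) (at 0)"
   using l2 by simp
  have "norm (\<phi> (x + h) *\<^sub>R \<psi> (x + h) - \<phi> x *\<^sub>R \<psi> x - \<phi>' h *\<^sub>R \<psi> x) / norm h
   \<le> norm (\<phi> (x + h) - \<phi> x - \<phi>' h) / norm h * norm (\<psi> (x + h)) + K * norm (\<psi> (x + h) - \<psi> x)" if "h \<noteq> 0" for h
  proof -
   have "\<phi> (x + h) *\<^sub>R \<psi> (x + h) - \<phi> x *\<^sub>R \<psi> x - \<phi>' h *\<^sub>R \<psi> x
    = (\<phi> (x + h) - \<phi> x - \<phi>' h) *\<^sub>R \<psi> (x + h) + \<phi>' h *\<^sub>R (\<psi> (x + h) - \<psi> x)"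
    using assms(2) by (simp add: algebra_simps)
   then have "norm (\<phi> (x + h) *\<^sub>R \<psi> (x + h) - \<phi> x *\<^sub>R \<psi> x - \<phi>' h *\<^sub>R \<psi> x)
    \<le> norm (\<phi> (x + h) - \<phi> x - \<phi>' h) * norm (\<psi> (x + h)) + norm (\<phi>' h) * norm (\<psi> (x + h) - \<psi> x)"
    using norm_triangle_ineq by (metis norm_scaleR real_norm_def)
   also have "\<dots> \<le> norm (\<phi> (x + h) - \<phi> x - \<phi>' h) * norm (\<psi> (x + h)) + (norm h * K) * norm (\<psi> (x + h) - \<psi> x)"
    by (intro add_left_mono mult_right_mono K) auto
   finally show ?thesis using that by (simp add: field_simps)
  qed
  then show "eventually (%h. norm (norm (\<phi> (x + h) *\<^sub>R \<psi> (x + h) - \<phi> x *\<^sub>R \<psi> x - \<phi>' h *\<^sub>R \<psi> x) / norm h)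
   \<le> norm (\<phi> (x + h) - \<phi> x - \<phi>' h) / norm h * norm (\<psi> (x + h)) + K * norm (\<psi> (x + h) - \<psi> x)) (at 0)"
   by (auto simp: eventually_at_filter)
 qed
 moreover have "bounded_linear (%h. \<phi>' h *\<^sub>R \<psi> x)"
  using bounded_linear_compose[OF bounded_linear_scaleR_left has_derivative_bounded_linear[OF d]] .
 ultimately show ?thesis by (simp add: has_derivative_at)
qed

section \<open>Families of linear maps and their inverses\<close>

lemma linear_inverse:
 assumes "linear A" "!!v. B (A v) = v" "!!v. A (B v) = v"
 shows "linear B"
proof (rule linearI)
 show "B (x + y) = B x + B y" for x y
  using linear_add[OF assms(1), of "B x" "B y"] assms(2)[of "B x + B y"] by (simp add: assms(3))
 show "B (c *\<^sub>R x) = c *\<^sub>R B x" for c x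
  using linear_cmul[OF assms(1), of c "B x"] assms(2)[of "c *\<^sub>R B x"] by (simp add: assms(3))
qed

lemma linear_expand:
 fixes A :: "'b::euclidean_space => 'c::real_vector"
 assumes "linear A" shows "A v = (\<Sum>b\<in>Basis. (v \<bullet> b) *\<^sub>R A b)"
 by (subst euclidean_representation[of v, symmetric]) (simp only: linear_sum[OF assms] linear_cmul[OF assms])

lemma linear_norm_le:
 fixes A :: "'b::euclidean_space => 'c::real_normed_vector"
 assumes "linear A" "!!b. b \<in> Basis ==> norm (A b) \<le> M b"
 shows "norm (A v) \<le> sum M Basis * norm v"
proof -
 have "norm (A v) \<le> (\<Sum>b\<in>Basis. norm ((v \<bullet> b) *\<^sub>R A b))"
  using linear_expand[OF assms(1), of v] norm_sum by metis
 also have "\<dots> \<le> (\<Sum>b\<in>Basis. norm v * M b)"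
  using assms(2) by (intro sum_mono) (auto intro!: mult_mono simp: Basis_le_norm)
 finally show ?thesis by (simp add: sum_distrib_left sum_distrib_right mult.commute)
qed

text \<open>Families of linear maps are kept as functions of two arguments. Their regularity is that
  of their values on fixed vectors and passes to moving vectors by expansion in
  \<open>Basis\<close>.\<close>

lemma C_k_on_linear_apply:
 fixes A :: "'a::euclidean_space => 'b::euclidean_space => 'c::real_normed_vector"
 assumes "open S" "!!x. x \<in> S ==> linear (A x)" "!!b. C_k_on k S (%x. A x b)" "C_k_on k S z"
 shows "C_k_on k S (%x. A x (z x))"
proof -
 have "C_k_on k S (%x. \<Sum>b\<in>Basis. (z x \<bullet> b) *\<^sub>R A x b)"
  by (intro C_k_on_sum assms C_k_on_bilinear[OF bounded_bilinear_scaleR] C_k_on_bounded_linear[OF bounded_linear_inner_left])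
 then show ?thesis
  by (rule C_k_on_cong[OF assms(1), rotated]) (use linear_expand[OF assms(2)] in metis)
qed

lemma smooth_on_linear_apply:
 fixes A :: "'a::euclidean_space => 'b::euclidean_space => 'c::real_normed_vector"
 assumes "open S" "!!x. x \<in> S ==> linear (A x)" "!!b. smooth_on S (%x. A x b)" "smooth_on S z"
 shows "smooth_on S (%x. A x (z x))"
 using assms C_k_on_linear_apply unfolding smooth_on_def by blast

text \<open>If |B x| <= K, every y with |A y - A x| < 1/(2K) satisfies |B y| <= 2K, and B y - B x =
  B y (A x - A y) B x then tends to 0.\<close>

lemma continuous_on_inverse_family:
 fixes A B :: "'a::euclidean_space => 'b::euclidean_space => 'b"
 assumes S: "open S" and lin: "!!x. x \<in> S ==> linear (A x)"
  and inv: "!!x v. x \<in> S ==> B x (A x v) = v" "!!x v. x \<in> S ==> A x (B x v) = v"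
  and cont: "!!v. continuous_on S (%x. A x v)"
 shows "continuous_on S (%x. B x v)"
proof -
 have linB: "linear (B x)" if "x \<in> S" for x
  using linear_inverse[of "A x" "B x"] lin inv that by blast
 have "isCont (%x. B x v) x" if x: "x \<in> S" for x
 proof -
  obtain K where K: "K > 0" "!!u. norm (B x u) \<le> K * norm u"
   using linear_bounded_pos[OF linB[OF x]] by auto
  have tb: "((%y. A y w) \<longlongrightarrow> A x w) (at x)" for w
   using cont S x by (auto simp: continuous_on_eq_continuous_at isCont_def)
  define E where "E y = (\<Sum>b\<in>Basis. norm (A y b - A x b))" for y
  have "(E \<longlongrightarrow> (\<Sum>b\<in>(Basis::'b set). 0)) (at x)"
   unfolding E_def by (intro tendsto_sum tendsto_norm_zero LIM_zero tb)
  then have "(E \<longlongrightarrow> 0) (at x)" by simp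
  then have evE: "eventually (%y. E y < 1 / (2 * K)) (at x)"
   using K by (intro order_tendstoD) auto
  have Ebd: "norm (A y u - A x u) \<le> E y * norm u" if "y \<in> S" for y u
   unfolding E_def by (rule linear_norm_le[OF linear_compose_sub[OF lin[OF that] lin[OF x]]]) simp
  have evS: "eventually (%y. y \<in> S) (at x)" using S x by (rule eventually_at_in_open')
  have "((%y. B y v - B x v) \<longlongrightarrow> 0) (at x)"
  proof (rule Lim_null_comparison)
   show "eventually (%y. norm (B y v - B x v) \<le> 2 * K * norm (A x (B x v) - A y (B x v))) (at x)"
    using evE evS
   proof eventually_elim
    case (elim y)
    have bd: "norm (B y w) \<le> 2 * K * norm w" for w
    proof -
     define u where "u = B y w"
     have w: "A y u = w" using inv elim by (simp add: u_def)
     have "norm u = norm (B x (A x u))" using inv x by simp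
     also have "\<dots> \<le> K * norm (A x u)" by (rule K)
     also have "norm (A x u) \<le> norm w + norm (A y u - A x u)"
      using norm_triangle_ineq4[of w "A y u - A x u"] w by simp
     also have "norm (A y u - A x u) \<le> 1 / (2 * K) * norm u"
      using Ebd[OF elim(2), of u] mult_right_mono[OF less_imp_le[OF elim(1)] norm_ge_zero[of u]] by linarith
     finally show ?thesis using K by (simp add: u_def algebra_simps)
    qed
    have "B y v - B x v = B y (A x (B x v) - A y (B x v))"
     using linear_diff[OF linB[OF elim(2)]] inv x elim(2) by simp
    then show ?case using bd by metis
   qed
   have "((%y. 2 * K * norm (A x (B x v) - A y (B x v))) \<longlongrightarrow> 2 * K * norm (A x (B x v) - A x (B x v))) (at x)"
    by (intro tendsto_intros tb)
   then show "((%y. 2 * K * norm (A x (B x v) - A y (B x v))) \<longlongrightarrow> 0) (at x)" by simp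
  qed
  then show ?thesis by (simp add: isCont_def LIM_zero_iff)
 qed
 then show ?thesis by (simp add: continuous_at_imp_continuous_on)
qed

text \<open>The derivative of the inverse is - B A' B, where B occurs only with the regularity
  already established; so one order is gained per induction step.\<close>

lemma C_k_on_inverse_family:
 fixes A B :: "'a::euclidean_space => 'b::euclidean_space => 'b"
 assumes S: "open S" and lin: "!!x. x \<in> S ==> linear (A x)"
  and inv: "!!x v. x \<in> S ==> B x (A x v) = v" "!!x v. x \<in> S ==> A x (B x v) = v"
 shows "(!!v. C_k_on k S (%x. A x v)) ==> C_k_on k S (%x. B x v)"
proof (induction k arbitrary: v)
 case 0
 then show ?case using continuous_on_inverse_family[of S A B v] S lin inv by auto
next
 case (Suc k)
 have linB: "linear (B x)" if "x \<in> S" for x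
  using linear_inverse[of "A x" "B x"] lin inv that by blast
 have cB: "isCont (%x. B x w) x" if "x \<in> S" for x w
 proof -
  have "continuous_on S (%x. B x w)"
   by (rule continuous_on_inverse_family[of S A B w, OF S]) (use lin inv C_k_on_continuous[OF Suc.prems] in auto)
  then show ?thesis using that S by (simp add: continuous_on_eq_continuous_at)
 qed
 have AD: "((%y. A y w) has_derivative dd (%y. A y w) x) (at x)" if "x \<in> S" for x w
  using C_k_on_has_derivative[OF Suc.prems that] .
 have Adlin: "dd (%y. A y w) x h = (\<Sum>b\<in>Basis. (w \<bullet> b) *\<^sub>R dd (%y. A y b) x h)" if x: "x \<in> S" for x w h
 proof -
  have "((%y. \<Sum>b\<in>Basis. (w \<bullet> b) *\<^sub>R A y b) has_derivative (%h. \<Sum>b\<in>Basis. (w \<bullet> b) *\<^sub>R dd (%y. A y b) x h)) (at x)"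
   by (intro has_derivative_sum has_derivative_scaleR_right AD x)
  then have "((%y. A y w) has_derivative (%h. \<Sum>b\<in>Basis. (w \<bullet> b) *\<^sub>R dd (%y. A y b) x h)) (at x)"
   by (rule has_derivative_transform_within_open[OF _ S x]) (use linear_expand[OF lin] in metis)
  then show ?thesis using has_derivative_unique[OF AD[OF x]] by metis
 qed
 define D where "D x h = - B x (\<Sum>b\<in>Basis. (B x v \<bullet> b) *\<^sub>R dd (%y. A y b) x h)" for x h
 \<comment> \<open>B y v - B x v = B y (A x w - A y w) with w = B x v; in coordinates every summand
   is a scalar vanishing at x times a continuous vector.\<close>
 have der: "((%y. B y v) has_derivative D x) (at x)" if x: "x \<in> S" for x
 proof -
  define w where "w = B x v"
  define \<phi> where "\<phi> b y = (A x w - A y w) \<bullet> b" for b y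
  have p: "(\<phi> b has_derivative (%h. - dd (%y. A y w) x h \<bullet> b)) (at x)" for b
   unfolding \<phi>_def by (auto intro!: derivative_eq_intros AD x)
  have "((%y. \<Sum>b\<in>Basis. \<phi> b y *\<^sub>R B y b) has_derivative (%h. \<Sum>b\<in>Basis. (- dd (%y. A y w) x h \<bullet> b) *\<^sub>R B x b)) (at x)"
   by (intro has_derivative_sum has_derivative_scaleR_continuous p cB x) (simp add: \<phi>_def)
  moreover have "(\<Sum>b\<in>Basis. (- dd (%y. A y w) x h \<bullet> b) *\<^sub>R B x b) = D x h" for h
   using linear_expand[OF linB[OF x], of "- dd (%y. A y w) x h"] Adlin[OF x, of w h] linear_neg[OF linB[OF x]]
   by (simp add: D_def w_def)
  ultimately have "((%y. \<Sum>b\<in>Basis. \<phi> b y *\<^sub>R B y b) has_derivative D x) (at x)" by simp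
  then have "((%y. B x v + (\<Sum>b\<in>Basis. \<phi> b y *\<^sub>R B y b)) has_derivative D x) (at x)"
   using has_derivative_add[OF has_derivative_const] by fastforce
  then show ?thesis
  proof (rule has_derivative_transform_within_open[OF _ S x])
   fix y assume y: "y \<in> S"
   have "(\<Sum>b\<in>Basis. \<phi> b y *\<^sub>R B y b) = B y (A x w - A y w)"
    unfolding \<phi>_def using linear_expand[OF linB[OF y]] by metis
   also have "\<dots> = B y v - B x v"
    using linear_diff[OF linB[OF y]] inv x y by (simp add: w_def)
   finally show "B x v + (\<Sum>b\<in>Basis. \<phi> b y *\<^sub>R B y b) = B y v" by simp
  qed
 qed
 have IH: "C_k_on k S (%x. B x w)" for w
  using Suc.IH[OF C_k_on_Suc[OF Suc.prems]] .
 have "C_k_on k S (%x. D x h)" for h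
  unfolding D_def using Suc.prems
  by (intro C_k_on_bounded_linear[OF bounded_linear_minus[OF bounded_linear_ident] S]
    C_k_on_linear_apply[OF S linB IH] C_k_on_sum[OF S] C_k_on_bilinear[OF bounded_bilinear_scaleR S]
    C_k_on_bounded_linear[OF bounded_linear_inner_left S] IH) auto
 then show ?case by (intro C_k_on_SucI[OF S der])
qed

lemma smooth_on_inverse_family:
 fixes A B :: "'a::euclidean_space => 'b::euclidean_space => 'b"
 assumes "open S" "!!x. x \<in> S ==> linear (A x)"
  "!!x v. x \<in> S ==> B x (A x v) = v" "!!x v. x \<in> S ==> A x (B x v) = v"
  "!!v. smooth_on S (%x. A x v)"
 shows "smooth_on S (%x. B x v)"
 using assms C_k_on_inverse_family[of S A B] unfolding smooth_on_def by blast

text \<open>The inverse function theorem yields a differentiable inverse g with dg = (df o g)^-1, so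
  g is of class C^(k+1) once it is of class C^k.\<close>

lemma smooth_inverse_function:
 fixes f :: "'a::euclidean_space => 'a"
 assumes U: "open U" "x0 \<in> U" and f: "smooth_on U f" and inj: "inj (dd f x0)"
 obtains U' g where "open U'" "x0 \<in> U'" "U' \<subseteq> U" "open (f ` U')" "smooth_on (f ` U') g"
  "!!x. x \<in> U' ==> g (f x) = x" "!!x. x \<in> U' ==> bij (dd f x)"
proof -
 have d: "(f has_derivative dd f x) (at x)" if "x \<in> U" for x
  using smooth_on_imp_has_derivative[OF f that] .
 define f' where "f' x = Blinfun (dd f x)" for x
 have f': "blinfun_apply (f' x) = dd f x" if "x \<in> U" for x
  unfolding f'_def using bounded_linear_Blinfun_apply[OF has_derivative_bounded_linear[OF d[OF that]]] .
 have cf': "continuous_on U f'"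
 proof (rule continuous_on_blinfun_componentwise)
  fix i :: 'a
  have "continuous_on U (%x. dd f x i)" using smooth_on_imp_continuous[OF smooth_on_dd[OF f]] .
  then show "continuous_on U (%x. blinfun_apply (f' x) i)" by (rule continuous_on_eq) (simp add: f')
 qed
 have lin0: "linear (dd f x0)" using has_derivative_linear[OF d[OF U(2)]] .
 obtain h where h: "linear h" "h \<circ> dd f x0 = id" using linear_injective_left_inverse[OF lin0 inj] by blast
 have hb: "blinfun_apply (Blinfun h) = h" using h(1) by (simp add: bounded_linear_Blinfun_apply linear_conv_bounded_linear)
 have inv: "Blinfun h o\<^sub>L f' x0 = id_blinfun"
  by (rule blinfun_eqI) (use h(2) hb f' U in \<open>simp add: fun_eq_iff\<close>)
 have fd: "(f has_derivative blinfun_apply (f' x)) (at x)" if "x \<in> U" for x using d f' that by simp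
 obtain U' V g g' where *: "open U'" "U' \<subseteq> U" "x0 \<in> U'" "open V" "f x0 \<in> V" "homeomorphism U' V f g"
  "!!y. y \<in> V ==> (g has_derivative (g' y)) (at y)"
  "!!y. y \<in> V ==> g' y = inv (blinfun_apply (f'(g y)))"
  "!!y. y \<in> V ==> bij (blinfun_apply (f'(g y)))"
  using inverse_function_theorem[OF U(1) fd cf' U(2) inv] by metis
 have V: "f ` U' = V" "g ` V = U'" "continuous_on V g" "!!x. x \<in> U' ==> g (f x) = x"
  using *(6) by (auto simp: homeomorphism_def)
 have gU: "g y \<in> U" if "y \<in> V" for y using V(2) *(2) that by blast
 have bij: "bij (dd f (g y))" if "y \<in> V" for y using *(9)[OF that] f'[OF gU[OF that]] by simp
 have "C_k_on k V g" for k
 proof (induction k)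
  case 0
  then show ?case using V by simp
 next
  case (Suc k)
  have "C_k_on k V (%y. dd f (g y) v)" for v
   using C_k_on_compose[OF *(4) U(1) Suc] smooth_on_dd[OF f, of v] gU by (auto simp: smooth_on_def)
  then have "C_k_on k V (%y. inv (dd f (g y)) v)" for v
   by (intro C_k_on_inverse_family[OF *(4), where A="%y. dd f (g y)" and B="%y. inv (dd f (g y))"])
     (use bij has_derivative_linear[OF d[OF gU]] in \<open>auto simp: bij_is_surj bij_is_inj surj_f_inv_f inv_f_f\<close>)
  then show ?case
   by (intro C_k_on_SucI[OF *(4), where f'="%y. inv (dd f (g y))"]) (use *(7,8) f' gU in auto)
 qed
 then have "smooth_on V g" by (simp add: smooth_on_def)
 moreover have "bij (dd f x)" if "x \<in> U'" for x using bij[of "f x"] V that by auto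
 ultimately show ?thesis using that[of U' g] * V by metis
qed

section \<open>Germs of smooth maps at the origin\<close>

definition smooth_germ :: "('a::euclidean_space => 'b::real_normed_vector) => bool" where
 "smooth_germ f \<longleftrightarrow> (\<exists>U. open U \<and> 0 \<in> U \<and> smooth_on U f)"

lemma smooth_germI: "open U ==> 0 \<in> U ==> smooth_on U f ==> smooth_germ f"
 unfolding smooth_germ_def by blast

lemma smooth_germE:
 assumes "smooth_germ f" obtains U where "open U" "0 \<in> U" "smooth_on U f"
 using assms unfolding smooth_germ_def by blast

lemma smooth_germ_cong:
 assumes "smooth_germ f" "eventually (%x. f x = g x) (nhds 0)" shows "smooth_germ g"
proof -
 obtain U where U: "open U" "0 \<in> U" "smooth_on U f" using assms(1) smooth_germE by blast
 obtain V where V: "open V" "0 \<in> V" "!!x. x \<in> V ==> f x = g x" using assms(2) by (auto simp: eventually_nhds)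
 have "smooth_on (U \<inter> V) g"
  by (rule smooth_on_cong[of _ f]) (use U V smooth_on_subset in \<open>auto intro: smooth_on_subset\<close>)
 then show ?thesis using U V by (auto intro!: smooth_germI[of "U \<inter> V"])
qed

lemma smooth_germ_eventually:
 assumes "smooth_germ f" shows "eventually (%x. (f has_derivative dd f x) (at x)) (nhds 0)"
 using assms smooth_on_imp_has_derivative unfolding smooth_germ_def eventually_nhds by blast

lemma smooth_germ_linear_dd:
 assumes "smooth_germ f" shows "eventually (%x. linear (dd f x)) (nhds 0)"
 using smooth_germ_eventually[OF assms] by eventually_elim (rule has_derivative_linear)

lemma smooth_germ_has_derivative_0: "smooth_germ f ==> (f has_derivative dd f 0) (at 0)"
 using smooth_germ_eventually eventually_nhds_x_imp_x by blast

lemma smooth_germ_isCont: "smooth_germ f ==> isCont f 0"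
 using smooth_germ_has_derivative_0 has_derivative_continuous by blast

lemma smooth_germ_dd: "smooth_germ f ==> smooth_germ (%x. dd f x v)"
 unfolding smooth_germ_def using smooth_on_dd by blast

lemma smooth_germ_const: "smooth_germ (%x. c)"
 by (rule smooth_germI[of UNIV]) (auto intro: smooth_on_const)

lemma smooth_germ_linear: "linear (L :: 'a::euclidean_space => 'b::real_normed_vector) ==> smooth_germ L"
 by (rule smooth_germI[of UNIV]) (auto intro: smooth_on_linear)

lemma smooth_germ_bounded_linear: "bounded_linear L ==> smooth_germ f ==> smooth_germ (%x. L (f x))"
 unfolding smooth_germ_def using smooth_on_bounded_linear by blast

lemma smooth_germ_bilinear:
 assumes "bounded_bilinear h" "smooth_germ f" "smooth_germ g" shows "smooth_germ (%x. h (f x) (g x))"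
proof -
 obtain U V where U: "open U" "0 \<in> U" "smooth_on U f" and V: "open V" "0 \<in> V" "smooth_on V g"
  using assms(2,3) by (auto simp: smooth_germ_def)
 have "smooth_on (U \<inter> V) f" "smooth_on (U \<inter> V) g"
  using U V by (auto intro: smooth_on_subset)
 then show ?thesis using U V smooth_on_bilinear[OF assms(1), of "U \<inter> V"] by (intro smooth_germI[of "U \<inter> V"]) auto
qed

lemmas smooth_germ_mult = smooth_germ_bilinear[OF bounded_bilinear_mult]
lemmas smooth_germ_scaleR = smooth_germ_bilinear[OF bounded_bilinear_scaleR]
lemmas smooth_germ_inner = smooth_germ_bilinear[OF bounded_bilinear_inner]

lemma smooth_germ_add:
 assumes "smooth_germ f" "smooth_germ g" shows "smooth_germ (%x. f x + g x)"
proof -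
 obtain U V where U: "open U" "0 \<in> U" "smooth_on U f" and V: "open V" "0 \<in> V" "smooth_on V g"
  using assms by (auto simp: smooth_germ_def)
 have "smooth_on (U \<inter> V) f" "smooth_on (U \<inter> V) g"
  using U V by (auto intro: smooth_on_subset)
 then show ?thesis using U V smooth_on_add[of "U \<inter> V"] by (intro smooth_germI[of "U \<inter> V"]) auto
qed

lemma smooth_germ_minus: "smooth_germ f ==> smooth_germ (%x. - f x)"
 using smooth_germ_bounded_linear[OF bounded_linear_minus[OF bounded_linear_ident]] .

lemma smooth_germ_diff: "smooth_germ f ==> smooth_germ g ==> smooth_germ (%x. f x - g x)"
 using smooth_germ_add[OF _ smooth_germ_minus] by fastforce

lemma smooth_germ_sum:
 assumes "!!i. i \<in> I ==> smooth_germ (f i)" shows "smooth_germ (%x. \<Sum>i\<in>I. f i x)"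
 using assms by (induction I rule: infinite_finite_induct) (auto intro: smooth_germ_add smooth_germ_const)

lemma smooth_germ_power:
 fixes f :: "'a::euclidean_space => real"
 shows "smooth_germ f ==> smooth_germ (%x. f x ^ n)"
 by (induction n) (auto intro: smooth_germ_mult smooth_germ_const)

lemma smooth_germ_nth: "smooth_germ (%x::real^'n. x $ i)"
 by (intro smooth_germ_linear bounded_linear.linear bounded_linear_vec_nth)

lemma eventually_compose_0:
 assumes "isCont f 0" "f 0 = 0" "eventually P (nhds 0)"
 shows "eventually (%x. P (f x)) (nhds 0)"
proof -
 have "filterlim f (nhds 0) (nhds 0)"
  using assms(1,2) tendsto_at_iff_tendsto_nhds[of f 0] by (simp add: isCont_def)
 then show ?thesis using assms(3) by (simp add: filterlim_iff)
qed

lemma smooth_germ_compose: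
 fixes f :: "'a::euclidean_space => 'b::euclidean_space"
 assumes "smooth_germ f" "f 0 = 0" "smooth_germ g" shows "smooth_germ (%x. g (f x))"
proof -
 obtain U V where U: "open U" "0 \<in> U" "smooth_on U f" and V: "open V" "0 \<in> V" "smooth_on V g"
  using assms by (auto simp: smooth_germ_def)
 have "open (U \<inter> f -` V)"
  using U V continuous_open_preimage smooth_on_imp_continuous by blast
 moreover have "smooth_on (U \<inter> f -` V) (%x. g (f x))"
  by (rule smooth_on_compose[where T=V]) (use U V calculation in \<open>auto intro: smooth_on_subset\<close>)
 ultimately show ?thesis using U V assms(2) by (intro smooth_germI[of "U \<inter> f -` V"]) auto
qed

lemma smooth_germ_componentwise:
 fixes f :: "'a::euclidean_space => 'b::euclidean_space"
 assumes "!!b. b \<in> Basis ==> smooth_germ (%x. f x \<bullet> b)"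
 shows "smooth_germ f"
proof -
 have "smooth_germ (%x. \<Sum>b\<in>Basis. (f x \<bullet> b) *\<^sub>R b)"
  by (intro smooth_germ_sum smooth_germ_scaleR smooth_germ_const assms)
 then show ?thesis by (simp add: euclidean_representation)
qed

lemma smooth_germ_linear_apply:
 fixes A :: "'a::euclidean_space => 'b::euclidean_space => 'c::real_normed_vector"
 assumes "eventually (%x. linear (A x)) (nhds 0)" "!!b. b \<in> Basis ==> smooth_germ (%x. A x b)" "smooth_germ z"
 shows "smooth_germ (%x. A x (z x))"
proof -
 have "smooth_germ (%x. \<Sum>b\<in>Basis. (z x \<bullet> b) *\<^sub>R A x b)"
  by (intro smooth_germ_sum smooth_germ_scaleR smooth_germ_inner smooth_germ_const assms)
 moreover have "eventually (%x. (\<Sum>b\<in>Basis. (z x \<bullet> b) *\<^sub>R A x b) = A x (z x)) (nhds 0)"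
  using assms(1) by eventually_elim (metis linear_expand)
 ultimately show ?thesis by (rule smooth_germ_cong)
qed

lemma eventually_dd_cong:
 assumes "eventually (%x. f x = g x) (nhds x0)"
 shows "eventually (%x. dd f x = dd g x) (nhds x0)"
proof -
 obtain U where U: "open U" "x0 \<in> U" "!!x. x \<in> U ==> f x = g x" using assms by (auto simp: eventually_nhds)
 have "dd f x = dd g x" if "x \<in> U" for x
 proof -
  have "(f has_derivative D) (at x) \<longleftrightarrow> (g has_derivative D) (at x)" for D
   using U that has_derivative_transform_within_open[OF _ U(1) that] by metis
  then show ?thesis unfolding frechet_derivative_def by simp
 qed
 then show ?thesis using U by (auto simp: eventually_nhds)
qed

lemma dd_cong: "eventually (%x. f x = g x) (nhds x0) ==> dd f x0 = dd g x0"
 using eventually_dd_cong eventually_nhds_x_imp_x by blast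

lemma dd_eq: "(f has_derivative f') (at x) ==> dd f x = f'"
 using frechet_derivative_at by metis

lemma smooth_germ_dd_commute:
 fixes f :: "'a::euclidean_space => real"
 assumes "smooth_germ f"
 shows "eventually (%x. \<forall>u v. dd (%z. dd f z u) x v = dd (%z. dd f z v) x u) (nhds 0)"
proof -
 obtain U where U: "open U" "0 \<in> U" "smooth_on U f" using assms smooth_germE by blast
 show ?thesis unfolding eventually_nhds
  by (rule exI[of _ U]) (use U C_k_on_dd_commute[of U f] in \<open>auto simp: smooth_on_def\<close>)
qed

text \<open>h(x) - h(0) is the integral over s in [0, 1] of dh(s x) x, and the direction x is
  expanded in \<open>Basis\<close>.\<close>

lemma Hadamard:
 fixes h :: "'a::euclidean_space => real"
 assumes "smooth_germ h"
 obtains k where "!!b. smooth_germ (k b)"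
  "eventually (%x. h x = h 0 + (\<Sum>b\<in>Basis. (x \<bullet> b) * k b x)) (nhds 0)"
proof -
 obtain U where U: "open U" "0 \<in> U" "smooth_on U h" using assms smooth_germE by blast
 obtain r where r: "r > 0" "ball 0 r \<subseteq> U" using U openE by blast
 \<comment> \<open>The parameter s ranges over an open interval around [0, 1], here |s| < 2; halving
   the radius keeps s x in U.\<close>
 let ?S = "ball (0::'a) (r / 2)" and ?T = "ball (0::real) 2"
 define k where "k b x = integral {0..1} (%s. dd h (s *\<^sub>R x) b)" for b x
 have inr: "s *\<^sub>R x \<in> U" if "s \<in> ?T" "x \<in> ?S" for s x
 proof -
  have "norm (s *\<^sub>R x) \<le> 2 * norm x" using that by (simp add: mult_right_mono)
  also have "\<dots> < r" using that by simp
  finally show ?thesis using r(2) by auto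
 qed
 have TS: "open (?T \<times> ?S)" by (intro open_Times) auto
 have sm: "smooth_on (?T \<times> ?S) (%p. dd h (fst p *\<^sub>R snd p) b)" for b
  by (rule smooth_on_compose[OF TS U(1) _ smooth_on_dd[OF U(3)]], rule smooth_on_scaleR[OF TS])
    (use inr in \<open>auto intro!: smooth_on_linear[OF _ TS] simp: linear_fst linear_snd\<close>)
 have "smooth_on ?S (%x. integral {0..1} (%s. dd h (fst (s, x) *\<^sub>R snd (s, x)) b))" for b
  by (rule smooth_on_integral[OF _ _ _ sm[of b]]) (auto simp: subset_iff)
 then have 1: "smooth_germ (k b)" for b
  by (intro smooth_germI[of ?S]) (use r in \<open>auto simp: k_def[abs_def]\<close>)
 have eq: "h x = h 0 + (\<Sum>b\<in>Basis. (x \<bullet> b) * k b x)" if x: "x \<in> ?S" for x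
 proof -
  have d: "(h has_derivative dd h y) (at y)" if "y \<in> U" for y
   using smooth_on_imp_has_derivative[OF U(3) that] .
  have c: "continuous_on {0..1} (%s. dd h (s *\<^sub>R x) b)" for b
   by (rule continuous_on_compose2[OF smooth_on_imp_continuous[OF smooth_on_dd[OF U(3)]]])
     (use inr x in \<open>auto intro!: continuous_intros\<close>)
  have "((%s. dd h (s *\<^sub>R x) x) has_integral h (1 *\<^sub>R x) - h (0 *\<^sub>R x)) {0..1}"
  proof (rule fundamental_theorem_of_calculus)
   fix s :: real assume s: "s \<in> {0..1}"
   have 1: "((%s. s *\<^sub>R x) has_derivative (%t. t *\<^sub>R x)) (at s within {0..1})"
    by (auto intro!: derivative_eq_intros)
   have U': "s *\<^sub>R x \<in> U" using inr x s by auto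
   show "((%s. h (s *\<^sub>R x)) has_vector_derivative dd h (s *\<^sub>R x) x) (at s within {0..1})"
    using has_derivative_compose[OF 1 d[OF U']] linear_cmul[OF has_derivative_linear[OF d[OF U']]]
    by (simp add: has_vector_derivative_def)
  qed simp
  then have "h x - h 0 = integral {0..1} (%s. dd h (s *\<^sub>R x) x)" by (simp add: integral_unique)
  also have "\<dots> = integral {0..1} (%s. \<Sum>b\<in>Basis. (x \<bullet> b) * dd h (s *\<^sub>R x) b)"
   using linear_expand[OF has_derivative_linear[OF d[OF inr]]] x
   by (intro integral_cong) auto
  also have "\<dots> = (\<Sum>b\<in>Basis. (x \<bullet> b) * k b x)"
   unfolding k_def by (subst integral_sum) (auto intro!: integrable_continuous_real continuous_intros c)
  finally show ?thesis by simp
 qed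
 have "0 \<in> ?S" using r by simp
 then have "eventually (%x. h x = h 0 + (\<Sum>b\<in>Basis. (x \<bullet> b) * k b x)) (nhds 0)"
  unfolding eventually_nhds using eq open_ball by blast
 then show ?thesis by (rule that[OF 1])
qed

section \<open>Smooth dependence of solutions of differential equations on parameters\<close>

text \<open>The energy |y|^2 + e^2 is differentiable even where |y| is not, and 2 <y, y'> <= 2 L
  |y|^2 + 2 e |y| <= (2 L + 1) (|y|^2 + e^2). This is the source of the constant 2 L + 1.\<close>

lemma gronwall:
 fixes y :: "real => 'a::euclidean_space"
 assumes d: "!!s. s \<in> {0..1} ==> (y has_vector_derivative y' s) (at s within {0..1})"
  and bd: "!!s. s \<in> {0..1} ==> norm (y' s) \<le> L * norm (y s) + e"
  and L: "0 \<le> L" "0 \<le> e" and s: "s \<in> {0..1}"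
 shows "norm (y s) \<le> exp (2 * L + 1) * (norm (y 0) + e)"
proof -
 define M where "M = 2 * L + 1"
 define g where "g s = exp (- M * s) * (y s \<bullet> y s + e\<^sup>2)" for s
 have cy: "continuous_on {0..1} y"
  unfolding continuous_on_eq_continuous_within using has_vector_derivative_continuous[OF d] by blast
 have "g s \<le> g 0"
 proof (cases "s = 0")
  case False
  show ?thesis
  proof (rule DERIV_nonpos_imp_decreasing_open[of 0 s g])
   show "0 \<le> s" using s by auto
   show "continuous_on {0..s} g"
    unfolding g_def using s by (auto intro!: continuous_intros continuous_on_subset[OF cy])
   fix r assume r: "0 < r" "r < s"
   then have r1: "r \<in> {0<..<1}" "r \<in> {0..1}" using s by auto
   have "(y has_vector_derivative y' r) (at r)"
    using d[OF r1(2)] at_within_interior[of r "{0..1}"] r1(1) by simp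
   then have dy: "(y has_derivative (%h. h *\<^sub>R y' r)) (at r)" by (simp add: has_vector_derivative_def)
   have "((%r. y r \<bullet> y r) has_derivative (%h. h * (2 * (y r \<bullet> y' r)))) (at r)"
    by (rule derivative_eq_intros dy)+ (auto simp: inner_commute algebra_simps)
   then have d2: "((%r. y r \<bullet> y r) has_real_derivative 2 * (y r \<bullet> y' r)) (at r)"
    by (simp add: has_field_derivative_def mult_commute_abs)
   have dg: "(g has_real_derivative exp (- M * r) * (2 * (y r \<bullet> y' r) - M * (y r \<bullet> y r + e\<^sup>2))) (at r)"
    unfolding g_def by (rule derivative_eq_intros d2 refl)+ (simp add: algebra_simps)
   have "y r \<bullet> y' r \<le> norm (y r) * norm (y' r)" by (rule norm_cauchy_schwarz)
   also have "\<dots> \<le> norm (y r) * (L * norm (y r) + e)" by (intro mult_left_mono bd r1) auto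
   also have "\<dots> = L * (y r \<bullet> y r) + norm (y r) * e"
    by (simp add: power2_norm_eq_inner[symmetric] power2_eq_square algebra_simps)
   also have "2 * (norm (y r) * e) \<le> (norm (y r))\<^sup>2 + e\<^sup>2"
    using sum_squares_bound[of "norm (y r)" e] by simp
   then have "norm (y r) * e \<le> (y r \<bullet> y r + e\<^sup>2) / 2" by (simp add: power2_norm_eq_inner)
   finally have "2 * (y r \<bullet> y' r) \<le> 2 * L * (y r \<bullet> y r) + (y r \<bullet> y r + e\<^sup>2)" by (simp add: field_simps)
   also have "\<dots> \<le> M * (y r \<bullet> y r + e\<^sup>2)"
    using L by (simp add: M_def algebra_simps)
   finally have "exp (- M * r) * (2 * (y r \<bullet> y' r) - M * (y r \<bullet> y r + e\<^sup>2)) \<le> 0"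
    by (simp add: mult_nonneg_nonpos)
   then show "\<exists>z. (g has_real_derivative z) (at r) \<and> z \<le> 0" using dg by blast
  qed
 qed simp
 then have "exp (- M * s) * ((norm (y s))\<^sup>2 + e\<^sup>2) \<le> (norm (y 0))\<^sup>2 + e\<^sup>2"
  by (simp add: g_def power2_norm_eq_inner)
 then have "(norm (y s))\<^sup>2 + e\<^sup>2 \<le> exp (M * s) * ((norm (y 0))\<^sup>2 + e\<^sup>2)"
  by (simp add: exp_minus field_simps)
 also have "\<dots> \<le> exp M * ((norm (y 0))\<^sup>2 + e\<^sup>2)"
  using s L by (intro mult_right_mono) (auto simp: M_def mult_left_le)
 also have "\<dots> \<le> exp M * (exp M * (norm (y 0) + e)\<^sup>2)"
 proof (intro mult_left_mono)
  have "(norm (y 0))\<^sup>2 + e\<^sup>2 \<le> 1 * (norm (y 0) + e)\<^sup>2" using L by (simp add: power2_sum)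
  also have "\<dots> \<le> exp M * (norm (y 0) + e)\<^sup>2" using L by (intro mult_right_mono) (auto simp: M_def)
  finally show "(norm (y 0))\<^sup>2 + e\<^sup>2 \<le> exp M * (norm (y 0) + e)\<^sup>2" .
 qed simp
 finally have "(norm (y s))\<^sup>2 \<le> (exp M * (norm (y 0) + e))\<^sup>2"
  by (smt (verit, best) power2_eq_square mult.assoc mult.left_commute zero_le_power2)
 then show ?thesis using L by (auto simp: M_def intro: power2_le_imp_le)
qed

text \<open>Picard iteration on the whole interval: against the weight exp(2 L s) every integration
  gains a factor 1/2, so the iterates converge uniformly without subdividing [0, 1].\<close>

lemma ode_exists:
 fixes f :: "real => 'a::euclidean_space => 'a"
 assumes cont: "continuous_on ({0..1} \<times> UNIV) (%(s, y). f s y)"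
  and lip: "!!s y z. s \<in> {0..1} ==> norm (f s y - f s z) \<le> L * norm (y - z)" and L: "L > 0"
 obtains y where "y 0 = c" "!!s. s \<in> {0..1} ==> (y has_vector_derivative f s (y s)) (at s within {0..1})"
proof -
 define g where "g = rec_nat (%s::real. c) (%n h s. c + integral {0..s} (%r. f r (h r)))"
 have g0: "g 0 = (%s. c)" and gS: "g (Suc n) s = c + integral {0..s} (%r. f r (g n r))" for n s
  by (simp_all add: g_def)
 have cf: "continuous_on {0..1} (%r. f r (h r))" if "continuous_on {0..1} h" for h
 proof -
  have "continuous_on {0..1} (%r. (r, h r))" using that by (intro continuous_intros)
  then show ?thesis using continuous_on_compose2[OF cont, of "{0..1}" "%r. (r, h r)"] by auto
 qed
 have int: "(%r. f r (h r)) integrable_on {0..s}" if "continuous_on {0..1} h" "s \<in> {0..1}" for h s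
  using cf[OF that(1)] that(2) by (intro integrable_continuous_real) (auto intro: continuous_on_subset)
 have cg: "continuous_on {0..1} (g n)" for n
 proof (induction n)
  case (Suc n)
  then show ?case
   by (simp add: gS[abs_def]) (intro continuous_intros indefinite_integral_continuous_1 int, auto)
 qed (simp add: g0)
 have "bounded ((%r. f r c) ` {0..1})"
  using cf[of "%_. c"] by (intro compact_imp_bounded compact_continuous_image) auto
 then obtain M where M: "!!r. r \<in> {0..1} ==> norm (f r c) \<le> M" unfolding bounded_iff by (metis image_eqI)
 have M0: "M \<ge> 0" using order_trans[OF norm_ge_zero M[of 0]] by simp
 have bound: "norm (g (Suc n) s - g n s) \<le> M * (1 / 2) ^ n * exp (2 * L * s)" if "s \<in> {0..1}" for n s
  using that
 proof (induction n arbitrary: s)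
  case 0
  have "norm (integral {0..s} (%r. f r c)) \<le> M * (s - 0)"
   by (rule integral_bound) (use 0 M cf[of "%_. c"] in \<open>auto intro: continuous_on_subset\<close>)
  also have "\<dots> \<le> M * exp (2 * L * s)"
  proof (intro mult_left_mono M0)
   have "1 \<le> exp (2 * L * s)" using 0 L by simp
   then show "s - 0 \<le> exp (2 * L * s)" using 0 unfolding atLeastAtMost_iff by linarith
  qed
  finally show ?case by (simp add: gS g0)
 next
  case (Suc n)
  have i: "(%r. f r (g m r)) integrable_on {0..s}" for m using int cg Suc.prems by blast
  have expint: "((%r. L * (M * (1 / 2) ^ n * exp (2 * L * r))) has_integral
   (M * (1 / 2) ^ Suc n * exp (2 * L * s)) - M * (1 / 2) ^ Suc n * exp (2 * L * 0)) {0..s}"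
   by (rule fundamental_theorem_of_calculus)
     (use Suc.prems in \<open>auto intro!: derivative_eq_intros simp: has_real_derivative_iff_has_vector_derivative[symmetric]\<close>)
  have "norm (g (Suc (Suc n)) s - g (Suc n) s) = norm (integral {0..s} (%r. f r (g (Suc n) r) - f r (g n r)))"
   using integral_diff[OF i[of "Suc n"] i[of n]] by (simp add: gS)
  also have "\<dots> \<le> integral {0..s} (%r. L * (M * (1 / 2) ^ n * exp (2 * L * r)))"
  proof (rule integral_norm_bound_integral)
   fix r assume r: "r \<in> {0..s}"
   have "norm (f r (g (Suc n) r) - f r (g n r)) \<le> L * norm (g (Suc n) r - g n r)"
    using lip r Suc.prems by auto
   also have "\<dots> \<le> L * (M * (1 / 2) ^ n * exp (2 * L * r))"
    using Suc.IH[of r] r Suc.prems L by (intro mult_left_mono) auto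
   finally show "norm (f r (g (Suc n) r) - f r (g n r)) \<le> L * (M * (1 / 2) ^ n * exp (2 * L * r))" .
  qed (use integrable_diff[OF i i] expint in auto)
  also have "\<dots> \<le> M * (1 / 2) ^ Suc n * exp (2 * L * s)"
   using integral_unique[OF expint] M0 by simp
  finally show ?case .
 qed
 define y where "y s = c + suminf (%i. g (Suc i) s - g i s)" for s
 have tel: "(\<Sum>i<n. g (Suc i) s - g i s) = g n s - c" for n s
  using sum_lessThan_telescope[of "%n. g n s" n] g0 by simp
 have "uniform_limit {0..1} (%n s. \<Sum>i<n. g (Suc i) s - g i s) (%s. suminf (%i. g (Suc i) s - g i s)) sequentially"
 proof (rule Weierstrass_m_test)
  show "norm (g (Suc n) s - g n s) \<le> M * exp (2 * L) * (1 / 2) ^ n" if "s \<in> {0..1}" for n s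
  proof -
   have "M * (1 / 2) ^ n * exp (2 * L * s) \<le> M * (1 / 2) ^ n * exp (2 * L)"
    using that L M0 by (intro mult_left_mono) (auto simp: mult_left_le)
   then show ?thesis using bound[OF that, of n] by (simp add: mult_ac)
  qed
  show "summable (%n. M * exp (2 * L) * (1 / 2) ^ n)" by (intro summable_mult summable_geometric) simp
 qed
 then have "uniform_limit {0..1} (%n s. c + (g n s - c)) (%s. c + suminf (%i. g (Suc i) s - g i s)) sequentially"
  unfolding tel by (intro uniform_limit_intros)
 then have ul: "uniform_limit {0..1} g y sequentially" by (simp add: y_def[abs_def])
 have cy: "continuous_on {0..1} y"
  by (rule uniform_limit_theorem[OF _ ul]) (auto simp: cg)
 have yint: "y s = c + integral {0..s} (%r. f r (y r))" if s: "s \<in> {0..1}" for s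
 proof -
  have "(%n. g n s) \<longlonglongrightarrow> y s" using tendsto_uniform_limitI[OF ul s] .
  then have 1: "(%n. g (Suc n) s) \<longlonglongrightarrow> y s" by (rule LIMSEQ_Suc)
  have "(%n. integral {0..s} (%r. f r (g n r))) \<longlonglongrightarrow> integral {0..s} (%r. f r (y r))"
  proof (rule LIMSEQ_I)
   fix e :: real assume e: "e > 0"
   have "eventually (%n. \<forall>r\<in>{0..1}. dist (g n r) (y r) < e / (2 * L)) sequentially"
    using ul e L unfolding uniform_limit_iff by simp
   then obtain N where N: "!!n r. n \<ge> N ==> r \<in> {0..1} ==> dist (g n r) (y r) < e / (2 * L)"
    unfolding eventually_sequentially by blast
   have "norm (integral {0..s} (%r. f r (g n r)) - integral {0..s} (%r. f r (y r))) < e" if n: "n \<ge> N" for n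
   proof -
    have "norm (integral {0..s} (%r. f r (g n r) - f r (y r))) \<le> (e / 2) * (s - 0)"
    proof (rule integral_bound)
     show "continuous_on {0..s} (%r. f r (g n r) - f r (y r))"
      using s by (intro continuous_intros continuous_on_subset[OF cf[OF cg]] continuous_on_subset[OF cf[OF cy]]) auto
     fix r assume r: "r \<in> {0..s}"
     have "norm (f r (g n r) - f r (y r)) \<le> L * norm (g n r - y r)" using lip r s by auto
     also have "\<dots> \<le> L * (e / (2 * L))"
      using N[OF n, of r] r s L by (intro mult_left_mono) (auto simp: dist_norm)
     finally show "norm (f r (g n r) - f r (y r)) \<le> e / 2" using L by simp
    qed (use s in auto)
    also have "\<dots> < e" using s e by (auto intro: le_less_trans[of _ "e / 2"] simp: mult_left_le)
    finally show ?thesis using integral_diff[OF int[OF cg s] int[OF cy s]] by simp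
   qed
   then show "\<exists>N. \<forall>n\<ge>N. norm (integral {0..s} (%r. f r (g n r)) - integral {0..s} (%r. f r (y r))) < e" by blast
  qed
  then have "(%n. g (Suc n) s) \<longlonglongrightarrow> c + integral {0..s} (%r. f r (y r))"
   unfolding gS by (intro tendsto_intros)
  then show ?thesis using 1 LIMSEQ_unique by blast
 qed
 show ?thesis
 proof
  show "y 0 = c" using yint[of 0] by simp
  fix s :: real assume s: "s \<in> {0..1}"
  have "((%s. c + integral {0..s} (%r. f r (y r))) has_vector_derivative 0 + f s (y s)) (at s within {0..1})"
   by (intro has_vector_derivative_add has_vector_derivative_const integral_has_vector_derivative cf[OF cy] s)
  then show "(y has_vector_derivative f s (y s)) (at s within {0..1})"
   by (intro has_vector_derivative_transform[OF s yint]) auto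
 qed
qed

text \<open>Functions of time \<open>s \<in> [0, 1]\<close> and a parameter, of class \<open>C\<^sup>k\<close> in the parameter only.\<close>

primrec PC :: "nat => 'p::euclidean_space set => (real => 'p => 'b::real_normed_vector) => bool" where
 "PC 0 S f \<longleftrightarrow> continuous_on ({0..1} \<times> S) (%p. f (fst p) (snd p))"
| "PC (Suc k) S f \<longleftrightarrow> continuous_on ({0..1} \<times> S) (%p. f (fst p) (snd p)) \<and>
   (\<forall>s\<in>{0..1}. \<forall>x\<in>S. f s differentiable (at x)) \<and> (\<forall>v. PC k S (%s x. dd (f s) x v))"

lemma PC_continuous: "PC k S f ==> continuous_on ({0..1} \<times> S) (%p. f (fst p) (snd p))"
 by (cases k) auto

lemma PC_has_derivative: "PC (Suc k) S f ==> s \<in> {0..1} ==> x \<in> S ==> (f s has_derivative dd (f s) x) (at x)"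
 unfolding PC.simps using frechet_derivative_works by blast

lemma PC_dd: "PC (Suc k) S f ==> PC k S (%s x. dd (f s) x v)"
 by auto

lemma PC_Suc: "PC (Suc k) S f ==> PC k S f"
proof (induction k arbitrary: f)
 case 0
 then show ?case by simp
next
 case (Suc k)
 have "PC k S (%s x. dd (f s) x v)" for v using Suc.IH[OF PC_dd[OF Suc.prems]] .
 then show ?case using Suc.prems unfolding PC.simps by blast
qed

lemma PC_C_k_on: "PC k S f ==> s \<in> {0..1} ==> C_k_on k S (f s)"
proof (induction k arbitrary: f)
 case 0
 have "continuous_on S (%x. (s, x))" by (intro continuous_intros)
 then show ?case using 0 continuous_on_compose2[of "{0..1} \<times> S" "%p. f (fst p) (snd p)" S "%x. (s, x)"]
  by (auto simp: image_subset_iff)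
next
 case (Suc k)
 have "C_k_on k S (%x. dd (f s) x v)" for v
  using Suc.IH[OF PC_dd[OF Suc.prems(1)] Suc.prems(2)] .
 then show ?case using Suc.prems by auto
qed

lemma PC_cong:
 assumes "open S" "!!s x. s \<in> {0..1} ==> x \<in> S ==> f s x = g s x" "PC k S f"
 shows "PC k S g"
 using assms(2,3)
proof (induction k arbitrary: f g)
 case 0
 show ?case unfolding PC.simps
  by (rule continuous_on_eq[OF 0(2)[unfolded PC.simps]]) (use 0(1) in auto)
next
 case (Suc k)
 have d: "(g s has_derivative dd (f s) x) (at x)" if "s \<in> {0..1}" "x \<in> S" for s x
  by (rule has_derivative_transform_within_open[OF PC_has_derivative[OF Suc.prems(2) that] assms(1) that(2)])
    (use that Suc.prems in auto)
 then have e: "dd (f s) x = dd (g s) x" if "s \<in> {0..1}" "x \<in> S" for s x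
  using that frechet_derivative_at by metis
 have "PC k S (%s x. dd (g s) x v)" for v
  by (rule Suc.IH[OF _ PC_dd[OF Suc.prems(2)]]) (use e in auto)
 moreover have "continuous_on ({0..1} \<times> S) (%p. g (fst p) (snd p))"
  by (rule continuous_on_eq[OF PC_continuous[OF Suc.prems(2)]]) (use Suc.prems(1) in auto)
 ultimately show ?case using d unfolding PC.simps differentiable_def by blast
qed

lemma PC_SucI:
 assumes "open S" and d: "!!s x. s \<in> {0..1} ==> x \<in> S ==> (f s has_derivative f' s x) (at x)"
  and "!!v. PC k S (%s x. f' s x v)" and "PC 0 S f"
 shows "PC (Suc k) S f"
proof -
 have "PC k S (%s x. dd (f s) x v)" for v
  by (rule PC_cong[OF assms(1) _ assms(3)[of v]]) (use frechet_derivative_at[OF d] in auto)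
 then show ?thesis using d assms(4) unfolding PC.simps differentiable_def by blast
qed

lemma PC_const: "PC k S (%s x. c)"
 by (induction k arbitrary: c) (auto simp: frechet_derivative_const)

lemma PC_snd: "open S ==> PC k S (%s x. x)"
 by (cases k) (auto intro!: PC_SucI[where f'="%_ _ v. v"] PC_const continuous_intros)

lemma PC_bounded_linear:
 assumes "bounded_linear L" "open S" shows "PC k S f ==> PC k S (%s x. L (f s x))"
proof (induction k arbitrary: f)
 case 0
 then show ?case using bounded_linear.continuous_on[OF assms(1)] by auto
next
 case (Suc k)
 show ?case
 proof (rule PC_SucI[OF assms(2) bounded_linear.has_derivative[OF assms(1) PC_has_derivative[OF Suc.prems]]])
  show "PC k S (%s x. L (dd (f s) x v))" for v using Suc.IH[OF PC_dd[OF Suc.prems]] .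
  show "PC 0 S (%s x. L (f s x))"
   using bounded_linear.continuous_on[OF assms(1) PC_continuous[OF Suc.prems]] by simp
 qed
qed

lemma PC_add:
 assumes "open S" "PC k S f" "PC k S g"
 shows "PC k S (%s x. f s x + g s x)"
 using assms(2,3)
proof (induction k arbitrary: f g)
 case 0
 then show ?case by (auto intro: continuous_on_add)
next
 case (Suc k)
 show ?case
 proof (rule PC_SucI[OF assms(1) has_derivative_add[OF PC_has_derivative[OF Suc.prems(1)] PC_has_derivative[OF Suc.prems(2)]]])
  show "PC k S (%s x. dd (f s) x v + dd (g s) x v)" for v
   using Suc.IH[OF PC_dd[OF Suc.prems(1)] PC_dd[OF Suc.prems(2)]] .
  show "PC 0 S (%s x. f s x + g s x)"
   using continuous_on_add[OF PC_continuous[OF Suc.prems(1)] PC_continuous[OF Suc.prems(2)]] by simp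
 qed
qed

lemma PC_bilinear:
 assumes "bounded_bilinear h" "open S"
 shows "PC k S f ==> PC k S g ==> PC k S (%s x. h (f s x) (g s x))"
proof (induction k arbitrary: f g)
 case 0
 then show ?case by (auto intro: bounded_bilinear.continuous_on[OF assms(1)])
next
 case (Suc k)
 note d = PC_has_derivative[OF Suc.prems(1)] PC_has_derivative[OF Suc.prems(2)]
 show ?case
 proof (rule PC_SucI[OF assms(2) bounded_bilinear.FDERIV[OF assms(1) d]])
  show "PC k S (%s x. h (f s x) (dd (g s) x v) + h (dd (f s) x v) (g s x))" for v
   by (intro PC_add[OF assms(2)] Suc.IH PC_dd[OF Suc.prems(1)] PC_dd[OF Suc.prems(2)]
     PC_Suc[OF Suc.prems(1)] PC_Suc[OF Suc.prems(2)])
  show "PC 0 S (%s x. h (f s x) (g s x))"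
   using bounded_bilinear.continuous_on[OF assms(1) PC_continuous[OF Suc.prems(1)] PC_continuous[OF Suc.prems(2)]] by simp
 qed
qed

lemma PC_sum:
 assumes "open S" "!!i. i \<in> I ==> PC k S (f i)"
 shows "PC k S (%s x. \<Sum>i\<in>I. f i s x)"
 using assms(2) by (induction I rule: infinite_finite_induct) (auto intro: PC_add PC_const assms(1))

lemma PC_linear_apply:
 fixes A :: "real => 'a::euclidean_space => 'b::euclidean_space => 'c::real_normed_vector"
 assumes "open S" "!!s x. s \<in> {0..1} ==> x \<in> S ==> linear (A s x)" "!!b. PC k S (%s x. A s x b)" "PC k S z"
 shows "PC k S (%s x. A s x (z s x))"
proof -
 have "PC k S (%s x. \<Sum>b\<in>Basis. (z s x \<bullet> b) *\<^sub>R A s x b)"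
  by (intro PC_sum assms PC_bilinear[OF bounded_bilinear_scaleR] PC_bounded_linear[OF bounded_linear_inner_left])
 then show ?thesis
  by (rule PC_cong[OF assms(1), rotated]) (use linear_expand[OF assms(2)] in metis)
qed

lemma PC_compose:
 fixes f :: "real => 'p::euclidean_space => 'b::euclidean_space" and g :: "real \<times> 'b => 'c::real_normed_vector"
 assumes "open S" "open \<Omega>" "PC k S f" "smooth_on \<Omega> g" "!!s x. s \<in> {0..1} ==> x \<in> S ==> (s, f s x) \<in> \<Omega>"
 shows "PC k S (%s x. g (s, f s x))"
 using assms(3,4)
proof (induction k arbitrary: g)
 case 0
 show ?case unfolding PC.simps
  by (rule continuous_on_compose2[OF smooth_on_imp_continuous[OF 0(2)]])
    (use 0 assms(5) in \<open>auto intro!: continuous_intros\<close>)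
next
 case (Suc k)
 have d: "((%x. g (s, f s x)) has_derivative (%v. dd g (s, f s x) (0, dd (f s) x v))) (at x)"
  if s: "s \<in> {0..1}" "x \<in> S" for s x
 proof -
  have 1: "((%x. (s, f s x)) has_derivative (%v. (0, dd (f s) x v))) (at x)"
   by (intro has_derivative_Pair has_derivative_const PC_has_derivative[OF Suc.prems(1)] s)
  show ?thesis
   using has_derivative_compose[OF 1 smooth_on_imp_has_derivative[OF Suc.prems(2) assms(5)[OF s]]] .
 qed
 have lin: "linear (%v. dd g (s, f s x) (0, v))" if s: "s \<in> {0..1}" "x \<in> S" for s x
 proof -
  have l: "linear (dd g (s, f s x))"
   using has_derivative_linear[OF smooth_on_imp_has_derivative[OF Suc.prems(2) assms(5)[OF s]]] .
  show ?thesis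
   by (rule linearI) (use linear_add[OF l, of "(0, _)" "(0, _)"] linear_cmul[OF l, of _ "(0, _)"] in auto)
 qed
 have c0: "PC 0 S (%s x. g (s, f s x))" unfolding PC.simps
  by (rule continuous_on_compose2[OF smooth_on_imp_continuous[OF Suc.prems(2)]])
    (use PC_continuous[OF Suc.prems(1)] assms(5) in \<open>auto intro!: continuous_intros\<close>)
 show ?case
 proof (rule PC_SucI[OF assms(1) d _ c0])
  show "PC k S (%s x. dd g (s, f s x) (0, dd (f s) x v))" for v
  proof (rule PC_linear_apply[OF assms(1), where A="%s x v. dd g (s, f s x) (0, v)"])
   show "PC k S (%s x. dd g (s, f s x) (0, b))" for b
    using Suc.IH[OF PC_Suc[OF Suc.prems(1)] smooth_on_dd[OF Suc.prems(2)]] .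
   show "PC k S (%s x. dd (f s) x v)" using PC_dd[OF Suc.prems(1)] .
  qed (use lin in auto)
 qed
qed

text \<open>Lets a family over S be read as a family over pairs (parameter, state), the domain of
  the right-hand side of a differential equation.\<close>

lemma PC_fst:
 fixes f :: "real => 'p::euclidean_space => 'b::real_normed_vector"
 assumes "open S" shows "PC k S f ==> PC k (S \<times> (UNIV::'q::euclidean_space set)) (%s p. f s (fst p))"
proof (induction k arbitrary: f)
 case 0
 show ?case unfolding PC.simps
  by (rule continuous_on_compose2[OF 0[unfolded PC.simps], of _ "%p. (fst p, fst (snd p))", simplified])
    (auto intro!: continuous_intros)
next
 case (Suc k)
 have o: "open (S \<times> (UNIV::'q set))" using assms by (simp add: open_Times)
 have d: "((%p. f s (fst p)) has_derivative (%v. dd (f s) (fst p) (fst v))) (at p)"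
  if "s \<in> {0..1}" "p \<in> S \<times> (UNIV::'q set)" for s p
  using has_derivative_compose[OF has_derivative_fst[OF has_derivative_ident] PC_has_derivative[OF Suc.prems that(1)]] that(2) by auto
 have c0: "PC 0 (S \<times> (UNIV::'q set)) (%s p. f s (fst p))" unfolding PC.simps
  by (rule continuous_on_compose2[OF PC_continuous[OF Suc.prems], of _ "%p. (fst p, fst (snd p))", simplified])
    (auto intro!: continuous_intros)
 show ?case
  by (rule PC_SucI[OF o d _ c0]) (use Suc.IH[OF PC_dd[OF Suc.prems]] in auto)
qed

lemma PC_uniform_bound:
 assumes "PC 0 S f" "compact K" "K \<subseteq> S"
 obtains M where "M > 0" "!!s x. s \<in> {0..1} ==> x \<in> K ==> norm (f s x) \<le> M"
proof -
 have "continuous_on ({0..1} \<times> K) (%p. f (fst p) (snd p))"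
  by (rule continuous_on_subset[OF PC_continuous[OF assms(1)]]) (use assms(3) in auto)
 then have "bounded ((%p. f (fst p) (snd p)) ` ({0..1} \<times> K))"
  by (intro compact_imp_bounded compact_continuous_image compact_Times assms) auto
 then obtain M where M: "!!p. p \<in> {0..1} \<times> K ==> norm (f (fst p) (snd p)) \<le> M"
  unfolding bounded_iff by (metis image_eqI)
 have "norm (f s x) \<le> max M 1" if "s \<in> {0..1}" "x \<in> K" for s x
  using M[of "(s, x)"] that by auto
 then show ?thesis by (intro that[of "max M 1"]) auto
qed

text \<open>Compactness of [0, 1] makes continuity in the parameter uniform in time.\<close>

lemma PC_continuous_uniformly:
 assumes "PC 0 S f" "open S" "x \<in> S" "e > 0"
 obtains d where "d > 0" "ball x d \<subseteq> S" "!!s y. s \<in> {0..1} ==> y \<in> ball x d ==> norm (f s y - f s x) < e"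
proof -
 obtain r where r: "r > 0" "cball x r \<subseteq> S" using assms(2,3) open_contains_cball by blast
 have "uniformly_continuous_on ({0..1} \<times> cball x r) (%p. f (fst p) (snd p))"
  by (intro compact_uniformly_continuous continuous_on_subset[OF PC_continuous[OF assms(1)]] compact_Times)
    (use r in auto)
 then obtain d where d: "d > 0" "!!p q. p \<in> {0..1} \<times> cball x r ==> q \<in> {0..1} \<times> cball x r ==> dist q p < d
   ==> dist (f (fst q) (snd q)) (f (fst p) (snd p)) < e"
  using assms(4) unfolding uniformly_continuous_on_def by metis
 have "norm (f s y - f s x) < e" if "s \<in> {0..1}" "y \<in> ball x (min d r)" for s y
  using d(2)[of "(s, x)" "(s, y)"] that r by (auto simp: dist_norm dist_Pair_Pair norm_minus_commute)
 then show ?thesis using that[of "min d r"] d r by (force simp: subset_iff)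
qed

lemma PC_linear_bound:
 fixes A :: "real => 'p::euclidean_space => 'a::euclidean_space => 'b::real_normed_vector"
 assumes lin: "!!s x. s \<in> {0..1} ==> x \<in> S ==> linear (A s x)" and A: "!!v. PC 0 S (%s x. A s x v)"
  and K: "compact K" "K \<subseteq> S"
 obtains C where "C > 0" "!!s x v. s \<in> {0..1} ==> x \<in> K ==> norm (A s x v) \<le> C * norm v"
proof -
 have "\<exists>M>0. \<forall>s\<in>{0..1}. \<forall>y\<in>K. norm (A s y b) \<le> M" for b
  using PC_uniform_bound[OF A[of b] K] by metis
 then obtain M where M: "!!b. M b > 0" "!!b s y. s \<in> {0..1} ==> y \<in> K ==> norm (A s y b) \<le> M b"
  by metis
 have "sum M (Basis::'a set) > 0" by (intro sum_pos) (auto simp: M)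
 moreover have "norm (A s x v) \<le> sum M Basis * norm v" if "s \<in> {0..1}" "x \<in> K" for s x v
  by (rule linear_norm_le[OF lin]) (use M K that in auto)
 ultimately show ?thesis using that by blast
qed

lemma PC_dd_bound:
 fixes f :: "real => 'p::euclidean_space => 'b::real_normed_vector"
 assumes P: "PC (Suc 0) S f" and K: "compact K" "K \<subseteq> S"
 obtains C where "C > 0" "!!s x v. s \<in> {0..1} ==> x \<in> K ==> norm (dd (f s) x v) \<le> C * norm v"
 using PC_linear_bound[OF has_derivative_linear[OF PC_has_derivative[OF P]] PC_dd[OF P] K] by metis

lemma PC_lipschitz:
 fixes f :: "real => 'p::euclidean_space => 'b::real_normed_vector"
 assumes P: "PC (Suc 0) S f" and K: "compact K" "convex K" "K \<subseteq> S"
 obtains C where "C > 0" "!!s x y. s \<in> {0..1} ==> x \<in> K ==> y \<in> K ==> norm (f s x - f s y) \<le> C * norm (x - y)"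
proof -
 obtain C where C: "C > 0" "!!s x v. s \<in> {0..1} ==> x \<in> K ==> norm (dd (f s) x v) \<le> C * norm v"
  using PC_dd_bound[OF P K(1,3)] by metis
 have "norm (f s x - f s y) \<le> C * norm (x - y)" if s: "s \<in> {0..1}" and xy: "x \<in> K" "y \<in> K" for s x y
 proof (rule differentiable_bound[of K "f s" "dd (f s)"])
  show "(f s has_derivative dd (f s) z) (at z within K)" if "z \<in> K" for z
   using PC_has_derivative[OF P s] K that has_derivative_at_withinI by blast
  show "onorm (dd (f s) z) \<le> C" if "z \<in> K" for z by (rule onorm_le) (use C(2) s that in auto)
 qed (use K xy in auto)
 then show ?thesis using that C by blast
qed

text \<open>The curve p has compact image, so a tube around it lies in \<Omega>, and the derivatives
  of all \<open>G s\<close> vary little across a thin tube, uniformly in s. The mean value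
  inequality on the segment from p s to p s + q then bounds the remainder.\<close>

lemma PC_uniform_remainder:
 fixes G :: "real => 'q::euclidean_space => 'b::real_normed_vector"
 assumes G: "PC 1 \<Omega> G" and O: "open \<Omega>" and p: "continuous_on {0..1} p" "!!s. s \<in> {0..1} ==> p s \<in> \<Omega>" and e: "e > 0"
 obtains d where "d > 0"
  "!!s q. s \<in> {0..1} ==> norm q < d ==> p s + q \<in> \<Omega> \<and> norm (G s (p s + q) - G s (p s) - dd (G s) (p s) q) \<le> e * norm q"
proof -
 have P: "PC (Suc 0) \<Omega> G" using G by simp
 have K: "compact (p ` {0..1})" "p ` {0..1} \<subseteq> \<Omega>" using p by (auto intro!: compact_continuous_image)
 obtain r where r: "r > 0" "(\<Union>x\<in>p ` {0..1}. cball x r) \<subseteq> \<Omega>"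
  using compact_subset_open_imp_cball_epsilon_subset[OF K(1) O K(2)] by blast
 have inO: "p s + q \<in> \<Omega>" if "s \<in> {0..1}" "norm q < r" for s q using r(2) that by (force simp: dist_norm)
 \<comment> \<open>A linear map that is at most \<open>e'\<close> on each of the
   \<open>DIM('q)\<close> basis vectors has norm at most e.\<close>
 define e' where "e' = e / DIM('q)"
 have e': "e' > 0" using e by (simp add: e'_def)
 have c: "PC 0 (ball 0 r) (%s q. dd (G s) (p s + q) b)" for b
  unfolding PC.simps
  by (rule continuous_on_compose2[OF PC_continuous[OF PC_dd[OF P, of b]], of _ "%q. (fst q, p (fst q) + snd q)", simplified])
    (use inO in \<open>auto intro!: continuous_intros continuous_on_compose2[OF p(1)]\<close>)
 have "\<exists>d>0. d \<le> r \<and> (\<forall>s\<in>{0..1}. \<forall>q. norm q < d --> norm (dd (G s) (p s + q) b - dd (G s) (p s) b) \<le> e')" for b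
 proof -
  obtain d where "d > 0" "ball 0 d \<subseteq> ball (0::'q) r"
   "!!s q. s \<in> {0..1} ==> q \<in> ball 0 d ==> norm (dd (G s) (p s + q) b - dd (G s) (p s + 0) b) < e'"
   using PC_continuous_uniformly[OF c[of b] open_ball _ e', of 0] r(1) by auto
  then show ?thesis by (intro exI[of _ "min d r"]) (use r in \<open>auto intro: less_imp_le\<close>)
 qed
 then obtain d where d: "!!b. d b > 0" "!!b. d b \<le> r" "!!b s q. s \<in> {0..1} ==> norm q < d b ==>
   norm (dd (G s) (p s + q) b - dd (G s) (p s) b) \<le> e'"
  by metis
 define D where "D = min r (Min (d ` (Basis::'q set)))"
 have D: "D > 0" "D \<le> r" "!!b. b \<in> Basis ==> D \<le> d b" using r d by (auto simp: D_def intro: min.coboundedI2)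
 show ?thesis
 proof (rule that[of D], rule D)
  fix s :: real and q :: 'q assume s: "s \<in> {0..1}" and q: "norm q < D"
  have tq: "norm (t *\<^sub>R q) < D" if "t \<in> {0..1}" for t
   using mult_left_le_one_le[of "norm q" t] q that by auto
  have "norm (G s (p s + q) - G s (p s) - dd (G s) (p s) (p s + q - p s)) \<le> norm (p s + q - p s) * e"
  proof (rule differentiable_bound_linearization[where S="(%t. p s + t *\<^sub>R q) ` {0..1}"])
   show "p s + t *\<^sub>R (p s + q - p s) \<in> (%t. p s + t *\<^sub>R q) ` {0..1}" if "t \<in> {0..1}" for t using that by auto
   fix z assume "z \<in> (%t. p s + t *\<^sub>R q) ` {0..1}"
   then obtain t where t: "t \<in> {0..1}" "z = p s + t *\<^sub>R q" by blast
   have dG: "(G s has_derivative dd (G s) (p s + t *\<^sub>R q)) (at (p s + t *\<^sub>R q))" if "t \<in> {0..1}" for t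
    by (rule PC_has_derivative[OF P s inO[OF s]]) (use tq[OF that] D in simp)
   show "(G s has_derivative dd (G s) z) (at z within (%t. p s + t *\<^sub>R q) ` {0..1})"
    using dG t has_derivative_at_withinI by blast
   have l: "linear (%v. dd (G s) z v - dd (G s) (p s) v)"
    by (rule linear_compose_sub) (use has_derivative_linear[OF dG] t p(2) s has_derivative_linear[OF PC_has_derivative[OF P s]] in auto)
   have "norm (dd (G s) z v - dd (G s) (p s) v) \<le> (\<Sum>b\<in>(Basis::'q set). e') * norm v" for v
    by (rule linear_norm_le[OF l]) (use d(3)[OF s] tq t D in \<open>force intro: less_le_trans\<close>)
   then show "onorm (dd (G s) z - dd (G s) (p s)) \<le> e"
    unfolding fun_diff_def by (intro onorm_le) (simp add: e'_def)
  qed (auto intro: image_eqI[of _ _ 0])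
  then show "p s + q \<in> \<Omega> \<and> norm (G s (p s + q) - G s (p s) - dd (G s) (p s) q) \<le> e * norm q"
   using inO[OF s, of q] q D by (simp add: mult.commute)
 qed
qed

text \<open>Joint continuity from continuity in time at each fixed parameter together with
  continuity in the parameter that is uniform in time.\<close>

lemma PC_0I:
 fixes f :: "real => 'a::euclidean_space => 'b::real_normed_vector"
 assumes "!!x. x \<in> S ==> continuous_on {0..1} (%s. f s x)"
  and "!!x e. x \<in> S ==> e > 0 ==> \<exists>d>0. \<forall>y\<in>ball x d \<inter> S. \<forall>s\<in>{0..1}. norm (f s y - f s x) < e"
 shows "PC 0 S f"
 unfolding PC.simps continuous_on_iff
proof (intro ballI allI impI)
 fix p :: "real \<times> 'a" and e :: real assume "p \<in> {0..1} \<times> S" and e: "e > 0"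
 then obtain s :: real and x where sx: "p = (s, x)" "s \<in> {0..1}" "x \<in> S" by blast
 obtain d1 where d1: "d1 > 0" "!!r. r \<in> {0..1} ==> dist r s < d1 ==> dist (f r x) (f s x) < e / 2"
  using assms(1)[OF sx(3)] sx(2) e unfolding continuous_on_iff by (metis half_gt_zero)
 obtain d2 where d2: "d2 > 0" "!!r y. y \<in> ball x d2 \<inter> S ==> r \<in> {0..1} ==> norm (f r y - f r x) < e / 2"
  using assms(2)[OF sx(3), of "e / 2"] e by (metis half_gt_zero)
 have "dist (f (fst q) (snd q)) (f s x) < e" if q: "q \<in> {0..1} \<times> S" "dist q p < min d1 d2" for q
 proof -
  have "dist (snd q) x < d2" "dist (fst q) s < d1"
   using le_less_trans[OF dist_snd_le q(2)] le_less_trans[OF dist_fst_le q(2)] sx by auto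
  then have "dist (f (fst q) x) (f s x) < e / 2" "dist (f (fst q) (snd q)) (f (fst q) x) < e / 2"
   using d1(2)[of "fst q"] d2(2)[of "snd q" "fst q"] q(1) by (auto simp: dist_norm norm_minus_commute mem_Times_iff)
  then show ?thesis using dist_triangle[of "f (fst q) (snd q)" "f s x" "f (fst q) x"] by simp
 qed
 then show "\<exists>d>0. \<forall>q\<in>{0..1} \<times> S. dist q p < d --> dist (f (fst q) (snd q)) (f (fst p) (snd p)) < e"
  using d1 d2 sx(1) by (intro exI[of _ "min d1 d2"]) auto
qed

lemma linear_ode_bound:
 fixes D :: "real => 'q::euclidean_space => 'b::euclidean_space"
 assumes "!!s. s \<in> {0..1} ==> linear (D s)" "!!b. continuous_on {0..1} (%s. D s b)"
 obtains M where "M > 0" "!!s v. s \<in> {0..1} ==> norm (D s v) \<le> M * norm v"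
proof -
 have P: "PC 0 UNIV (%s (x::real). D s b)" for b
  unfolding PC.simps by (intro continuous_on_compose2[OF assms(2)] continuous_intros) auto
 obtain C where "C > 0" "!!s x v. s \<in> {0..1} ==> x \<in> {0::real} ==> norm (D s v) \<le> C * norm v"
  by (rule PC_linear_bound[of UNIV "%s (x::real). D s" "{0}", OF assms(1) P]) auto
 then show ?thesis using that by blast
qed

lemma linear_ode_exists:
 fixes A :: "real => 'a::euclidean_space => 'a"
 assumes A: "!!s. s \<in> {0..1} ==> linear (A s)" "!!b. continuous_on {0..1} (%s. A s b)" and b: "continuous_on {0..1} b"
 obtains n where "n 0 = 0" "!!s. s \<in> {0..1} ==> (n has_vector_derivative A s (n s) + b s) (at s within {0..1})"
proof -
 obtain M where M: "M > 0" "!!s v. s \<in> {0..1} ==> norm (A s v) \<le> M * norm v"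
  using linear_ode_bound[OF A] by metis
 have cA: "continuous_on ({0..1} \<times> UNIV) (%p. A (fst p) (snd p))"
 proof (rule continuous_on_eq)
  show "continuous_on ({0..1} \<times> UNIV) (%p. \<Sum>c\<in>Basis. (snd p \<bullet> c) *\<^sub>R A (fst p) c)"
   by (intro continuous_intros continuous_on_compose2[OF A(2), of _ fst]) auto
  show "(\<Sum>c\<in>Basis. (snd p \<bullet> c) *\<^sub>R A (fst p) c) = A (fst p) (snd p)" if "p \<in> {0..1} \<times> UNIV" for p
   using linear_expand[OF A(1), of "fst p" "snd p"] that by auto
 qed
 have "continuous_on ({0..1} \<times> UNIV) (%p. A (fst p) (snd p) + b (fst p))"
  by (intro continuous_on_add cA continuous_on_compose2[OF b, of _ fst] continuous_intros) auto
 then have c: "continuous_on ({0..1} \<times> UNIV) (%(s, z). A s z + b s)" by (simp add: split_beta)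
 show ?thesis
 proof (rule ode_exists[OF c, of M 0])
  fix s y z assume s: "s \<in> {0..1::real}"
  show "norm (A s y + b s - (A s z + b s)) \<le> M * norm (y - z)"
   using M(2)[OF s, of "y - z"] linear_diff[OF A(1)[OF s]] by simp
 qed (use M that in auto)
qed

text \<open>The derivative in the parameter must solve the linearised equation. Its solution n
  exists, and Gronwall's inequality bounds y s x' - y s x - n s (x' - x) by the uniform first-order
  remainder of G. The initial value c does not depend on x, so n starts at 0. The Lipschitz bound is
  a hypothesis because it is obtained differently for linear equations and for flows.\<close>

lemma ode_param_derivative:
 fixes G :: "real => 'p::euclidean_space \<times> 'a::euclidean_space => 'a" and y :: "real => 'p => 'a"
 assumes S: "open S" and O: "open \<Omega>" and G: "PC 1 \<Omega> G"
  and y0: "!!x. x \<in> S ==> y 0 x = c"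
  and ode: "!!x s. x \<in> S ==> s \<in> {0..1} ==> ((%s. y s x) has_vector_derivative G s (x, y s x)) (at s within {0..1})"
  and inO: "!!x s. x \<in> S ==> s \<in> {0..1} ==> (x, y s x) \<in> \<Omega>"
  and lip: "!!x. x \<in> S ==> \<exists>C d. C \<ge> 0 \<and> d > 0 \<and> (\<forall>x'\<in>ball x d. x' \<in> S \<and> (\<forall>s\<in>{0..1}. norm (y s x' - y s x) \<le> C * norm (x' - x)))"
 obtains n where "!!x w. x \<in> S ==> n 0 x w = 0"
  "!!x s w. x \<in> S ==> s \<in> {0..1} ==> ((%s. n s x w) has_vector_derivative dd (G s) (x, y s x) (w, n s x w)) (at s within {0..1})"
  "!!x s. x \<in> S ==> s \<in> {0..1} ==> (y s has_derivative n s x) (at x)"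
proof -
 have P: "PC (Suc 0) \<Omega> G" using G by simp
 have "\<exists>n. \<forall>w. n 0 w = 0 \<and>
   (\<forall>s\<in>{0..1}. ((%s. n s w) has_vector_derivative dd (G s) (x, y s x) (w, n s w)) (at s within {0..1}) \<and>
     (y s has_derivative n s) (at x))" if x: "x \<in> S" for x
 proof -
  define p where "p s = (x, y s x)" for s
  define D where "D s q = dd (G s) (p s) q" for s q
  have cy: "continuous_on {0..1} (%s. y s x)"
   unfolding continuous_on_eq_continuous_within using has_vector_derivative_continuous[OF ode[OF x]] by blast
  have cp: "continuous_on {0..1} p" unfolding p_def by (intro continuous_intros cy)
  have pO: "p s \<in> \<Omega>" if "s \<in> {0..1}" for s using inO x that by (simp add: p_def)
  have Dlin: "linear (D s)" if "s \<in> {0..1}" for s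
   using has_derivative_linear[OF PC_has_derivative[OF P that pO[OF that]]] unfolding D_def[abs_def] .
  have cD: "continuous_on {0..1} (%s. D s q)" for q
  proof -
   have "continuous_on {0..1} (%s. (s, p s))" by (intro continuous_intros cp)
   then show ?thesis
    using continuous_on_compose2[OF PC_continuous[OF PC_dd[OF P, of q]], of "{0..1}" "%s. (s, p s)"] pO
    by (auto simp: D_def image_subset_iff)
  qed
  obtain M where M: "M > 0" "!!s v. s \<in> {0..1} ==> norm (D s v) \<le> M * norm v"
   using linear_ode_bound[OF Dlin cD] by metis
  have Dsplit: "D s (w, z) = D s (0, z) + D s (w, 0)" if "s \<in> {0..1}" for s w z
   using linear_add[OF Dlin[OF that], of "(0, z)" "(w, 0)"] by simp
  have A1: "linear (%z. D s (0, z))" if "s \<in> {0..1}" for s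
   by (rule linearI) (use linear_add[OF Dlin[OF that], of "(0, _)" "(0, _)"] linear_cmul[OF Dlin[OF that], of _ "(0, _)"] in auto)
  have "\<exists>n. n 0 = 0 \<and> (\<forall>s\<in>{0..1}. (n has_vector_derivative D s (w, n s)) (at s within {0..1}))" for w
  proof -
   have "\<exists>n. n 0 = 0 \<and> (\<forall>s\<in>{0..1}. (n has_vector_derivative D s (0, n s) + D s (w, 0)) (at s within {0..1}))"
    by (rule linear_ode_exists[of "%s z. D s (0, z)" "%s. D s (w, 0)", OF A1 cD cD]) blast+
   then obtain n where n: "n 0 = 0" "!!s. s \<in> {0..1} ==> (n has_vector_derivative D s (0, n s) + D s (w, 0)) (at s within {0..1})"
    by blast
   have "(n has_vector_derivative D s (w, n s)) (at s within {0..1})" if "s \<in> {0..1}" for s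
    using n(2)[OF that] unfolding Dsplit[OF that, of w "n s"] .
   then show ?thesis using n(1) by blast
  qed
  then obtain n' where n': "!!w. n' w 0 = 0" "!!w s. s \<in> {0..1} ==> (n' w has_vector_derivative D s (w, n' w s)) (at s within {0..1})"
   by metis
  define n where "n s w = n' w s" for s w
  have n0: "n 0 w = 0" and nd: "s \<in> {0..1} ==> ((%s. n s w) has_vector_derivative D s (w, n s w)) (at s within {0..1})" for w s
   using n' by (simp_all add: n_def)
  \<comment> \<open>The difference of both sides solves the homogeneous equation with initial value
    0, so Gronwall with e = 0 gives linearity in the direction.\<close>
  have ncomb: "n s (k *\<^sub>R v + w) = k *\<^sub>R n s v + n s w" if s: "s \<in> {0..1}" for s k v w
  proof -
   have "norm (n s (k *\<^sub>R v + w) - k *\<^sub>R n s v - n s w) \<le> exp (2 * M + 1) * (norm (n 0 (k *\<^sub>R v + w) - k *\<^sub>R n 0 v - n 0 w) + 0)"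
   proof (rule gronwall[OF _ _ _ _ s])
    fix r :: real assume r: "r \<in> {0..1}"
    let ?d = "D r (k *\<^sub>R v + w, n r (k *\<^sub>R v + w)) - k *\<^sub>R D r (v, n r v) - D r (w, n r w)"
    show "((%s. n s (k *\<^sub>R v + w) - k *\<^sub>R n s v - n s w) has_vector_derivative ?d) (at r within {0..1})"
     by (intro has_vector_derivative_diff bounded_linear.has_vector_derivative[OF bounded_linear_scaleR_right] nd r)
    have "?d = D r (0, n r (k *\<^sub>R v + w) - k *\<^sub>R n r v - n r w)"
     by (simp add: linear_diff[OF Dlin[OF r], symmetric] linear_cmul[OF Dlin[OF r], symmetric])
    then show "norm ?d \<le> M * norm (n r (k *\<^sub>R v + w) - k *\<^sub>R n r v - n r w) + 0"
     using M(2)[OF r, of "(0, n r (k *\<^sub>R v + w) - k *\<^sub>R n r v - n r w)"] by (simp add: norm_Pair)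
   qed (use M in auto)
   then show ?thesis by (simp add: n0 algebra_simps)
  qed
  have nlin: "linear (n s)" if s: "s \<in> {0..1}" for s
   by (rule linearI) (use ncomb[OF s, of 1] ncomb[OF s, of _ _ 0] ncomb[OF s, of 1 0 0] in auto)
  obtain C d where Cd: "C \<ge> 0" "d > 0" "!!x'. x' \<in> ball x d ==> x' \<in> S"
   "!!x' s. x' \<in> ball x d ==> s \<in> {0..1} ==> norm (y s x' - y s x) \<le> C * norm (x' - x)"
   using lip[OF x] by blast
  have der: "(y s has_derivative n s) (at x)" if s: "s \<in> {0..1}" for s
   unfolding has_derivative_at_alt
  proof (intro conjI allI impI)
   show "bounded_linear (n s)" using nlin[OF s] linear_conv_bounded_linear by blast
   fix e :: real assume e: "e > 0"
   \<comment> \<open>Collects the factors contributed by Gronwall and by the Lipschitz bound, so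
     that a remainder bound e / E ends as e.\<close>
   define E where "E = exp (2 * M + 1) * (1 + C)"
   have E: "E > 0" using Cd by (simp add: E_def)
   obtain \<delta> where \<delta>: "\<delta> > 0" "!!s q. s \<in> {0..1} ==> norm q < \<delta> ==> p s + q \<in> \<Omega> \<and> norm (G s (p s + q) - G s (p s) - dd (G s) (p s) q) \<le> (e / E) * norm q"
    using PC_uniform_remainder[OF G O cp pO, of "e / E"] e E by (metis divide_pos_pos)
   have main: "norm (y s x' - y s x - n s (x' - x)) \<le> e * norm (x' - x)" if x': "norm (x' - x) < min d (\<delta> / (1 + C))" for x'
   proof -
    define h where "h = x' - x"
    have xb: "x' \<in> ball x d" using x' by (simp add: dist_norm norm_minus_commute)
    have x'S: "x' \<in> S" using Cd(3)[OF xb] .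
    have hC: "norm h * (1 + C) < \<delta>" using x' Cd(1) by (simp add: h_def pos_less_divide_eq)
    have q: "norm (h, y r x' - y r x) \<le> norm h * (1 + C)" if "r \<in> {0..1}" for r
     using norm_Pair_le[of h "y r x' - y r x"] Cd(4)[OF xb that] by (simp add: h_def algebra_simps)
    have "norm (y s x' - y s x - n s h) \<le> exp (2 * M + 1) * (norm (y 0 x' - y 0 x - n 0 h) + (e / E) * (norm h * (1 + C)))"
    proof (rule gronwall[OF _ _ _ _ s])
     fix r :: real assume r: "r \<in> {0..1}"
     show "((%s. y s x' - y s x - n s h) has_vector_derivative G r (x', y r x') - G r (x, y r x) - D r (h, n r h)) (at r within {0..1})"
      by (intro has_vector_derivative_diff nd ode r x x'S)
     define R where "R = G r (p r + (h, y r x' - y r x)) - G r (p r) - D r (h, y r x' - y r x)"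
     have R: "norm R \<le> (e / E) * (norm h * (1 + C))"
     proof -
      have "norm R \<le> (e / E) * norm (h, y r x' - y r x)"
       using \<delta>(2)[OF r, of "(h, y r x' - y r x)"] q[OF r] hC by (simp add: R_def D_def)
      also have "\<dots> \<le> (e / E) * (norm h * (1 + C))" using q[OF r] e E by (intro mult_left_mono) auto
      finally show ?thesis .
     qed
     have "D r (h, y r x' - y r x) - D r (h, n r h) = D r (0, y r x' - y r x - n r h)"
      by (simp add: linear_diff[OF Dlin[OF r], symmetric])
     then have eq: "G r (x', y r x') - G r (x, y r x) - D r (h, n r h) = D r (0, y r x' - y r x - n r h) + R"
      by (simp add: R_def p_def h_def algebra_simps)
     have "norm (D r (0, y r x' - y r x - n r h) + R) \<le> M * norm (y r x' - y r x - n r h) + (e / E) * (norm h * (1 + C))"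
      using norm_triangle_ineq[of "D r (0, y r x' - y r x - n r h)" R] M(2)[OF r, of "(0, y r x' - y r x - n r h)"] R
      by (simp add: norm_Pair)
     then show "norm (G r (x', y r x') - G r (x, y r x) - D r (h, n r h)) \<le> M * norm (y r x' - y r x - n r h) + (e / E) * (norm h * (1 + C))"
      unfolding eq .
    qed (use M e E Cd in auto)
    also have "y 0 x' - y 0 x - n 0 h = 0" using y0 x x'S n0 by simp
    also have "exp (2 * M + 1) * (norm (0::'a) + e / E * (norm h * (1 + C))) = e * norm h"
     using Cd(1) by (simp add: E_def add_nonneg_eq_0_iff)
    finally show ?thesis by (simp add: h_def)
   qed
   have "min d (\<delta> / (1 + C)) > 0" using Cd \<delta> by auto
   then show "\<exists>d>0. \<forall>x'. norm (x' - x) < d --> norm (y s x' - y s x - n s (x' - x)) \<le> e * norm (x' - x)"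
    using main by blast
  qed
  show ?thesis using n0 nd der by (intro exI[of _ n]) (auto simp: D_def p_def)
 qed
 then have "\<forall>x\<in>S. \<exists>n. \<forall>w. n 0 w = 0 \<and>
   (\<forall>s\<in>{0..1}. ((%s. n s w) has_vector_derivative dd (G s) (x, y s x) (w, n s w)) (at s within {0..1}) \<and>
     (y s has_derivative n s) (at x))" by blast
 then obtain N where N: "!!x. x \<in> S ==> \<forall>w. N x 0 w = 0 \<and>
   (\<forall>s\<in>{0..1}. ((%s. N x s w) has_vector_derivative dd (G s) (x, y s x) (w, N x s w)) (at s within {0..1}) \<and>
     (y s has_derivative N x s) (at x))" by metis
 show ?thesis by (rule that[of "%s x. N x s"]) (use N in blast)+
qed

lemma PC_time:
 fixes z :: "real => 'b::real_normed_vector"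
 assumes "open S" "continuous_on {0..1} z"
 shows "PC k S (%s x. z s)"
proof -
 have c: "PC 0 S (%s x. z s)"
  unfolding PC.simps by (rule continuous_on_compose2[OF assms(2), of _ fst]) (auto intro!: continuous_intros)
 show ?thesis
 proof (cases k)
  case (Suc j)
  show ?thesis unfolding Suc
   by (rule PC_SucI[OF assms(1) has_derivative_const PC_const c])
 qed (use c in simp)
qed

text \<open>n s y - n s x solves the equation at y with an extra source: the difference of the two
  right-hand sides, both taken at n s x. Hence continuity and Lipschitz bounds for n only involve
  data along the fixed solution at x.\<close>

lemma linear_ode_difference:
 fixes A :: "real => 'p::euclidean_space => 'a::euclidean_space => 'a"
 assumes S: "open S" and lin: "!!s x. s \<in> {0..1} ==> x \<in> S ==> linear (A s x)"
  and A: "!!v. PC 0 S (%s x. A s x v)"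
  and n0: "!!x. x \<in> S ==> n 0 x = 0"
  and ode: "!!x s. x \<in> S ==> s \<in> {0..1} ==> ((%s. n s x) has_vector_derivative A s x (n s x) + b s x) (at s within {0..1})"
  and x: "x \<in> S"
 obtains K d where "K > 0" "d > 0" "cball x d \<subseteq> S"
  "!!y s e. y \<in> cball x d ==> s \<in> {0..1} ==> e \<ge> 0 ==>
   \<forall>r\<in>{0..1}. norm ((A r y (n r x) + b r y) - (A r x (n r x) + b r x)) \<le> e ==>
   norm (n s y - n s x) \<le> K * e"
proof -
 obtain r where r: "r > 0" "cball x r \<subseteq> S" using S x open_contains_cball by blast
 obtain L where L: "L > 0" and Abd: "!!s y v. s \<in> {0..1} ==> y \<in> cball x r ==> norm (A s y v) \<le> L * norm v"
  using PC_linear_bound[OF lin A compact_cball r(2)] by metis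
 show ?thesis
 proof (rule that[of "exp (2 * L + 1)" r])
  fix y s and e :: real
  assume y: "y \<in> cball x r" and s: "s \<in> {0..1::real}" and e: "e \<ge> 0"
   and bd: "\<forall>r\<in>{0..1}. norm ((A r y (n r x) + b r y) - (A r x (n r x) + b r x)) \<le> e"
  have yS: "y \<in> S" using y r by auto
  have "norm (n s y - n s x) \<le> exp (2 * L + 1) * (norm (n 0 y - n 0 x) + e)"
  proof (rule gronwall[OF _ _ _ e s])
   fix t :: real assume t: "t \<in> {0..1}"
   show "((%s. n s y - n s x) has_vector_derivative (A t y (n t y) + b t y) - (A t x (n t x) + b t x)) (at t within {0..1})"
    by (intro has_vector_derivative_diff ode t x yS)
   have eq: "(A t y (n t y) + b t y) - (A t x (n t x) + b t x)
    = A t y (n t y - n t x) + ((A t y (n t x) + b t y) - (A t x (n t x) + b t x))"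
    using linear_diff[OF lin[OF t yS]] by simp
   show "norm ((A t y (n t y) + b t y) - (A t x (n t x) + b t x)) \<le> L * norm (n t y - n t x) + e"
    unfolding eq by (rule norm_triangle_le) (intro add_mono Abd t y bd[rule_format])
  qed (use L in auto)
  then show "norm (n s y - n s x) \<le> exp (2 * L + 1) * e" using n0 x yS by simp
 qed (use r in auto)
qed

text \<open>The derivative of n in a direction w satisfies a linear equation with the same A; its
  source contains n and the derivatives of A and b, all of class k, so the induction closes.\<close>

lemma linear_ode_smooth:
 fixes A :: "real => 'p::euclidean_space => 'a::euclidean_space => 'a"
 assumes S: "open S" and lin: "!!s x. s \<in> {0..1} ==> x \<in> S ==> linear (A s x)"
  and n0: "!!x. x \<in> S ==> n 0 x = 0"
  and ode: "!!x s. x \<in> S ==> s \<in> {0..1} ==> ((%s. n s x) has_vector_derivative A s x (n s x) + b s x) (at s within {0..1})"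
  and A: "!!v. PC k S (%s x. A s x v)" and b: "PC k S b"
 shows "PC k S n"
 using n0 ode A b
proof (induction k arbitrary: n b)
 case 0
 note n0 = 0(1) and ode = 0(2) and A = 0(3) and b = 0(4)
 have cn: "continuous_on {0..1} (%s. n s x)" if "x \<in> S" for x
  unfolding continuous_on_eq_continuous_within using has_vector_derivative_continuous[OF ode[OF that]] by blast
 show ?case
 proof (rule PC_0I[OF cn])
  fix x and e :: real assume x: "x \<in> S" and e: "e > 0"
  obtain K d where K: "K > 0" "d > 0" "cball x d \<subseteq> S" and K4: "!!y s e. y \<in> cball x d ==> s \<in> {0..1} ==> e \<ge> 0 ==>
   \<forall>r\<in>{0..1}. norm ((A r y (n r x) + b r y) - (A r x (n r x) + b r x)) \<le> e ==>
   norm (n s y - n s x) \<le> K * e"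
   using linear_ode_difference[OF S lin A n0 ode x] by blast
  have f: "PC 0 S (%r y. A r y (n r x) + b r y)"
   by (rule PC_add[OF S PC_linear_apply[OF S lin A PC_time[OF S cn[OF x]]] b])
  have "0 < e / (2 * K)" using e K(1) by simp
  then obtain d1 where d1: "d1 > 0" "ball x d1 \<subseteq> S" "!!r y. r \<in> {0..1} ==> y \<in> ball x d1 ==>
    norm ((A r y (n r x) + b r y) - (A r x (n r x) + b r x)) < e / (2 * K)"
   using PC_continuous_uniformly[OF f S x] by metis
  have "norm (n s y - n s x) < e" if "y \<in> ball x (min d d1)" "s \<in> {0..1}" for s y
  proof -
   have "norm (n s y - n s x) \<le> K * (e / (2 * K))"
    using e K(1) that by (intro K4 ballI less_imp_le[OF d1(3)]) auto
   then show ?thesis using K(1) e by simp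
  qed
  then show "\<exists>d>0. \<forall>y\<in>ball x d \<inter> S. \<forall>s\<in>{0..1}. norm (n s y - n s x) < e"
   using K(2) d1(1) by (intro exI[of _ "min d d1"]) auto
 qed
next
 case (Suc k)
 note n0 = Suc.prems(1) and ode = Suc.prems(2) and A = Suc.prems(3) and b = Suc.prems(4)
 have mono1: "PC 1 T f" if "PC (Suc k) T f" for T :: "'q::euclidean_space set" and f :: "real => 'q => 'c::real_normed_vector"
  using that
 proof (induction k)
  case (Suc k)
  then show ?case using PC_Suc by blast
 qed simp
 define \<Omega> where "\<Omega> = S \<times> (UNIV::'a set)"
 have O: "open \<Omega>" unfolding \<Omega>_def using S by (simp add: open_Times)
 define G where "G s q = A s (fst q) (snd q) + b s (fst q)" for s and q :: "'p \<times> 'a"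
 have psnd: "PC j \<Omega> (%s q. snd q)" for j
  by (rule PC_bounded_linear[OF bounded_linear_snd O PC_snd[OF O]])
 have Af: "PC (Suc k) \<Omega> (%s q. A s (fst q) v)" for v
  unfolding \<Omega>_def by (rule PC_fst[OF S A])
 have bf: "PC (Suc k) \<Omega> (%s q. b s (fst q))"
  unfolding \<Omega>_def by (rule PC_fst[OF S b])
 have linf: "linear (A s (fst q))" if "s \<in> {0..1}" "q \<in> \<Omega>" for s q
  using lin that by (auto simp: \<Omega>_def)
 have "PC (Suc k) \<Omega> G"
  using PC_add[OF O PC_linear_apply[OF O linf Af psnd] bf] unfolding G_def[abs_def] .
 then have G1: "PC 1 \<Omega> G" by (rule mono1)
 have A0: "PC 0 S (%s x. A s x v)" and A1: "PC (Suc 0) S (%s x. A s x v)" for v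
  using mono1[OF A[of v]] PC_Suc[of 0 S] by auto
 have b1: "PC (Suc 0) S b" using mono1[OF b] by simp
 have cn: "continuous_on {0..1} (%s. n s x)" if "x \<in> S" for x
  unfolding continuous_on_eq_continuous_within using has_vector_derivative_continuous[OF ode[OF that]] by blast
 have lip: "\<exists>C d. C \<ge> 0 \<and> d > 0 \<and> (\<forall>x'\<in>ball x d. x' \<in> S \<and> (\<forall>s\<in>{0..1}. norm (n s x' - n s x) \<le> C * norm (x' - x)))" if x: "x \<in> S" for x
 proof -
  obtain K d where K: "K > 0" "d > 0" "cball x d \<subseteq> S" and K4: "!!y s e. y \<in> cball x d ==> s \<in> {0..1} ==> e \<ge> 0 ==>
   \<forall>r\<in>{0..1}. norm ((A r y (n r x) + b r y) - (A r x (n r x) + b r x)) \<le> e ==>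
   norm (n s y - n s x) \<le> K * e"
   using linear_ode_difference[OF S lin A0 n0 ode x] by blast
  have f: "PC (Suc 0) S (%r y. A r y (n r x) + b r y)"
   by (rule PC_add[OF S PC_linear_apply[OF S lin A1 PC_time[OF S cn[OF x]]] b1])
  obtain C where C: "C > 0" "!!r y z. r \<in> {0..1} ==> y \<in> cball x d ==> z \<in> cball x d ==>
    norm ((A r y (n r x) + b r y) - (A r z (n r x) + b r z)) \<le> C * norm (y - z)"
   using PC_lipschitz[OF f compact_cball convex_cball K(3)] by metis
  have "norm (n s y - n s x) \<le> K * (C * norm (y - x))" if "y \<in> cball x d" "s \<in> {0..1}" for y s
   using C(1) K(2) by (intro K4 ballI that C(2)) auto
  then show ?thesis
   by (intro exI[of _ "K * C"] exI[of _ d]) (use K C in \<open>auto simp: mult.assoc subset_iff\<close>)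
 qed
 have odeG: "((%s. n s x) has_vector_derivative G s (x, n s x)) (at s within {0..1})" if "x \<in> S" "s \<in> {0..1}" for x s
  using ode[OF that] by (simp add: G_def)
 have inO: "(x, n s x) \<in> \<Omega>" if "x \<in> S" "s \<in> {0..1}" for x s
  using that by (simp add: \<Omega>_def)
 obtain m where m: "!!x w. x \<in> S ==> m 0 x w = 0"
  "!!x s w. x \<in> S ==> s \<in> {0..1} ==> ((%s. m s x w) has_vector_derivative dd (G s) (x, n s x) (w, m s x w)) (at s within {0..1})"
  "!!x s. x \<in> S ==> s \<in> {0..1} ==> (n s has_derivative m s x) (at x)"
  using ode_param_derivative[OF S O G1 n0 odeG inO lip] by metis
 have nk: "PC k S n"
  by (rule Suc.IH[OF n0 ode PC_Suc[OF A] PC_Suc[OF b]])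
 have n0': "PC 0 S n"
  using PC_continuous[OF nk] by simp
 have dG: "dd (G s) (x, z) (w, h) = A s x h + ((\<Sum>c\<in>Basis. (z \<bullet> c) *\<^sub>R dd (%x. A s x c) x w) + dd (b s) x w)"
  if s: "s \<in> {0..1}" "x \<in> S" for s x z w h
 proof -
  have s': "fst (x, z) \<in> S" using s by simp
  have dA: "((%q. A s (fst q) c) has_derivative (%v. dd (%x. A s x c) x (fst v))) (at (x, z))" for c
   using has_derivative_compose[OF has_derivative_fst[OF has_derivative_ident] PC_has_derivative[OF A[of c] s(1) s']] by simp
  have db: "((%q. b s (fst q)) has_derivative (%v. dd (b s) x (fst v))) (at (x, z))"
   using has_derivative_compose[OF has_derivative_fst[OF has_derivative_ident] PC_has_derivative[OF b s(1) s']] by simp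
  have "((%q. (\<Sum>c\<in>Basis. (snd q \<bullet> c) *\<^sub>R A s (fst q) c) + b s (fst q)) has_derivative
    (%v. (\<Sum>c\<in>Basis. (z \<bullet> c) *\<^sub>R dd (%x. A s x c) x (fst v) + (snd v \<bullet> c) *\<^sub>R A s x c) + dd (b s) x (fst v))) (at (x, z))"
   by (intro has_derivative_add has_derivative_sum db)
     (rule has_derivative_eq_rhs[OF has_derivative_scaleR[OF has_derivative_inner_left[OF has_derivative_snd[OF has_derivative_ident]] dA]], simp)
  then have "(G s has_derivative
    (%v. (\<Sum>c\<in>Basis. (z \<bullet> c) *\<^sub>R dd (%x. A s x c) x (fst v) + (snd v \<bullet> c) *\<^sub>R A s x c) + dd (b s) x (fst v))) (at (x, z))"
  proof (rule has_derivative_transform_within_open[OF _ O])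
   show "(x, z) \<in> \<Omega>" using s by (simp add: \<Omega>_def)
   fix q assume "q \<in> \<Omega>"
   then have "fst q \<in> S" by (auto simp: \<Omega>_def)
   then show "(\<Sum>c\<in>Basis. (snd q \<bullet> c) *\<^sub>R A s (fst q) c) + b s (fst q) = G s q"
    unfolding G_def using linear_expand[OF lin[OF s(1)], of "fst q" "snd q"] by simp
  qed
  then have "dd (G s) (x, z) (w, h) = (\<Sum>c\<in>Basis. (z \<bullet> c) *\<^sub>R dd (%x. A s x c) x w + (h \<bullet> c) *\<^sub>R A s x c) + dd (b s) x w"
   using dd_eq by fastforce
  also have "\<dots> = A s x h + ((\<Sum>c\<in>Basis. (z \<bullet> c) *\<^sub>R dd (%x. A s x c) x w) + dd (b s) x w)"
   using linear_expand[OF lin[OF s], of h] by (simp add: sum.distrib)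
  finally show ?thesis .
 qed
 have mk: "PC k S (%s x. m s x w)" for w
 proof (rule Suc.IH[where b="%s x. (\<Sum>c\<in>Basis. (n s x \<bullet> c) *\<^sub>R dd (%x. A s x c) x w) + dd (b s) x w"])
  show "PC k S (%s x. A s x v)" for v by (rule PC_Suc[OF A])
  show "PC k S (%s x. (\<Sum>c\<in>Basis. (n s x \<bullet> c) *\<^sub>R dd (%x. A s x c) x w) + dd (b s) x w)"
   by (intro PC_add S PC_sum PC_bilinear[OF bounded_bilinear_scaleR S] PC_bounded_linear[OF bounded_linear_inner_left S] nk
     PC_dd[OF A] PC_dd[OF b])
 qed (use m dG in auto)
 show ?case by (rule PC_SucI[OF S m(3) mk n0'])
qed

text \<open>X is given on a ball only, so it is made globally Lipschitz by composition with the
  nearest-point projection \<rho> onto \<open>cball 0 r\<close>. Solutions starting in U never leave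
  the ball on which \<rho> is the identity and therefore solve the original equation. Smoothness in
  x comes from the linear equation satisfied by the derivative.\<close>

lemma smooth_flow:
 fixes X :: "real \<times> 'a::euclidean_space => 'a"
 assumes T: "open T" "{0..1} \<subseteq> T" and R: "R > 0" and X: "smooth_on (T \<times> ball 0 R) X"
  and X0: "!!s. s \<in> {0..1} ==> X (s, 0) = 0"
 obtains F U where "open U" "0 \<in> U" "!!s. s \<in> {0..1} ==> smooth_on U (F s)"
  "!!x. F 0 x = x" "!!s x. s \<in> {0..1} ==> x \<in> U ==> norm (F s x) < R"
  "!!s x. s \<in> {0..1} ==> x \<in> U ==> ((%s. F s x) has_vector_derivative X (s, F s x)) (at s within {0..1})"
  "!!s x w. s \<in> {0..1} ==> x \<in> U ==>
    ((%s. dd (F s) x w) has_vector_derivative dd X (s, F s x) (0, dd (F s) x w)) (at s within {0..1})"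
  "!!s x. s \<in> {0..1} ==> x \<in> U ==> (!!s. s \<in> {0..1} ==> X (s, x) = 0) ==> F s x = x"
proof -
 define r where "r = R / 2"
 have r: "r > 0" "r < R" using R by (auto simp: r_def)
 have TB: "open (T \<times> ball (0::'a) R)" using T by (simp add: open_Times)
 have PX: "PC k (ball 0 R) (%s y. X (s, y))" for k
  by (rule PC_compose[OF open_ball TB PC_snd[OF open_ball] X]) (use T in auto)
 obtain L where L: "L > 0"
  and lipX: "!!s y z. s \<in> {0..1} ==> y \<in> cball 0 r ==> z \<in> cball 0 r ==> norm (X (s, y) - X (s, z)) \<le> L * norm (y - z)"
  by (rule PC_lipschitz[OF PX compact_cball convex_cball, of 0 r]) (use r in auto)
 define \<rho> where "\<rho> = closest_point (cball (0::'a) r)"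
 have cb: "closed (cball (0::'a) r)" "cball (0::'a) r \<noteq> {}" "convex (cball (0::'a) r)" using r by auto
 have \<rho>in: "\<rho> y \<in> cball 0 r" for y unfolding \<rho>_def by (rule closest_point_in_set[OF cb(1,2)])
 have \<rho>R: "\<rho> y \<in> ball 0 R" for y using \<rho>in[of y] r by auto
 have \<rho>lip: "norm (\<rho> y - \<rho> z) \<le> norm (y - z)" for y z
  using closest_point_lipschitz[OF cb(3,1,2), of y z] by (simp add: \<rho>_def dist_norm)
 have \<rho>id: "\<rho> y = y" if "y \<in> cball 0 r" for y unfolding \<rho>_def by (rule closest_point_self[OF that])
 have \<rho>c: "continuous_on UNIV \<rho>" unfolding \<rho>_def by (rule continuous_on_closest_point[OF cb(3,1,2)])
 define Y where "Y s y = X (s, \<rho> y)" for s y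
 have cY: "continuous_on ({0..1} \<times> UNIV) (%(s, y). Y s y)"
  unfolding split_beta Y_def
 proof (rule continuous_on_compose2[OF smooth_on_imp_continuous[OF X]])
  show "continuous_on ({0..1} \<times> UNIV) (%p. (fst p, \<rho> (snd p)))"
   by (intro continuous_intros continuous_on_compose2[OF \<rho>c]) auto
  show "(%p. (fst p, \<rho> (snd p))) ` ({0..1} \<times> UNIV) \<subseteq> T \<times> ball 0 R"
   using T \<rho>R by auto
 qed
 have lipY: "norm (Y s y - Y s z) \<le> L * norm (y - z)" if s: "s \<in> {0..1}" for s y z
 proof -
  have "norm (Y s y - Y s z) \<le> L * norm (\<rho> y - \<rho> z)" unfolding Y_def by (rule lipX[OF s \<rho>in \<rho>in])
  also have "\<dots> \<le> L * norm (y - z)" using L by (intro mult_left_mono \<rho>lip) auto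
  finally show ?thesis .
 qed
 have "\<exists>y. y 0 = c \<and> (\<forall>s\<in>{0..1}. (y has_vector_derivative Y s (y s)) (at s within {0..1}))" for c
  by (rule ode_exists[OF cY lipY L, of c]) blast+
 then obtain f where f: "!!c. f c 0 = c" "!!c s. s \<in> {0..1} ==> (f c has_vector_derivative Y s (f c s)) (at s within {0..1})"
  by metis
 define F where "F s x = f x s" for s x
 have F0: "F 0 x = x" for x by (simp add: F_def f)
 have Fode: "((%s. F s x) has_vector_derivative Y s (F s x)) (at s within {0..1})" if "s \<in> {0..1}" for s x
  using f(2)[OF that] by (simp add: F_def)
 define E where "E = exp (2 * L + 1)"
 have E: "E > 0" by (simp add: E_def)
 have Flip: "norm (F s x - F s y) \<le> E * norm (x - y)" if s: "s \<in> {0..1}" for s x y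
 proof -
  have "norm (F s x - F s y) \<le> exp (2 * L + 1) * (norm (F 0 x - F 0 y) + 0)"
   by (rule gronwall[OF has_vector_derivative_diff[OF Fode Fode] _ _ _ s]) (use lipY L in auto)
  then show ?thesis by (simp add: F0 E_def)
 qed
 have Y0: "Y s 0 = 0" if "s \<in> {0..1}" for s
  using X0[OF that] \<rho>id[of 0] r by (simp add: Y_def)
 have Fbd: "norm (F s x) \<le> E * norm x" if s: "s \<in> {0..1}" for s x
 proof -
  have "norm (F s x) \<le> exp (2 * L + 1) * (norm (F 0 x) + 0)"
   by (rule gronwall[OF Fode _ _ _ s]) (use lipY[of _ _ 0] Y0 L in auto)
  then show ?thesis by (simp add: F0 E_def)
 qed
 \<comment> \<open>Gronwall gives |F s x| <= E |x|, so orbits starting in the ball of radius r / E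
   stay within radius r.\<close>
 define U where "U = ball (0::'a) (r / E)"
 have U: "open U" "0 \<in> U" using r E by (auto simp: U_def)
 have Fr: "norm (F s x) < r" if "s \<in> {0..1}" "x \<in> U" for s x
  using le_less_trans[OF Fbd[OF that(1)], of x r] that(2) E by (simp add: U_def pos_less_divide_eq mult.commute)
 have FX: "Y s (F s x) = X (s, F s x)" if "s \<in> {0..1}" "x \<in> U" for s x
  using \<rho>id[of "F s x"] Fr[OF that] by (simp add: Y_def)
 have ode: "((%s. F s x) has_vector_derivative X (s, F s x)) (at s within {0..1})" if "s \<in> {0..1}" "x \<in> U" for s x
  using Fode[OF that(1), of x] FX[OF that] by simp
 define \<Omega> where "\<Omega> = (%q::'a \<times> 'a. fst q + snd q) -` ball 0 R"
 have O: "open \<Omega>" unfolding \<Omega>_def by (rule open_vimage) (auto intro!: continuous_intros)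
 define G where "G s q = X (s, fst q + snd q)" for s and q :: "'a \<times> 'a"
 have G1: "PC 1 \<Omega> G"
  unfolding G_def[abs_def]
  by (rule PC_compose[OF O TB PC_bounded_linear[OF bounded_linear_add[OF bounded_linear_fst bounded_linear_snd] O PC_snd[OF O]] X])
    (use T in \<open>auto simp: \<Omega>_def\<close>)
 \<comment> \<open>Subtracting x makes the initial value independent of the parameter, as
   \<open>ode_param_derivative\<close> requires; \<Omega> and G express the equation for this
   difference.\<close>
 define y where "y s x = F s x - x" for s x
 have Xd: "(X has_derivative dd X (s, z)) (at (s, z))" if "s \<in> {0..1}" "norm z < R" for s z
  by (rule smooth_on_imp_has_derivative[OF X]) (use that T in auto)
 have dG: "dd (G s) (x, z) (w, h) = dd X (s, x + z) (0, w + h)" if "s \<in> {0..1}" "norm (x + z) < R" for s x z w h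
 proof -
  have 1: "((%q. (s, fst q + snd q)) has_derivative (%v. (0, fst v + snd v))) (at (x, z))"
   by (auto intro!: derivative_eq_intros)
  have 2: "(X has_derivative dd X (s, x + z)) (at (s, fst (x, z) + snd (x, z)))" using Xd[OF that] by simp
  show ?thesis unfolding G_def[abs_def] using dd_eq[OF has_derivative_compose[OF 1 2]] by simp
 qed
 have y0: "y 0 x = 0" if "x \<in> U" for x by (simp add: y_def F0)
 have odey: "((%s. y s x) has_vector_derivative G s (x, y s x)) (at s within {0..1})" if "x \<in> U" "s \<in> {0..1}" for x s
  using has_vector_derivative_diff[OF ode[OF that(2,1)] has_vector_derivative_const[of x]] by (simp add: y_def G_def)
 have inO: "(x, y s x) \<in> \<Omega>" if "x \<in> U" "s \<in> {0..1}" for x s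
  using Fr[OF that(2,1)] r by (simp add: \<Omega>_def y_def)
 have lip: "\<exists>C d. C \<ge> 0 \<and> d > 0 \<and> (\<forall>x'\<in>ball x d. x' \<in> U \<and> (\<forall>s\<in>{0..1}. norm (y s x' - y s x) \<le> C * norm (x' - x)))" if x: "x \<in> U" for x
 proof -
  obtain d where d: "d > 0" "ball x d \<subseteq> U" using U(1) x openE by blast
  have "norm (y s x' - y s x) \<le> (E + 1) * norm (x' - x)" if s: "s \<in> {0..1}" for s x'
  proof -
   have "y s x' - y s x = (F s x' - F s x) - (x' - x)" by (simp add: y_def)
   then have "norm (y s x' - y s x) \<le> norm (F s x' - F s x) + norm (x' - x)" by (metis norm_triangle_ineq4)
   then show ?thesis using Flip[OF s, of x' x] by (simp add: algebra_simps)
  qed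
  then show ?thesis using d E by - (rule exI[of _ "E + 1"], rule exI[of _ d], auto)
 qed
 obtain n where n: "!!x w. x \<in> U ==> n 0 x w = 0"
  "!!x s w. x \<in> U ==> s \<in> {0..1} ==> ((%s. n s x w) has_vector_derivative dd (G s) (x, y s x) (w, n s x w)) (at s within {0..1})"
  "!!x s. x \<in> U ==> s \<in> {0..1} ==> (y s has_derivative n s x) (at x)"
  using ode_param_derivative[OF U(1) O G1 y0 odey inO lip] by metis
 have Fd: "(F s has_derivative (%w. w + n s x w)) (at x)" if "s \<in> {0..1}" "x \<in> U" for s x
  using has_derivative_add[OF has_derivative_ident n(3)[OF that(2,1)]] by (simp add: y_def)
 have ddF: "dd (F s) x = (%w. w + n s x w)" if "s \<in> {0..1}" "x \<in> U" for s x
  using dd_eq[OF Fd[OF that]] .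
 have node: "((%s. n s x w) has_vector_derivative dd X (s, F s x) (0, w + n s x w)) (at s within {0..1})"
  if "s \<in> {0..1}" "x \<in> U" for s x w
 proof -
  have "norm (x + y s x) < R" using Fr[OF that] r by (simp add: y_def)
  then show ?thesis using n(2)[OF that(2,1), of w] dG[OF that(1), of x "y s x" w "n s x w"] by (simp add: y_def)
 qed
 have PF: "PC k U F" for k
 proof (induction k)
  case 0
  have cF: "continuous_on {0..1} (%s. F s x)" for x
   unfolding continuous_on_eq_continuous_within using has_vector_derivative_continuous[OF Fode] by blast
  show ?case
  proof (rule PC_0I[OF cF])
   fix x and e :: real assume e: "e > 0"
   have "norm (F s y - F s x) < e" if "y \<in> ball x (e / E)" "s \<in> {0..1}" for y s
    using le_less_trans[OF Flip[OF that(2), of y x], of e] that(1) E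
    by (simp add: dist_norm norm_minus_commute pos_less_divide_eq mult.commute)
   then show "\<exists>d>0. \<forall>y\<in>ball x d \<inter> U. \<forall>s\<in>{0..1}. norm (F s y - F s x) < e"
    using e E by (intro exI[of _ "e / E"]) auto
  qed
 next
  case (Suc k)
  have inTB: "(s, F s x) \<in> T \<times> ball 0 R" if "s \<in> {0..1}" "x \<in> U" for s x
   using Fr[OF that] that T r by auto
  have PA: "PC k U (%s x. dd X (s, F s x) (0, v))" for v
   by (rule PC_compose[OF U(1) TB Suc smooth_on_dd[OF X] inTB])
  have lin: "linear (%v. dd X (s, F s x) (0, v))" if s: "s \<in> {0..1}" "x \<in> U" for s x
  proof -
   have l: "linear (dd X (s, F s x))"
    using has_derivative_linear[OF Xd[OF s(1)]] Fr[OF s] r by simp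
   show ?thesis
    by (rule linearI) (use linear_add[OF l, of "(0, _)" "(0, _)"] linear_cmul[OF l, of _ "(0, _)"] in auto)
  qed
  have nk: "PC k U (%s x. n s x w)" for w
  proof (rule linear_ode_smooth[OF U(1) lin _ _ PA PA[of w]])
   fix x s assume xs: "x \<in> U" "s \<in> {0..1::real}"
   show "((%s. n s x w) has_vector_derivative dd X (s, F s x) (0, n s x w) + dd X (s, F s x) (0, w)) (at s within {0..1})"
    using node[OF xs(2,1), of w] linear_add[OF lin[OF xs(2,1)], of w "n s x w"] by (simp add: add.commute)
  qed (use n in auto)
  have c0: "PC 0 U F" using PC_continuous[OF Suc] by simp
  show ?case by (rule PC_SucI[OF U(1) Fd PC_add[OF U(1) PC_const nk] c0])
 qed
 show ?thesis
 proof (rule that[OF U, of F])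
  show "smooth_on U (F s)" if "s \<in> {0..1}" for s
   unfolding smooth_on_def using PC_C_k_on[OF PF that] by blast
  show "F 0 x = x" for x by (rule F0)
  show "norm (F s x) < R" if "s \<in> {0..1}" "x \<in> U" for s x
   using Fr[OF that] r by simp
  show "((%s. F s x) has_vector_derivative X (s, F s x)) (at s within {0..1})" if "s \<in> {0..1}" "x \<in> U" for s x
   by (rule ode[OF that])
  show "((%s. dd (F s) x w) has_vector_derivative dd X (s, F s x) (0, dd (F s) x w)) (at s within {0..1})"
   if s: "s \<in> {0..1}" "x \<in> U" for s x w
  proof -
   have "((%s. w + n s x w) has_vector_derivative 0 + dd X (s, F s x) (0, w + n s x w)) (at s within {0..1})"
    by (intro has_vector_derivative_add has_vector_derivative_const node s)
   then have "((%s. dd (F s) x w) has_vector_derivative 0 + dd X (s, F s x) (0, w + n s x w)) (at s within {0..1})"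
    by (rule has_vector_derivative_transform[OF s(1), rotated]) (use ddF s in auto)
   then show ?thesis using ddF[OF s] by simp
  qed
  show "F s x = x" if s: "s \<in> {0..1}" "x \<in> U" and z: "!!s. s \<in> {0..1} ==> X (s, x) = 0" for s x
  proof -
   have "r / E \<le> r" using r L by (simp add: E_def divide_le_eq mult_left_le)
   then have xr: "x \<in> cball 0 r" using s(2) by (auto simp: U_def)
   have "norm (F s x - x) \<le> exp (2 * L + 1) * (norm (F 0 x - x) + 0)"
   proof (rule gronwall[OF _ _ _ _ s(1)])
    fix t :: real assume t: "t \<in> {0..1}"
    show "((%s. F s x - x) has_vector_derivative X (t, F t x) - 0) (at t within {0..1})"
     by (intro has_vector_derivative_diff ode t s has_vector_derivative_const)
    have "F t x \<in> cball 0 r" using Fr[OF t s(2)] by simp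
    then show "norm (X (t, F t x) - 0) \<le> L * norm (F t x - x) + 0"
     using lipX[OF t, of "F t x" x] z[OF t] xr by simp
   qed (use L in auto)
   then show ?thesis by (simp add: F0)
  qed
 qed
qed

section \<open>Diffeomorphism germs\<close>

lemma smooth_germ_chain:
 fixes f :: "'a::euclidean_space => 'b::euclidean_space"
 assumes "smooth_germ f" "f 0 = 0" "smooth_germ g"
 shows "eventually (%x. dd (%x. g (f x)) x = (%v. dd g (f x) (dd f x v))) (nhds 0)"
 using smooth_germ_eventually[OF assms(1)]
  eventually_compose_0[OF smooth_germ_isCont[OF assms(1)] assms(2) smooth_germ_eventually[OF assms(3)]]
 by eventually_elim (rule dd_eq[OF has_derivative_compose])

text \<open>By the inverse function theorem, the inverse demanded by \<open>diffeo_on\<close> exists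
  once the derivative at 0 is injective. Injectivity of \<Phi> near 0 turns equality of set germs
  into a pointwise equivalence.\<close>

lemma diffeo_germ_onto_iff:
 "diffeo_germ_onto \<Phi> A B \<longleftrightarrow> \<Phi> 0 = 0 \<and> smooth_germ \<Phi> \<and> inj (dd \<Phi> 0) \<and> (NEAR x. x \<in> A \<longleftrightarrow> \<Phi> x \<in> B)"
proof (intro iffI conjI)
 assume a: "diffeo_germ_onto \<Phi> A B"
 then obtain U \<Psi> where U: "\<Phi> 0 = 0" "0 \<in> U" "open U" "open (\<Phi> ` U)" "smooth_on U \<Phi>" "smooth_on (\<Phi> ` U) \<Psi>"
  "!!x. x \<in> U ==> \<Psi> (\<Phi> x) = x" "\<Phi> ` (A \<inter> U) = B \<inter> \<Phi> ` U"
  unfolding diffeo_germ_onto_def diffeo_on_def by blast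
 show "\<Phi> 0 = 0" by fact
 show "smooth_germ \<Phi>" using U smooth_germI by blast
 have d: "(\<Phi> has_derivative dd \<Phi> 0) (at 0)" using smooth_on_imp_has_derivative U by blast
 have e: "(\<Psi> has_derivative dd \<Psi> (\<Phi> 0)) (at (\<Phi> 0))" using smooth_on_imp_has_derivative U by blast
 have "((%x. \<Psi> (\<Phi> x)) has_derivative (%x. x)) (at 0)"
  by (rule has_derivative_transform_within_open[OF has_derivative_ident U(3,2)]) (simp add: U)
 then have "dd \<Psi> (\<Phi> 0) (dd \<Phi> 0 v) = v" for v
  using has_derivative_unique[OF has_derivative_compose[OF d e]] by metis
 then show "inj (dd \<Phi> 0)" by (rule inj_on_inverseI)
 have "x \<in> A \<longleftrightarrow> \<Phi> x \<in> B" if x: "x \<in> U" for x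
 proof
  assume "x \<in> A"
  then have "\<Phi> x \<in> \<Phi> ` (A \<inter> U)" using x by blast
  then show "\<Phi> x \<in> B" using U(8) by blast
 next
  assume "\<Phi> x \<in> B"
  then have "\<Phi> x \<in> \<Phi> ` (A \<inter> U)" using x U(8) by blast
  then obtain y where y: "y \<in> A" "y \<in> U" "\<Phi> x = \<Phi> y" by blast
  then show "x \<in> A" using U(7)[OF x] U(7)[OF y(2)] by metis
 qed
 then show "NEAR x. x \<in> A \<longleftrightarrow> \<Phi> x \<in> B" using U unfolding eventually_nhds by blast
next
 assume a: "\<Phi> 0 = 0 \<and> smooth_germ \<Phi> \<and> inj (dd \<Phi> 0) \<and> (NEAR x. x \<in> A \<longleftrightarrow> \<Phi> x \<in> B)"
 then obtain U V where UV: "open U" "0 \<in> U" "smooth_on U \<Phi>" "open V" "0 \<in> V" "!!x. x \<in> V ==> x \<in> A \<longleftrightarrow> \<Phi> x \<in> B"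
  unfolding smooth_germ_def eventually_nhds by blast
 have o: "open (U \<inter> V)" "0 \<in> U \<inter> V" "smooth_on (U \<inter> V) \<Phi>" using UV by (auto intro: smooth_on_subset)
 obtain U' g where U': "open U'" "0 \<in> U'" "U' \<subseteq> U \<inter> V" "open (\<Phi> ` U')" "smooth_on (\<Phi> ` U') g" "!!x. x \<in> U' ==> g (\<Phi> x) = x"
  using smooth_inverse_function[OF o conjunct1[OF conjunct2[OF conjunct2[OF a]]]] by metis
 have "\<Phi> ` (A \<inter> U') = B \<inter> \<Phi> ` U'" using UV(6) U'(3) by blast
 moreover have "diffeo_on U' \<Phi>"
  unfolding diffeo_on_def using U' o(3) smooth_on_subset by blast
 ultimately show "diffeo_germ_onto \<Phi> A B" unfolding diffeo_germ_onto_def using a U'(2) by blast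
qed

lemma inj_dd_compose:
 assumes "smooth_germ f" "smooth_germ g" "f 0 = 0" "inj (dd f 0)" "inj (dd g 0)"
 shows "inj (dd (%x. g (f x)) 0)"
proof -
 have "dd (%x. g (f x)) 0 = (%v. dd g 0 (dd f 0 v))"
  using eventually_nhds_x_imp_x[OF smooth_germ_chain[OF assms(1,3,2)]] assms(3) by simp
 then show ?thesis using inj_compose[OF assms(5,4)] by (simp add: o_def)
qed

lemma diffeo_germ_compose:
 assumes "diffeo_germ_onto \<Phi> A B" "diffeo_germ_onto \<Psi> B C"
 shows "diffeo_germ_onto (%x. \<Psi> (\<Phi> x)) A C"
proof -
 have a: "\<Phi> 0 = 0" "smooth_germ \<Phi>" "inj (dd \<Phi> 0)" and a4: "NEAR x. x \<in> A \<longleftrightarrow> \<Phi> x \<in> B"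
  using assms(1) unfolding diffeo_germ_onto_iff by blast+
 have b: "\<Psi> 0 = 0" "smooth_germ \<Psi>" "inj (dd \<Psi> 0)" and b4: "NEAR x. x \<in> B \<longleftrightarrow> \<Psi> x \<in> C"
  using assms(2) unfolding diffeo_germ_onto_iff by blast+
 have "NEAR x. x \<in> A \<longleftrightarrow> \<Psi> (\<Phi> x) \<in> C"
  using a4 eventually_compose_0[OF smooth_germ_isCont[OF a(2)] a(1) b4] by eventually_elim simp
 then show ?thesis unfolding diffeo_germ_onto_iff
  using smooth_germ_compose[OF a(2,1) b(2)] inj_dd_compose[OF a(2) b(2) a(1,3) b(3)] a b by simp
qed

lemma smooth_germ_inverse:
 fixes \<Phi> :: "'a::euclidean_space => 'a"
 assumes s: "smooth_germ \<Phi>" and 0: "\<Phi> 0 = 0" and inj: "inj (dd \<Phi> 0)"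
 obtains \<Psi> where "smooth_germ \<Psi>" "\<Psi> 0 = 0" "inj (dd \<Psi> 0)"
  "NEAR x. \<Psi> (\<Phi> x) = x" "NEAR x. \<Phi> (\<Psi> x) = x"
proof -
 obtain U where U: "open U" "0 \<in> U" "smooth_on U \<Phi>" using s smooth_germE by blast
 obtain U' g where U': "open U'" "0 \<in> U'" "U' \<subseteq> U" "open (\<Phi> ` U')" "smooth_on (\<Phi> ` U') g" "!!x. x \<in> U' ==> g (\<Phi> x) = x"
  using smooth_inverse_function[OF U inj] by metis
 have m: "0 \<in> \<Phi> ` U'" using U'(2) 0 by (metis image_eqI)
 have 1: "smooth_germ g" by (rule smooth_germI[OF U'(4) m U'(5)])
 have 2: "g 0 = 0" using U'(6)[OF U'(2)] 0 by simp
 have 3: "NEAR x. g (\<Phi> x) = x" unfolding eventually_nhds using U' by blast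
 have "\<Phi> (g y) = y" if "y \<in> \<Phi> ` U'" for y
  using that U'(6) by (metis imageE)
 then have 4: "NEAR x. \<Phi> (g x) = x" unfolding eventually_nhds using U'(4) m by blast
 have "((%x. \<Phi> (g x)) has_derivative (%x. dd \<Phi> 0 (dd g 0 x))) (at 0)"
  using has_derivative_compose[OF smooth_germ_has_derivative_0[OF 1], of \<Phi>] smooth_germ_has_derivative_0[OF s] 2 by simp
 moreover have "dd (%x. \<Phi> (g x)) 0 = dd (%x. x) 0" by (rule dd_cong[OF 4])
 ultimately have "dd \<Phi> 0 (dd g 0 x) = x" for x using dd_eq dd_eq[OF has_derivative_ident] by metis
 then have "inj (dd g 0)" by (rule inj_on_inverseI)
 with 1 2 3 4 show ?thesis using that by blast
qed

lemma diffeo_germ_inverse: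
 assumes "diffeo_germ_onto \<Phi> A B"
 obtains \<Psi> where "diffeo_germ_onto \<Psi> B A" "NEAR x. \<Psi> (\<Phi> x) = x" "NEAR x. \<Phi> (\<Psi> x) = x"
proof -
 have a: "\<Phi> 0 = 0" "smooth_germ \<Phi>" "inj (dd \<Phi> 0)" and a4: "NEAR x. x \<in> A \<longleftrightarrow> \<Phi> x \<in> B"
  using assms unfolding diffeo_germ_onto_iff by blast+
 obtain \<Psi> where P: "smooth_germ \<Psi>" "\<Psi> 0 = 0" "inj (dd \<Psi> 0)"
  "NEAR x. \<Psi> (\<Phi> x) = x" "NEAR x. \<Phi> (\<Psi> x) = x"
  using smooth_germ_inverse[OF a(2,1,3)] by metis
 have "NEAR x. \<Psi> x \<in> A \<longleftrightarrow> \<Phi> (\<Psi> x) \<in> B"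
  using eventually_compose_0[OF smooth_germ_isCont[OF P(1)] P(2) a4] .
 then have "NEAR x. x \<in> B \<longleftrightarrow> \<Psi> x \<in> A" using P(5) by eventually_elim simp
 then show ?thesis using that[of \<Psi>] P unfolding diffeo_germ_onto_iff by blast
qed

section \<open>Germs of differential forms and algebraic restrictions\<close>

lemma eventually_Basis:
 assumes "!!b. b \<in> Basis ==> eventually (%x. P b x) F"
 shows "eventually (%x. \<forall>b\<in>(Basis::'a::euclidean_space set). P b x) F"
 using assms by (simp add: eventually_ball_finite_distrib)

text \<open>Linearity reduces smoothness in all directions to finitely many coefficients, whose
  neighbourhoods can be intersected.\<close>

lemma form1_germ_iff:
 "form1_germ \<beta> \<longleftrightarrow> (NEAR x. linear (\<beta> x)) \<and> (\<forall>b\<in>Basis. smooth_germ (%x. \<beta> x b))"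
proof (intro iffI conjI)
 assume "form1_germ \<beta>"
 then obtain U where U: "open U" "0 \<in> U" "\<forall>x\<in>U. linear (\<beta> x)" "\<forall>u. smooth_on U (%x. \<beta> x u)"
  unfolding form1_germ_def by blast
 show "NEAR x. linear (\<beta> x)" using U unfolding eventually_nhds by blast
 show "\<forall>b\<in>Basis. smooth_germ (%x. \<beta> x b)" using U smooth_germI by blast
next
 assume a: "(NEAR x. linear (\<beta> x)) \<and> (\<forall>b\<in>Basis. smooth_germ (%x. \<beta> x b))"
 then obtain V where V: "open V" "0 \<in> V" "!!x. x \<in> V ==> linear (\<beta> x)" unfolding eventually_nhds by blast
 have "\<forall>b\<in>Basis. \<exists>U. open U \<and> 0 \<in> U \<and> smooth_on U (%x. \<beta> x b)" using a unfolding smooth_germ_def by blast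
 then obtain W where W: "!!b. b \<in> Basis ==> open (W b) \<and> 0 \<in> W b \<and> smooth_on (W b) (%x. \<beta> x b)" by metis
 define U where "U = V \<inter> (\<Inter>b\<in>Basis. W b)"
 have U: "open U" "0 \<in> U" unfolding U_def using V W by (auto intro!: open_Int open_INT)
 have sb: "smooth_on U (%x. \<beta> x b)" if "b \<in> Basis" for b
  using smooth_on_subset[of "W b" _ U] W[OF that] that by (auto simp: U_def)
 have "smooth_on U (%x. \<beta> x u)" for u
 proof -
  have sm: "smooth_on U (%x. \<Sum>b\<in>Basis. (u \<bullet> b) *\<^sub>R \<beta> x b)"
   by (intro smooth_on_sum smooth_on_scaleR smooth_on_const U sb)
  have eq: "(\<Sum>b\<in>Basis. (u \<bullet> b) *\<^sub>R \<beta> x b) = \<beta> x u" if "x \<in> U" for x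
   using linear_expand[OF V(3), of x u] that by (simp add: U_def)
  show ?thesis by (rule smooth_on_cong[OF U(1) eq sm])
 qed
 then show "form1_germ \<beta>" unfolding form1_germ_def using U V(3) by (intro exI[of _ U]) (auto simp: U_def)
qed

lemma bilinear_expand:
 fixes h :: "'a::euclidean_space => 'b::euclidean_space => real"
 assumes "bilinear h"
 shows "h u v = (\<Sum>b\<in>Basis. \<Sum>c\<in>Basis. (u \<bullet> b) * (v \<bullet> c) * h b c)"
proof -
 have 1: "linear (%u. h u v)" and 2: "!!u. linear (h u)" using assms by (auto simp: bilinear_def)
 have "h u v = (\<Sum>b\<in>Basis. (u \<bullet> b) * h b v)" using linear_expand[OF 1, of u] by simp
 also have "\<dots> = (\<Sum>b\<in>Basis. (u \<bullet> b) * (\<Sum>c\<in>Basis. (v \<bullet> c) * h b c))"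
  using linear_expand[OF 2, of _ v] by (intro sum.cong) auto
 finally show ?thesis by (simp add: sum_distrib_left mult.assoc)
qed

lemma form2_germ_iff:
 "form2_germ \<omega> \<longleftrightarrow> (NEAR x. bilinear (\<omega> x) \<and> (\<forall>u. \<omega> x u u = 0)) \<and>
   (\<forall>b\<in>Basis. \<forall>c\<in>Basis. smooth_germ (%x. \<omega> x b c))"
proof (intro iffI conjI)
 assume "form2_germ \<omega>"
 then obtain U where U: "open U" "0 \<in> U" "\<forall>x\<in>U. bilinear (\<omega> x) \<and> (\<forall>u. \<omega> x u u = 0)" "\<forall>u v. smooth_on U (%x. \<omega> x u v)"
  unfolding form2_germ_def by blast
 show "NEAR x. bilinear (\<omega> x) \<and> (\<forall>u. \<omega> x u u = 0)" using U unfolding eventually_nhds by blast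
 show "\<forall>b\<in>Basis. \<forall>c\<in>Basis. smooth_germ (%x. \<omega> x b c)" using U smooth_germI by blast
next
 assume a: "(NEAR x. bilinear (\<omega> x) \<and> (\<forall>u. \<omega> x u u = 0)) \<and>
   (\<forall>b\<in>Basis. \<forall>c\<in>Basis. smooth_germ (%x. \<omega> x b c))"
 then obtain V where V: "open V" "0 \<in> V" "!!x. x \<in> V ==> bilinear (\<omega> x)" "!!x u. x \<in> V ==> \<omega> x u u = 0"
  unfolding eventually_nhds by blast
 have "\<forall>b\<in>Basis. \<forall>c\<in>Basis. \<exists>U. open U \<and> 0 \<in> U \<and> smooth_on U (%x. \<omega> x b c)" using a unfolding smooth_germ_def by blast
 then obtain W where W: "!!b c. b \<in> Basis ==> c \<in> Basis ==> open (W b c) \<and> 0 \<in> W b c \<and> smooth_on (W b c) (%x. \<omega> x b c)" by metis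
 define U where "U = V \<inter> (\<Inter>b\<in>Basis. \<Inter>c\<in>Basis. W b c)"
 have U: "open U" "0 \<in> U" unfolding U_def using V W by (auto intro!: open_Int open_INT)
 have sb: "smooth_on U (%x. \<omega> x b c)" if "b \<in> Basis" "c \<in> Basis" for b c
  using smooth_on_subset[of "W b c" _ U] W[OF that] that by (auto simp: U_def)
 have "smooth_on U (%x. \<omega> x u v)" for u v
 proof -
  have sm: "smooth_on U (%x. \<Sum>b\<in>Basis. \<Sum>c\<in>Basis. (u \<bullet> b) * (v \<bullet> c) * \<omega> x b c)"
   by (intro smooth_on_sum smooth_on_mult smooth_on_const U sb)
  have eq: "(\<Sum>b\<in>Basis. \<Sum>c\<in>Basis. (u \<bullet> b) * (v \<bullet> c) * \<omega> x b c) = \<omega> x u v" if "x \<in> U" for x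
   using bilinear_expand[OF V(3), of x u v] that by (simp add: U_def)
  show ?thesis by (rule smooth_on_cong[OF U(1) eq sm])
 qed
 then show "form2_germ \<omega>" unfolding form2_germ_def using U V(3,4) by (intro exI[of _ U]) (auto simp: U_def)
qed

lemma form1_germ_smooth: "form1_germ \<beta> ==> smooth_germ (%x. \<beta> x u)"
 unfolding form1_germ_def smooth_germ_def by blast

lemma form2_germ_smooth: "form2_germ \<omega> ==> smooth_germ (%x. \<omega> x u v)"
 unfolding form2_germ_def smooth_germ_def by blast

lemma form1_germ_linear: "form1_germ \<beta> ==> NEAR x. linear (\<beta> x)"
 unfolding form1_germ_iff by blast

lemma form2_germ_bilinear: "form2_germ \<omega> ==> NEAR x. bilinear (\<omega> x) \<and> (\<forall>u. \<omega> x u u = 0)"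
 unfolding form2_germ_iff by blast

lemma form1_germ_derivative:
 assumes "form1_germ \<beta>"
 shows "NEAR x. \<forall>u. ((%y. \<beta> y u) has_derivative dd (%y. \<beta> y u) x) (at x)"
 using assms smooth_on_imp_has_derivative unfolding form1_germ_def eventually_nhds by metis

lemma form2_germ_derivative:
 assumes "form2_germ \<omega>"
 shows "NEAR x. \<forall>u v. ((%y. \<omega> y u v) has_derivative dd (%y. \<omega> y u v) x) (at x)"
 using assms smooth_on_imp_has_derivative unfolding form2_germ_def eventually_nhds by metis

lemma bilinear_alternating_swap:
 assumes "bilinear h" "!!u. h u u = (0::real)" shows "h u v = - h v u"
proof -
 have "h (u + v) (u + v) = 0" using assms(2) .
 then have "h u u + h u v + (h v u + h v v) = 0"
  by (simp add: bilinear_ladd[OF assms(1)] bilinear_radd[OF assms(1)] add_ac)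
 then show ?thesis using assms(2) by simp
qed

lemma form1_germ_add: "form1_germ \<beta> ==> form1_germ \<gamma> ==> form1_germ (%x v. \<beta> x v + \<gamma> x v)"
 unfolding form1_germ_iff by (auto intro: smooth_germ_add linear_compose_add elim: eventually_elim2)

lemma linear_mult_const: "linear f ==> linear (%v. c * f v :: real)"
 by (auto intro!: linearI simp: linear_add linear_cmul algebra_simps)

lemma form1_germ_mult: "smooth_germ h ==> form1_germ \<beta> ==> form1_germ (%x v. h x * \<beta> x v)"
 unfolding form1_germ_iff
 by (auto intro: smooth_germ_mult linear_mult_const elim!: eventually_mono)

lemma form1_germ_const: "linear l ==> form1_germ (%x. l)"
 unfolding form1_germ_iff by (simp add: smooth_germ_const)

lemma form2_germ_add:
 assumes "form2_germ \<beta>" "form2_germ \<gamma>" shows "form2_germ (%x u v. \<beta> x u v + \<gamma> x u v)"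
 unfolding form2_germ_iff
proof (intro conjI ballI)
 show "NEAR x. bilinear (%u v. \<beta> x u v + \<gamma> x u v) \<and> (\<forall>u. \<beta> x u u + \<gamma> x u u = 0)"
  using form2_germ_bilinear[OF assms(1)] form2_germ_bilinear[OF assms(2)]
  by eventually_elim (auto simp: bilinear_def intro: linear_compose_add)
qed (intro smooth_germ_add form2_germ_smooth assms)

lemma form2_germ_mult:
 assumes "smooth_germ h" "form2_germ \<beta>" shows "form2_germ (%x u v. h x * \<beta> x u v)"
 unfolding form2_germ_iff
proof (intro conjI ballI)
 show "NEAR x. bilinear (%u v. h x * \<beta> x u v) \<and> (\<forall>u. h x * \<beta> x u u = 0)"
  using form2_germ_bilinear[OF assms(2)]
  by eventually_elim (auto simp: bilinear_def intro: linear_mult_const)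
qed (intro smooth_germ_mult form2_germ_smooth assms)

lemma form2_germ_diff: "form2_germ \<beta> ==> form2_germ \<gamma> ==> form2_germ (%x u v. \<beta> x u v - \<gamma> x u v)"
 using form2_germ_add[OF _ form2_germ_mult[OF smooth_germ_const[of "-1"]]] by fastforce

lemma form2_germ_zero: "form2_germ (%x u v. 0)"
 unfolding form2_germ_iff by (simp add: smooth_germ_const bilinear_def linear_zero)

lemma form2_germ_wedge:
 assumes "form1_germ \<beta>" "form1_germ \<gamma>"
 shows "form2_germ (%x u v. \<beta> x u * \<gamma> x v - \<beta> x v * \<gamma> x u)"
 unfolding form2_germ_iff
proof (intro conjI ballI)
 show "NEAR x. bilinear (%u v. \<beta> x u * \<gamma> x v - \<beta> x v * \<gamma> x u) \<and> (\<forall>u. \<beta> x u * \<gamma> x u - \<beta> x u * \<gamma> x u = 0)"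
  using form1_germ_linear[OF assms(1)] form1_germ_linear[OF assms(2)]
 proof eventually_elim
  case (elim x)
  show ?case unfolding bilinear_def
   by (auto intro!: linearI simp: linear_add[OF elim(1)] linear_add[OF elim(2)] linear_cmul[OF elim(1)] linear_cmul[OF elim(2)] algebra_simps)
 qed
qed (intro smooth_germ_diff smooth_germ_mult form1_germ_smooth assms)+

lemma form2_germ_ext_d1:
 assumes "form1_germ \<beta>" shows "form2_germ (ext_d1 \<beta>)"
 unfolding form2_germ_iff
proof (intro conjI ballI)
 have 1: "NEAR x. \<forall>\<^sub>F y in nhds x. linear (\<beta> y)"
  using form1_germ_linear[OF assms] by (simp add: eventually_eventually)
 show "NEAR x. bilinear (ext_d1 \<beta> x) \<and> (\<forall>u. ext_d1 \<beta> x u u = 0)"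
  using 1 form1_germ_derivative[OF assms]
 proof eventually_elim
  case (elim x)
  have l: "linear (dd (%y. \<beta> y v) x)" for v using has_derivative_linear elim(2) by blast
  have a: "dd (%y. \<beta> y (v + w)) x u = dd (%y. \<beta> y v) x u + dd (%y. \<beta> y w) x u" for u v w
  proof -
   have "dd (%y. \<beta> y (v + w)) x = dd (%y. \<beta> y v + \<beta> y w) x"
    by (rule dd_cong) (use elim(1) in eventually_elim, simp add: linear_add)
   also have "\<dots> = (%u. dd (%y. \<beta> y v) x u + dd (%y. \<beta> y w) x u)"
    by (rule dd_eq) (intro has_derivative_add elim(2)[rule_format])
   finally show ?thesis by simp
  qed
  have s: "dd (%y. \<beta> y (c *\<^sub>R v)) x u = c * dd (%y. \<beta> y v) x u" for u v c
  proof -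
   have "dd (%y. \<beta> y (c *\<^sub>R v)) x = dd (%y. c * \<beta> y v) x"
    by (rule dd_cong) (use elim(1) in eventually_elim, simp add: linear_cmul)
   also have "\<dots> = (%u. c * dd (%y. \<beta> y v) x u)"
    by (rule dd_eq) (intro has_derivative_mult_right elim(2)[rule_format])
   finally show ?thesis by simp
  qed
  show ?case unfolding bilinear_def ext_d1_def
   by (auto intro!: linearI simp: linear_add[OF l] linear_cmul[OF l] a s algebra_simps)
 qed
qed (unfold ext_d1_def, intro smooth_germ_diff smooth_germ_dd form1_germ_smooth assms)

lemma ext_d1_add:
 assumes "form1_germ \<beta>" "form1_germ \<gamma>"
 shows "NEAR x. \<forall>u v. ext_d1 (%x v. \<beta> x v + \<gamma> x v) x u v = ext_d1 \<beta> x u v + ext_d1 \<gamma> x u v"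
 using form1_germ_derivative[OF assms(1)] form1_germ_derivative[OF assms(2)]
proof eventually_elim
 case (elim x)
 have "dd (%y. \<beta> y v + \<gamma> y v) x = (%u. dd (%y. \<beta> y v) x u + dd (%y. \<gamma> y v) x u)" for v
  by (rule dd_eq) (intro has_derivative_add elim[rule_format])
 then show ?case by (simp add: ext_d1_def)
qed

lemma ext_d1_mult:
 assumes "smooth_germ h" "form1_germ \<beta>"
 shows "NEAR x. \<forall>u v. ext_d1 (%x v. h x * \<beta> x v) x u v = dd h x u * \<beta> x v - dd h x v * \<beta> x u + h x * ext_d1 \<beta> x u v"
 using smooth_germ_eventually[OF assms(1)] form1_germ_derivative[OF assms(2)]
proof eventually_elim
 case (elim x)
 have "dd (%y. h y * \<beta> y v) x = (%u. h x * dd (%y. \<beta> y v) x u + dd h x u * \<beta> x v)" for v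
  by (rule dd_eq) (intro has_derivative_mult elim(1) elim(2)[rule_format])
 then show ?case by (simp add: ext_d1_def algebra_simps)
qed

lemma ext_d1_const: "ext_d1 (%x. l) x u v = 0"
 by (simp add: ext_d1_def frechet_derivative_const)

definition closed_germ :: "'a::euclidean_space form2 => bool" where
 "closed_germ \<omega> \<longleftrightarrow> (NEAR x. \<forall>u v w. ext_d2 \<omega> x u v w = 0)"

lemma closed_germ_cong:
 assumes "NEAR x. \<forall>u v. \<omega> x u v = \<omega>' x u v" "closed_germ \<omega>"
 shows "closed_germ \<omega>'"
proof -
 have "NEAR x. \<forall>\<^sub>F y in nhds x. \<forall>u v. \<omega> y u v = \<omega>' y u v"
  using assms(1) by (simp add: eventually_eventually)
 with assms(2)[unfolded closed_germ_def] show ?thesis unfolding closed_germ_def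
 proof eventually_elim
  case (elim x)
  have "dd (%y. \<omega> y u v) x = dd (%y. \<omega>' y u v) x" for u v
   by (rule dd_cong) (use elim(2) in eventually_elim, simp)
  then show ?case using elim(1) by (simp add: ext_d2_def)
 qed
qed

lemma closed_germ_add:
 assumes "form2_germ \<omega>" "form2_germ \<omega>'" "closed_germ \<omega>" "closed_germ \<omega>'"
 shows "closed_germ (%x u v. \<omega> x u v + \<omega>' x u v)"
 using form2_germ_derivative[OF assms(1)] form2_germ_derivative[OF assms(2)] assms(3,4)[unfolded closed_germ_def]
 unfolding closed_germ_def
proof eventually_elim
 case (elim x)
 have "dd (%y. \<omega> y u v + \<omega>' y u v) x = (%w. dd (%y. \<omega> y u v) x w + dd (%y. \<omega>' y u v) x w)" for u v
  by (rule dd_eq) (intro has_derivative_add elim(1,2)[rule_format])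
 then show ?case using elim(3,4) by (simp add: ext_d2_def) (smt (verit))
qed

lemma closed_germ_scale:
 assumes "form2_germ \<omega>" "closed_germ \<omega>" shows "closed_germ (%x u v. c * \<omega> x u v)"
 using form2_germ_derivative[OF assms(1)] assms(2)[unfolded closed_germ_def]
 unfolding closed_germ_def
proof eventually_elim
 case (elim x)
 have "dd (%y. c * \<omega> y u v) x = (%w. c * dd (%y. \<omega> y u v) x w)" for u v
  by (rule dd_eq) (intro has_derivative_mult_right elim(1)[rule_format])
 then have "ext_d2 (%x u v. c * \<omega> x u v) x u v w = c * ext_d2 \<omega> x u v w" for u v w
  by (simp add: ext_d2_def algebra_simps)
 then show ?case using elim(2) by simp
qed

lemma closed_germ_diff:
 assumes "form2_germ \<omega>" "form2_germ \<omega>'" "closed_germ \<omega>" "closed_germ \<omega>'"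
 shows "closed_germ (%x u v. \<omega> x u v - \<omega>' x u v)"
 using closed_germ_add[OF assms(1) form2_germ_mult[OF smooth_germ_const[of "-1"] assms(2)] assms(3) closed_germ_scale[OF assms(2,4)]]
 by simp

lemma closed_germ_const: "closed_germ (%x. h)"
 by (simp add: closed_germ_def ext_d2_def frechet_derivative_const)

lemma closed_germ_ext_d1:
 assumes "form1_germ \<beta>" shows "closed_germ (ext_d1 \<beta>)"
proof -
 obtain U where U: "open U" "0 \<in> U" "!!u. smooth_on U (%x. \<beta> x u)" using assms unfolding form1_germ_def by blast
 have d: "((%y. dd (%z. \<beta> z w) y u) has_derivative dd (%y. dd (%z. \<beta> z w) y u) x) (at x)" if "x \<in> U" for x u w
  using smooth_on_imp_has_derivative[OF smooth_on_dd[OF U(3)] that] .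
 have e: "dd (%y. ext_d1 \<beta> y v w) x u = dd (%y. dd (%z. \<beta> z w) y v) x u - dd (%y. dd (%z. \<beta> z v) y w) x u" if "x \<in> U" for x u v w
  unfolding ext_d1_def using dd_eq[OF has_derivative_diff[OF d[OF that] d[OF that]]] by metis
 have c: "dd (%z. dd (%y. \<beta> y w) z u) x v = dd (%z. dd (%y. \<beta> y w) z v) x u" if "x \<in> U" for x u v w
  by (rule C_k_on_dd_commute[OF U(1) _ that]) (use U(3) in \<open>auto simp: smooth_on_def\<close>)
 have "ext_d2 (ext_d1 \<beta>) x u v w = 0" if x: "x \<in> U" for x u v w
  unfolding ext_d2_def e[OF x] using c[OF x, of w u v] c[OF x, of v u w] c[OF x, of u v w] by simp
 then show ?thesis unfolding closed_germ_def eventually_nhds using U(1,2) by blast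
qed

lemma linear_expand_real:
 fixes A :: "'b::euclidean_space => real"
 assumes "linear A" shows "A v = (\<Sum>b\<in>Basis. (v \<bullet> b) * A b)"
 using linear_expand[OF assms, of v] by simp

text \<open>Product rule for a form evaluated at a moving point on two moving vectors. It is stated
  for derivatives within S so that it covers the closed time interval [0, 1] as well as full
  derivatives in x.\<close>

lemma form2_chain:
 fixes \<alpha> :: "'a::euclidean_space form2" and P Q R :: "'b::real_normed_vector => 'a"
 assumes U: "open U" "!!z. z \<in> U ==> bilinear (\<alpha> z)"
  "!!z u v. z \<in> U ==> ((%z. \<alpha> z u v) has_derivative dd (%z. \<alpha> z u v) z) (at z)"
  and y: "P y \<in> U" and P: "(P has_derivative P') (at y within S)" and Q: "(Q has_derivative Q') (at y within S)"
  and R: "(R has_derivative R') (at y within S)"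
 shows "((%y. \<alpha> (P y) (Q y) (R y)) has_derivative
  (%h. dd (%z. \<alpha> z (Q y) (R y)) (P y) (P' h) + \<alpha> (P y) (Q' h) (R y) + \<alpha> (P y) (Q y) (R' h))) (at y within S)"
proof -
 let ?d = "%b c. dd (%z. \<alpha> z b c) (P y)"
 have 1: "((%y. \<Sum>b\<in>Basis. \<Sum>c\<in>Basis. (Q y \<bullet> b) * (R y \<bullet> c) * \<alpha> (P y) b c) has_derivative
   (%h. \<Sum>b\<in>Basis. \<Sum>c\<in>Basis. (Q y \<bullet> b) * (R y \<bullet> c) * ?d b c (P' h)
    + ((Q y \<bullet> b) * (R' h \<bullet> c) + (Q' h \<bullet> b) * (R y \<bullet> c)) * \<alpha> (P y) b c)) (at y within S)"
  by (intro has_derivative_sum has_derivative_mult has_derivative_inner_left Q R has_derivative_compose[OF P U(3)] y)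
 have d2: "?d u v h = (\<Sum>b\<in>Basis. \<Sum>c\<in>Basis. (u \<bullet> b) * (v \<bullet> c) * ?d b c h)" for u v h
 proof -
  have ev: "\<forall>\<^sub>F z in nhds (P y). bilinear (\<alpha> z)" using U(1,2) y unfolding eventually_nhds by blast
  have "?d u v = dd (%z. \<Sum>b\<in>Basis. \<Sum>c\<in>Basis. (u \<bullet> b) * (v \<bullet> c) * \<alpha> z b c) (P y)"
   by (rule dd_cong) (use ev in eventually_elim, rule bilinear_expand)
  also have "\<dots> = (%h. \<Sum>b\<in>Basis. \<Sum>c\<in>Basis. (u \<bullet> b) * (v \<bullet> c) * ?d b c h)"
   by (rule dd_eq) (intro has_derivative_sum has_derivative_mult_right U(3) y)
  finally show ?thesis by simp
 qed
 have "(\<Sum>b\<in>Basis. \<Sum>c\<in>Basis. (Q y \<bullet> b) * (R y \<bullet> c) * ?d b c (P' h)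
    + ((Q y \<bullet> b) * (R' h \<bullet> c) + (Q' h \<bullet> b) * (R y \<bullet> c)) * \<alpha> (P y) b c)
   = ?d (Q y) (R y) (P' h) + \<alpha> (P y) (Q' h) (R y) + \<alpha> (P y) (Q y) (R' h)" for h
  unfolding d2[of "Q y" "R y" "P' h"] bilinear_expand[OF U(2)[OF y], of "Q' h" "R y"] bilinear_expand[OF U(2)[OF y], of "Q y" "R' h"]
  by (simp add: sum.distrib algebra_simps)
 then have 2: "((%y. \<Sum>b\<in>Basis. \<Sum>c\<in>Basis. (Q y \<bullet> b) * (R y \<bullet> c) * \<alpha> (P y) b c) has_derivative
   (%h. ?d (Q y) (R y) (P' h) + \<alpha> (P y) (Q' h) (R y) + \<alpha> (P y) (Q y) (R' h))) (at y within S)"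
  using 1 by simp
 have c: "\<forall>\<^sub>F z in at y within S. P z \<in> U"
  using has_derivative_continuous[OF P] U(1) y unfolding continuous_within by (rule topological_tendstoD)
 \<comment> \<open>The filter does not see whether y belongs to S, while the transformation rule
   wants y in the set.\<close>
 have ins: "at y within S = at y within insert y S" by (simp add: at_within_def)
 show ?thesis unfolding ins
 proof (rule has_derivative_transform_eventually[OF 2[unfolded ins]])
  show "\<forall>\<^sub>F z in at y within insert y S. (\<Sum>b\<in>Basis. \<Sum>c\<in>Basis. (Q z \<bullet> b) * (R z \<bullet> c) * \<alpha> (P z) b c) = \<alpha> (P z) (Q z) (R z)"
   using c unfolding ins by eventually_elim (rule bilinear_expand[OF U(2), symmetric])
  show "(\<Sum>b\<in>Basis. \<Sum>c\<in>Basis. (Q y \<bullet> b) * (R y \<bullet> c) * \<alpha> (P y) b c) = \<alpha> (P y) (Q y) (R y)"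
   by (rule bilinear_expand[OF U(2)[OF y], symmetric])
 qed simp
qed

text \<open>Reduced to the bilinear case: \<beta> is multiplied by the functional v \<mapsto> v
  \<bullet> e for a basis vector e, and the second argument is held at e.\<close>

lemma form1_chain:
 fixes \<beta> :: "'a::euclidean_space => 'a => real" and P Q :: "'b::real_normed_vector => 'a"
 assumes U: "open U" "!!z. z \<in> U ==> linear (\<beta> z)"
  "!!z u. z \<in> U ==> ((%z. \<beta> z u) has_derivative dd (%z. \<beta> z u) z) (at z)"
  and y: "P y \<in> U" and P: "(P has_derivative P') (at y within S)" and Q: "(Q has_derivative Q') (at y within S)"
 shows "((%y. \<beta> (P y) (Q y)) has_derivative (%h. dd (%z. \<beta> z (Q y)) (P y) (P' h) + \<beta> (P y) (Q' h))) (at y within S)"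
proof -
 obtain e :: 'a where e: "e \<in> Basis" by (metis ex_in_conv nonempty_Basis)
 let ?\<alpha> = "%z u v. \<beta> z u * (v \<bullet> e)"
 have d: "((%z. ?\<alpha> z u v) has_derivative (%h. dd (%z. \<beta> z u) z h * (v \<bullet> e))) (at z)" if "z \<in> U" for z u v
  by (rule has_derivative_mult_left[OF U(3)[OF that]])
 have b: "bilinear (?\<alpha> z)" if "z \<in> U" for z
  unfolding bilinear_def
  by (auto intro!: linearI simp: linear_add[OF U(2)[OF that]] linear_cmul[OF U(2)[OF that]] inner_add_left algebra_simps)
 have "((%z. ?\<alpha> z u v) has_derivative dd (%z. ?\<alpha> z u v) z) (at z)" if "z \<in> U" for z u v
  using d[OF that, of u v] dd_eq[OF d[OF that, of u v]] by simp
 from form2_chain[where R="%_. e", OF U(1) b this y P Q has_derivative_const]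
 show ?thesis using e by (simp add: dd_eq[OF d[OF y]])
qed

section \<open>Pullbacks\<close>

definition pullback1 :: "('a::euclidean_space => 'a) => 'a form1 => 'a form1" where
 "pullback1 \<Phi> \<beta> x v = \<beta> (\<Phi> x) (dd \<Phi> x v)"

lemma smooth_germ_dd2:
 fixes \<Phi> :: "'a::euclidean_space => 'b::euclidean_space"
 assumes "smooth_germ \<Phi>"
 shows "NEAR x. \<forall>v. ((%y. dd \<Phi> y v) has_derivative dd (%y. dd \<Phi> y v) x) (at x)"
  "NEAR x. \<forall>u v. dd (%y. dd \<Phi> y v) x u = dd (%y. dd \<Phi> y u) x v"
proof -
 obtain U where U: "open U" "0 \<in> U" "smooth_on U \<Phi>" using assms smooth_germE by blast
 have d: "((%y. dd \<Phi> y v) has_derivative dd (%y. dd \<Phi> y v) x) (at x)" if "x \<in> U" for x v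
  using smooth_on_imp_has_derivative[OF smooth_on_dd[OF U(3)] that] .
 show "NEAR x. \<forall>v. ((%y. dd \<Phi> y v) has_derivative dd (%y. dd \<Phi> y v) x) (at x)"
  using U(1,2) d unfolding eventually_nhds by blast
 have "dd (%y. dd \<Phi> y v) x u = dd (%y. dd \<Phi> y u) x v" if x: "x \<in> U" for x u v
 proof (rule euclidean_eqI)
  fix b :: 'b
  have sb: "smooth_on U (%x. \<Phi> x \<bullet> b)"
   using smooth_on_inner[OF U(1,3) smooth_on_const] .
  have "dd (%y. \<Phi> y \<bullet> b) z w = dd \<Phi> z w \<bullet> b" if "z \<in> U" for z w
   using dd_eq[OF has_derivative_inner_left[OF smooth_on_imp_has_derivative[OF U(3) that]]] by simp
  then have "dd (%z. dd (%y. \<Phi> y \<bullet> b) z w) x = dd (%z. dd \<Phi> z w \<bullet> b) x" for w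
   by (intro dd_cong) (use U(1) x in \<open>auto simp: eventually_nhds\<close>)
  moreover have "dd (%z. dd \<Phi> z w \<bullet> b) x = (%v. dd (%z. dd \<Phi> z w) x v \<bullet> b)" for w
   by (rule dd_eq[OF has_derivative_inner_left[OF d[OF x]]])
  moreover have "dd (%z. dd (%y. \<Phi> y \<bullet> b) z v) x u = dd (%z. dd (%y. \<Phi> y \<bullet> b) z u) x v"
   by (rule C_k_on_dd_commute[OF U(1) _ x]) (use sb in \<open>auto simp: smooth_on_def\<close>)
  ultimately show "dd (%y. dd \<Phi> y v) x u \<bullet> b = dd (%y. dd \<Phi> y u) x v \<bullet> b" by simp
 qed
 then show "NEAR x. \<forall>u v. dd (%y. dd \<Phi> y v) x u = dd (%y. dd \<Phi> y u) x v"
  using U(1,2) unfolding eventually_nhds by blast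
qed

text \<open>The chain rule produces second derivatives of \<Phi>; being symmetric, they cancel in
  the exterior derivative.\<close>

lemma ext_d1_pullback1:
 assumes \<Phi>: "smooth_germ \<Phi>" "\<Phi> 0 = 0" and \<beta>: "form1_germ \<beta>"
 shows "NEAR x. \<forall>u v. ext_d1 (pullback1 \<Phi> \<beta>) x u v = pullback \<Phi> (ext_d1 \<beta>) x u v"
proof -
 obtain U where U: "open U" "0 \<in> U" "\<forall>x\<in>U. linear (\<beta> x)" "!!u. smooth_on U (%x. \<beta> x u)"
  using \<beta> unfolding form1_germ_def by blast
 have bd: "((%z. \<beta> z u) has_derivative dd (%z. \<beta> z u) z) (at z)" if "z \<in> U" for z u
  using smooth_on_imp_has_derivative[OF U(4) that] .
 have "NEAR x. \<Phi> x \<in> U"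
  by (rule eventually_compose_0[OF smooth_germ_isCont[OF \<Phi>(1)] \<Phi>(2)]) (use U in \<open>auto simp: eventually_nhds\<close>)
 with smooth_germ_eventually[OF \<Phi>(1)] smooth_germ_dd2[OF \<Phi>(1)] show ?thesis
 proof eventually_elim
  case (elim x)
  have "dd (%y. pullback1 \<Phi> \<beta> y v) x u = dd (%z. \<beta> z (dd \<Phi> x v)) (\<Phi> x) (dd \<Phi> x u) + \<beta> (\<Phi> x) (dd (%y. dd \<Phi> y v) x u)" for u v
   unfolding pullback1_def
   using dd_eq[OF form1_chain[where P=\<Phi> and Q="%y. dd \<Phi> y v" and \<beta>=\<beta>, OF U(1) U(3)[rule_format] bd elim(4,1) elim(2)[rule_format]]]
   by simp
  then show ?case using elim(3) by (simp add: ext_d1_def pullback_def)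
 qed
qed

lemma form1_germ_pullback1:
 assumes \<Phi>: "smooth_germ \<Phi>" "\<Phi> 0 = 0" and \<beta>: "form1_germ \<beta>"
 shows "form1_germ (pullback1 \<Phi> \<beta>)"
 unfolding form1_germ_iff
proof (intro conjI ballI)
 have lin: "NEAR x. linear (\<beta> (\<Phi> x))"
  by (rule eventually_compose_0[OF smooth_germ_isCont[OF \<Phi>(1)] \<Phi>(2) form1_germ_linear[OF \<beta>]])
 with smooth_germ_linear_dd[OF \<Phi>(1)] show "NEAR x. linear (pullback1 \<Phi> \<beta> x)"
  by eventually_elim (auto intro!: linearI simp: pullback1_def linear_add linear_cmul)
 show "smooth_germ (%x. pullback1 \<Phi> \<beta> x b)" for b
  unfolding pullback1_def
  by (rule smooth_germ_linear_apply[OF lin smooth_germ_compose[OF \<Phi> form1_germ_smooth[OF \<beta>]] smooth_germ_dd[OF \<Phi>(1)]])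
qed

lemma form2_germ_pullback:
 assumes \<Phi>: "smooth_germ \<Phi>" "\<Phi> 0 = 0" and \<omega>: "form2_germ \<omega>"
 shows "form2_germ (pullback \<Phi> \<omega>)"
 unfolding form2_germ_iff
proof (intro conjI ballI)
 have bil: "NEAR x. bilinear (\<omega> (\<Phi> x)) \<and> (\<forall>u. \<omega> (\<Phi> x) u u = 0)"
  by (rule eventually_compose_0[OF smooth_germ_isCont[OF \<Phi>(1)] \<Phi>(2) form2_germ_bilinear[OF \<omega>]])
 with smooth_germ_linear_dd[OF \<Phi>(1)]
 show "NEAR x. bilinear (pullback \<Phi> \<omega> x) \<and> (\<forall>u. pullback \<Phi> \<omega> x u u = 0)"
 proof eventually_elim
  case (elim x)
  have b: "bilinear (\<omega> (\<Phi> x))" using elim by blast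
  show ?case
   unfolding bilinear_def pullback_def
   by (auto intro!: linearI simp: linear_add[OF elim(1)] linear_cmul[OF elim(1)] bilinear_ladd[OF b] bilinear_radd[OF b]
     bilinear_lmul[OF b] bilinear_rmul[OF b] elim(2))
 qed
 fix b c :: 'a
 have s: "smooth_germ (%x. \<omega> (\<Phi> x) d e)" for d e
  by (rule smooth_germ_compose[OF \<Phi> form2_germ_smooth[OF \<omega>]])
 have t: "smooth_germ (%x. dd \<Phi> x b \<bullet> d)" for b d
  by (rule smooth_germ_inner[OF smooth_germ_dd[OF \<Phi>(1)] smooth_germ_const])
 have "smooth_germ (%x. \<Sum>d\<in>Basis. \<Sum>e\<in>Basis. (dd \<Phi> x b \<bullet> d) * (dd \<Phi> x c \<bullet> e) * \<omega> (\<Phi> x) d e)"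
  by (intro smooth_germ_sum smooth_germ_mult s t)
 moreover have "NEAR x. (\<Sum>d\<in>Basis. \<Sum>e\<in>Basis. (dd \<Phi> x b \<bullet> d) * (dd \<Phi> x c \<bullet> e) * \<omega> (\<Phi> x) d e) = pullback \<Phi> \<omega> x b c"
  using bil by eventually_elim (unfold pullback_def, rule bilinear_expand[symmetric], blast)
 ultimately show "smooth_germ (%x. pullback \<Phi> \<omega> x b c)" by (rule smooth_germ_cong)
qed

lemma pullback_compose:
 assumes "smooth_germ \<Phi>" "\<Phi> 0 = 0" "smooth_germ \<Psi>"
 shows "NEAR x. \<forall>u v. pullback (%x. \<Psi> (\<Phi> x)) \<omega> x u v = pullback \<Phi> (pullback \<Psi> \<omega>) x u v"
 using smooth_germ_chain[OF assms] by eventually_elim (simp add: pullback_def)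

lemma pullback_cong_form:
 assumes "smooth_germ \<Phi>" "\<Phi> 0 = 0" "NEAR x. \<forall>u v. \<omega> x u v = \<omega>' x u v"
 shows "NEAR x. \<forall>u v. pullback \<Phi> \<omega> x u v = pullback \<Phi> \<omega>' x u v"
 using eventually_compose_0[OF smooth_germ_isCont[OF assms(1)] assms(2,3)]
 by eventually_elim (simp add: pullback_def)

lemma pullback_id:
 assumes "NEAR x. \<Phi> x = x"
 shows "NEAR x. \<forall>u v. pullback \<Phi> \<omega> x u v = \<omega> x u v"
 using assms eventually_dd_cong[OF assms]
 by eventually_elim (simp add: pullback_def dd_eq[OF has_derivative_ident])

section \<open>Algebraic restrictions\<close>

text \<open>The zero class of algebraic restrictions. Equality of restrictions means that the
  difference is null, so computations with restrictions become linear algebra with null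
  forms.\<close>

definition alg_null :: "'a::euclidean_space set => 'a form2 => bool" where
 "alg_null N \<sigma> \<longleftrightarrow> (\<exists>\<alpha> \<beta>. form2_germ \<alpha> \<and> form1_germ \<beta> \<and>
   (NEAR x. (x \<in> N --> (\<forall>u v. \<alpha> x u v = 0) \<and> (\<forall>u. \<beta> x u = 0)) \<and>
    (\<forall>u v. \<sigma> x u v = \<alpha> x u v + ext_d1 \<beta> x u v)))"

lemma same_alg_restr_iff: "same_alg_restr N \<omega> \<omega>' \<longleftrightarrow> alg_null N (%x u v. \<omega> x u v - \<omega>' x u v)"
 by (simp add: same_alg_restr_def alg_null_def)

lemma alg_nullI:
 assumes "form2_germ \<alpha>" "form1_germ \<beta>" "NEAR x. x \<in> N --> (\<forall>u v. \<alpha> x u v = 0)"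
  "NEAR x. x \<in> N --> (\<forall>u. \<beta> x u = 0)"
  "NEAR x. \<forall>u v. \<sigma> x u v = \<alpha> x u v + ext_d1 \<beta> x u v"
 shows "alg_null N \<sigma>"
proof -
 have "NEAR x. (x \<in> N --> (\<forall>u v. \<alpha> x u v = 0) \<and> (\<forall>u. \<beta> x u = 0)) \<and>
    (\<forall>u v. \<sigma> x u v = \<alpha> x u v + ext_d1 \<beta> x u v)"
  using assms(3-5) by eventually_elim blast
 then show ?thesis unfolding alg_null_def using assms(1,2) by blast
qed

lemma alg_nullE:
 assumes "alg_null N \<sigma>"
 obtains \<alpha> \<beta> where "form2_germ \<alpha>" "form1_germ \<beta>" "NEAR x. x \<in> N --> (\<forall>u v. \<alpha> x u v = 0)"
  "NEAR x. x \<in> N --> (\<forall>u. \<beta> x u = 0)"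
  "NEAR x. \<forall>u v. \<sigma> x u v = \<alpha> x u v + ext_d1 \<beta> x u v"
proof -
 obtain \<alpha> \<beta> where *: "form2_germ \<alpha>" "form1_germ \<beta>" "NEAR x. (x \<in> N --> (\<forall>u v. \<alpha> x u v = 0) \<and> (\<forall>u. \<beta> x u = 0)) \<and>
    (\<forall>u v. \<sigma> x u v = \<alpha> x u v + ext_d1 \<beta> x u v)"
  using assms unfolding alg_null_def by blast
 show ?thesis by (rule that[OF *(1,2)]) (use *(3) in \<open>eventually_elim, blast\<close>)+
qed

lemma alg_null_cong:
 assumes "NEAR x. \<forall>u v. \<sigma> x u v = \<sigma>' x u v" "alg_null N \<sigma>" shows "alg_null N \<sigma>'"
proof -
 obtain \<alpha> \<beta> where *: "form2_germ \<alpha>" "form1_germ \<beta>" "NEAR x. x \<in> N --> (\<forall>u v. \<alpha> x u v = 0)"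
  "NEAR x. x \<in> N --> (\<forall>u. \<beta> x u = 0)"
  "NEAR x. \<forall>u v. \<sigma> x u v = \<alpha> x u v + ext_d1 \<beta> x u v"
  using assms(2) alg_nullE by blast
 show ?thesis by (rule alg_nullI[OF *(1-4)]) (use assms(1) *(5) in \<open>eventually_elim, simp\<close>)
qed

lemma alg_null_vanishing:
 assumes "form2_germ \<alpha>" "NEAR x. x \<in> N --> (\<forall>u v. \<alpha> x u v = 0)"
 shows "alg_null N \<alpha>"
 by (rule alg_nullI[OF assms(1) form1_germ_const[OF linear_zero] assms(2)]) (simp_all add: ext_d1_const)

lemma alg_null_zero: "alg_null N (%x u v. 0)"
 by (rule alg_null_vanishing[OF form2_germ_zero]) simp

lemma alg_null_add:
 assumes "alg_null N \<sigma>" "alg_null N \<tau>" shows "alg_null N (%x u v. \<sigma> x u v + \<tau> x u v)"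
proof -
 obtain \<alpha> \<beta> where *: "form2_germ \<alpha>" "form1_germ \<beta>" "NEAR x. x \<in> N --> (\<forall>u v. \<alpha> x u v = 0)"
  "NEAR x. x \<in> N --> (\<forall>u. \<beta> x u = 0)"
  "NEAR x. \<forall>u v. \<sigma> x u v = \<alpha> x u v + ext_d1 \<beta> x u v"
  using assms(1) alg_nullE by blast
 obtain \<alpha>' \<beta>' where **: "form2_germ \<alpha>'" "form1_germ \<beta>'" "NEAR x. x \<in> N --> (\<forall>u v. \<alpha>' x u v = 0)"
  "NEAR x. x \<in> N --> (\<forall>u. \<beta>' x u = 0)"
  "NEAR x. \<forall>u v. \<tau> x u v = \<alpha>' x u v + ext_d1 \<beta>' x u v"
  using assms(2) alg_nullE by blast
 show ?thesis
 proof (rule alg_nullI[OF form2_germ_add[OF *(1) **(1)] form1_germ_add[OF *(2) **(2)]])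
  show "NEAR x. x \<in> N --> (\<forall>u v. \<alpha> x u v + \<alpha>' x u v = 0)"
   using *(3) **(3) by eventually_elim simp
  show "NEAR x. x \<in> N --> (\<forall>u. \<beta> x u + \<beta>' x u = 0)"
   using *(4) **(4) by eventually_elim simp
  show "NEAR x. \<forall>u v. \<sigma> x u v + \<tau> x u v = \<alpha> x u v + \<alpha>' x u v + ext_d1 (%x v. \<beta> x v + \<beta>' x v) x u v"
   using *(5) **(5) ext_d1_add[OF *(2) **(2)] by eventually_elim simp
 qed
qed

lemma alg_null_scale:
 assumes "alg_null N \<sigma>" shows "alg_null N (%x u v. c * \<sigma> x u v)"
proof -
 obtain \<alpha> \<beta> where *: "form2_germ \<alpha>" "form1_germ \<beta>" "NEAR x. x \<in> N --> (\<forall>u v. \<alpha> x u v = 0)"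
  "NEAR x. x \<in> N --> (\<forall>u. \<beta> x u = 0)"
  "NEAR x. \<forall>u v. \<sigma> x u v = \<alpha> x u v + ext_d1 \<beta> x u v"
  using assms(1) alg_nullE by blast
 show ?thesis
 proof (rule alg_nullI[OF form2_germ_mult[OF smooth_germ_const *(1)] form1_germ_mult[OF smooth_germ_const *(2)], of _ c c])
  show "NEAR x. x \<in> N --> (\<forall>u v. c * \<alpha> x u v = 0)"
   using *(3) by eventually_elim simp
  show "NEAR x. x \<in> N --> (\<forall>u. c * \<beta> x u = 0)"
   using *(4) by eventually_elim simp
  show "NEAR x. \<forall>u v. c * \<sigma> x u v = c * \<alpha> x u v + ext_d1 (%x v. c * \<beta> x v) x u v"
   using *(5) ext_d1_mult[OF smooth_germ_const[of c] *(2)]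
   by eventually_elim (simp add: frechet_derivative_const algebra_simps)
 qed
qed

lemma alg_null_diff:
 "alg_null N \<sigma> ==> alg_null N \<tau> ==> alg_null N (%x u v. \<sigma> x u v - \<tau> x u v)"
 using alg_null_add[OF _ alg_null_scale[of N \<tau> "-1"]] by fastforce

lemma alg_null_sum: "(!!i. i \<in> I ==> alg_null N (\<sigma> i)) ==> alg_null N (%x u v. \<Sum>i\<in>I. \<sigma> i x u v)"
 by (induction I rule: infinite_finite_induct) (auto intro: alg_null_add alg_null_zero)

text \<open>\<open>df \<and> \<tau> = d(f \<tau>) - f d\<tau>\<close>.\<close>

lemma alg_null_dd_wedge:
 assumes f: "smooth_germ f" "NEAR x. x \<in> N --> f x = 0" and t: "form1_germ \<tau>"
 shows "alg_null N (%x u v. dd f x u * \<tau> x v - dd f x v * \<tau> x u)"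
proof (rule alg_nullI[OF form2_germ_mult[OF f(1) form2_germ_mult[OF smooth_germ_const form2_germ_ext_d1[OF t]]] form1_germ_mult[OF f(1) t], of _ "-1"])
 show "NEAR x. x \<in> N --> (\<forall>u v. f x * (- 1 * ext_d1 \<tau> x u v) = 0)"
  using f(2) by eventually_elim simp
 show "NEAR x. x \<in> N --> (\<forall>u. f x * \<tau> x u = 0)"
  using f(2) by eventually_elim simp
 show "NEAR x. \<forall>u v. dd f x u * \<tau> x v - dd f x v * \<tau> x u =
   f x * (- 1 * ext_d1 \<tau> x u v) + ext_d1 (%x v. f x * \<tau> x v) x u v"
  using ext_d1_mult[OF f(1) t] by eventually_elim simp
qed

lemma alg_null_pullback:
 assumes S: "diffeo_germ_onto S N' N" and n: "alg_null N \<sigma>"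
 shows "alg_null N' (pullback S \<sigma>)"
proof -
 have s: "smooth_germ S" "S 0 = 0" and m: "NEAR x. x \<in> N' \<longleftrightarrow> S x \<in> N"
  using S unfolding diffeo_germ_onto_iff by blast+
 note ev = eventually_compose_0[OF smooth_germ_isCont[OF s(1)] s(2)]
 obtain \<alpha> \<beta> where *: "form2_germ \<alpha>" "form1_germ \<beta>" "NEAR x. x \<in> N --> (\<forall>u v. \<alpha> x u v = 0)"
  "NEAR x. x \<in> N --> (\<forall>u. \<beta> x u = 0)"
  "NEAR x. \<forall>u v. \<sigma> x u v = \<alpha> x u v + ext_d1 \<beta> x u v"
  using n alg_nullE by blast
 show ?thesis
 proof (rule alg_nullI[OF form2_germ_pullback[OF s *(1)] form1_germ_pullback1[OF s *(2)]])
  show "NEAR x. x \<in> N' --> (\<forall>u v. pullback S \<alpha> x u v = 0)"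
   using m ev[OF *(3)] by eventually_elim (simp add: pullback_def)
  show "NEAR x. x \<in> N' --> (\<forall>u. pullback1 S \<beta> x u = 0)"
   using m ev[OF *(4)] by eventually_elim (simp add: pullback1_def)
  show "NEAR x. \<forall>u v. pullback S \<sigma> x u v = pullback S \<alpha> x u v + ext_d1 (pullback1 S \<beta>) x u v"
   using ev[OF *(5)] ext_d1_pullback1[OF s *(2)] by eventually_elim (simp add: pullback_def)
 qed
qed

section \<open>Homotopy formulas\<close>

text \<open>The bound covers |s| <= 2 because parameter integrals are taken over an open interval
  containing [0, 1].\<close>

lemma linear_family_bound:
 fixes \<Lambda> :: "real => 'a::euclidean_space => 'b::euclidean_space"
 assumes "!!s. linear (\<Lambda> s)" "!!x. continuous_on {-2..2} (%s. \<Lambda> s x)"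
 obtains C where "C > 0" "!!s x. \<bar>s\<bar> \<le> 2 ==> norm (\<Lambda> s x) \<le> C * norm x"
proof -
 have "continuous_on {0..1} (%s. \<Lambda> (4 * s - 2) x)" for x
  by (rule continuous_on_compose2[OF assms(2)]) (auto intro!: continuous_intros)
 then obtain C where C: "C > 0" "!!s x. s \<in> {0..1} ==> norm (\<Lambda> (4 * s - 2) x) \<le> C * norm x"
  using linear_ode_bound[of "%s. \<Lambda> (4 * s - 2)"] assms(1) by metis
 have "norm (\<Lambda> s x) \<le> C * norm x" if "\<bar>s\<bar> \<le> 2" for s x
  using C(2)[of "(s + 2) / 4" x] that by (simp add: field_simps abs_le_iff)
 then show ?thesis using that C(1) by blast
qed

text \<open>Cartan's formula: for closed \<alpha> the s-derivative of the pullback of \<alpha> under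
  \<open>\<Lambda> s\<close> is the exterior derivative of the integrand of \<beta>. The velocity
  \<open>\<Lambda>' s x\<close> stands in for a vector field, since \<open>\<Lambda> 0\<close> may
  be degenerate. The families in use are dilations, weighted dilations and contractions onto a
  linear Lagrangian subspace.\<close>

lemma linear_homotopy:
 fixes \<Lambda> \<Lambda>' :: "real => 'a::euclidean_space => 'a"
 assumes lin: "!!s. linear (\<Lambda> s)" "!!s. linear (\<Lambda>' s)"
  and sm: "!!x. smooth_on UNIV (%s. \<Lambda> s x)" "!!x. smooth_on UNIV (%s. \<Lambda>' s x)"
  and der: "!!s x. ((%s. \<Lambda> s x) has_vector_derivative \<Lambda>' s x) (at s)"
  and \<alpha>: "form2_germ \<alpha>" "closed_germ \<alpha>"
 defines "\<beta> \<equiv> %x v. integral {0..1} (%s. \<alpha> (\<Lambda> s x) (\<Lambda>' s x) (\<Lambda> s v))"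
 shows "form1_germ \<beta>"
  and "NEAR x. \<forall>u v. ext_d1 \<beta> x u v = \<alpha> (\<Lambda> 1 x) (\<Lambda> 1 u) (\<Lambda> 1 v) - \<alpha> (\<Lambda> 0 x) (\<Lambda> 0 u) (\<Lambda> 0 v)"
proof -
 obtain C where C: "C > 0" "!!s x. \<bar>s\<bar> \<le> 2 ==> norm (\<Lambda> s x) \<le> C * norm x"
  using linear_family_bound[of \<Lambda>] lin(1) continuous_on_subset[OF smooth_on_imp_continuous[OF sm(1)]] by (metis subset_UNIV)
 obtain U1 where U1: "open U1" "0 \<in> U1" "\<forall>x\<in>U1. bilinear (\<alpha> x) \<and> (\<forall>u. \<alpha> x u u = 0)" "!!u v. smooth_on U1 (%x. \<alpha> x u v)"
  using \<alpha>(1) unfolding form2_germ_def by blast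
 obtain U2 where U2: "open U2" "0 \<in> U2" "!!x u v w. x \<in> U2 ==> ext_d2 \<alpha> x u v w = 0"
  using \<alpha>(2) unfolding closed_germ_def eventually_nhds by blast
 define W where "W = U1 \<inter> U2"
 have W: "open W" "0 \<in> W" using U1 U2 by (auto simp: W_def)
 have bil: "bilinear (\<alpha> x)" and alt: "\<alpha> x u u = 0" if "x \<in> W" for x u using U1(3) that by (auto simp: W_def)
 have smW: "smooth_on W (%x. \<alpha> x u v)" for u v using smooth_on_subset[OF U1(4)] by (auto simp: W_def)
 have dW: "((%z. \<alpha> z u v) has_derivative dd (%z. \<alpha> z u v) z) (at z)" if "z \<in> W" for z u v
  using smooth_on_imp_has_derivative[OF smW that] .
 obtain r where r: "r > 0" "ball 0 r \<subseteq> W" using W openE by blast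
 define V where "V = ball (0::'a) (r / C)"
 define T where "T = ball (0::real) 2"
 have V: "open V" "0 \<in> V" using r C by (auto simp: V_def)
 have T: "open T" "{0..1} \<subseteq> T" by (auto simp: T_def)
 have TV: "open (T \<times> V)" using T V by (simp add: open_Times)
 have inW: "\<Lambda> s x \<in> W" if "s \<in> T" "x \<in> V" for s x
 proof -
  have "norm (\<Lambda> s x) \<le> C * norm x" using C(2) that by (simp add: T_def)
  also have "\<dots> < r" using that C(1) by (simp add: V_def pos_less_divide_eq mult.commute)
  finally show ?thesis using r by auto
 qed
 have joint: "smooth_on (T \<times> V) (%p. \<Gamma> (fst p) (snd p))" if "!!s. linear (\<Gamma> s)" "!!x. smooth_on UNIV (%s. \<Gamma> s x)"
  for \<Gamma> :: "real => 'a => 'a"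
 proof -
  have "smooth_on (T \<times> V) (%p. \<Sum>b\<in>Basis. (snd p \<bullet> b) *\<^sub>R \<Gamma> (fst p) b)"
   by (intro smooth_on_sum smooth_on_scaleR smooth_on_inner smooth_on_const TV smooth_on_linear[OF linear_snd TV]
     smooth_on_compose[OF TV open_UNIV smooth_on_linear[OF linear_fst TV] that(2)] UNIV_I)
  moreover have "(%p. \<Sum>b\<in>Basis. (snd p \<bullet> b) *\<^sub>R \<Gamma> (fst p) b) = (%p. \<Gamma> (fst p) (snd p))"
   by (rule ext, rule linear_expand[OF that(1), symmetric])
  ultimately show ?thesis by (rule subst[rotated])
 qed
 define g where "g v p = \<alpha> (\<Lambda> (fst p) (snd p)) (\<Lambda>' (fst p) (snd p)) (\<Lambda> (fst p) v)" for v and p :: "real \<times> 'a"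
 have smg: "smooth_on (T \<times> V) (g v)" for v
 proof -
  have s: "smooth_on (T \<times> V) (%p. \<Sum>b\<in>Basis. \<Sum>c\<in>Basis. (\<Lambda>' (fst p) (snd p) \<bullet> b) * (\<Lambda> (fst p) v \<bullet> c) * \<alpha> (\<Lambda> (fst p) (snd p)) b c)"
   by (intro smooth_on_sum smooth_on_mult smooth_on_inner smooth_on_const TV joint lin sm
     smooth_on_compose[OF TV open_UNIV smooth_on_linear[OF linear_fst TV] sm(1)] UNIV_I
     smooth_on_compose[OF TV W(1) joint[OF lin(1) sm(1)] smW])
     (use inW in auto)
  have e: "(\<Sum>b\<in>Basis. \<Sum>c\<in>Basis. (\<Lambda>' (fst p) (snd p) \<bullet> b) * (\<Lambda> (fst p) v \<bullet> c) * \<alpha> (\<Lambda> (fst p) (snd p)) b c) = g v p"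
   if "p \<in> T \<times> V" for p
   unfolding g_def by (rule bilinear_expand[OF bil, symmetric]) (use inW that in auto)
  show ?thesis by (rule smooth_on_cong[OF TV e s])
 qed
 have \<beta>: "\<beta> x v = integral {0..1} (%s. g v (s, x))" for x v by (simp add: \<beta>_def g_def)
 have cg: "continuous_on {0..1} (%s. g v (s, x))" if x: "x \<in> V" for v x
  by (rule continuous_on_compose2[OF smooth_on_imp_continuous[OF smg]]) (use T x in \<open>auto intro!: continuous_intros\<close>)
 have sm\<beta>: "smooth_on V (%x. \<beta> x v)" for v
  unfolding \<beta> by (rule smooth_on_integral[OF T V(1) smg])
 have lin\<beta>: "linear (\<beta> x)" if x: "x \<in> V" for x
 proof (rule linearI)
  have m: "\<Lambda> s x \<in> W" if "s \<in> {0..1}" for s using inW[OF _ x] T that by blast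
  show "\<beta> x (u + v) = \<beta> x u + \<beta> x v" for u v
  proof -
   have "\<beta> x (u + v) = integral {0..1} (%s. g u (s, x) + g v (s, x))"
    unfolding \<beta> by (rule integral_cong) (use m in \<open>simp add: g_def linear_add[OF lin(1)] bilinear_radd[OF bil]\<close>)
   then show ?thesis unfolding \<beta>
    using integral_add[OF integrable_continuous_real[OF cg[OF x]] integrable_continuous_real[OF cg[OF x]]] by simp
  qed
  show "\<beta> x (c *\<^sub>R u) = c *\<^sub>R \<beta> x u" for c u
  proof -
   have "\<beta> x (c *\<^sub>R u) = integral {0..1} (%s. c *\<^sub>R g u (s, x))"
    unfolding \<beta> by (rule integral_cong) (use m in \<open>simp add: g_def linear_cmul[OF lin(1)] bilinear_rmul[OF bil]\<close>)
   then show ?thesis unfolding \<beta> by simp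
  qed
 qed
 show "form1_germ \<beta>" unfolding form1_germ_def using V lin\<beta> sm\<beta> by blast
 have dg: "dd (g v) (s, x) (0, u) = dd (%z. \<alpha> z (\<Lambda>' s x) (\<Lambda> s v)) (\<Lambda> s x) (\<Lambda> s u) + \<alpha> (\<Lambda> s x) (\<Lambda>' s u) (\<Lambda> s v)"
  if s: "s \<in> T" "x \<in> V" for s x u v
 proof -
  have 1: "((%x. (s, x)) has_derivative (%u. (0, u))) (at x)" by (auto intro!: derivative_eq_intros)
  have 2: "(g v has_derivative dd (g v) (s, x)) (at (s, x))"
   using smooth_on_imp_has_derivative[OF smg, of "(s, x)"] s by simp
  have 3: "((%x. g v (s, x)) has_derivative (%u. dd (g v) (s, x) (0, u))) (at x)"
   using has_derivative_compose[OF 1 2] .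
  have l: "(\<Lambda> s has_derivative \<Lambda> s) (at x)" "(\<Lambda>' s has_derivative \<Lambda>' s) (at x)"
   using lin linear_imp_has_derivative by auto
  have 4: "((%x. g v (s, x)) has_derivative (%h. dd (%z. \<alpha> z (\<Lambda>' s x) (\<Lambda> s v)) (\<Lambda> s x) (\<Lambda> s h) + \<alpha> (\<Lambda> s x) (\<Lambda>' s h) (\<Lambda> s v)
    + \<alpha> (\<Lambda> s x) (\<Lambda>' s x) 0)) (at x)"
   unfolding g_def fst_conv snd_conv
   by (rule form2_chain[where \<alpha>=\<alpha> and P="\<Lambda> s" and Q="\<Lambda>' s" and R="%_. \<Lambda> s v", OF W(1) bil dW inW[OF s] l has_derivative_const])
  show ?thesis using fun_cong[OF has_derivative_unique[OF 3 4], of u] bilinear_rzero[OF bil[OF inW[OF s]]] by simp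
 qed
 have "ext_d1 \<beta> x u v = \<alpha> (\<Lambda> 1 x) (\<Lambda> 1 u) (\<Lambda> 1 v) - \<alpha> (\<Lambda> 0 x) (\<Lambda> 0 u) (\<Lambda> 0 v)" if x: "x \<in> V" for x u v
 proof -
  have dB: "dd (%y. \<beta> y v) x u = integral {0..1} (%s. dd (g v) (s, x) (0, u))" for u v
   unfolding \<beta> using dd_eq[OF integral_has_derivative[OF T V(1) _ x, of 0 "g v"]] smg[of v]
   unfolding smooth_on_def by metis
  have cdg: "continuous_on {0..1} (%s. dd (g v) (s, x) (0, u))" for u v
   by (rule continuous_on_compose2[OF smooth_on_imp_continuous[OF smooth_on_dd[OF smg]]]) (use T x in \<open>auto intro!: continuous_intros\<close>)
  have "ext_d1 \<beta> x u v = integral {0..1} (%s. dd (g v) (s, x) (0, u) - dd (g u) (s, x) (0, v))"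
   unfolding ext_d1_def dB
   using integral_diff[OF integrable_continuous_real[OF cdg] integrable_continuous_real[OF cdg]] by simp
  also have "((%s. dd (g v) (s, x) (0, u) - dd (g u) (s, x) (0, v)) has_integral
    \<alpha> (\<Lambda> 1 x) (\<Lambda> 1 u) (\<Lambda> 1 v) - \<alpha> (\<Lambda> 0 x) (\<Lambda> 0 u) (\<Lambda> 0 v)) {0..1}"
  proof (rule fundamental_theorem_of_calculus)
   fix s :: real assume s: "s \<in> {0..1}"
   then have sT: "s \<in> T" using T by blast
   note m = inW[OF sT x]
   have d: "((%s. \<Lambda> s y) has_derivative (%t. t *\<^sub>R \<Lambda>' s y)) (at s within {0..1})" for y
    using has_vector_derivative_at_within[OF der[of y s]] by (simp add: has_vector_derivative_def)
   let ?D = "dd (%z. \<alpha> z (\<Lambda> s u) (\<Lambda> s v)) (\<Lambda> s x)"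
   have linD: "linear ?D" using has_derivative_linear[OF dW[OF m]] .
   have "((%s. \<alpha> (\<Lambda> s x) (\<Lambda> s u) (\<Lambda> s v)) has_derivative
     (%t. ?D (t *\<^sub>R \<Lambda>' s x) + \<alpha> (\<Lambda> s x) (t *\<^sub>R \<Lambda>' s u) (\<Lambda> s v) + \<alpha> (\<Lambda> s x) (\<Lambda> s u) (t *\<^sub>R \<Lambda>' s v))) (at s within {0..1})"
    by (rule form2_chain[OF W(1) bil dW m d d d])
   then have "((%s. \<alpha> (\<Lambda> s x) (\<Lambda> s u) (\<Lambda> s v)) has_vector_derivative
     (?D (\<Lambda>' s x) + \<alpha> (\<Lambda> s x) (\<Lambda>' s u) (\<Lambda> s v) + \<alpha> (\<Lambda> s x) (\<Lambda> s u) (\<Lambda>' s v))) (at s within {0..1})"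
    unfolding has_vector_derivative_def
    by (rule has_derivative_eq_rhs)
      (simp add: fun_eq_iff linear_cmul[OF linD] bilinear_lmul[OF bil[OF m]] bilinear_rmul[OF bil[OF m]] distrib_left)
   \<comment> \<open>This is \<open>ext_d2 \<alpha> = 0\<close> at \<open>\<Lambda> s x\<close>,
     applied to the velocity and the images of u and v.\<close>
   moreover have "?D (\<Lambda>' s x) + \<alpha> (\<Lambda> s x) (\<Lambda>' s u) (\<Lambda> s v) + \<alpha> (\<Lambda> s x) (\<Lambda> s u) (\<Lambda>' s v)
     = dd (g v) (s, x) (0, u) - dd (g u) (s, x) (0, v)"
   proof -
    have "\<Lambda> s x \<in> U2" using m by (simp add: W_def)
    from U2(3)[OF this, of "\<Lambda>' s x" "\<Lambda> s u" "\<Lambda> s v"]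
    show ?thesis unfolding dg[OF sT x] ext_d2_def
     using bilinear_alternating_swap[OF bil[OF m] alt[OF m], of "\<Lambda> s u" "\<Lambda>' s v"] by linarith
   qed
   ultimately show "((%s. \<alpha> (\<Lambda> s x) (\<Lambda> s u) (\<Lambda> s v)) has_vector_derivative
     dd (g v) (s, x) (0, u) - dd (g u) (s, x) (0, v)) (at s within {0..1})" by simp
  qed simp
  then have "integral {0..1} (%s. dd (g v) (s, x) (0, u) - dd (g u) (s, x) (0, v))
   = \<alpha> (\<Lambda> 1 x) (\<Lambda> 1 u) (\<Lambda> 1 v) - \<alpha> (\<Lambda> 0 x) (\<Lambda> 0 u) (\<Lambda> 0 v)" by (rule integral_unique)
  finally show ?thesis .
 qed
 then show "NEAR x. \<forall>u v. ext_d1 \<beta> x u v = \<alpha> (\<Lambda> 1 x) (\<Lambda> 1 u) (\<Lambda> 1 v) - \<alpha> (\<Lambda> 0 x) (\<Lambda> 0 u) (\<Lambda> 0 v)"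
  using V unfolding eventually_nhds by blast
qed

lemma poincare:
 assumes "form2_germ \<alpha>" "closed_germ \<alpha>"
 obtains \<beta> where "form1_germ \<beta>" "NEAR x. \<forall>u v. \<alpha> x u v = ext_d1 \<beta> x u v"
proof -
 define \<beta> where "\<beta> = (%x v. integral {0..1} (%s. \<alpha> (s *\<^sub>R x) x (s *\<^sub>R v)))"
 have l: "linear (%x. s *\<^sub>R x)" for s :: real by (simp add: linear_compose_scale_right linear_id[unfolded id_def])
 have s: "smooth_on UNIV (%s::real. s *\<^sub>R x)" for x :: 'a
  by (intro smooth_on_scaleR smooth_on_ident smooth_on_const open_UNIV)
 have d: "((%s. s *\<^sub>R x) has_vector_derivative x) (at s)" for s and x :: 'a
  by (auto intro!: derivative_eq_intros simp: has_vector_derivative_def)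
 note h = linear_homotopy[of "%s x. s *\<^sub>R x" "%s x. x", OF l linear_id[unfolded id_def] s smooth_on_const d assms, folded \<beta>_def]
 have "NEAR x. \<forall>u v. \<alpha> x u v = ext_d1 \<beta> x u v"
 proof -
  have z: "\<alpha> 0 0 0 = 0" using eventually_nhds_x_imp_x[OF form2_germ_bilinear[OF assms(1)]] by blast
  show ?thesis using h(2) by eventually_elim (simp add: z)
 qed
 then show ?thesis using that h(1) by blast
qed

text \<open>A local primitive replaces the direct computation: pullback commutes with the exterior
  derivative of one-forms, and exact forms are closed.\<close>

lemma closed_germ_pullback:
 assumes "smooth_germ \<Phi>" "\<Phi> 0 = 0" "form2_germ \<omega>" "closed_germ \<omega>"
 shows "closed_germ (pullback \<Phi> \<omega>)"
proof -
 obtain \<beta> where b: "form1_germ \<beta>" "NEAR x. \<forall>u v. \<omega> x u v = ext_d1 \<beta> x u v"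
  using poincare assms(3,4) by blast
 have "NEAR x. \<forall>u v. ext_d1 (pullback1 \<Phi> \<beta>) x u v = pullback \<Phi> \<omega> x u v"
  using ext_d1_pullback1[OF assms(1,2) b(1)] pullback_cong_form[OF assms(1,2) b(2)] by eventually_elim simp
 then show ?thesis by (rule closed_germ_cong[OF _ closed_germ_ext_d1[OF form1_germ_pullback1[OF assms(1,2) b(1)]]])
qed

section \<open>Moser's method\<close>

lemma linear_inj_bounded_below:
 fixes A :: "'a::euclidean_space => 'b::euclidean_space"
 assumes "linear A" "!!u. u \<noteq> 0 ==> A u \<noteq> 0"
 obtains c where "c > 0" "!!u. norm (A u) \<ge> c * norm u"
proof -
 have "inj A" using assms by (simp add: linear_injective_0) metis
 then obtain B where "B > 0" "!!u. B * norm u \<le> norm (A u)"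
  using linear_inj_bounded_below_pos assms(1) by metis
 then show ?thesis using that by blast
qed

text \<open>
 The vector field \<open>X\<^sub>s\<close> with \<open>\<iota>\<^sub>X \<omega>\<^sub>s = - \<beta>\<close>, \<open>\<omega>\<^sub>s = \<omega> + s d\<beta>\<close>, is defined for all \<open>s\<close> near \<open>[0, 1]\<close> since all
 \<open>\<omega>\<^sub>s\<close> agree at \<open>0\<close>, and its flow fixes every zero of \<open>\<beta>\<close>.
\<close>

lemma moser:
 fixes \<omega> \<delta> :: "'a::euclidean_space form2"
 assumes w: "form2_germ \<omega>" "closed_germ \<omega>" and dl: "form2_germ \<delta>" "closed_germ \<delta>"
  and d0: "!!u v. \<delta> 0 u v = 0" and nd: "!!u. u \<noteq> 0 ==> \<exists>v. \<omega> 0 u v \<noteq> 0"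
  and b: "form1_germ \<beta>" "NEAR x. \<forall>u v. \<delta> x u v = ext_d1 \<beta> x u v" and b0: "!!u. \<beta> 0 u = 0"
 obtains \<Psi> where "smooth_germ \<Psi>" "\<Psi> 0 = 0" "inj (dd \<Psi> 0)" "NEAR x. (\<forall>u. \<beta> x u = 0) --> \<Psi> x = x"
  "NEAR x. \<forall>u v. pullback \<Psi> (%x u v. \<omega> x u v + \<delta> x u v) x u v = \<omega> x u v"
proof -
 obtain U1 where U1: "open U1" "0 \<in> U1" "\<forall>x\<in>U1. bilinear (\<omega> x) \<and> (\<forall>u. \<omega> x u u = 0)" "!!u v. smooth_on U1 (%x. \<omega> x u v)"
  using w(1) unfolding form2_germ_def by blast
 obtain U2 where U2: "open U2" "0 \<in> U2" "\<forall>x\<in>U2. bilinear (\<delta> x) \<and> (\<forall>u. \<delta> x u u = 0)" "!!u v. smooth_on U2 (%x. \<delta> x u v)"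
  using dl(1) unfolding form2_germ_def by blast
 obtain U3 where U3: "open U3" "0 \<in> U3" "\<forall>x\<in>U3. linear (\<beta> x)" "!!u. smooth_on U3 (%x. \<beta> x u)"
  using b(1) unfolding form1_germ_def by blast
 obtain V1 where V1: "open V1" "0 \<in> V1" "\<forall>x\<in>V1. \<forall>u v p. ext_d2 \<omega> x u v p = 0"
  using w(2) unfolding closed_germ_def eventually_nhds by blast
 obtain V2 where V2: "open V2" "0 \<in> V2" "\<forall>x\<in>V2. \<forall>u v p. ext_d2 \<delta> x u v p = 0"
  using dl(2) unfolding closed_germ_def eventually_nhds by blast
 obtain V3 where V3: "open V3" "0 \<in> V3" "\<forall>x\<in>V3. \<forall>u v. \<delta> x u v = ext_d1 \<beta> x u v"
  using b(2) unfolding eventually_nhds by blast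
 define U4 where "U4 = V1 \<inter> V2 \<inter> V3"
 have U4: "open U4" "0 \<in> U4" "!!x u v p. x \<in> U4 ==> ext_d2 \<omega> x u v p = 0"
  "!!x u v p. x \<in> U4 ==> ext_d2 \<delta> x u v p = 0" "!!x u v. x \<in> U4 ==> \<delta> x u v = ext_d1 \<beta> x u v"
  using V1 V2 V3 by (auto simp: U4_def)
 define W where "W = U1 \<inter> U2 \<inter> U3 \<inter> U4"
 have W: "open W" "0 \<in> W" "W \<subseteq> U1" "W \<subseteq> U2" "W \<subseteq> U3" "W \<subseteq> U4" using U1 U2 U3 U4 by (auto simp: W_def)
 define \<Omega> where "\<Omega> s x u v = \<omega> x u v + s * \<delta> x u v" for s x u v
 have wb: "bilinear (\<omega> x)" "bilinear (\<delta> x)" "linear (\<beta> x)" if "x \<in> W" for x using U1 U2 U3 W that by auto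
 have walt: "\<omega> x u u = 0" "\<delta> x u u = 0" if "x \<in> W" for x u using U1 U2 W that by auto
 have smw: "smooth_on W (%x. \<omega> x u v)" "smooth_on W (%x. \<delta> x u v)" "smooth_on W (%x. \<beta> x u)" for u v
  by (rule smooth_on_subset[OF U1(4) W(3)], rule smooth_on_subset[OF U2(4) W(4)], rule smooth_on_subset[OF U3(4) W(5)])
 have dw: "((%z. \<omega> z u v) has_derivative dd (%z. \<omega> z u v) z) (at z)"
  "((%z. \<delta> z u v) has_derivative dd (%z. \<delta> z u v) z) (at z)"
  "((%z. \<beta> z u) has_derivative dd (%z. \<beta> z u) z) (at z)" if "z \<in> W" for z u v
  by (rule smooth_on_imp_has_derivative[OF smw(1) that], rule smooth_on_imp_has_derivative[OF smw(2) that],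
    rule smooth_on_imp_has_derivative[OF smw(3) that])
 have \<Omega>b: "bilinear (\<Omega> s x)" if "x \<in> W" for s x
  unfolding bilinear_def \<Omega>_def
  by (auto intro!: linearI simp: bilinear_ladd[OF wb(1)[OF that]] bilinear_radd[OF wb(1)[OF that]] bilinear_lmul[OF wb(1)[OF that]]
    bilinear_rmul[OF wb(1)[OF that]] bilinear_ladd[OF wb(2)[OF that]] bilinear_radd[OF wb(2)[OF that]] bilinear_lmul[OF wb(2)[OF that]]
    bilinear_rmul[OF wb(2)[OF that]] algebra_simps)
 have d\<Omega>: "((%z. \<Omega> s z u v) has_derivative (%h. dd (%z. \<omega> z u v) z h + s * dd (%z. \<delta> z u v) z h)) (at z)" if "z \<in> W" for s z u v
  unfolding \<Omega>_def by (intro has_derivative_add has_derivative_mult_right dw that)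
 have dd\<Omega>: "dd (%z. \<Omega> s z u v) z = (%h. dd (%z. \<omega> z u v) z h + s * dd (%z. \<delta> z u v) z h)" if "z \<in> W" for s z u v
  using dd_eq[OF d\<Omega>[OF that]] .
 have d\<Omega>': "((%z. \<Omega> s z u v) has_derivative dd (%z. \<Omega> s z u v) z) (at z)" if "z \<in> W" for s z u v
  using d\<Omega>[OF that] dd\<Omega>[OF that] by metis
 \<comment> \<open>\<open>A s x\<close> represents \<open>\<Omega> s x\<close> through the inner
   product; inverting it solves the equation that defines the Moser field.\<close>
 define A where "A s x u = (\<Sum>b\<in>Basis. \<Omega> s x u b *\<^sub>R b)" for s x u
 have Alin: "linear (A s x)" if "x \<in> W" for s x
  unfolding A_def
  by (auto intro!: linearI simp: bilinear_ladd[OF \<Omega>b[OF that]] bilinear_lmul[OF \<Omega>b[OF that]] algebra_simps sum.distrib scaleR_sum_right)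
 have A_inner: "A s x u \<bullet> b = \<Omega> s x u b" if "b \<in> Basis" for s x u b
  using that unfolding A_def by (simp add: inner_sum_left inner_Basis if_distrib sum.If_cases cong: if_cong)
 have A_eq: "\<Omega> s x u v = A s x u \<bullet> v" if "x \<in> W" for s x u v
 proof -
  have "\<Omega> s x u v = (\<Sum>c\<in>Basis. (v \<bullet> c) * \<Omega> s x u c)"
   using linear_expand[of "\<Omega> s x u" v] \<Omega>b[OF that] by (simp add: bilinear_def)
  also have "\<dots> = (\<Sum>c\<in>Basis. (A s x u \<bullet> c) * (v \<bullet> c))"
   by (intro sum.cong) (auto simp: A_inner)
  finally show ?thesis by (simp add: euclidean_inner[of "A s x u" v])
 qed
 have A0: "A s 0 = A 0 0" for s by (simp add: A_def \<Omega>_def d0 fun_eq_iff)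
 have nz: "A 0 0 u \<noteq> 0" if u: "u \<noteq> 0" for u
 proof -
  obtain v where v: "\<omega> 0 u v \<noteq> 0" using nd u by blast
  have "A 0 0 u \<bullet> v = \<omega> 0 u v" using A_eq[OF W(2), of 0 u v] by (simp add: \<Omega>_def)
  then show ?thesis using v by auto
 qed
 obtain c where c: "c > 0" "!!u. norm (A 0 0 u) \<ge> c * norm u"
  using linear_inj_bounded_below[OF Alin[OF W(2)] nz] by metis
 \<comment> \<open>Near 0 each basis vector contributes at most e from \<omega> and 2 e from s
   \<delta>, as |s| < 2. Summed over the basis this is c / 2, half the lower bound of
   \<open>A 0 0\<close>, so every \<open>A s x\<close> stays injective.\<close>
 define e where "e = c / (6 * real DIM('a))"
 have e: "e > 0" using c by (simp add: e_def)
 have lim: "isCont (%x. \<omega> x u v) 0" "isCont (%x. \<delta> x u v) 0" for u v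
  by (rule has_derivative_continuous[OF dw(1)[OF W(2)]], rule has_derivative_continuous[OF dw(2)[OF W(2)]])
 define S where "S \<eta> x b = (\<Sum>d\<in>Basis. \<eta> x b d *\<^sub>R d)" for \<eta> :: "'a form2" and x b
 have "NEAR x. \<forall>b\<in>Basis. dist (S \<omega> x b) (S \<omega> 0 b) < e \<and> dist (S \<delta> x b) (S \<delta> 0 b) < e"
 proof (intro eventually_Basis eventually_conj)
  have ev: "NEAR x. dist (f x) (f 0) < e" if "isCont f 0" for f :: "'a => 'a"
   by (rule tendstoD[OF that[unfolded isCont_def tendsto_at_iff_tendsto_nhds] e])
  show "NEAR x. dist (S \<omega> x b) (S \<omega> 0 b) < e" "NEAR x. dist (S \<delta> x b) (S \<delta> 0 b) < e" for b
   unfolding S_def by (rule ev, intro continuous_intros lim)+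
 qed
 then obtain U5 where U5: "open U5" "0 \<in> U5" "!!x b. x \<in> U5 ==> b \<in> Basis ==> dist (S \<omega> x b) (S \<omega> 0 b) < e \<and> dist (S \<delta> x b) (S \<delta> 0 b) < e"
  unfolding eventually_nhds by blast
 have "open (W \<inter> U5)" "0 \<in> W \<inter> U5" using W U5 by auto
 then obtain R where R: "R > 0" "ball 0 R \<subseteq> W \<inter> U5" using openE by blast
 define T where "T = ball (0::real) 2"
 have T: "open T" "{0..1} \<subseteq> T" by (auto simp: T_def)
 have TB: "open (T \<times> ball (0::'a) R)" using T by (simp add: open_Times)
 have inW: "x \<in> W" if "x \<in> ball 0 R" for x using R that by blast
 have Abd: "norm (A s x u - A 0 0 u) \<le> (c / 2) * norm u" if s: "s \<in> T" "x \<in> ball 0 R" for s x u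
 proof -
  have x: "x \<in> W" "x \<in> U5" using R s by auto
  have "norm (A s x u - A s 0 u) \<le> (\<Sum>b\<in>(Basis::'a set). 3 * e) * norm u"
  proof (rule linear_norm_le)
   show "linear (%u. A s x u - A s 0 u)" by (intro linear_compose_sub Alin x W)
   fix b :: 'a assume b: "b \<in> Basis"
   have eq: "A s x b - A s 0 b = (S \<omega> x b - S \<omega> 0 b) + s *\<^sub>R (S \<delta> x b - S \<delta> 0 b)"
    by (simp add: A_def S_def \<Omega>_def algebra_simps sum.distrib scaleR_sum_right)
   have "norm (s *\<^sub>R (S \<delta> x b - S \<delta> 0 b)) \<le> 2 * e"
    unfolding norm_scaleR using U5(3)[OF x(2) b] s by (intro mult_mono) (auto simp: T_def dist_norm)
   then show "norm (A s x b - A s 0 b) \<le> 3 * e"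
    unfolding eq using U5(3)[OF x(2) b] by (intro norm_triangle_le) (simp add: dist_norm)
  qed
  then show ?thesis by (simp add: A0[of s] e_def)
 qed
 have Ainj: "inj (A s x)" if s: "s \<in> T" "x \<in> ball 0 R" for s x
 proof -
  have "u = 0" if "A s x u = 0" for u
  proof -
   have "c * norm u \<le> norm (A 0 0 u)" by (rule c)
   also have "\<dots> \<le> (c / 2) * norm u" using Abd[OF s, of u] that by simp
   finally show ?thesis using c(1) by (auto simp: zero_less_mult_iff)
  qed
  then show ?thesis using Alin[OF inW[OF s(2)]] by (simp add: linear_injective_0)
 qed
 define B where "B p = inv (A (fst p) (snd p))" for p
 have Abij: "bij (A (fst p) (snd p))" if "p \<in> T \<times> ball 0 R" for p
  using Ainj Alin[OF inW] linear_injective_imp_surjective that unfolding bij_def by fastforce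
 have BA: "B p (A (fst p) (snd p) v) = v" "A (fst p) (snd p) (B p v) = v" if "p \<in> T \<times> ball 0 R" for p v
  using Abij[OF that] by (simp_all add: B_def bij_is_inj bij_is_surj surj_f_inv_f inv_f_f)
 have smR: "smooth_on (T \<times> ball 0 R) (%p. f (snd p))" if "smooth_on W f" for f :: "'a => real"
  by (rule smooth_on_compose[OF TB W(1) smooth_on_linear[OF linear_snd TB] that]) (use inW in auto)
 have smA: "smooth_on (T \<times> ball 0 R) (%p. A (fst p) (snd p) v)" for v
  unfolding A_def \<Omega>_def
  by (intro smooth_on_sum smooth_on_scaleR smooth_on_add smooth_on_mult smooth_on_const TB smR smw smooth_on_linear[OF linear_fst TB])
 have linA': "linear (A (fst p) (snd p))" if "p \<in> T \<times> ball 0 R" for p using Alin inW that by auto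
 have smB: "smooth_on (T \<times> ball 0 R) (%p. B p v)" for v
  by (rule smooth_on_inverse_family[where A="%p. A (fst p) (snd p)" and B=B, OF TB linA' BA smA])
 have linB: "linear (B p)" if "p \<in> T \<times> ball 0 R" for p
  by (rule linear_inverse[OF linA'[OF that] BA[OF that]])
 define bv where "bv x = (\<Sum>b\<in>Basis. (- \<beta> x b) *\<^sub>R b)" for x
 have bv_inner: "bv x \<bullet> v = - \<beta> x v" if "x \<in> W" for x v
 proof -
  have "bv x \<bullet> v = (\<Sum>b\<in>Basis. (v \<bullet> b) * (- \<beta> x b))"
   unfolding bv_def inner_sum_left by (intro sum.cong) (auto simp: inner_commute[of v])
  also have "\<dots> = - \<beta> x v" using linear_expand[OF wb(3)[OF that], of v] by (simp add: sum_negf)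
  finally show ?thesis .
 qed
 have smbv: "smooth_on (T \<times> ball 0 R) (%p. bv (snd p))"
  unfolding bv_def by (intro smooth_on_sum smooth_on_scaleR smooth_on_minus smooth_on_const TB smR smw)
 define X where "X p = B p (bv (snd p))" for p
 have smX: "smooth_on (T \<times> ball 0 R) X"
  unfolding X_def[abs_def] by (rule smooth_on_linear_apply[OF TB linB smB smbv])
 have X0: "X (s, x) = 0" if "\<forall>u. \<beta> x u = 0" "s \<in> T" "x \<in> ball 0 R" for s x
  using linear_0[OF linB[of "(s, x)"]] that by (simp add: X_def bv_def)
 have rel: "\<Omega> s x (X (s, x)) v = - \<beta> x v" if "s \<in> T" "x \<in> ball 0 R" for s x v
  using A_eq[OF inW[OF that(2)], of s "X (s, x)" v] BA(2)[of "(s, x)"] bv_inner[OF inW[OF that(2)], of v] that by (simp add: X_def)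
 have X00: "X (s, 0) = 0" if "s \<in> {0..1}" for s using X0[of 0 s] b0 T that R by auto
 obtain F U where F: "open U" "0 \<in> U" "!!s. s \<in> {0..1} ==> smooth_on U (F s)"
  "!!x. F 0 x = x" "!!s x. s \<in> {0..1} ==> x \<in> U ==> norm (F s x) < R"
  "!!s x. s \<in> {0..1} ==> x \<in> U ==> ((%s. F s x) has_vector_derivative X (s, F s x)) (at s within {0..1})"
  "!!s x w. s \<in> {0..1} ==> x \<in> U ==>
    ((%s. dd (F s) x w) has_vector_derivative dd X (s, F s x) (0, dd (F s) x w)) (at s within {0..1})"
  "!!s x. s \<in> {0..1} ==> x \<in> U ==> (!!s. s \<in> {0..1} ==> X (s, x) = 0) ==> F s x = x"
  by (rule smooth_flow[OF T R(1) smX X00]) blast+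
 \<comment> \<open>The pullback of \<omega> + s \<delta> under F s does not depend on s, and at s =
   0 it is \<omega>.\<close>
 have key: "\<Omega> 1 (F 1 x) (dd (F 1) x u) (dd (F 1) x v) = \<omega> x u v" if x: "x \<in> U" for x u v
 proof -
  define h where "h s = \<Omega> s (F s x) (dd (F s) x u) (dd (F s) x v)" for s
  have "(h has_vector_derivative 0) (at s within {0..1})" if s: "s \<in> {0..1}" for s
  proof -
   define y p q Xs p' q' where "y = F s x" and "p = dd (F s) x u" and "q = dd (F s) x v" and "Xs = X (s, y)"
    and "p' = dd X (s, y) (0, p)" and "q' = dd X (s, y) (0, q)"
   have sT: "s \<in> T" using s T by blast
   have yR: "y \<in> ball 0 R" using F(5)[OF s x] by (simp add: y_def)
   have yW: "y \<in> W" using inW[OF yR] .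
   note bw = wb(1)[OF yW] and bd = wb(2)[OF yW]
   have dF: "((%s. F s x) has_derivative (%t. t *\<^sub>R Xs)) (at s within {0..1})"
    "((%s. dd (F s) x u) has_derivative (%t. t *\<^sub>R p')) (at s within {0..1})"
    "((%s. dd (F s) x v) has_derivative (%t. t *\<^sub>R q')) (at s within {0..1})"
    using F(6)[OF s x] F(7)[OF s x, of u] F(7)[OF s x, of v]
    by (auto simp: has_vector_derivative_def y_def p_def q_def Xs_def p'_def q'_def)
   have yW': "F s x \<in> W" using yW by (simp add: y_def)
   have 1: "((%s. \<omega> (F s x) (dd (F s) x u) (dd (F s) x v)) has_derivative
     (%t. dd (%z. \<omega> z p q) y (t *\<^sub>R Xs) + \<omega> y (t *\<^sub>R p') q + \<omega> y p (t *\<^sub>R q'))) (at s within {0..1})"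
    using form2_chain[where \<alpha>=\<omega>, OF W(1) wb(1) dw(1) yW' dF] by (simp add: y_def p_def q_def)
   have 2: "((%s. \<delta> (F s x) (dd (F s) x u) (dd (F s) x v)) has_derivative
     (%t. dd (%z. \<delta> z p q) y (t *\<^sub>R Xs) + \<delta> y (t *\<^sub>R p') q + \<delta> y p (t *\<^sub>R q'))) (at s within {0..1})"
    using form2_chain[where \<alpha>=\<delta>, OF W(1) wb(2) dw(2) yW' dF] by (simp add: y_def p_def q_def)
   have l1: "linear (dd (%z. \<omega> z p q) y)" "linear (dd (%z. \<delta> z p q) y)"
    by (rule has_derivative_linear[OF dw(1)[OF yW]], rule has_derivative_linear[OF dw(2)[OF yW]])
   have "(h has_derivative (%t. (dd (%z. \<omega> z p q) y (t *\<^sub>R Xs) + \<omega> y (t *\<^sub>R p') q + \<omega> y p (t *\<^sub>R q'))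
     + (s * (dd (%z. \<delta> z p q) y (t *\<^sub>R Xs) + \<delta> y (t *\<^sub>R p') q + \<delta> y p (t *\<^sub>R q')) + t * \<delta> (F s x) (dd (F s) x u) (dd (F s) x v)))) (at s within {0..1})"
    unfolding h_def \<Omega>_def by (intro has_derivative_add 1 has_derivative_mult has_derivative_ident 2)
   then have dh: "(h has_vector_derivative (dd (%z. \<Omega> s z p q) y Xs + \<Omega> s y p' q + \<Omega> s y p q' + \<delta> y p q)) (at s within {0..1})"
    unfolding has_vector_derivative_def dd\<Omega>[OF yW]
    by (rule has_derivative_eq_rhs)
      (simp add: fun_eq_iff \<Omega>_def linear_cmul[OF l1(1)] linear_cmul[OF l1(2)] bilinear_lmul[OF bw] bilinear_rmul[OF bw]
       bilinear_lmul[OF bd] bilinear_rmul[OF bd] algebra_simps y_def[symmetric] p_def[symmetric] q_def[symmetric])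
   \<comment> \<open>The derivative along h of the defining relation \<Omega>(X, w) = - \<beta>(w).
     Two instances of it, together with closedness of \<Omega>, reduce the time derivative to
     \<delta> - d\<beta> = 0.\<close>
   have i1: "dd (%z. \<Omega> s z Xs w) y h + \<Omega> s y (dd X (s, y) (0, h)) w = - dd (%z. \<beta> z w) y h" for w h
   proof -
    have dX: "((%z. X (s, z)) has_derivative (%h. dd X (s, y) (0, h))) (at y)"
    proof -
     have a: "((%z. (s, z)) has_derivative (%h. (0, h))) (at y)" by (auto intro!: derivative_eq_intros)
     have b: "(X has_derivative dd X (s, y)) (at (s, y))"
      by (rule smooth_on_imp_has_derivative[OF smX]) (use sT yR in auto)
     show ?thesis using has_derivative_compose[OF a b] .
    qed
    have "((%z. \<Omega> s z (X (s, z)) w) has_derivative (%h. dd (%z. \<Omega> s z (X (s, y)) w) y h + \<Omega> s y (dd X (s, y) (0, h)) w + \<Omega> s y (X (s, y)) 0)) (at y)"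
     by (rule form2_chain[where \<alpha>="\<Omega> s" and P="%z. z" and Q="%z. X (s, z)" and R="%_. w",
        OF W(1) \<Omega>b d\<Omega>' yW has_derivative_ident dX has_derivative_const])
    then have n: "((%z. - \<beta> z w) has_derivative (%h. dd (%z. \<Omega> s z (X (s, y)) w) y h + \<Omega> s y (dd X (s, y) (0, h)) w + \<Omega> s y (X (s, y)) 0)) (at y)"
     by (rule has_derivative_transform_within_open[OF _ open_ball yR]) (use rel[OF sT] in auto)
    show ?thesis
     using fun_cong[OF has_derivative_unique[OF n has_derivative_minus[OF dw(3)[OF yW, of w]]], of h]
      bilinear_rzero[OF \<Omega>b[OF yW]] by (simp add: Xs_def)
   qed
   have yU4: "y \<in> U4" using yW W by blast
   have c2: "dd (%z. \<Omega> s z p q) y Xs - dd (%z. \<Omega> s z Xs q) y p + dd (%z. \<Omega> s z Xs p) y q = 0"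
   proof -
    have "ext_d2 \<omega> y Xs p q + s * ext_d2 \<delta> y Xs p q = 0" using U4(3,4)[OF yU4] by simp
    then show ?thesis by (simp add: ext_d2_def dd\<Omega>[OF yW] algebra_simps)
   qed
   have b2: "\<delta> y p q = dd (%z. \<beta> z q) y p - dd (%z. \<beta> z p) y q"
    using U4(5)[OF yU4] by (simp add: ext_d1_def)
   have sw: "\<Omega> s y p q' = - \<Omega> s y q' p"
    by (rule bilinear_alternating_swap[OF \<Omega>b[OF yW]]) (simp add: \<Omega>_def walt[OF yW])
   have "dd (%z. \<Omega> s z p q) y Xs + \<Omega> s y p' q + \<Omega> s y p q' + \<delta> y p q = 0"
    using i1[of q p] i1[of p q] c2 b2 sw unfolding p'_def q'_def by linarith
   then show ?thesis using dh by simp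
  qed
  then obtain k where k: "!!s. s \<in> {0..1} ==> h s = k"
   using has_vector_derivative_zero_constant[OF convex_real_interval(5)] by metis
  have "h 1 = h 0" using k[of 0] k[of 1] by simp
  moreover have "F 0 = (%x. x)" by (simp add: F(4) fun_eq_iff)
  then have "h 0 = \<omega> x u v" by (simp add: h_def \<Omega>_def dd_eq[OF has_derivative_ident])
  ultimately show ?thesis by (simp add: h_def)
 qed
 show ?thesis
 proof (rule that[of "F 1"])
  show s: "smooth_germ (F 1)" using F(1-3) by (intro smooth_germI[of U]) auto
  show z: "F 1 0 = 0" using F(8)[of 1 0] F(2) X00 by simp
  have "open (U \<inter> ball 0 R)" "0 \<in> U \<inter> ball 0 R" using F R by auto
  moreover have "F 1 x = x" if "x \<in> U \<inter> ball 0 R" "\<forall>u. \<beta> x u = 0" for x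
  proof (rule F(8))
   show "X (s, x) = 0" if "s \<in> {0..1}" for s
    by (rule X0) (use that \<open>x \<in> U \<inter> ball 0 R\<close> \<open>\<forall>u. \<beta> x u = 0\<close> T in auto)
  qed (use that in auto)
  ultimately show "NEAR x. (\<forall>u. \<beta> x u = 0) --> F 1 x = x" unfolding eventually_nhds by blast
  show "NEAR x. \<forall>u v. pullback (F 1) (%x u v. \<omega> x u v + \<delta> x u v) x u v = \<omega> x u v"
   unfolding eventually_nhds using F(1,2) key by (intro exI[of _ U]) (auto simp: pullback_def \<Omega>_def)
  have lin: "linear (dd (F 1) 0)" using has_derivative_linear[OF smooth_germ_has_derivative_0[OF s]] .
  show "inj (dd (F 1) 0)"
  proof -
   \<comment> \<open>The pullback under F 1 is \<omega>, nondegenerate at 0, so the derivative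
     annihilates no u \<noteq> 0.\<close>
   have "u = 0" if "dd (F 1) 0 u = 0" for u
   proof (rule ccontr)
    assume "u \<noteq> 0"
    then obtain v where v: "\<omega> 0 u v \<noteq> 0" using nd by blast
    have "\<Omega> 1 0 0 (dd (F 1) 0 v) = \<omega> 0 u v" using key[OF F(2), of u v] that z by simp
    then show False using v bilinear_lzero[OF \<Omega>b[OF W(2)]] by simp
   qed
   then show ?thesis using lin by (simp add: linear_injective_0)
  qed
 qed
qed

section \<open>Algebraic restrictions of closed two-forms to \<open>U\<^sub>7\<close>\<close>

lemma form2_germ_dxdx: "form2_germ (%x. dxdx i j)"
proof -
 have "form1_germ (%x u. u $ k)" for k
  by (intro form1_germ_const bounded_linear.linear bounded_linear_vec_nth)
 from form2_germ_wedge[OF this[of i] this[of j]] show ?thesis by (simp add: dxdx_def[abs_def] mult.commute)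
qed

lemma has_derivative_nth: "((%x::real^'m. x $ i) has_derivative (%v. v $ i)) (at x)"
 by (rule bounded_linear_imp_has_derivative[OF bounded_linear_vec_nth])

lemma dd_nth: "dd (%x::real^'m. x $ i) x v = v $ i"
 using dd_eq[OF has_derivative_nth] by metis

lemma alg_null_eqI: "alg_null N \<sigma> ==> (!!x u v. \<tau> x u v = \<sigma> x u v) ==> alg_null N \<tau>"
proof -
 assume a: "alg_null N \<sigma>" and e: "!!x u v. \<tau> x u v = \<sigma> x u v"
 have "\<tau> = \<sigma>" by (intro ext) (rule e)
 then show "alg_null N \<tau>" using a by simp
qed

text \<open>The parameter \<open>ty\<close> ties the locale to the index type; \<open>card2\<close>
  makes the indices 1, 2, 3 distinct.\<close>

locale U7_setting =
 fixes ty :: "'n::finite itself"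
 assumes card2: "CARD('n) \<ge> 2"
begin

lemmas dist123 = bit0_distinct_123[OF card2]
lemmas dist = dist123 dist123[symmetric]

abbreviation E :: "'n bit0 => 'n R2n" where "E i \<equiv> axis i 1"
abbreviation A :: "'n R2n => 'n R2n => real" where "A \<equiv> dxdx 1 3"
abbreviation B :: "'n R2n => 'n R2n => real" where "B \<equiv> dxdx 2 3"
abbreviation C :: "'n R2n => 'n R2n => real" where "C \<equiv> dxdx 1 2"
abbreviation AN :: "'n R2n form2 => bool" where "AN \<equiv> alg_null U7"

definition f7 :: "'n R2n => real" where "f7 x = (x $ 1)\<^sup>2 + x $ 2 * x $ 3"
definition g7 :: "'n R2n => real" where "g7 x = x $ 1 * x $ 2 + (x $ 3)^3"

lemma U7_f7: "x \<in> U7 ==> f7 x = 0" and U7_g7: "x \<in> U7 ==> g7 x = 0"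
 and U7_rest: "x \<in> U7 ==> i \<notin> {1, 2, 3} ==> x $ i = 0"
 by (auto simp: U7_def f7_def g7_def)

lemma smooth_f7: "smooth_germ f7" and smooth_g7: "smooth_germ g7"
 unfolding f7_def[abs_def] g7_def[abs_def]
 by (intro smooth_germ_add smooth_germ_mult smooth_germ_power smooth_germ_nth)+

lemma dd_f7: "dd f7 x v = 2 * x $ 1 * v $ 1 + x $ 3 * v $ 2 + x $ 2 * v $ 3"
proof -
 note n = has_derivative_nth
 have "(f7 has_derivative (%v. 2 * x $ 1 * v $ 1 + x $ 3 * v $ 2 + x $ 2 * v $ 3)) (at x)"
  unfolding f7_def[abs_def] power2_eq_square
  by (rule has_derivative_eq_rhs[OF has_derivative_add[OF has_derivative_mult[OF n n] has_derivative_mult[OF n n]]])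
    (simp add: fun_eq_iff algebra_simps)
 from dd_eq[OF this] show ?thesis by simp
qed

lemma dd_g7: "dd g7 x v = x $ 2 * v $ 1 + x $ 1 * v $ 2 + 3 * (x $ 3)\<^sup>2 * v $ 3"
proof -
 note n = has_derivative_nth
 have "(g7 has_derivative (%v. x $ 2 * v $ 1 + x $ 1 * v $ 2 + 3 * (x $ 3)\<^sup>2 * v $ 3)) (at x)"
  unfolding g7_def[abs_def] power3_eq_cube
  by (rule has_derivative_eq_rhs[OF has_derivative_add[OF has_derivative_mult[OF n n] has_derivative_mult[OF has_derivative_mult[OF n n] n]]])
    (simp add: fun_eq_iff algebra_simps power2_eq_square)
 from dd_eq[OF this] show ?thesis by simp
qed

lemma form1_coord: "smooth_germ h ==> form1_germ (%x v. h x * v $ (k::'n bit0))"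
 by (intro form1_germ_mult form1_germ_const bounded_linear.linear bounded_linear_vec_nth)

lemma AN_f7: assumes "smooth_germ h" shows "AN (%x u v. h x * (dd f7 x u * v $ k - dd f7 x v * u $ k))"
 by (rule alg_null_eqI[OF alg_null_dd_wedge[OF smooth_f7 _ form1_coord[OF assms, of k]]])
   (auto intro!: always_eventually simp: U7_f7 algebra_simps)

lemma AN_g7: assumes "smooth_germ h" shows "AN (%x u v. h x * (dd g7 x u * v $ k - dd g7 x v * u $ k))"
 by (rule alg_null_eqI[OF alg_null_dd_wedge[OF smooth_g7 _ form1_coord[OF assms, of k]]])
   (auto intro!: always_eventually simp: U7_g7 algebra_simps)

lemma AN_vanish:
 assumes "smooth_germ h" "!!x. x \<in> U7 ==> h x = 0" shows "AN (%x u v. h x * dxdx i j u v)"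
 by (rule alg_null_vanishing[OF form2_germ_mult[OF assms(1) form2_germ_dxdx]]) (auto intro!: always_eventually simp: assms(2))

text \<open>The relations given by \<open>df \<and> dx\<^sub>i\<close> and \<open>dg \<and> dx\<^sub>i\<close>, where \<open>f = x\<^sub>1\<^sup>2 + x\<^sub>2 x\<^sub>3\<close> and \<open>g = x\<^sub>1 x\<^sub>2 + x\<^sub>3\<^sup>3\<close>.\<close>

lemma R1: "smooth_germ h ==> AN (%x u v. h x * (x $ 3 * C u v + x $ 2 * A u v))"
 by (rule alg_null_eqI[OF alg_null_scale[OF AN_f7[of h 1], of "-1"]]) (auto simp: dd_f7 dxdx_def algebra_simps)

lemma R2: "smooth_germ h ==> AN (%x u v. h x * (2 * x $ 1 * C u v - x $ 2 * B u v))"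
 by (rule alg_null_eqI[OF AN_f7[of h 2]]) (auto simp: dd_f7 dxdx_def algebra_simps)

lemma R3: "smooth_germ h ==> AN (%x u v. h x * (2 * x $ 1 * A u v + x $ 3 * B u v))"
 by (rule alg_null_eqI[OF AN_f7[of h 3]]) (auto simp: dd_f7 dxdx_def algebra_simps)

lemma R4: "smooth_germ h ==> AN (%x u v. h x * (x $ 1 * C u v + 3 * (x $ 3)\<^sup>2 * A u v))"
 by (rule alg_null_eqI[OF alg_null_scale[OF AN_g7[of h 1], of "-1"]]) (auto simp: dd_g7 dxdx_def algebra_simps)

lemma R5: "smooth_germ h ==> AN (%x u v. h x * (x $ 2 * C u v - 3 * (x $ 3)\<^sup>2 * B u v))"
 by (rule alg_null_eqI[OF AN_g7[of h 2]]) (auto simp: dd_g7 dxdx_def algebra_simps)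

lemma R6: "smooth_germ h ==> AN (%x u v. h x * (x $ 2 * A u v + x $ 1 * B u v))"
 by (rule alg_null_eqI[OF AN_g7[of h 3]]) (auto simp: dd_g7 dxdx_def algebra_simps)

lemma sx: "smooth_germ h ==> smooth_germ (%x::'n R2n. h x * x $ i)"
 by (rule smooth_germ_mult[OF _ smooth_germ_nth])

lemma AN_fA: "smooth_germ h ==> AN (%x u v. (h x * f7 x) * dxdx i j u v)"
 by (rule AN_vanish) (auto intro: smooth_germ_mult smooth_f7 simp: U7_f7)

lemma AN_gA: "smooth_germ h ==> AN (%x u v. (h x * g7 x) * dxdx i j u v)"
 by (rule AN_vanish) (auto intro: smooth_germ_mult smooth_g7 simp: U7_g7)

text \<open>x1 times \<open>R3\<close> and x3 times \<open>R6\<close> share the term x1 x3 B. Their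
  difference is (2 x1^2 - x2 x3) A, and adding f A, null because f vanishes on U7, leaves 3 x1^2
  A.\<close>

lemma A11: assumes h: "smooth_germ h" shows "AN (%x u v. h x * (x $ 1)\<^sup>2 * A u v)"
 by (rule alg_null_eqI[OF alg_null_scale[OF alg_null_add[OF alg_null_diff[OF R3[OF sx[OF h, of 1]] R6[OF sx[OF h, of 3]]] AN_fA[OF h, of 1 3]], of "1/3"]])
   (simp add: f7_def algebra_simps power2_eq_square)

lemma A23: assumes h: "smooth_germ h" shows "AN (%x u v. h x * (x $ 2 * x $ 3) * A u v)"
 by (rule alg_null_eqI[OF alg_null_diff[OF AN_fA[OF h, of 1 3] A11[OF h]]])
   (simp add: f7_def algebra_simps power2_eq_square)

text \<open>x3 times \<open>R4\<close> and x1 times \<open>R1\<close> share the term x1 x3 C; the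
  difference (3 x3^3 - x1 x2) A plus g A is 4 x3^3 A.\<close>

lemma A333: assumes h: "smooth_germ h" shows "AN (%x u v. h x * (x $ 3)^3 * A u v)"
 by (rule alg_null_eqI[OF alg_null_scale[OF alg_null_add[OF alg_null_diff[OF R4[OF sx[OF h, of 3]] R1[OF sx[OF h, of 1]]] AN_gA[OF h, of 1 3]], of "1/4"]])
   (simp add: g7_def algebra_simps power2_eq_square power3_eq_cube)

lemma A12: assumes h: "smooth_germ h" shows "AN (%x u v. h x * (x $ 1 * x $ 2) * A u v)"
 by (rule alg_null_eqI[OF alg_null_diff[OF AN_gA[OF h, of 1 3] A333[OF h]]])
   (simp add: g7_def algebra_simps)

text \<open>An elimination through all three basis forms: x3^2 \<open>R3\<close> - g B - x1
  \<open>R2\<close> + 2 x1 \<open>R4\<close> is 8 x1 x3^2 A.\<close>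

lemma A133: assumes h: "smooth_germ h" shows "AN (%x u v. h x * (x $ 1 * (x $ 3)\<^sup>2) * A u v)"
 by (rule alg_null_eqI[OF alg_null_scale[OF alg_null_add[OF alg_null_diff[OF alg_null_diff[OF R3[OF sx[OF sx[OF h, of 3], of 3]] AN_gA[OF h, of 2 3]]
     R2[OF sx[OF h, of 1]]] alg_null_scale[OF R4[OF sx[OF h, of 1]], of 2]], of "1/8"]])
   (simp add: g7_def algebra_simps power2_eq_square power3_eq_cube)

lemma A22: assumes h: "smooth_germ h" shows "AN (%x u v. h x * (x $ 2)\<^sup>2 * A u v)"
 by (rule alg_null_eqI[OF alg_null_add[OF alg_null_diff[OF alg_null_add[OF R6[OF sx[OF h, of 2]] R2[OF sx[OF h, of 1]]]
     alg_null_scale[OF R4[OF sx[OF h, of 1]], of 2]] alg_null_scale[OF A133[OF h], of 6]]])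
   (simp add: algebra_simps power2_eq_square)

section \<open>Coefficient functions modulo J\<close>

definition restW :: "('n R2n => real) => bool" where
 "restW r \<longleftrightarrow> smooth_germ r \<and> (NEAR x. (\<forall>i. i \<notin> {1, 2, 3} --> x $ i = 0) --> r x = 0)"

lemma restW_mult: "smooth_germ h ==> restW s ==> restW (%x. h x * s x)"
 unfolding restW_def by (auto intro: smooth_germ_mult elim!: eventually_mono)

lemma restW_zero: "restW (%x. 0)"
 unfolding restW_def by (auto intro: smooth_germ_const)

text \<open>For \<open>h \<in> J\<close> the forms \<open>h dx\<^sub>i \<and> dx\<^sub>j\<close> are algebraically null, so coefficients matter only modulo \<open>J\<close>.\<close>

inductive inJ :: "('n R2n => real) => bool" where
 inJ_11: "inJ (%x. (x $ 1)\<^sup>2)"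
| inJ_12: "inJ (%x. x $ 1 * x $ 2)"
| inJ_22: "inJ (%x. (x $ 2)\<^sup>2)"
| inJ_23: "inJ (%x. x $ 2 * x $ 3)"
| inJ_333: "inJ (%x. (x $ 3)^3)"
| inJ_133: "inJ (%x. x $ 1 * (x $ 3)\<^sup>2)"
| inJ_restW: "restW h ==> inJ h"
| inJ_add: "inJ h ==> inJ k ==> inJ (%x. h x + k x)"
| inJ_mult: "smooth_germ k ==> inJ h ==> inJ (%x. k x * h x)"
| inJ_cong: "inJ h ==> NEAR x. k x = h x ==> inJ k"

lemmas inJ_gens = inJ_11 inJ_12 inJ_22 inJ_23 inJ_333 inJ_133

lemma inJ_zero: "inJ (%x. 0)"
 by (rule inJ_restW[OF restW_zero])

text \<open>The monomials in x1, x2, x3 divisible by no generator of J: modulo J every smooth germ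
  is such a polynomial.\<close>

abbreviation quad :: "real => real => real => real => real => real => 'n R2n => real" where
 "quad c0 c1 c2 c3 c13 c33 x \<equiv> c0 + c1 * x $ 1 + c2 * x $ 2 + c3 * x $ 3 + c13 * (x $ 1 * x $ 3) + c33 * (x $ 3)\<^sup>2"

definition J2 :: "('n R2n => real) => real => real => real => real => real => real => bool" where
 "J2 h c0 c1 c2 c3 c13 c33 \<longleftrightarrow> smooth_germ h \<and> inJ (%x. h x - quad c0 c1 c2 c3 c13 c33 x)"

lemma J2_smooth: "J2 h c0 c1 c2 c3 c13 c33 ==> smooth_germ h"
 by (simp add: J2_def)

lemma J2_const: "J2 (%x. c) c 0 0 0 0 0"
 by (simp add: J2_def smooth_germ_const inJ_zero)

lemma J2_x1: "J2 (%x. x $ 1) 0 1 0 0 0 0" and J2_x2: "J2 (%x. x $ 2) 0 0 1 0 0 0" and J2_x3: "J2 (%x. x $ 3) 0 0 0 1 0 0"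
 by (simp_all add: J2_def smooth_germ_nth inJ_zero)

lemma J2_add:
 assumes "J2 h c0 c1 c2 c3 c13 c33" "J2 k d0 d1 d2 d3 d13 d33"
 shows "J2 (%x. h x + k x) (c0 + d0) (c1 + d1) (c2 + d2) (c3 + d3) (c13 + d13) (c33 + d33)"
proof -
 have "inJ (%x. (h x - (c0 + c1 * x $ 1 + c2 * x $ 2 + c3 * x $ 3 + c13 * (x $ 1 * x $ 3) + c33 * (x $ 3)\<^sup>2))
   + (k x - (d0 + d1 * x $ 1 + d2 * x $ 2 + d3 * x $ 3 + d13 * (x $ 1 * x $ 3) + d33 * (x $ 3)\<^sup>2)))"
  using assms unfolding J2_def by (intro inJ_add) blast+
 then have "inJ (%x. h x + k x - (c0 + d0 + (c1 + d1) * x $ 1 + (c2 + d2) * x $ 2 + (c3 + d3) * x $ 3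
   + (c13 + d13) * (x $ 1 * x $ 3) + (c33 + d33) * (x $ 3)\<^sup>2))"
  by (rule inJ_cong) (simp add: algebra_simps)
 then show ?thesis using assms smooth_germ_add unfolding J2_def by blast
qed

text \<open>Truncated multiplication: in the product of two representatives only the constant,
  linear, x1 x3 and x3^2 terms survive modulo J.\<close>

lemma J2_mult:
 assumes "J2 h c0 c1 c2 c3 c13 c33" "J2 k d0 d1 d2 d3 d13 d33"
 shows "J2 (%x. h x * k x) (c0 * d0) (c0 * d1 + c1 * d0) (c0 * d2 + c2 * d0) (c0 * d3 + c3 * d0)
   (c0 * d13 + c13 * d0 + c1 * d3 + c3 * d1) (c0 * d33 + c33 * d0 + c3 * d3)"
proof -
 define p where "p = quad c0 c1 c2 c3 c13 c33"
 define q where "q = quad d0 d1 d2 d3 d13 d33"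
 have sm: "smooth_germ h" "smooth_germ k" "smooth_germ p" "smooth_germ q"
  using assms J2_smooth unfolding p_def q_def
  by (blast, blast) (intro smooth_germ_add smooth_germ_mult smooth_germ_power smooth_germ_const smooth_germ_nth)+
 have J: "inJ (%x. h x - p x)" "inJ (%x. k x - q x)" using assms by (auto simp: J2_def p_def q_def)
 define e where "e = quad (c0 * d0) (c0 * d1 + c1 * d0) (c0 * d2 + c2 * d0) (c0 * d3 + c3 * d0)
   (c0 * d13 + c13 * d0 + c1 * d3 + c3 * d1) (c0 * d33 + c33 * d0 + c3 * d3)"
 \<comment> \<open>The discarded terms of p q, sorted by a generator of J that divides them.\<close>
 have "inJ (%x. (c1 * d1 + (c1 * d13 + c13 * d1) * x $ 3 + c13 * d13 * (x $ 3)\<^sup>2) * (x $ 1)\<^sup>2 +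
    (c1 * d2 + c2 * d1 + (c2 * d13 + c13 * d2) * x $ 3) * (x $ 1 * x $ 2) + c2 * d2 * (x $ 2)\<^sup>2 +
    (c2 * d3 + c3 * d2 + (c2 * d33 + c33 * d2) * x $ 3) * (x $ 2 * x $ 3) +
    (c3 * d33 + c33 * d3 + c33 * d33 * x $ 3 + (c13 * d33 + c33 * d13) * x $ 1) * x $ 3 ^ 3 +
    (c3 * d13 + c13 * d3 + c1 * d33 + c33 * d1) * (x $ 1 * (x $ 3)\<^sup>2))"
  by (rule inJ_add[OF inJ_add[OF inJ_add[OF inJ_add[OF inJ_add[OF inJ_mult[OF _ inJ_gens(1)] inJ_mult[OF _ inJ_gens(2)]]
     inJ_mult[OF _ inJ_gens(3)]] inJ_mult[OF _ inJ_gens(4)]] inJ_mult[OF _ inJ_gens(5)]] inJ_mult[OF _ inJ_gens(6)]])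
    (intro smooth_germ_add smooth_germ_mult smooth_germ_power smooth_germ_const smooth_germ_nth)+
 then have "inJ (%x. p x * q x - e x)"
  by (rule inJ_cong)
    (intro always_eventually allI, simp add: p_def q_def e_def algebra_simps power2_eq_square power3_eq_cube)
 then have "inJ (%x. (h x * (k x - q x) + q x * (h x - p x)) + (p x * q x - e x))"
  by (intro inJ_add inJ_mult sm J)
 then have "inJ (%x. h x * k x - e x)"
  by (rule inJ_cong) (simp add: algebra_simps)
 then show ?thesis unfolding J2_def e_def using smooth_germ_mult sm by blast
qed

lemma J2_cong: "J2 h c0 c1 c2 c3 c13 c33 ==> NEAR x. h x = k x ==> J2 k c0 c1 c2 c3 c13 c33"
 unfolding J2_def by (auto intro: smooth_germ_cong elim!: inJ_cong eventually_mono)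

lemma AN_inJ:
 assumes "inJ h"
  and g: "!!r. smooth_germ r ==> AN (%x u v. r x * (x $ 1)\<^sup>2 * dxdx i j u v)"
   "!!r. smooth_germ r ==> AN (%x u v. r x * (x $ 1 * x $ 2) * dxdx i j u v)"
   "!!r. smooth_germ r ==> AN (%x u v. r x * (x $ 2)\<^sup>2 * dxdx i j u v)"
   "!!r. smooth_germ r ==> AN (%x u v. r x * (x $ 2 * x $ 3) * dxdx i j u v)"
   "!!r. smooth_germ r ==> AN (%x u v. r x * (x $ 3)^3 * dxdx i j u v)"
   "!!r. smooth_germ r ==> AN (%x u v. r x * (x $ 1 * (x $ 3)\<^sup>2) * dxdx i j u v)"
 shows "AN (%x u v. h x * dxdx i j u v)"
proof -
 \<comment> \<open>The induction carries an arbitrary smooth factor r, because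
   \<open>inJ_mult\<close> multiplies members of J by such factors.\<close>
 have "smooth_germ r ==> AN (%x u v. r x * h x * dxdx i j u v)" for r
  using assms(1)
 proof (induction arbitrary: r)
  case (inJ_restW h)
  show ?case
  proof (rule alg_null_vanishing[OF form2_germ_mult[OF smooth_germ_mult form2_germ_dxdx]])
   show "smooth_germ r" "smooth_germ h" using inJ_restW by (simp_all add: restW_def)
   show "NEAR x. x \<in> U7 --> (\<forall>u v. r x * h x * dxdx i j u v = 0)"
    using inJ_restW(1)[unfolded restW_def, THEN conjunct2] by eventually_elim (use U7_rest in auto)
  qed
 next
  case (inJ_add h k)
  show ?case by (rule alg_null_eqI[OF alg_null_add[OF inJ_add(3,4)[OF inJ_add(5)]]]) (simp add: algebra_simps)
 next
  case (inJ_mult k h)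
  show ?case by (rule alg_null_eqI[OF inJ_mult(3)[OF smooth_germ_mult[OF inJ_mult(4,1)]]]) (simp add: mult.assoc)
 next
  case (inJ_cong h k)
  show ?case by (rule alg_null_cong[OF _ inJ_cong(3)[OF inJ_cong(4)]]) (use inJ_cong(2) in eventually_elim, simp)
 qed (rule g, assumption)+
 from this[OF smooth_germ_const[of 1]] show ?thesis by simp
qed

lemma AN_inJ_A: "inJ h ==> AN (%x u v. h x * A u v)"
 by (rule AN_inJ[OF _ A11 A12 A22 A23 A333 A133])

text \<open>The relations trade monomials times B for monomials times A or C whose nullity is
  already known; the lemmas on C continue the same elimination.\<close>

lemma B11: assumes h: "smooth_germ h" shows "AN (%x u v. h x * (x $ 1)\<^sup>2 * B u v)"
 by (rule alg_null_eqI[OF alg_null_diff[OF R6[OF sx[OF h, of 1]] A12[OF h]]]) (simp add: algebra_simps power2_eq_square)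

lemma B12: assumes h: "smooth_germ h" shows "AN (%x u v. h x * (x $ 1 * x $ 2) * B u v)"
 by (rule alg_null_eqI[OF alg_null_diff[OF R6[OF sx[OF h, of 2]] A22[OF h]]]) (simp add: algebra_simps power2_eq_square)

lemma C12: assumes h: "smooth_germ h" shows "AN (%x u v. h x * (x $ 1 * x $ 2) * C u v)"
 by (rule alg_null_eqI[OF alg_null_diff[OF R4[OF sx[OF h, of 2]] alg_null_scale[OF A23[OF sx[OF h, of 3]], of 3]]])
   (simp add: algebra_simps power2_eq_square)

lemma B22: assumes h: "smooth_germ h" shows "AN (%x u v. h x * (x $ 2)\<^sup>2 * B u v)"
 by (rule alg_null_eqI[OF alg_null_diff[OF alg_null_scale[OF C12[OF h], of 2] R2[OF sx[OF h, of 2]]]])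
   (simp add: algebra_simps power2_eq_square)

lemma B23: assumes h: "smooth_germ h" shows "AN (%x u v. h x * (x $ 2 * x $ 3) * B u v)"
 by (rule alg_null_eqI[OF alg_null_diff[OF R3[OF sx[OF h, of 2]] alg_null_scale[OF A12[OF h], of 2]]]) (simp add: algebra_simps)

lemma B333: assumes h: "smooth_germ h" shows "AN (%x u v. h x * (x $ 3)^3 * B u v)"
 by (rule alg_null_eqI[OF alg_null_diff[OF R3[OF sx[OF sx[OF h, of 3], of 3]] alg_null_scale[OF A133[OF h], of 2]]])
   (simp add: algebra_simps power2_eq_square power3_eq_cube)

lemma B133: assumes h: "smooth_germ h" shows "AN (%x u v. h x * (x $ 1 * (x $ 3)\<^sup>2) * B u v)"
 by (rule alg_null_eqI[OF alg_null_diff[OF R3[OF sx[OF sx[OF h, of 1], of 3]] alg_null_scale[OF A11[OF sx[OF h, of 3]], of 2]]])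
   (simp add: algebra_simps power2_eq_square)

lemma AN_inJ_B: "inJ h ==> AN (%x u v. h x * B u v)"
 by (rule AN_inJ[OF _ B11 B12 B22 B23 B333 B133])

lemma C11: assumes h: "smooth_germ h" shows "AN (%x u v. h x * (x $ 1)\<^sup>2 * C u v)"
 by (rule alg_null_eqI[OF alg_null_diff[OF R4[OF sx[OF h, of 1]] alg_null_scale[OF A133[OF h], of 3]]])
   (simp add: algebra_simps power2_eq_square)

lemma C22: assumes h: "smooth_germ h" shows "AN (%x u v. h x * (x $ 2)\<^sup>2 * C u v)"
 by (rule alg_null_eqI[OF alg_null_add[OF R5[OF sx[OF h, of 2]] alg_null_scale[OF B23[OF sx[OF h, of 3]], of 3]]])
   (simp add: algebra_simps power2_eq_square)

lemma C23: assumes h: "smooth_germ h" shows "AN (%x u v. h x * (x $ 2 * x $ 3) * C u v)"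
 by (rule alg_null_eqI[OF alg_null_diff[OF R1[OF sx[OF h, of 2]] A22[OF h]]]) (simp add: algebra_simps power2_eq_square)

lemma C333: assumes h: "smooth_germ h" shows "AN (%x u v. h x * (x $ 3)^3 * C u v)"
 by (rule alg_null_eqI[OF alg_null_diff[OF R1[OF sx[OF sx[OF h, of 3], of 3]] A23[OF sx[OF h, of 3]]]])
   (simp add: algebra_simps power3_eq_cube)

lemma C133: assumes h: "smooth_germ h" shows "AN (%x u v. h x * (x $ 1 * (x $ 3)\<^sup>2) * C u v)"
 by (rule alg_null_eqI[OF alg_null_diff[OF R1[OF sx[OF sx[OF h, of 1], of 3]] A12[OF sx[OF h, of 3]]]])
   (simp add: algebra_simps power2_eq_square)

lemma AN_inJ_C: "inJ h ==> AN (%x u v. h x * C u v)"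
 by (rule AN_inJ[OF _ C11 C12 C22 C23 C333 C133])

text \<open>The indices order the terms by their weights 7, 8, 9, 10, 11, 13, 14, where x1, x2, x3
  and their differentials count 4, 5, 3.\<close>

definition \<Theta> :: "real => real => real => real => real => real => real => 'n R2n form2" where
 "\<Theta> a1 a2 a3 a4 a5 a6 a7 x u v = (a1 + a4 * x $ 3 + a5 * x $ 1 + a6 * (x $ 3)\<^sup>2 + a7 * (x $ 1 * x $ 3)) * A u v
   + a2 * B u v + a3 * C u v"

text \<open>Modulo null forms x3 B = -2 x1 A, x1 C = -3 x3^2 A, x2 B = 2 x1 C = -6 x3^2 A, x3^2 B =
  -2 x1 x3 A and x2 C = 3 x3^2 B = -6 x1 x3 A, which explains the constants. Moreover x1 B = x3 C =
  - x2 A, so x2 A receives the coefficient p2 - q1 - r3, and closedness annihilates it.\<close>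

lemma AN_components:
 assumes p: "J2 p p0 p1 p2 p3 p13 p33" and q: "J2 q q0 q1 q2 q3 q13 q33" and r: "J2 r r0 r1 r2 r3 r13 r33"
  and closed: "p2 = q1 + r3"
 shows "AN (%x u v. (p x * A u v + q x * B u v + r x * C u v)
   - \<Theta> p0 q0 r0 p3 (p1 - 2 * q3) (p33 - 6 * q2 - 3 * r1) (p13 - 2 * q33 - 6 * r2) x u v)"
proof -
 let ?j = quad
 have J: "AN (%x u v. (p x - ?j p0 p1 p2 p3 p13 p33 x) * A u v)" "AN (%x u v. (q x - ?j q0 q1 q2 q3 q13 q33 x) * B u v)"
  "AN (%x u v. (r x - ?j r0 r1 r2 r3 r13 r33 x) * C u v)"
  by (rule AN_inJ_A[OF conjunct2[OF p[unfolded J2_def]]], rule AN_inJ_B[OF conjunct2[OF q[unfolded J2_def]]],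
    rule AN_inJ_C[OF conjunct2[OF r[unfolded J2_def]]])
 note c = smooth_germ_const
 have q': "AN (%x u v. (?j q0 q1 q2 q3 q13 q33 x - q0) * B u v
   + (q1 * x $ 2 + 6 * q2 * (x $ 3)\<^sup>2 + 2 * q3 * x $ 1 + 2 * q33 * (x $ 1 * x $ 3)) * A u v)"
  by (rule alg_null_eqI[OF alg_null_add[OF alg_null_add[OF alg_null_add[OF alg_null_add[OF
     R6[OF c[of q1]] alg_null_diff[OF alg_null_scale[OF R4[OF c[of q2]], of 2] R2[OF c[of q2]]]] R3[OF c[of q3]]]
     alg_null_diff[OF R3[OF sx[OF c[of q13], of 1]] alg_null_scale[OF A11[OF c[of q13]], of 2]]]
     R3[OF sx[OF c[of q33], of 3]]]]) (simp add: algebra_simps power2_eq_square)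
 have r': "AN (%x u v. (?j r0 r1 r2 r3 r13 r33 x - r0) * C u v
   + (3 * r1 * (x $ 3)\<^sup>2 + 6 * r2 * (x $ 1 * x $ 3) + r3 * x $ 2) * A u v)"
  by (rule alg_null_eqI[OF alg_null_add[OF alg_null_add[OF alg_null_add[OF alg_null_add[OF
     R4[OF c[of r1]] alg_null_add[OF R5[OF c[of r2]] alg_null_scale[OF R3[OF sx[OF c[of r2], of 3]], of 3]]] R1[OF c[of r3]]]
     alg_null_diff[OF R4[OF sx[OF c[of r13], of 3]] alg_null_scale[OF A333[OF c[of r13]], of 3]]]
     alg_null_diff[OF R1[OF sx[OF c[of r33], of 3]] A23[OF c[of r33]]]]])
    (simp add: algebra_simps power2_eq_square power3_eq_cube)
 show ?thesis
  by (rule alg_null_eqI[OF alg_null_add[OF alg_null_add[OF alg_null_add[OF alg_null_add[OF J(1) J(2)] J(3)] q'] r']])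
    (simp add: \<Theta>_def closed algebra_simps)
qed

end

text \<open>Hadamard's coefficients are not unique, but their values at 0 are the partial
  derivatives.\<close>

lemma Hadamard_dd:
 fixes h :: "'a::euclidean_space => real"
 assumes "!!b. smooth_germ (k b)" "NEAR x. h x = c + (\<Sum>b\<in>Basis. (x \<bullet> b) * k b x)" "b \<in> Basis"
 shows "dd h 0 b = k b 0"
proof -
 have "dd h 0 = dd (%x. c + (\<Sum>b\<in>Basis. (x \<bullet> b) * k b x)) 0" by (rule dd_cong[OF assms(2)])
 also have "\<dots> = (%v. 0 + (\<Sum>b\<in>Basis. (0 \<bullet> b) * dd (k b) 0 v + (v \<bullet> b) * k b 0))"
  by (rule dd_eq) (intro has_derivative_add has_derivative_const has_derivative_sum has_derivative_mult
    has_derivative_inner_left has_derivative_ident smooth_germ_has_derivative_0 assms)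
 finally have "dd h 0 b = (\<Sum>c\<in>Basis. (b \<bullet> c) * k c 0)" by simp
 also have "\<dots> = (\<Sum>c\<in>Basis. if c = b then k b 0 else 0)"
  by (intro sum.cong) (auto simp: inner_Basis assms(3))
 finally show ?thesis using assms(3) by simp
qed

lemma sum_Basis_axis: "(\<Sum>b\<in>(Basis :: (real ^ 'm) set). F b) = (\<Sum>i\<in>UNIV. F (axis i 1))"
proof -
 have 1: "(Basis :: (real ^ 'm) set) = range (%i. axis i 1)" by (auto simp: Basis_vec_def)
 have 2: "inj (%i::'m. axis i (1::real))" by (auto intro!: injI simp: axis_eq_axis)
 show ?thesis unfolding 1 using sum.reindex[OF 2, of F] by (simp add: o_def)
qed

context U7_setting
begin

lemma sum_split123: "(\<Sum>i\<in>UNIV. F i) = F 1 + F 2 + F 3 + (\<Sum>i\<in>-{1, 2, 3 :: 'n bit0}. F i :: real)"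
proof -
 have "(\<Sum>i\<in>UNIV. F i) = (\<Sum>i\<in>{1, 2, 3} \<union> -{1, 2, 3}. F i)" by (rule sum.cong) auto
 also have "\<dots> = (\<Sum>i\<in>{1, 2, 3}. F i) + (\<Sum>i\<in>-{1, 2, 3}. F i)" by (rule sum.union_disjoint) auto
 also have "(\<Sum>i\<in>{1, 2, 3}. F i) = F 1 + F 2 + F 3" using dist123 by (simp add: add.assoc)
 finally show ?thesis .
qed

text \<open>The summands with indices outside 1, 2, 3 are collected in r, which vanishes on W and
  hence on U7.\<close>

lemma Hadamard3:
 assumes "smooth_germ h"
 obtains k1 k2 k3 r where "smooth_germ k1" "smooth_germ k2" "smooth_germ k3" "restW r"
  "NEAR x. h x = h 0 + k1 x * x $ 1 + k2 x * x $ 2 + k3 x * x $ 3 + r x"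
  "k1 0 = dd h 0 (E 1)" "k2 0 = dd h 0 (E 2)" "k3 0 = dd h 0 (E 3)"
proof -
 have "\<exists>k. (\<forall>b. smooth_germ (k b)) \<and> (NEAR x. h x = h 0 + (\<Sum>b\<in>Basis. (x \<bullet> b) * k b x))"
  by (rule Hadamard[OF assms]) blast
 then obtain k where k: "!!b. smooth_germ (k b)" "NEAR x. h x = h 0 + (\<Sum>b\<in>Basis. (x \<bullet> b) * k b x)"
  by blast
 define r where "r x = (\<Sum>i\<in>-{1, 2, 3}. x $ i * k (E i) x)" for x
 have d: "k (E i) 0 = dd h 0 (E i)" for i
  using Hadamard_dd[OF k, of "E i"] by (auto simp: axis_in_Basis_iff)
 have "smooth_germ r" unfolding r_def[abs_def] by (intro smooth_germ_sum smooth_germ_mult smooth_germ_nth k)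
 then have 1: "restW r" unfolding restW_def by (auto intro!: always_eventually sum.neutral simp: r_def)
 have "NEAR x. h x = h 0 + k (E 1) x * x $ 1 + k (E 2) x * x $ 2 + k (E 3) x * x $ 3 + r x"
  using k(2)
 proof eventually_elim
  case (elim x)
  show ?case unfolding elim sum_Basis_axis sum_split123 by (simp add: r_def inner_axis mult.commute)
 qed
 then show ?thesis using that[OF k(1) k(1) k(1) 1] d by blast
qed

text \<open>Freezing the coefficient of x1 x3 at its value in 0 costs multiples of x1^2 x3, x1 x2
  x3, x1 x3^2 and a term vanishing on W, all in J.\<close>

lemma inJ_x13: assumes "smooth_germ k" shows "inJ (%x. k x * (x $ 1 * x $ 3) - k 0 * (x $ 1 * x $ 3))"
proof -
 obtain k1 k2 k3 r where k: "smooth_germ k1" "smooth_germ k2" "smooth_germ k3" "restW r"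
  "NEAR x. k x = k 0 + k1 x * x $ 1 + k2 x * x $ 2 + k3 x * x $ 3 + r x"
  by (rule Hadamard3[OF assms]) (rule that)
 have "inJ (%x. k1 x * x $ 3 * (x $ 1)\<^sup>2 + k2 x * x $ 3 * (x $ 1 * x $ 2) + k3 x * (x $ 1 * (x $ 3)\<^sup>2) + (x $ 1 * x $ 3) * r x)"
  by (rule inJ_add[OF inJ_add[OF inJ_add[OF inJ_mult[OF sx[OF k(1)] inJ_gens(1)] inJ_mult[OF sx[OF k(2)] inJ_gens(2)]]
     inJ_mult[OF k(3) inJ_gens(6)]] inJ_restW[OF restW_mult[OF smooth_germ_mult[OF smooth_germ_nth smooth_germ_nth] k(4)]]])
 then show ?thesis
  by (rule inJ_cong) (use k(5) in eventually_elim, simp add: algebra_simps power2_eq_square)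
qed

lemma inJ_x33: assumes "smooth_germ k" shows "inJ (%x. k x * (x $ 3)\<^sup>2 - k 0 * (x $ 3)\<^sup>2)"
proof -
 obtain k1 k2 k3 r where k: "smooth_germ k1" "smooth_germ k2" "smooth_germ k3" "restW r"
  "NEAR x. k x = k 0 + k1 x * x $ 1 + k2 x * x $ 2 + k3 x * x $ 3 + r x"
  by (rule Hadamard3[OF assms]) (rule that)
 have "inJ (%x. k1 x * (x $ 1 * (x $ 3)\<^sup>2) + k2 x * x $ 3 * (x $ 2 * x $ 3) + k3 x * (x $ 3)^3 + (x $ 3)\<^sup>2 * r x)"
  by (rule inJ_add[OF inJ_add[OF inJ_add[OF inJ_mult[OF k(1) inJ_gens(6)] inJ_mult[OF sx[OF k(2)] inJ_gens(4)]]
     inJ_mult[OF k(3) inJ_gens(5)]] inJ_restW[OF restW_mult[OF smooth_germ_power[OF smooth_germ_nth] k(4)]]])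
 then show ?thesis
  by (rule inJ_cong) (use k(5) in eventually_elim, simp add: algebra_simps power2_eq_square power3_eq_cube)
qed

text \<open>Hadamard's lemma is applied to h and to its three coefficient functions. The first-order
  coefficients are named as partial derivatives because closedness is a condition on them; the
  second-order ones may stay existential.\<close>

lemma J2_exists:
 assumes "smooth_germ h"
 obtains c13 c33 where "J2 h (h 0) (dd h 0 (E 1)) (dd h 0 (E 2)) (dd h 0 (E 3)) c13 c33"
proof -
 obtain k1 k2 k3 r where k: "smooth_germ k1" "smooth_germ k2" "smooth_germ k3" "restW r"
  "NEAR x. h x = h 0 + k1 x * x $ 1 + k2 x * x $ 2 + k3 x * x $ 3 + r x"
  and d: "k1 0 = dd h 0 (E 1)" "k2 0 = dd h 0 (E 2)" "k3 0 = dd h 0 (E 3)"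
  by (rule Hadamard3[OF assms]) (rule that)
 obtain k11 k12 k13 r1 where a: "smooth_germ k11" "smooth_germ k12" "smooth_germ k13" "restW r1"
  "NEAR x. k1 x = k1 0 + k11 x * x $ 1 + k12 x * x $ 2 + k13 x * x $ 3 + r1 x"
  by (rule Hadamard3[OF k(1)]) (rule that)
 obtain k21 k22 k23 r2 where b: "smooth_germ k21" "smooth_germ k22" "smooth_germ k23" "restW r2"
  "NEAR x. k2 x = k2 0 + k21 x * x $ 1 + k22 x * x $ 2 + k23 x * x $ 3 + r2 x"
  by (rule Hadamard3[OF k(2)]) (rule that)
 obtain k31 k32 k33 r3 where c: "smooth_germ k31" "smooth_germ k32" "smooth_germ k33" "restW r3"
  "NEAR x. k3 x = k3 0 + k31 x * x $ 1 + k32 x * x $ 2 + k33 x * x $ 3 + r3 x"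
  by (rule Hadamard3[OF k(3)]) (rule that)
 have "inJ (%x. k11 x * (x $ 1)\<^sup>2 + k12 x * (x $ 1 * x $ 2) + (k13 x * (x $ 1 * x $ 3) - k13 0 * (x $ 1 * x $ 3)) + x $ 1 * r1 x
   + k21 x * (x $ 1 * x $ 2) + k22 x * (x $ 2)\<^sup>2 + k23 x * (x $ 2 * x $ 3) + x $ 2 * r2 x
   + (k31 x * (x $ 1 * x $ 3) - k31 0 * (x $ 1 * x $ 3)) + k32 x * (x $ 2 * x $ 3) + (k33 x * (x $ 3)\<^sup>2 - k33 0 * (x $ 3)\<^sup>2) + x $ 3 * r3 x + r x)"
  by (rule inJ_add[OF inJ_add[OF inJ_add[OF inJ_add[OF inJ_add[OF inJ_add[OF inJ_add[OF inJ_add[OF inJ_add[OF inJ_add[OF inJ_add[OF inJ_add[OF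
     inJ_mult[OF a(1) inJ_gens(1)] inJ_mult[OF a(2) inJ_gens(2)]] inJ_x13[OF a(3)]] inJ_restW[OF restW_mult[OF smooth_germ_nth a(4)]]]
     inJ_mult[OF b(1) inJ_gens(2)]] inJ_mult[OF b(2) inJ_gens(3)]] inJ_mult[OF b(3) inJ_gens(4)]] inJ_restW[OF restW_mult[OF smooth_germ_nth b(4)]]]
     inJ_x13[OF c(1)]] inJ_mult[OF c(2) inJ_gens(4)]] inJ_x33[OF c(3)]] inJ_restW[OF restW_mult[OF smooth_germ_nth c(4)]]] inJ_restW[OF k(4)]])
 then have "inJ (%x. h x - (h 0 + k1 0 * x $ 1 + k2 0 * x $ 2 + k3 0 * x $ 3 + (k13 0 + k31 0) * (x $ 1 * x $ 3) + k33 0 * (x $ 3)\<^sup>2))"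
  by (rule inJ_cong) (use k(5) a(5) b(5) c(5) in eventually_elim, simp add: algebra_simps power2_eq_square)
 then show ?thesis using that assms unfolding J2_def d by blast
qed

text \<open>If x_j vanishes on U7 then dx_j \<and> \<tau> is null, and \<sigma> differs from its
  restriction to W by a sum of such forms.\<close>

lemma AN_restrict_W:
 assumes s: "form2_germ \<sigma>"
 shows "AN (%x u v. \<sigma> x u v - (\<sigma> x (E 1) (E 3) * A u v + \<sigma> x (E 2) (E 3) * B u v + \<sigma> x (E 1) (E 2) * C u v))"
proof -
 define pr where "pr x = x $ 1 *\<^sub>R E 1 + x $ 2 *\<^sub>R E 2 + x $ 3 *\<^sub>R E 3" for x :: "'n R2n"
 define qr where "qr x = x - pr x" for x :: "'n R2n"
 have linp: "linear pr" unfolding pr_def by (auto intro!: linearI simp: algebra_simps)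
 have linq: "linear qr" unfolding qr_def[abs_def] by (intro linear_compose_sub linp linear_id[unfolded id_def])
 have qr: "qr x = (\<Sum>i\<in>-{1, 2, 3}. x $ i *\<^sub>R E i)" for x
 proof (rule vec_eq_iff[THEN iffD2], rule allI)
  fix k
  have "(\<Sum>i\<in>-{1, 2, 3}. x $ i *\<^sub>R E i) $ k = (\<Sum>i\<in>-{1, 2, 3}. if i = k then x $ i else 0)"
   unfolding sum_component by (intro sum.cong) (auto simp: axis_def)
  also have "\<dots> = (if k \<in> -{1, 2, 3} then x $ k else 0)" by (rule sum.delta) simp
  also have "\<dots> = qr x $ k" using dist by (auto simp: qr_def pr_def axis_def)
  finally show "qr x $ k = (\<Sum>i\<in>-{1, 2, 3}. x $ i *\<^sub>R E i) $ k" by simp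
 qed
 \<comment> \<open>The factor 1/2 compensates that the part of \<sigma> with both directions outside
   W is met twice, once through each argument.\<close>
 define \<tau> where "\<tau> j x v = \<sigma> x (E j) (pr v) + (1/2) * \<sigma> x (E j) (qr v)" for j x v
 have t: "form1_germ (\<tau> j)" for j
  unfolding form1_germ_iff
 proof (intro conjI ballI)
  show "NEAR x. linear (\<tau> j x)"
   using form2_germ_bilinear[OF s]
  proof eventually_elim
   case (elim x)
   then have b: "bilinear (\<sigma> x)" by blast
   show ?case unfolding \<tau>_def
    by (rule linearI) (simp_all add: linear_add[OF linp] linear_add[OF linq] linear_cmul[OF linp] linear_cmul[OF linq]
      bilinear_radd[OF b] bilinear_rmul[OF b] algebra_simps)
  qed
  show "smooth_germ (%x. \<tau> j x b)" for b
   unfolding \<tau>_def by (intro smooth_germ_add smooth_germ_mult smooth_germ_const form2_germ_smooth[OF s])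
 qed
 have "AN (%x u v. dd (%x. x $ j) x u * \<tau> j x v - dd (%x. x $ j) x v * \<tau> j x u)" if "j \<in> -{1, 2, 3}" for j
  by (rule alg_null_dd_wedge[OF smooth_germ_nth _ t]) (use that in \<open>auto intro!: always_eventually U7_rest\<close>)
 then have "AN (%x u v. \<Sum>j\<in>-{1, 2, 3}. u $ j * \<tau> j x v - v $ j * \<tau> j x u)"
  by (intro alg_null_sum) (simp add: dd_nth)
 then show ?thesis
 proof (rule alg_null_cong[rotated])
  show "NEAR x. \<forall>u v. (\<Sum>j\<in>-{1, 2, 3}. u $ j * \<tau> j x v - v $ j * \<tau> j x u)
    = \<sigma> x u v - (\<sigma> x (E 1) (E 3) * A u v + \<sigma> x (E 2) (E 3) * B u v + \<sigma> x (E 1) (E 2) * C u v)"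
   using form2_germ_bilinear[OF s]
  proof eventually_elim
   case (elim x)
   then have b: "bilinear (\<sigma> x)" and alt: "!!u. \<sigma> x u u = 0" by blast+
   have sw: "\<sigma> x u v = - \<sigma> x v u" for u v by (rule bilinear_alternating_swap[OF b alt])
   have l: "linear (%u. \<sigma> x u w)" for w using b by (simp add: bilinear_def)
   have q: "\<sigma> x (qr u) w = (\<Sum>j\<in>-{1, 2, 3}. u $ j * \<sigma> x (E j) w)" for u w
    unfolding qr by (simp add: linear_sum[OF l] linear_cmul[OF l])
   have 1: "(\<Sum>j\<in>-{1, 2, 3}. u $ j * \<tau> j x v) = \<sigma> x (qr u) (pr v) + (1/2) * \<sigma> x (qr u) (qr v)" for u v
    unfolding q \<tau>_def by (simp add: sum.distrib sum_distrib_left algebra_simps)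
   have pp: "\<sigma> x (pr u) (pr v) = \<sigma> x (E 1) (E 3) * A u v + \<sigma> x (E 2) (E 3) * B u v + \<sigma> x (E 1) (E 2) * C u v" for u v
    unfolding pr_def
    by (simp add: bilinear_ladd[OF b] bilinear_radd[OF b] bilinear_lmul[OF b] bilinear_rmul[OF b] alt
      sw[of "E 3" "E 1"] sw[of "E 3" "E 2"] sw[of "E 2" "E 1"] dxdx_def algebra_simps)
   have sp: "\<sigma> x u v = \<sigma> x (pr u) (pr v) + \<sigma> x (pr u) (qr v) + \<sigma> x (qr u) (pr v) + \<sigma> x (qr u) (qr v)" for u v
   proof -
    have "\<sigma> x (pr u + qr u) (pr v + qr v) = \<sigma> x (pr u) (pr v) + \<sigma> x (pr u) (qr v) + \<sigma> x (qr u) (pr v) + \<sigma> x (qr u) (qr v)"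
     by (simp only: bilinear_ladd[OF b] bilinear_radd[OF b] add_ac)
    then show ?thesis by (simp add: qr_def)
   qed
   show ?case
   proof (intro allI)
    fix u v
    have "(\<Sum>j\<in>-{1, 2, 3}. u $ j * \<tau> j x v - v $ j * \<tau> j x u)
     = \<sigma> x (qr u) (pr v) + (1/2) * \<sigma> x (qr u) (qr v) - (\<sigma> x (qr v) (pr u) + (1/2) * \<sigma> x (qr v) (qr u))"
     unfolding sum_subtractf 1 ..
    also have "\<dots> = \<sigma> x u v - \<sigma> x (pr u) (pr v)"
     using sp[of u v] sw[of "qr v" "pr u"] sw[of "qr v" "qr u"] by linarith
    finally show "(\<Sum>j\<in>-{1, 2, 3}. u $ j * \<tau> j x v - v $ j * \<tau> j x u)
      = \<sigma> x u v - (\<sigma> x (E 1) (E 3) * A u v + \<sigma> x (E 2) (E 3) * B u v + \<sigma> x (E 1) (E 2) * C u v)"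
     unfolding pp .
   qed
  qed
 qed
qed

lemma AN_form:
 assumes s: "form2_germ \<sigma>"
  and "J2 (%x. \<sigma> x (E 1) (E 3)) p0 p1 p2 p3 p13 p33" "J2 (%x. \<sigma> x (E 2) (E 3)) q0 q1 q2 q3 q13 q33"
  "J2 (%x. \<sigma> x (E 1) (E 2)) r0 r1 r2 r3 r13 r33" "p2 = q1 + r3"
 shows "AN (%x u v. \<sigma> x u v - \<Theta> p0 q0 r0 p3 (p1 - 2 * q3) (p33 - 6 * q2 - 3 * r1) (p13 - 2 * q33 - 6 * r2) x u v)"
 by (rule alg_null_eqI[OF alg_null_add[OF AN_restrict_W[OF s] AN_components[OF assms(2-5)]]]) simp

text \<open>\<open>ext_d2 \<sigma> = 0\<close> at 0 on \<open>E 1\<close>, \<open>E 2\<close>,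
  \<open>E 3\<close> is exactly the relation among first-order coefficients that
  \<open>AN_form\<close> requires.\<close>

lemma closed_algebraic_restriction:
 assumes s: "form2_germ \<sigma>" "closed_germ \<sigma>"
 obtains a4 a5 a6 a7 where
  "AN (%x u v. \<sigma> x u v - \<Theta> (\<sigma> 0 (E 1) (E 3)) (\<sigma> 0 (E 2) (E 3)) (\<sigma> 0 (E 1) (E 2)) a4 a5 a6 a7 x u v)"
proof -
 note sm = form2_germ_smooth[OF s(1)]
 obtain p13 p33 where p: "J2 (%x. \<sigma> x (E 1) (E 3)) (\<sigma> 0 (E 1) (E 3)) (dd (%x. \<sigma> x (E 1) (E 3)) 0 (E 1))
   (dd (%x. \<sigma> x (E 1) (E 3)) 0 (E 2)) (dd (%x. \<sigma> x (E 1) (E 3)) 0 (E 3)) p13 p33"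
  by (rule J2_exists[OF sm]) (rule that)
 obtain q13 q33 where q: "J2 (%x. \<sigma> x (E 2) (E 3)) (\<sigma> 0 (E 2) (E 3)) (dd (%x. \<sigma> x (E 2) (E 3)) 0 (E 1))
   (dd (%x. \<sigma> x (E 2) (E 3)) 0 (E 2)) (dd (%x. \<sigma> x (E 2) (E 3)) 0 (E 3)) q13 q33"
  by (rule J2_exists[OF sm]) (rule that)
 obtain r13 r33 where r: "J2 (%x. \<sigma> x (E 1) (E 2)) (\<sigma> 0 (E 1) (E 2)) (dd (%x. \<sigma> x (E 1) (E 2)) 0 (E 1))
   (dd (%x. \<sigma> x (E 1) (E 2)) 0 (E 2)) (dd (%x. \<sigma> x (E 1) (E 2)) 0 (E 3)) r13 r33"
  by (rule J2_exists[OF sm]) (rule that)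
 have "ext_d2 \<sigma> 0 (E 1) (E 2) (E 3) = 0"
  using eventually_nhds_x_imp_x[OF s(2)[unfolded closed_germ_def]] by blast
 then have c: "dd (%x. \<sigma> x (E 1) (E 3)) 0 (E 2) = dd (%x. \<sigma> x (E 2) (E 3)) 0 (E 1) + dd (%x. \<sigma> x (E 1) (E 2)) 0 (E 3)"
  by (simp add: ext_d2_def)
 show ?thesis by (rule that[OF AN_form[OF s(1) p q r c]])
qed

section \<open>Normal forms\<close>

definition sym7 :: "('n R2n => 'n R2n) => bool" where
 "sym7 S \<longleftrightarrow> diffeo_germ_onto S U7 U7"

definition equivT :: "'n R2n form2 => 'n R2n form2 => bool" where
 "equivT \<sigma> \<tau> \<longleftrightarrow> (\<exists>S. sym7 S \<and> AN (%x u v. pullback S \<sigma> x u v - \<tau> x u v))"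

lemma equivT_trans:
 assumes "equivT \<sigma> \<tau>" "equivT \<tau> \<rho>" shows "equivT \<sigma> \<rho>"
proof -
 obtain S T where S: "sym7 S" "AN (%x u v. pullback S \<sigma> x u v - \<tau> x u v)"
  and T: "sym7 T" "AN (%x u v. pullback T \<tau> x u v - \<rho> x u v)" using assms unfolding equivT_def by blast
 have s: "smooth_germ S" "S 0 = 0" "smooth_germ T" "T 0 = 0"
  using S(1) T(1) unfolding sym7_def diffeo_germ_onto_iff by blast+
 have 1: "sym7 (%x. S (T x))" using S(1) T(1) diffeo_germ_compose unfolding sym7_def by blast
 have "AN (%x u v. pullback T (%x u v. pullback S \<sigma> x u v - \<tau> x u v) x u v + (pullback T \<tau> x u v - \<rho> x u v))"
  using alg_null_add[OF alg_null_pullback[OF T(1)[unfolded sym7_def] S(2)] T(2)] .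
 then have "AN (%x u v. pullback (%x. S (T x)) \<sigma> x u v - \<rho> x u v)"
  by (rule alg_null_cong[rotated])
    (use pullback_compose[OF s(3,4,1), of \<sigma>] in eventually_elim, simp, simp add: pullback_def)
 then show ?thesis using 1 unfolding equivT_def by blast
qed

lemma sym7_id: "sym7 (%x. x)"
 unfolding sym7_def diffeo_germ_onto_iff
 using smooth_germ_linear[OF linear_id] by (simp add: id_def dd_eq[OF has_derivative_ident])

lemma equivT_AN:
 assumes "AN (%x u v. \<sigma> x u v - \<tau> x u v)" shows "equivT \<sigma> \<tau>"
proof -
 have "pullback (%x. x) \<sigma> = \<sigma>" by (simp add: pullback_def[abs_def] dd_eq[OF has_derivative_ident])
 then show ?thesis unfolding equivT_def
  by (intro exI[of _ "%x. x"] conjI sym7_id) (simp add: assms)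
qed

text \<open>Rescaling the quasi-homogeneous coordinates by a function \<open>u\<close> maps \<open>U\<^sub>7\<close> into itself.\<close>

definition wt :: "'n bit0 => nat" where "wt i = (if i = 1 then 4 else if i = 2 then 5 else if i = 3 then 3 else 0)"

definition qh :: "('n R2n => real) => 'n R2n => 'n R2n" where
 "qh w x = (\<chi> i. w x ^ wt i * x $ i)"

lemma wt123: "wt 1 = 4" "wt 2 = 5" "wt 3 = 3" using dist by (simp_all add: wt_def)

text \<open>f and g are multiplied by w^8 and w^9 even for nonconstant w, because membership is
  checked at one point at a time.\<close>

lemma qh_U7: assumes "w x \<noteq> 0" shows "qh w x \<in> U7 \<longleftrightarrow> x \<in> U7"
proof -
 have 1: "(w x ^ 4 * x $ 1)\<^sup>2 + w x ^ 5 * x $ 2 * (w x ^ 3 * x $ 3) = w x ^ 8 * ((x $ 1)\<^sup>2 + x $ 2 * x $ 3)"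
  "w x ^ 4 * x $ 1 * (w x ^ 5 * x $ 2) + (w x ^ 3 * x $ 3) ^ 3 = w x ^ 9 * (x $ 1 * x $ 2 + (x $ 3)^3)"
  by (simp_all add: algebra_simps power_mult_distrib power_add[symmetric] power_mult[symmetric])
 show ?thesis unfolding U7_def mem_Collect_eq qh_def vec_lambda_beta wt123 1 using assms by simp
qed

lemma qh_has_derivative:
 assumes "(w has_derivative w') (at x)"
 shows "(qh w has_derivative (%v. \<chi> i. w x ^ wt i * v $ i + of_nat (wt i) * w x ^ (wt i - 1) * w' v * x $ i)) (at x)"
proof (subst has_derivative_componentwise_within, intro ballI)
 fix b :: "'n R2n" assume "b \<in> Basis"
 then obtain i where b: "b = E i" by (auto simp: Basis_vec_def)
 note n = has_derivative_nth
 have "((%x. w x ^ wt i * x $ i) has_derivative (%v. w x ^ wt i * v $ i + of_nat (wt i) * w' v * w x ^ (wt i - 1) * x $ i)) (at x)"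
  by (rule has_derivative_mult[OF has_derivative_power[OF assms] n])
 then show "((%x. qh w x \<bullet> b) has_derivative (%v. (\<chi> i. w x ^ wt i * v $ i + of_nat (wt i) * w x ^ (wt i - 1) * w' v * x $ i) \<bullet> b)) (at x)"
  by (simp add: b inner_axis qh_def mult_ac)
qed

lemma sym7_qh:
 assumes "smooth_germ w" "w 0 \<noteq> 0" shows "sym7 (qh w)"
 unfolding sym7_def diffeo_germ_onto_iff
proof (intro conjI)
 show "qh w 0 = 0" by (simp add: qh_def vec_eq_iff)
 show "smooth_germ (qh w)"
 proof (rule smooth_germ_componentwise)
  fix b :: "'n R2n" assume "b \<in> Basis"
  then obtain i where b: "b = E i" by (auto simp: Basis_vec_def)
  show "smooth_germ (%x. qh w x \<bullet> b)"
   unfolding b inner_axis qh_def by (simp add: smooth_germ_mult smooth_germ_power smooth_germ_nth assms)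
 qed
 have "dd (qh w) 0 = (%v. \<chi> i. w 0 ^ wt i * v $ i)"
  using dd_eq[OF qh_has_derivative[OF smooth_germ_has_derivative_0[OF assms(1)]]] by simp
 then show "inj (dd (qh w) 0)" using assms(2) by (auto intro!: injI simp: vec_eq_iff)
 have "(w \<longlongrightarrow> w 0) (nhds 0)"
  using smooth_germ_isCont[OF assms(1)] tendsto_at_iff_tendsto_nhds[of w 0] by (simp add: isCont_def)
 then have "NEAR x. w x \<noteq> 0" by (rule tendsto_imp_eventually_ne) (rule assms)
 then show "NEAR x. x \<in> U7 \<longleftrightarrow> qh w x \<in> U7"
  by eventually_elim (simp add: qh_U7)
qed

lemma form2_germ_\<Theta>: "form2_germ (\<Theta> a1 a2 a3 a4 a5 a6 a7)"
 unfolding \<Theta>_def[abs_def]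
 by (intro form2_germ_add form2_germ_mult form2_germ_dxdx smooth_germ_add smooth_germ_mult smooth_germ_power smooth_germ_const smooth_germ_nth)

end

context U7_setting begin

lemma J2_eq:
 assumes "J2 h c0 c1 c2 c3 c13 c33" "c0 = d0" "c1 = d1" "c2 = d2" "c3 = d3" "c13 = d13" "c33 = d33"
 shows "J2 h d0 d1 d2 d3 d13 d33"
 using assms by simp

text \<open>Binomial expansion truncated modulo J: the square of the linear part contributes 2 e1 e3
  to x1 x3 and e3^2 to x3^2.\<close>

lemma J2_power:
 assumes "J2 w 1 e1 e2 e3 e13 e33"
 shows "J2 (%x. w x ^ n) 1 (n * e1) (n * e2) (n * e3) (n * e13 + n * (n - 1) * e1 * e3) (n * e33 + n * (n - 1) / 2 * e3\<^sup>2)"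
proof (induction n)
 case 0
 show ?case using J2_const[of 1] by simp
next
 case (Suc n)
 have "J2 (%x. w x * w x ^ n) 1 (Suc n * e1) (Suc n * e2) (Suc n * e3) (Suc n * e13 + Suc n * (Suc n - 1) * e1 * e3)
   (Suc n * e33 + Suc n * (Suc n - 1) / 2 * e3\<^sup>2)"
  by (rule J2_eq[OF J2_mult[OF assms Suc]]) (simp_all add: field_simps power2_eq_square)
 then show ?case by (simp add: algebra_simps)
qed

lemma E_nth: "E 1 $ 1 = (1::real)" "E 2 $ 2 = (1::real)" "E 3 $ 3 = (1::real)" "E 1 $ 2 = (0::real)" "E 1 $ 3 = (0::real)"
 "E 2 $ 1 = (0::real)" "E 2 $ 3 = (0::real)" "E 3 $ 1 = (0::real)" "E 3 $ 2 = (0::real)"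
 using dist by (simp_all add: axis_def)

text \<open>The derivative of \<open>qh w\<close> is diagonal plus terms containing the derivative
  of w; K is the coefficient of A at the image point.\<close>

lemma pullback_qh_components:
 fixes a1 a2 a3 a4 a5 a6 a7 :: real
 assumes "(w has_derivative w') (at x)"
 defines "K \<equiv> a1 + a4 * (w x ^ 3 * x $ 3) + a5 * (w x ^ 4 * x $ 1) + a6 * (w x ^ 3 * x $ 3)\<^sup>2 + a7 * (w x ^ 4 * x $ 1 * (w x ^ 3 * x $ 3))"
 shows "pullback (qh w) (\<Theta> a1 a2 a3 a4 a5 a6 a7) x (E 1) (E 3) =
   K * (w x ^ 7 + w x ^ 6 * (4 * (x $ 1 * w' (E 1)) + 3 * (x $ 3 * w' (E 3)))) + 5 * a2 * (w x ^ 7 * (x $ 2 * w' (E 1)))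
   + 5 * a3 * (w x ^ 8 * (x $ 2 * w' (E 3)))"
  "pullback (qh w) (\<Theta> a1 a2 a3 a4 a5 a6 a7) x (E 2) (E 3) =
   4 * (K * (w x ^ 6 * (x $ 1 * w' (E 2)))) + a2 * (w x ^ 8 + w x ^ 7 * (5 * (x $ 2 * w' (E 2)) + 3 * (x $ 3 * w' (E 3))))
   + (- 4) * a3 * (w x ^ 8 * (x $ 1 * w' (E 3)))"
  "pullback (qh w) (\<Theta> a1 a2 a3 a4 a5 a6 a7) x (E 1) (E 2) =
   3 * (K * (w x ^ 6 * (x $ 3 * w' (E 2)))) + (- 3) * a2 * (w x ^ 7 * (x $ 3 * w' (E 1)))
   + a3 * (w x ^ 9 + w x ^ 8 * (4 * (x $ 1 * w' (E 1)) + 5 * (x $ 2 * w' (E 2))))"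
 unfolding pullback_def \<Theta>_def dd_eq[OF qh_has_derivative[OF assms(1)]] dxdx_def qh_def vec_lambda_beta wt123 E_nth K_def[symmetric]
 by (simp_all add: algebra_simps power2_eq_square power_numeral_reduce)

lemma form2_germ_pullback_qh:
 assumes "smooth_germ w" "w 0 \<noteq> 0" shows "form2_germ (pullback (qh w) (\<Theta> a1 a2 a3 a4 a5 a6 a7))"
proof -
 have s: "smooth_germ (qh w)" "qh w 0 = 0"
  using sym7_qh[OF assms] unfolding sym7_def diffeo_germ_onto_iff by blast+
 show ?thesis by (rule form2_germ_pullback[OF s form2_germ_\<Theta>])
qed

text \<open>The rescaling function is w = 1 + e1 x1 + e2 x2 + e3 x3 + e13 x1 x3 + e33 x3^2. To first
  order, multiplying a term of \<Theta> by a monomial of w contributes the weight of the resulting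
  form: 10, 11, 13, 14 for \<theta>4, ..., \<theta>7. The other constants in the terms linear in the
  e's carry the factors of \<open>AN_components\<close>: 22 = 2 * 11, 39 = 3 * 13, 78 = 6 * 13, 28 =
  2 * 14, 84 = 6 * 14. Terms quadratic in the e's come from the powers of w.\<close>

lemma equivT_shear:
 "equivT (\<Theta> a1 a2 a3 a4 a5 a6 a7) (\<Theta> a1 a2 a3 (a4 + 10 * e3 * a1) (a5 - 22 * e3 * a2 + 11 * e1 * a1)
   (a6 + 13 * e33 * a1 + 13 * e3 * a4 + 39 * e3\<^sup>2 * a1 - 78 * e2 * a2 - 39 * e1 * a3)
   (a7 - 28 * e33 * a2 + 14 * e13 * a1 + 14 * e3 * a5 - 98 * e3\<^sup>2 * a2 - 84 * e2 * a3 + 14 * e1 * a4 + 84 * e1 * e3 * a1))"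
proof -
 define w where "w x = 1 + e1 * x $ 1 + e2 * x $ 2 + e3 * x $ 3 + e13 * (x $ 1 * x $ 3) + e33 * (x $ 3)\<^sup>2" for x :: "'n R2n"
 define w' where "w' x v = e1 * v $ 1 + e2 * v $ 2 + e3 * v $ 3 + e13 * (x $ 1 * v $ 3 + x $ 3 * v $ 1) + 2 * e33 * x $ 3 * v $ 3" for x v :: "'n R2n"
 have w: "smooth_germ w" "w 0 \<noteq> 0"
  unfolding w_def[abs_def] by (intro smooth_germ_add smooth_germ_mult smooth_germ_power smooth_germ_const smooth_germ_nth) simp
 note n = has_derivative_nth
 have d: "(w has_derivative w' x) (at x)" for x
  unfolding w_def[abs_def] w'_def power2_eq_square
  by (auto intro!: derivative_eq_intros n simp: algebra_simps)
 note c = E_nth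
 have d1: "J2 (%x. w' x (E 1)) e1 0 0 e13 0 0" unfolding w'_def c
  by (rule J2_cong[OF J2_eq[OF J2_add[OF J2_const[of e1] J2_mult[OF J2_const[of e13] J2_x3]]]]) (simp_all add: always_eventually)
 have d2: "J2 (%x. w' x (E 2)) e2 0 0 0 0 0" unfolding w'_def c
  by (rule J2_cong[OF J2_const[of e2]]) (simp_all add: always_eventually)
 have d3: "J2 (%x. w' x (E 3)) e3 e13 0 (2 * e33) 0 0" unfolding w'_def c
  by (rule J2_cong[OF J2_eq[OF J2_add[OF J2_const[of e3] J2_add[OF J2_mult[OF J2_const[of e13] J2_x1] J2_mult[OF J2_const[of "2 * e33"] J2_x3]]]]])
    (simp_all add: always_eventually)
 have jw: "J2 w 1 e1 e2 e3 e13 e33"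
  unfolding J2_def using w(1) inJ_zero by (simp add: w_def)
 note jn = J2_power[OF jw]
 define K where "K x = a1 + a4 * (w x ^ 3 * x $ 3) + a5 * (w x ^ 4 * x $ 1) + a6 * (w x ^ 3 * x $ 3)\<^sup>2 + a7 * (w x ^ 4 * x $ 1 * (w x ^ 3 * x $ 3))" for x
 have z3: "J2 (%x. w x ^ 3 * x $ 3) 0 0 0 1 (3 * e1) (3 * e3)"
  by (rule J2_eq[OF J2_mult[OF jn J2_x3]]) simp_all
 have z1: "J2 (%x. w x ^ 4 * x $ 1) 0 1 0 0 (4 * e3) 0"
  by (rule J2_eq[OF J2_mult[OF jn J2_x1]]) simp_all
 have jK: "J2 K a1 a5 0 a4 (a7 + 3 * e1 * a4 + 4 * e3 * a5) (a6 + 3 * e3 * a4)"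
  unfolding K_def[abs_def] power2_eq_square
  by (rule J2_eq[OF J2_add[OF J2_add[OF J2_add[OF J2_add[OF J2_const[of a1] J2_mult[OF J2_const[of a4] z3]] J2_mult[OF J2_const[of a5] z1]]
    J2_mult[OF J2_const[of a6] J2_mult[OF z3 z3]]] J2_mult[OF J2_const[of a7] J2_mult[OF z1 z3]]]]) simp_all
 let ?P = "pullback (qh w) (\<Theta> a1 a2 a3 a4 a5 a6 a7)"
 have x1: "J2 (%x. x $ 1 * w' x (E 1)) 0 e1 0 0 e13 0"
  by (rule J2_eq[OF J2_mult[OF J2_x1 d1]]) simp_all
 have x2: "J2 (%x. x $ 3 * w' x (E 3)) 0 0 0 e3 e13 (2 * e33)"
  by (rule J2_eq[OF J2_mult[OF J2_x3 d3]]) simp_all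
 have x3: "J2 (%x. x $ 2 * w' x (E 1)) 0 0 e1 0 0 0"
  by (rule J2_eq[OF J2_mult[OF J2_x2 d1]]) simp_all
 have x4: "J2 (%x. x $ 2 * w' x (E 3)) 0 0 e3 0 0 0"
  by (rule J2_eq[OF J2_mult[OF J2_x2 d3]]) simp_all
 have x5: "J2 (%x. x $ 1 * w' x (E 2)) 0 e2 0 0 0 0"
  by (rule J2_eq[OF J2_mult[OF J2_x1 d2]]) simp_all
 have x6: "J2 (%x. x $ 2 * w' x (E 2)) 0 0 e2 0 0 0"
  by (rule J2_eq[OF J2_mult[OF J2_x2 d2]]) simp_all
 have x7: "J2 (%x. x $ 1 * w' x (E 3)) 0 e3 0 0 (2 * e33) 0"
  by (rule J2_eq[OF J2_mult[OF J2_x1 d3]]) simp_all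
 have x8: "J2 (%x. x $ 3 * w' x (E 2)) 0 0 0 e2 0 0"
  by (rule J2_eq[OF J2_mult[OF J2_x3 d2]]) simp_all
 have x9: "J2 (%x. x $ 3 * w' x (E 1)) 0 0 0 e1 0 e13"
  by (rule J2_eq[OF J2_mult[OF J2_x3 d1]]) simp_all
 note f = algebra_simps power2_eq_square
 have p: "J2 (%x. ?P x (E 1) (E 3)) a1 (a5 + 11 * e1 * a1) (5 * e3 * a3 + 7 * e2 * a1 + 5 * e1 * a2) (a4 + 10 * e3 * a1)
   (a7 + 14 * e13 * a1 + 14 * e3 * a5 + 14 * e1 * a4 + 84 * e1 * e3 * a1) (a6 + 13 * e33 * a1 + 13 * e3 * a4 + 39 * e3\<^sup>2 * a1)"
  unfolding pullback_qh_components(1)[OF d] K_def[symmetric]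
  by (rule J2_eq[OF J2_add[OF J2_add[OF J2_mult[OF jK J2_add[OF jn J2_mult[OF jn J2_add[OF J2_mult[OF J2_const[of 4] x1] J2_mult[OF J2_const[of 3] x2]]]]]
     J2_mult[OF J2_const[of "5 * a2"] J2_mult[OF jn x3]]] J2_mult[OF J2_const[of "5 * a3"] J2_mult[OF jn x4]]]]) (simp_all add: f)
 have q: "J2 (%x. ?P x (E 2) (E 3)) a2 (- 4 * e3 * a3 + 4 * e2 * a1 + 8 * e1 * a2) (13 * e2 * a2) (11 * e3 * a2)
   (- 8 * e33 * a3 + 11 * e13 * a2 - 32 * e3\<^sup>2 * a3 + 4 * e2 * a4 + 24 * e2 * e3 * a1 + 77 * e1 * e3 * a2) (14 * e33 * a2 + 49 * e3\<^sup>2 * a2)"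
  unfolding pullback_qh_components(2)[OF d] K_def[symmetric]
  by (rule J2_eq[OF J2_add[OF J2_add[OF J2_mult[OF J2_const[of 4] J2_mult[OF jK J2_mult[OF jn x5]]]
     J2_mult[OF J2_const[of a2] J2_add[OF jn J2_mult[OF jn J2_add[OF J2_mult[OF J2_const[of 5] x6] J2_mult[OF J2_const[of 3] x2]]]]]]
     J2_mult[OF J2_const[of "- 4 * a3"] J2_mult[OF jn x7]]]]) (simp_all add: f)
 have r: "J2 (%x. ?P x (E 1) (E 2)) a3 (13 * e1 * a3) (14 * e2 * a3) (9 * e3 * a3 + 3 * e2 * a1 - 3 * e1 * a2)
   (13 * e13 * a3 + 3 * e2 * a5 + 104 * e1 * e3 * a3 + 18 * e1 * e2 * a1 - 21 * e1\<^sup>2 * a2)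
   (9 * e33 * a3 - 3 * e13 * a2 + 36 * e3\<^sup>2 * a3 + 3 * e2 * a4 + 18 * e2 * e3 * a1 - 21 * e1 * e3 * a2)"
  unfolding pullback_qh_components(3)[OF d] K_def[symmetric]
  by (rule J2_eq[OF J2_add[OF J2_add[OF J2_mult[OF J2_const[of 3] J2_mult[OF jK J2_mult[OF jn x8]]]
     J2_mult[OF J2_const[of "- 3 * a2"] J2_mult[OF jn x9]]]
     J2_mult[OF J2_const[of a3] J2_add[OF jn J2_mult[OF jn J2_add[OF J2_mult[OF J2_const[of 4] x1] J2_mult[OF J2_const[of 5] x6]]]]]]])
    (simp_all add: f)
 have "equivT (\<Theta> a1 a2 a3 a4 a5 a6 a7) (\<Theta> a1 a2 a3 (a4 + 10 * e3 * a1) (a5 + 11 * e1 * a1 - 2 * (11 * e3 * a2))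
  (a6 + 13 * e33 * a1 + 13 * e3 * a4 + 39 * e3\<^sup>2 * a1 - 6 * (13 * e2 * a2) - 3 * (13 * e1 * a3))
  (a7 + 14 * e13 * a1 + 14 * e3 * a5 + 14 * e1 * a4 + 84 * e1 * e3 * a1 - 2 * (14 * e33 * a2 + 49 * e3\<^sup>2 * a2) - 6 * (14 * e2 * a3)))"
  unfolding equivT_def
  by (rule exI, rule conjI[OF sym7_qh[OF w] AN_form[OF form2_germ_pullback_qh[OF w] p q r]]) (simp add: algebra_simps)
 then show ?thesis by (simp add: algebra_simps)
qed

lemma equivT_scale:
 assumes "s \<noteq> 0"
 shows "equivT (\<Theta> a1 a2 a3 a4 a5 a6 a7) (\<Theta> (s^7 * a1) (s^8 * a2) (s^9 * a3) (s^10 * a4) (s^11 * a5) (s^13 * a6) (s^14 * a7))"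
proof -
 let ?w = "%x::'n R2n. s"
 have w: "smooth_germ ?w" "?w 0 \<noteq> 0" using assms by (simp_all add: smooth_germ_const)
 have d: "(?w has_derivative (%v. 0)) (at x)" for x by simp
 let ?P = "pullback (qh ?w) (\<Theta> a1 a2 a3 a4 a5 a6 a7)"
 have p: "J2 (%x. ?P x (E 1) (E 3)) (s^7 * a1) (s^11 * a5) 0 (s^10 * a4) (s^14 * a7) (s^13 * a6)"
  unfolding pullback_qh_components(1)[OF d] J2_def
  by (intro conjI inJ_cong[OF inJ_zero] smooth_germ_add smooth_germ_mult smooth_germ_power smooth_germ_const smooth_germ_nth)
    (simp add: algebra_simps power_mult_distrib power_add[symmetric] power_mult[symmetric] always_eventually)
 have q: "J2 (%x. ?P x (E 2) (E 3)) (s^8 * a2) 0 0 0 0 0"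
  unfolding pullback_qh_components(2)[OF d] by (simp add: mult.commute J2_const)
 have r: "J2 (%x. ?P x (E 1) (E 2)) (s^9 * a3) 0 0 0 0 0"
  unfolding pullback_qh_components(3)[OF d] by (simp add: mult.commute J2_const)
 have "equivT (\<Theta> a1 a2 a3 a4 a5 a6 a7) (\<Theta> (s^7 * a1) (s^8 * a2) (s^9 * a3) (s^10 * a4) (s^11 * a5 - 2 * 0) (s^13 * a6 - 6 * 0 - 3 * 0) (s^14 * a7 - 2 * 0 - 6 * 0))"
  unfolding equivT_def
  by (rule exI, rule conjI[OF sym7_qh[OF w] AN_form[OF form2_germ_pullback_qh[OF w] p q r]]) simp
 then show ?thesis by simp
qed

text \<open>Used for the even weights 8, 10, 14, where a sign remains; for the odd weights 7, 9, 11,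
  13 real roots of negative numbers exist and the coefficient becomes 1. This is the origin of the
  signs in the normal forms.\<close>

lemma scale_to_sign:
 assumes "a \<noteq> 0" "0 < n" obtains s where "s \<noteq> 0" "s ^ n * a \<in> {1, -1::real}"
proof
 show "root n (1 / \<bar>a\<bar>) \<noteq> 0" using assms by simp
 have "root n (1 / \<bar>a\<bar>) ^ n = 1 / \<bar>a\<bar>" by (rule real_root_pow_pos2) (use assms in auto)
 then show "root n (1 / \<bar>a\<bar>) ^ n * a \<in> {1, -1}" using assms by (simp add: abs_if)
qed

lemma scale_to_1:
 assumes "a \<noteq> 0" "odd n" obtains s where "s \<noteq> 0" "s ^ n * a = (1::real)"
proof
 show "root n (1 / a) \<noteq> 0" using assms by (simp add: odd_pos)
 show "root n (1 / a) ^ n * a = 1" using assms by (simp add: odd_real_root_pow)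
qed

lemma equivT_shear_scale:
 assumes "s \<noteq> 0" and "b4 = a4 + 10 * e3 * a1" "b5 = a5 - 22 * e3 * a2 + 11 * e1 * a1"
   "b6 = a6 + 13 * e33 * a1 + 13 * e3 * a4 + 39 * e3\<^sup>2 * a1 - 78 * e2 * a2 - 39 * e1 * a3"
   "b7 = a7 - 28 * e33 * a2 + 14 * e13 * a1 + 14 * e3 * a5 - 98 * e3\<^sup>2 * a2 - 84 * e2 * a3 + 14 * e1 * a4 + 84 * e1 * e3 * a1"
 shows "equivT (\<Theta> a1 a2 a3 a4 a5 a6 a7) (\<Theta> (s^7 * a1) (s^8 * a2) (s^9 * a3) (s^10 * b4) (s^11 * b5) (s^13 * b6) (s^14 * b7))"
 unfolding assms by (rule equivT_trans[OF equivT_shear equivT_scale[OF assms(1)]])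

text \<open>With a1 \<noteq> 0 the coefficients of weights 10, 11, 13, 14 are removed by e3, e1,
  e33, e13 in this order, each equation being linear in its own unknown. The second conclusion
  records whether a2 vanishes, for the subdivision of the class.\<close>

lemma normal_form_0:
 assumes "a1 \<noteq> 0"
 obtains c1 c2 where "equivT (\<Theta> a1 a2 a3 a4 a5 a6 a7) (nf0 c1 c2)" "c1 = 0 \<longleftrightarrow> a2 = 0"
proof -
 define e3 where "e3 = - a4 / (10 * a1)"
 define e1 where "e1 = (22 * e3 * a2 - a5) / (11 * a1)"
 define e33 where "e33 = - (a6 + 13 * e3 * a4 + 39 * e3\<^sup>2 * a1 - 39 * e1 * a3) / (13 * a1)"
 define e13 where "e13 = - (a7 - 28 * e33 * a2 + 14 * e3 * a5 - 98 * e3\<^sup>2 * a2 + 14 * e1 * a4 + 84 * e1 * e3 * a1) / (14 * a1)"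
 obtain s where s: "s \<noteq> 0" "s ^ 7 * a1 = 1" by (rule scale_to_1[OF assms, of 7]) (simp, rule that)
 have "10 * a1 * e3 = - a4" "11 * a1 * e1 = 22 * e3 * a2 - a5"
  "13 * a1 * e33 = - (a6 + 13 * e3 * a4 + 39 * e3\<^sup>2 * a1 - 39 * e1 * a3)"
  "14 * a1 * e13 = - (a7 - 28 * e33 * a2 + 14 * e3 * a5 - 98 * e3\<^sup>2 * a2 + 14 * e1 * a4 + 84 * e1 * e3 * a1)"
  using assms unfolding e3_def e1_def e33_def e13_def by (simp_all del: power_divide minus_diff_eq)
 then have "equivT (\<Theta> a1 a2 a3 a4 a5 a6 a7) (\<Theta> (s^7 * a1) (s^8 * a2) (s^9 * a3) (s^10 * 0) (s^11 * 0) (s^13 * 0) (s^14 * 0))"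
  by (intro equivT_shear_scale[OF s(1), of _ _ e3 _ _ _ _ e1 _ _ e33 0 _ _ _ e13]) (simp_all add: algebra_simps)
 moreover have "\<Theta> (s^7 * a1) (s^8 * a2) (s^9 * a3) (s^10 * 0) (s^11 * 0) (s^13 * 0) (s^14 * 0) = nf0 (s^8 * a2) (s^9 * a3)"
  by (intro ext) (simp only: s, simp add: \<Theta>_def nf0_def \<theta>1_def \<theta>2_def \<theta>3_def)
 ultimately show ?thesis using that s(1) by simp
qed

text \<open>For a1 = 0 the shear leaves a4 alone, as its change is 10 e3 a1; the coefficient a2 lets
  e3, e2, e33 remove a5, a6, a7.\<close>

lemma normal_form_1:
 assumes "a2 \<noteq> 0" shows "\<exists>\<theta>\<in>normal_forms ! 1. equivT (\<Theta> 0 a2 a3 a4 a5 a6 a7) \<theta>"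
proof -
 define e3 where "e3 = a5 / (22 * a2)"
 define e2 where "e2 = (a6 + 13 * e3 * a4) / (78 * a2)"
 define e33 where "e33 = (a7 + 14 * e3 * a5 - 98 * e3\<^sup>2 * a2 - 84 * e2 * a3) / (28 * a2)"
 obtain s where s: "s \<noteq> 0" "s ^ 8 * a2 \<in> {1, -1}" by (rule scale_to_sign[OF assms, of 8]) (simp, rule that)
 have "22 * a2 * e3 = a5" "78 * a2 * e2 = a6 + 13 * e3 * a4" "28 * a2 * e33 = a7 + 14 * e3 * a5 - 98 * e3\<^sup>2 * a2 - 84 * e2 * a3"
  using assms unfolding e3_def e2_def e33_def by simp_all
 then have "equivT (\<Theta> 0 a2 a3 a4 a5 a6 a7) (\<Theta> (s^7 * 0) (s^8 * a2) (s^9 * a3) (s^10 * a4) (s^11 * 0) (s^13 * 0) (s^14 * 0))"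
  by (intro equivT_shear_scale[OF s(1), of _ _ e3 _ _ _ _ 0 _ _ e33 e2 _ _ _ 0]) (simp_all add: algebra_simps)
 moreover have "\<Theta> (s^7 * 0) (s^8 * a2) (s^9 * a3) (s^10 * a4) (s^11 * 0) (s^13 * 0) (s^14 * 0)
  = (%x u v. s^8 * a2 * \<theta>2 x u v + s^9 * a3 * \<theta>3 x u v + s^10 * a4 * \<theta>4 x u v)"
  by (intro ext) (simp add: \<Theta>_def \<theta>2_def \<theta>3_def \<theta>4_def)
 ultimately show ?thesis using s(2) unfolding normal_forms_def by auto
qed

text \<open>For a1 = a2 = 0 the shear leaves a4 and a5 alone; e1 removes a6 through - 39 e1 a3 and
  e2 removes a7 through - 84 e2 a3.\<close>

lemma normal_form_2:
 assumes "a3 \<noteq> 0" shows "\<exists>\<theta>\<in>normal_forms ! 2. equivT (\<Theta> 0 0 a3 a4 a5 a6 a7) \<theta>"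
proof -
 define e1 where "e1 = a6 / (39 * a3)"
 define e2 where "e2 = (a7 + 14 * e1 * a4) / (84 * a3)"
 obtain s where s: "s \<noteq> 0" "s ^ 9 * a3 = 1" by (rule scale_to_1[OF assms, of 9]) (simp, rule that)
 have "39 * a3 * e1 = a6" "84 * a3 * e2 = a7 + 14 * e1 * a4"
  using assms unfolding e1_def e2_def by simp_all
 then have "equivT (\<Theta> 0 0 a3 a4 a5 a6 a7) (\<Theta> (s^7 * 0) (s^8 * 0) (s^9 * a3) (s^10 * a4) (s^11 * a5) (s^13 * 0) (s^14 * 0))"
  by (intro equivT_shear_scale[OF s(1), of _ _ 0 _ _ _ _ e1 _ _ 0 e2 _ _ _ 0]) (simp_all add: algebra_simps)
 moreover have "\<Theta> (s^7 * 0) (s^8 * 0) (s^9 * a3) (s^10 * a4) (s^11 * a5) (s^13 * 0) (s^14 * 0)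
  = (%x u v. \<theta>3 x u v + s^10 * a4 * \<theta>4 x u v + s^11 * a5 * \<theta>5 x u v)"
  by (intro ext) (simp only: s, simp add: \<Theta>_def \<theta>3_def \<theta>4_def \<theta>5_def algebra_simps)
 ultimately show ?thesis unfolding normal_forms_def by (auto simp: numeral_eq_Suc)
qed

lemma normal_form_3:
 assumes "a4 \<noteq> 0" shows "\<exists>\<theta>\<in>normal_forms ! 3. equivT (\<Theta> 0 0 0 a4 a5 a6 a7) \<theta>"
proof -
 define e3 where "e3 = - a6 / (13 * a4)"
 define e1 where "e1 = - (a7 + 14 * e3 * a5) / (14 * a4)"
 obtain s where s: "s \<noteq> 0" "s ^ 10 * a4 \<in> {1, -1}" by (rule scale_to_sign[OF assms, of 10]) (simp, rule that)
 have "13 * a4 * e3 = - a6" "14 * a4 * e1 = - (a7 + 14 * e3 * a5)"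
  using assms unfolding e3_def e1_def by simp_all
 then have "equivT (\<Theta> 0 0 0 a4 a5 a6 a7) (\<Theta> (s^7 * 0) (s^8 * 0) (s^9 * 0) (s^10 * a4) (s^11 * a5) (s^13 * 0) (s^14 * 0))"
  by (intro equivT_shear_scale[OF s(1), of _ _ e3 _ _ _ _ e1 _ _ 0 0 _ _ _ 0]) (simp_all add: algebra_simps)
 moreover have "\<Theta> (s^7 * 0) (s^8 * 0) (s^9 * 0) (s^10 * a4) (s^11 * a5) (s^13 * 0) (s^14 * 0)
  = (%x u v. s^10 * a4 * \<theta>4 x u v + s^11 * a5 * \<theta>5 x u v)"
  by (intro ext) (simp add: \<Theta>_def \<theta>4_def \<theta>5_def algebra_simps)
 ultimately show ?thesis using s(2) unfolding normal_forms_def by (auto simp: numeral_eq_Suc)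
qed

lemma normal_form_4:
 assumes "a5 \<noteq> 0" shows "\<exists>\<theta>\<in>normal_forms ! 4. equivT (\<Theta> 0 0 0 0 a5 a6 a7) \<theta>"
proof -
 define e3 where "e3 = - a7 / (14 * a5)"
 obtain s where s: "s \<noteq> 0" "s ^ 11 * a5 = 1" by (rule scale_to_1[OF assms, of 11]) (simp, rule that)
 have "14 * a5 * e3 = - a7"
  using assms unfolding e3_def by simp_all
 then have "equivT (\<Theta> 0 0 0 0 a5 a6 a7) (\<Theta> (s^7 * 0) (s^8 * 0) (s^9 * 0) (s^10 * 0) (s^11 * a5) (s^13 * a6) (s^14 * 0))"
  by (intro equivT_shear_scale[OF s(1), of _ _ e3 _ _ _ _ 0 _ _ 0 0 _ _ _ 0]) (simp_all add: algebra_simps)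
 moreover have "\<Theta> (s^7 * 0) (s^8 * 0) (s^9 * 0) (s^10 * 0) (s^11 * a5) (s^13 * a6) (s^14 * 0)
  = (%x u v. \<theta>5 x u v + s^13 * a6 * \<theta>6 x u v)"
  by (intro ext) (simp only: s, simp add: \<Theta>_def \<theta>5_def \<theta>6_def algebra_simps)
 ultimately show ?thesis unfolding normal_forms_def by (auto simp: numeral_eq_Suc)
qed

lemma normal_form_5:
 assumes "a6 \<noteq> 0" shows "\<exists>\<theta>\<in>normal_forms ! 5. equivT (\<Theta> 0 0 0 0 0 a6 a7) \<theta>"
proof -
 obtain s where s: "s \<noteq> 0" "s ^ 13 * a6 = 1" by (rule scale_to_1[OF assms, of 13]) (simp, rule that)
 have "\<Theta> (s^7 * 0) (s^8 * 0) (s^9 * 0) (s^10 * 0) (s^11 * 0) (s^13 * a6) (s^14 * a7)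
  = (%x u v. \<theta>6 x u v + s^14 * a7 * \<theta>7 x u v)"
  by (intro ext) (simp only: s, simp add: \<Theta>_def \<theta>6_def \<theta>7_def algebra_simps)
 then show ?thesis using equivT_scale[OF s(1), of 0 0 0 0 0 a6 a7] unfolding normal_forms_def by auto
qed

lemma normal_form_6:
 assumes "a7 \<noteq> 0" shows "\<exists>\<theta>\<in>normal_forms ! 6. equivT (\<Theta> 0 0 0 0 0 0 a7) \<theta>"
proof -
 obtain s where s: "s \<noteq> 0" "s ^ 14 * a7 \<in> {1, -1}" by (rule scale_to_sign[OF assms, of 14]) (simp, rule that)
 have "\<Theta> (s^7 * 0) (s^8 * 0) (s^9 * 0) (s^10 * 0) (s^11 * 0) (s^13 * 0) (s^14 * a7) = (%x u v. s^14 * a7 * \<theta>7 x u v)"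
  by (intro ext) (simp add: \<Theta>_def \<theta>7_def algebra_simps)
 then show ?thesis using equivT_scale[OF s(1), of 0 0 0 0 0 0 a7] s(2) unfolding normal_forms_def by auto
qed

text \<open>The position of the first nonzero coefficient in the order of weights, which will be the
  index of the class.\<close>

definition level :: "real => real => real => real => real => real => real => nat" where
 "level a1 a2 a3 a4 a5 a6 a7 = (if a1 \<noteq> 0 then 0 else if a2 \<noteq> 0 then 1 else if a3 \<noteq> 0 then 2 else if a4 \<noteq> 0 then 3
   else if a5 \<noteq> 0 then 4 else if a6 \<noteq> 0 then 5 else if a7 \<noteq> 0 then 6 else 7)"

lemma normal_form_exists: "\<exists>\<theta>\<in>normal_forms ! level a1 a2 a3 a4 a5 a6 a7. equivT (\<Theta> a1 a2 a3 a4 a5 a6 a7) \<theta>"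
proof -
 have 0: "\<exists>\<theta>\<in>normal_forms ! 0. equivT (\<Theta> a1 a2 a3 a4 a5 a6 a7) \<theta>" if "a1 \<noteq> 0"
  by (rule normal_form_0[OF that, of a2 a3 a4 a5 a6 a7]) (auto simp: normal_forms_def)
 have 7: "\<exists>\<theta>\<in>normal_forms ! 7. equivT (\<Theta> 0 0 0 0 0 0 0) \<theta>"
 proof -
  have "\<Theta> 0 0 0 0 0 0 0 = (%x u v. 0)" by (intro ext) (simp add: \<Theta>_def)
  then show ?thesis using equivT_scale[of 1 0 0 0 0 0 0 0] unfolding normal_forms_def by auto
 qed
 show ?thesis unfolding level_def
  using 0 normal_form_1 normal_form_2 normal_form_3 normal_form_4 normal_form_5 normal_form_6 7 by simp
qed

lemma normal_form_level:
 assumes "i \<le> 7" "\<theta> \<in> normal_forms ! i"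
 obtains a1 a2 a3 a4 a5 a6 a7 where "\<theta> = \<Theta> a1 a2 a3 a4 a5 a6 a7" "level a1 a2 a3 a4 a5 a6 a7 = i"
proof -
 note d = \<Theta>_def fun_eq_iff algebra_simps level_def nf0_def \<theta>1_def \<theta>2_def \<theta>3_def \<theta>4_def \<theta>5_def \<theta>6_def \<theta>7_def
 consider c1 c2 where "i = 0" "\<theta> = nf0 c1 c2"
  | s c1 c2 where "i = 1" "s \<in> {1, -1}" "\<theta> = (%x u v. s * \<theta>2 x u v + c1 * \<theta>3 x u v + c2 * \<theta>4 x u v)"
  | c1 c2 where "i = 2" "\<theta> = (%x u v. \<theta>3 x u v + c1 * \<theta>4 x u v + c2 * \<theta>5 x u v)"
  | s c where "i = 3" "s \<in> {1, -1}" "\<theta> = (%x u v. s * \<theta>4 x u v + c * \<theta>5 x u v)"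
  | c where "i = 4" "\<theta> = (%x u v. \<theta>5 x u v + c * \<theta>6 x u v)"
  | c where "i = 5" "\<theta> = (%x u v. \<theta>6 x u v + c * \<theta>7 x u v)"
  | s where "i = 6" "s \<in> {1, -1}" "\<theta> = (%x u v. s * \<theta>7 x u v)"
  | "i = 7" "\<theta> = (%x u v. 0)"
 proof -
  have "i \<in> {0, 1, 2, 3, 4, 5, 6, 7}" using assms(1) by auto
  then show ?thesis using assms(2) that unfolding normal_forms_def
   by (elim insertE) (simp_all del: insert_iff, blast+)
 qed
 then show ?thesis
 proof cases
  case (1 c1 c2)
  then show ?thesis by (intro that[of 1 c1 c2 0 0 0 0]) (auto simp: d)
 next
  case (2 s c1 c2)
  then show ?thesis by (intro that[of 0 s c1 c2 0 0 0]) (auto simp: d)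
 next
  case (3 c1 c2)
  then show ?thesis by (intro that[of 0 0 1 c1 c2 0 0]) (auto simp: d)
 next
  case (4 s c)
  then show ?thesis by (intro that[of 0 0 0 s c 0 0]) (auto simp: d)
 next
  case (5 c)
  then show ?thesis by (intro that[of 0 0 0 0 1 c 0]) (auto simp: d)
 next
  case (6 c)
  then show ?thesis by (intro that[of 0 0 0 0 0 1 c]) (auto simp: d)
 next
  case (7 s)
  then show ?thesis by (intro that[of 0 0 0 0 0 0 s]) (auto simp: d)
 next
  case 8
  then show ?thesis by (intro that[of 0 0 0 0 0 0 0]) (auto simp: d)
 qed
qed

end

section \<open>Symmetries of \<open>U\<^sub>7\<close>\<close>

text \<open>Orders of vanishing as growth bounds: these can be compared along reparametrizations
  that are chosen pointwise and of which nothing but a bound is known.\<close>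

definition Ot :: "nat => (real => 'b::real_normed_vector) => bool" where
 "Ot k g \<longleftrightarrow> (\<exists>C. NEAR t. norm (g t) \<le> C * \<bar>t\<bar> ^ k)"

lemma OtI: "NEAR t. norm (g t) \<le> C * \<bar>t\<bar> ^ k ==> Ot k g"
 unfolding Ot_def by blast

lemma OtE:
 assumes "Ot k g" obtains C where "C > 0" "NEAR t. norm (g t) \<le> C * \<bar>t\<bar> ^ k"
proof -
 obtain C where "NEAR t. norm (g t) \<le> C * \<bar>t\<bar> ^ k" using assms unfolding Ot_def by blast
 then have "NEAR t. norm (g t) \<le> (\<bar>C\<bar> + 1) * \<bar>t\<bar> ^ k"
 proof eventually_elim
  case (elim t)
  have "C * \<bar>t\<bar> ^ k \<le> (\<bar>C\<bar> + 1) * \<bar>t\<bar> ^ k" by (intro mult_right_mono) auto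
  with elim show ?case by linarith
 qed
 then show ?thesis using that[of "\<bar>C\<bar> + 1"] by simp
qed

lemma Ot_cong: "Ot k f ==> NEAR t. f t = g t ==> Ot k g"
proof -
 assume "Ot k f" and e: "NEAR t. f t = g t"
 then obtain C where C: "NEAR t. norm (f t) \<le> C * \<bar>t\<bar> ^ k" unfolding Ot_def by blast
 show "Ot k g" by (rule OtI[of _ C]) (use C e in eventually_elim, simp)
qed

lemma Ot_add: assumes "Ot k f" "Ot k g" shows "Ot k (%t. f t + g t)"
proof -
 obtain C where C: "NEAR t. norm (f t) \<le> C * \<bar>t\<bar> ^ k" using assms(1) unfolding Ot_def by blast
 obtain D where D: "NEAR t. norm (g t) \<le> D * \<bar>t\<bar> ^ k" using assms(2) unfolding Ot_def by blast
 show ?thesis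
 proof (rule OtI[of _ "C + D"])
  show "NEAR t. norm (f t + g t) \<le> (C + D) * \<bar>t\<bar> ^ k"
   using C D
  proof eventually_elim
   case (elim t)
   then show ?case using norm_triangle_ineq[of "f t" "g t"] by (simp add: distrib_right)
  qed
 qed
qed

lemma Ot_bound: assumes "Ot k f" "!!t. norm (g t) \<le> C * norm (f t)" "C \<ge> 0" shows "Ot k g"
proof -
 obtain D where D: "NEAR t. norm (f t) \<le> D * \<bar>t\<bar> ^ k" using assms(1) unfolding Ot_def by blast
 show ?thesis
 proof (rule OtI[of _ "C * D"])
  show "NEAR t. norm (g t) \<le> C * D * \<bar>t\<bar> ^ k"
   using D
  proof eventually_elim
   case (elim t)
   have "norm (g t) \<le> C * norm (f t)" by (rule assms(2))
   also have "\<dots> \<le> C * (D * \<bar>t\<bar> ^ k)" by (rule mult_left_mono[OF elim assms(3)])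
   finally show ?case by (simp add: mult.assoc)
  qed
 qed
qed

lemma Ot_minus: "Ot k f ==> Ot k (%t. - f t)"
 by (rule Ot_bound[of _ _ _ 1]) auto

lemma Ot_diff: "Ot k f ==> Ot k g ==> Ot k (%t. f t - g t)"
 using Ot_add[OF _ Ot_minus] by (metis (mono_tags, lifting) Ot_cong always_eventually diff_conv_add_uminus)

lemma Ot_nth: "Ot k f ==> Ot k (%t. f t $ i :: real)"
 by (rule Ot_bound[of _ _ _ 1]) (auto simp: component_le_norm_cart)

lemma Ot_mono: assumes "Ot k f" "j \<le> k" shows "Ot j f"
proof -
 obtain C where C: "C > 0" "NEAR t. norm (f t) \<le> C * \<bar>t\<bar> ^ k" using assms(1) by (rule OtE)
 have s: "\<forall>\<^sub>F t in nhds (0::real). \<bar>t\<bar> < 1" by (rule eventually_nhds_in_open[of "{-1<..<1}", THEN eventually_mono]) auto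
 show ?thesis
 proof (rule OtI[of _ C])
  show "NEAR t. norm (f t) \<le> C * \<bar>t\<bar> ^ j" using C(2) s
  proof eventually_elim
   case (elim t)
   have "C * \<bar>t\<bar> ^ k \<le> C * \<bar>t\<bar> ^ j" using elim C(1) by (intro mult_left_mono power_decreasing[OF assms(2)]) auto
   with elim show ?case by linarith
  qed
 qed
qed

lemma Ot_mult: fixes f g :: "real => real" assumes "Ot j f" "Ot k g" shows "Ot (j + k) (%t. f t * g t)"
proof -
 obtain C where C: "C > 0" "NEAR t. norm (f t) \<le> C * \<bar>t\<bar> ^ j" using assms(1) by (rule OtE)
 obtain D where D: "D > 0" "NEAR t. norm (g t) \<le> D * \<bar>t\<bar> ^ k" using assms(2) by (rule OtE)
 show ?thesis
 proof (rule OtI[of _ "C * D"])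
  show "NEAR t. norm (f t * g t) \<le> C * D * \<bar>t\<bar> ^ (j + k)" using C(2) D(2)
  proof eventually_elim
   case (elim t)
   have "norm (f t) * norm (g t) \<le> (C * \<bar>t\<bar> ^ j) * (D * \<bar>t\<bar> ^ k)"
    by (rule mult_mono[OF elim]) (use C(1) in auto)
   then show ?case by (simp add: abs_mult power_add mult_ac)
  qed
 qed
qed

lemma Ot_power: "j \<le> k ==> Ot j (%t::real. c * t ^ k :: real)"
 by (rule Ot_mono[of k], rule OtI[of _ "\<bar>c\<bar>"]) (simp_all add: abs_mult power_abs)

lemma Ot_zero: "Ot k (%t. 0)"
 unfolding Ot_def by (rule exI[of _ 0]) simp

lemma Ot_quotient_limit:
 assumes "Ot (Suc k) (%t. g t - c * t ^ k)" shows "((%t. g t / t ^ k) \<longlongrightarrow> (c::real)) (at 0)"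
proof -
 obtain C where C: "C > 0" "NEAR t. norm (g t - c * t ^ k) \<le> C * \<bar>t\<bar> ^ Suc k" using assms by (rule OtE)
 have 1: "\<forall>\<^sub>F t in at 0. t \<noteq> (0::real)" by (rule eventually_neq_at_within)
 have "\<forall>\<^sub>F t in at 0. norm (g t / t ^ k - c) \<le> C * \<bar>t\<bar>"
  using filter_leD[OF at_within_le_nhds C(2)] 1
 proof eventually_elim
  case (elim t)
  have "g t / t ^ k - c = (g t - c * t ^ k) / t ^ k" using elim(2) by (simp add: field_simps)
  then have "norm (g t / t ^ k - c) = norm (g t - c * t ^ k) / \<bar>t\<bar> ^ k" by (simp add: power_abs)
  also have "\<dots> \<le> C * \<bar>t\<bar>" using elim by (simp add: field_simps)
  finally show ?case .
 qed
 moreover have "((%t. C * \<bar>t\<bar>) \<longlongrightarrow> 0) (at 0)" by (auto intro!: tendsto_eq_intros)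
 ultimately have "((%t. g t / t ^ k - c) \<longlongrightarrow> 0) (at 0)" by (rule Lim_null_comparison)
 then show ?thesis by (simp add: LIM_zero_iff)
qed

lemma Ot_coeff_zero: assumes "Ot (Suc k) (%t. c * t ^ k)" shows "c = (0::real)"
proof -
 have "Ot (Suc k) (%t. 0 - - c * t ^ k)" using assms by simp
 from Ot_quotient_limit[OF this] have "((%t. 0) \<longlongrightarrow> - c) (at (0::real))" by simp
 then have "0 = - c" by (rule LIM_const_eq[symmetric, THEN sym])
 then show ?thesis by simp
qed

lemma smooth_germ_Lipschitz:
 fixes f :: "'a::euclidean_space => 'b::real_normed_vector"
 assumes "smooth_germ f"
 obtains C where "C > 0" "NEAR x. norm (f x - f 0) \<le> C * norm x"
proof -
 have d: "(f has_derivative dd f 0) (at 0)" by (rule smooth_germ_has_derivative_0[OF assms])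
 interpret bounded_linear "dd f 0" by (rule has_derivative_bounded_linear[OF d])
 obtain K where K: "K > 0" "!!x. norm (dd f 0 x) \<le> norm x * K" using pos_bounded by blast
 obtain e where e: "e > 0" "!!y. norm (y - 0) < e ==> norm (f y - f 0 - dd f 0 (y - 0)) \<le> 1 * norm (y - 0)"
  using d[unfolded has_derivative_at_alt, THEN conjunct2, rule_format, of 1] by auto
 have "NEAR x. norm (f x - f 0) \<le> (K + 1) * norm x"
  unfolding eventually_nhds_metric
 proof (intro exI conjI allI impI)
  fix y :: 'a assume "dist y 0 < e"
  then have "norm (f y - f 0 - dd f 0 y) \<le> norm y" using e(2)[of y] by simp
  then show "norm (f y - f 0) \<le> (K + 1) * norm y"
   using K(2)[of y] norm_triangle_sub[of "f y - f 0" "dd f 0 y"] by (simp add: algebra_simps)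
 qed (rule e)
 then show ?thesis using that[of "K + 1"] K(1) by simp
qed

text \<open>Hadamard's coefficients are Lipschitz at 0, and each comes with a further factor of size
  |x|.\<close>

lemma smooth_germ_quadratic_real:
 fixes f :: "'a::euclidean_space => real"
 assumes "smooth_germ f"
 obtains C where "C > 0" "NEAR x. \<bar>f x - f 0 - dd f 0 x\<bar> \<le> C * (norm x)\<^sup>2"
proof -
 have "\<exists>k. (\<forall>b. smooth_germ (k b)) \<and> (NEAR x. f x = f 0 + (\<Sum>b\<in>Basis. (x \<bullet> b) * k b x))"
  by (rule Hadamard[OF assms]) blast
 then obtain k where k: "!!b. smooth_germ (k b)" "NEAR x. f x = f 0 + (\<Sum>b\<in>Basis. (x \<bullet> b) * k b x)"
  by blast
 have "\<forall>b. \<exists>C>0. NEAR x. \<bar>k b x - k b 0\<bar> \<le> C * norm x"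
 proof
  fix b
  obtain D where "D > 0" "NEAR x. norm (k b x - k b 0) \<le> D * norm x"
   by (rule smooth_germ_Lipschitz[OF k(1)[of b]])
  then show "\<exists>C>0. NEAR x. \<bar>k b x - k b 0\<bar> \<le> C * norm x" unfolding real_norm_def by blast
 qed
 from choice[OF this] obtain C where C: "!!b. C b > 0" "!!b. NEAR x. \<bar>k b x - k b 0\<bar> \<le> C b * norm x" by blast
 have l: "linear (dd f 0)" by (rule has_derivative_linear[OF smooth_germ_has_derivative_0[OF assms]])
 have d: "dd f 0 x = (\<Sum>b\<in>Basis. (x \<bullet> b) * k b 0)" for x
  unfolding linear_expand_real[OF l, of x] by (intro sum.cong) (simp_all add: Hadamard_dd[OF k])
 have "NEAR x. \<forall>b\<in>(Basis::'a set). \<bar>k b x - k b 0\<bar> \<le> C b * norm x"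
  by (rule eventually_ball_finite[OF finite_Basis]) (use C(2) in blast)
 then have "NEAR x. \<bar>f x - f 0 - dd f 0 x\<bar> \<le> (\<Sum>b\<in>Basis. C b) * (norm x)\<^sup>2" using k(2)
 proof eventually_elim
  case (elim x)
  have "f x - f 0 - dd f 0 x = (\<Sum>b\<in>Basis. (x \<bullet> b) * (k b x - k b 0))"
   by (simp add: elim(2) d right_diff_distrib sum_subtractf)
  also have "\<bar>\<dots>\<bar> \<le> (\<Sum>b\<in>Basis. \<bar>(x \<bullet> b) * (k b x - k b 0)\<bar>)" by (rule sum_abs)
  also have "\<dots> \<le> (\<Sum>b\<in>Basis. C b * (norm x)\<^sup>2)"
  proof (rule sum_mono)
   fix b :: 'a assume b: "b \<in> Basis"
   have "\<bar>x \<bullet> b\<bar> * \<bar>k b x - k b 0\<bar> \<le> norm x * (C b * norm x)"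
    by (rule mult_mono) (use elim b Basis_le_norm in auto)
   then show "\<bar>(x \<bullet> b) * (k b x - k b 0)\<bar> \<le> C b * (norm x)\<^sup>2" by (simp add: abs_mult power2_eq_square mult_ac)
  qed
  finally show ?case by (simp add: sum_distrib_right)
 qed
 moreover have "(\<Sum>b\<in>(Basis::'a set). C b) > 0" by (rule sum_pos) (use C(1) in auto)
 ultimately show ?thesis using that by blast
qed

lemma Ot_smooth_1:
 fixes \<gamma> :: "real => 'a::euclidean_space" and f :: "'a => 'b::real_normed_vector"
 assumes "smooth_germ f" "isCont \<gamma> 0" "\<gamma> 0 = 0" "Ot k \<gamma>"
 shows "Ot k (%t. f (\<gamma> t) - f 0)"
proof -
 obtain C where C: "C > 0" "NEAR x. norm (f x - f 0) \<le> C * norm x" by (rule smooth_germ_Lipschitz[OF assms(1)])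
 obtain D where D: "NEAR t. norm (\<gamma> t) \<le> D * \<bar>t\<bar> ^ k" using assms(4) unfolding Ot_def by blast
 show ?thesis
 proof (rule OtI[of _ "C * D"])
  show "NEAR t. norm (f (\<gamma> t) - f 0) \<le> C * D * \<bar>t\<bar> ^ k"
   using eventually_compose_0[OF assms(2,3) C(2)] D
  proof eventually_elim
   case (elim t)
   have "C * norm (\<gamma> t) \<le> C * (D * \<bar>t\<bar> ^ k)" using elim C(1) by simp
   with elim show ?case by (simp add: mult.assoc)
  qed
 qed
qed

lemma Ot_smooth_2:
 fixes \<gamma> :: "real => 'a::euclidean_space" and f :: "'a => real"
 assumes "smooth_germ f" "isCont \<gamma> 0" "\<gamma> 0 = 0" "Ot k \<gamma>"
 shows "Ot (2 * k) (%t. f (\<gamma> t) - f 0 - dd f 0 (\<gamma> t))"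
proof -
 obtain C where C: "C > 0" "NEAR x. \<bar>f x - f 0 - dd f 0 x\<bar> \<le> C * (norm x)\<^sup>2"
  by (rule smooth_germ_quadratic_real[OF assms(1)])
 obtain D where D: "D > 0" "NEAR t. norm (\<gamma> t) \<le> D * \<bar>t\<bar> ^ k" using assms(4) by (rule OtE)
 show ?thesis
 proof (rule OtI[of _ "C * D\<^sup>2"])
  show "NEAR t. norm (f (\<gamma> t) - f 0 - dd f 0 (\<gamma> t)) \<le> C * D\<^sup>2 * \<bar>t\<bar> ^ (2 * k)"
   using eventually_compose_0[OF assms(2,3) C(2)] D(2)
  proof eventually_elim
   case (elim t)
   have "(norm (\<gamma> t))\<^sup>2 \<le> (D * \<bar>t\<bar> ^ k)\<^sup>2" by (rule power_mono[OF elim(2)]) simp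
   then have "C * (norm (\<gamma> t))\<^sup>2 \<le> C * (D * \<bar>t\<bar> ^ k)\<^sup>2" using C(1) by simp
   with elim show ?case by (simp add: power_mult_distrib power_mult[symmetric] mult.commute[of k 2] mult.assoc)
  qed
 qed
qed

section \<open>The action of symmetries on the two branches\<close>

context U7_setting begin

abbreviation b1 :: "real => 'n R2n" where "b1 \<equiv> branch1"
abbreviation b2 :: "real => 'n R2n" where "b2 \<equiv> branch2"

lemma b1_eq: "b1 t = t *\<^sub>R E 2" by (simp add: branch1_def vec_eq_iff axis_def)

lemma b2_eq: "b2 t = t^3 *\<^sub>R E 3 + t^4 *\<^sub>R E 1 - t^5 *\<^sub>R E 2"
 using dist by (auto simp: branch2_def vec_eq_iff axis_def)

lemma b2_nth: "b2 t $ 1 = t^4" "b2 t $ 2 = - (t^5)" "b2 t $ 3 = t^3" "i \<notin> {1, 2, 3} ==> b2 t $ i = 0"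
 using dist by (auto simp: branch2_def)

lemma smooth_germ_ident: "smooth_germ (%x. x)"
 by (rule smooth_germ_linear[OF linear_ident])

lemma smooth_b1: "smooth_germ b1" and smooth_b2: "smooth_germ b2"
proof -
 show "smooth_germ b1" unfolding b1_eq[abs_def] by (intro smooth_germ_scaleR smooth_germ_ident smooth_germ_const)
 show "smooth_germ b2" unfolding b2_eq[abs_def]
  by (intro smooth_germ_add smooth_germ_diff smooth_germ_scaleR smooth_germ_power smooth_germ_ident smooth_germ_const)
qed

lemma b_0 [simp]: "b1 0 = 0" "b2 0 = 0"
 by (simp_all add: b1_eq b2_eq)

lemma Ot_b1: "Ot 1 b1"
 by (rule OtI[of _ 1]) (simp add: b1_eq)

lemma Ot_scaleR: "j \<le> k ==> Ot j (%t. t ^ k *\<^sub>R v)"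
 by (rule Ot_mono[of k], rule OtI[of _ "norm v"]) (simp_all add: power_abs mult.commute)

lemma Ot_b2: "Ot 3 b2"
 unfolding b2_eq[abs_def] by (intro Ot_add Ot_diff Ot_scaleR) auto

lemma U7_branches: "U7 = range b1 \<union> range b2"
 by (rule U7_eq_branches[OF card2])

lemma b1_b2: "b1 s = b2 t ==> t = 0"
proof -
 assume "b1 s = b2 t"
 then have "b1 s $ 3 = b2 t $ 3" by (rule arg_cong)
 then show "t = 0" using dist by (simp only: b2_nth) (simp add: branch1_def)
qed

lemma sym7D:
 assumes "sym7 S"
 shows "S 0 = 0" "smooth_germ S" "inj (dd S 0)" "linear (dd S 0)" "NEAR x. x \<in> U7 \<longleftrightarrow> S x \<in> U7"
 using assms has_derivative_linear[OF smooth_germ_has_derivative_0] unfolding sym7_def diffeo_germ_onto_iff by blast+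

lemma smooth_germ_comp_nth: "smooth_germ f ==> smooth_germ (%x. f x $ i)"
 by (rule smooth_germ_bounded_linear[OF bounded_linear_vec_nth])

lemma dd_comp_nth: assumes "smooth_germ (f :: 'a::euclidean_space => real ^ 'm)" shows "dd (%x. f x $ i) 0 v = dd f 0 v $ i"
 using dd_eq[OF bounded_linear.has_derivative[OF bounded_linear_vec_nth smooth_germ_has_derivative_0[OF assms], of i]] by metis

lemma sym7_expand1:
 assumes "sym7 S" shows "Ot (Suc 1) (%t. S (b1 t) $ i - dd S 0 (E 2) $ i * t ^ 1)"
proof -
 note S = sym7D[OF assms]
 have "Ot (2 * 1) (%t. S (b1 t) $ i - S 0 $ i - dd (%x. S x $ i) 0 (b1 t))"
  by (rule Ot_smooth_2[OF smooth_germ_comp_nth[OF S(2)] smooth_germ_isCont[OF smooth_b1] _ Ot_b1]) simp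
 then show ?thesis unfolding dd_comp_nth[OF S(2)] by (simp add: S(1) b1_eq linear_cmul[OF S(4)] mult.commute numeral_2_eq_2)
qed

text \<open>b2 is of order 3, so the second-order remainder of S is O(t^6), and the coefficients of
  t^3, t^4, t^5 see only the derivative at 0.\<close>

lemma sym7_expand2:
 assumes "sym7 S"
 shows "Ot 6 (%t. S (b2 t) $ i - (dd S 0 (E 3) $ i * t ^ 3 + dd S 0 (E 1) $ i * t ^ 4 - dd S 0 (E 2) $ i * t ^ 5))"
proof -
 note S = sym7D[OF assms]
 have "Ot (2 * 3) (%t. S (b2 t) $ i - S 0 $ i - dd (%x. S x $ i) 0 (b2 t))"
  by (rule Ot_smooth_2[OF smooth_germ_comp_nth[OF S(2)] smooth_germ_isCont[OF smooth_b2] _ Ot_b2]) simp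
 then show ?thesis unfolding dd_comp_nth[OF S(2)]
  by (simp add: S(1) b2_eq linear_add[OF S(4)] linear_diff[OF S(4)] linear_cmul[OF S(4)] mult.commute)
qed

text \<open>If \<open>S\<close> mapped \<open>B\<^sub>1\<close> into \<open>B\<^sub>2\<close> along a sequence \<open>t \<rightarrow> 0\<close>, say \<open>S (b\<^sub>1 t) = b\<^sub>2 \<tau>\<close>, then \<open>\<tau>\<^sup>3\<close> would be of order \<open>t\<close>
 while \<open>\<tau>\<^sup>4\<close>, the value of a smooth function with vanishing derivative, would be of order \<open>t\<^sup>2\<close>.\<close>

lemma sym7_b1_range:
 assumes "sym7 S" shows "NEAR t. S (b1 t) \<in> range b1"
proof (rule ccontr)
 assume n: "\<not> ?thesis"
 note S = sym7D[OF assms]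
 define Q where "Q = {t. S (b1 t) \<in> U7 \<and> S (b1 t) \<notin> range b1}"
 \<comment> \<open>The filter of bad parameters tending to 0; the assumed failure of the claim makes
   it nontrivial, so limits along it are unique.\<close>
 define F where "F = at 0 within Q"
 have U: "b1 t \<in> U7" for t unfolding U7_branches by blast
 have e: "NEAR t. S (b1 t) \<in> U7"
  using eventually_compose_0[OF smooth_germ_isCont[OF smooth_b1] b_0(1) S(5)] by eventually_elim (simp add: U)
 have F: "F \<noteq> bot"
 proof
  assume "F = bot"
  then have "\<forall>\<^sub>F t in F. False" by simp
  then have "NEAR t. t \<noteq> 0 --> t \<notin> Q" unfolding F_def eventually_at_filter by simp
  with e have "NEAR t. S (b1 t) \<in> range b1"
  proof eventually_elim
   case (elim t)
   have "S (b1 0) \<in> range b1" using rangeI[of b1 0] by (simp add: S(1))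
   with elim show ?case unfolding Q_def by (cases "t = 0") auto
  qed
  with n show False ..
 qed
 have at: "\<forall>\<^sub>F t in F. P t" if "\<forall>\<^sub>F t in at 0. P t" for P
  unfolding F_def by (rule filter_leD[OF at_le that]) simp
 have lim: "(g \<longlongrightarrow> c) F" if "(g \<longlongrightarrow> c) (at 0)" for g :: "real => real" and c
  unfolding F_def by (rule tendsto_within_subset[OF that]) simp
 have FQ: "\<forall>\<^sub>F t in F. t \<in> Q \<and> t \<noteq> 0" unfolding F_def by (simp add: eventually_at_filter)
 define \<tau> where "\<tau> t = (SOME s. S (b1 t) = b2 s)" for t
 have \<tau>: "S (b1 t) = b2 (\<tau> t)" if "t \<in> Q" for t
 proof -
  have "\<exists>s. S (b1 t) = b2 s" using that unfolding Q_def U7_branches by blast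
  then show ?thesis unfolding \<tau>_def by (rule someI_ex)
 qed
 let ?v = "dd S 0 (E 2)"
 have v: "((%t. b2 (\<tau> t) $ i / t) \<longlongrightarrow> ?v $ i) F" for i
 proof (rule Lim_transform_eventually[OF lim[OF Ot_quotient_limit[OF sym7_expand1[OF assms, of i]]]])
  show "\<forall>\<^sub>F t in F. S (b1 t) $ i / t ^ 1 = b2 (\<tau> t) $ i / t" using FQ by eventually_elim (simp add: \<tau>)
 qed
 have t0: "((%t. t) \<longlongrightarrow> 0) F" unfolding F_def by (rule tendsto_ident_at)
 have "((%t. \<tau> t ^ 3 / t * t) \<longlongrightarrow> ?v $ 3 * 0) F" using tendsto_mult[OF v[of 3, unfolded b2_nth] t0] .
 then have "((%t. \<tau> t ^ 3) \<longlongrightarrow> ?v $ 3 * 0) F"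
  by (rule Lim_transform_eventually) (use FQ in eventually_elim, simp)
 then have "((%t. \<tau> t ^ 3) \<longlongrightarrow> 0) F" by simp
 \<comment> \<open>By continuity of the cube root \<tau> tends to 0. As \<tau>^3 / t converges, the
   components \<tau>^4 and \<tau>^5 are o(t), and the corresponding components of the derivative
   vanish.\<close>
 then have "((%t. root 3 (\<tau> t ^ 3)) \<longlongrightarrow> root 3 0) F" by (rule tendsto_real_root)
 then have \<tau>0: "(\<tau> \<longlongrightarrow> 0) F" by (simp add: odd_real_root_power_cancel)
 have "((%t. \<tau> t * (\<tau> t ^ 3 / t)) \<longlongrightarrow> 0 * ?v $ 3) F" by (rule tendsto_mult[OF \<tau>0 v[of 3, unfolded b2_nth]])
 then have "((%t. \<tau> t ^ 4 / t) \<longlongrightarrow> 0) F" by (simp add: power_numeral_reduce)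
 then have v1: "?v $ 1 = 0" using tendsto_unique[OF F v[of 1, unfolded b2_nth]] by blast
 have "((%t. - (\<tau> t * (\<tau> t * (\<tau> t ^ 3 / t)))) \<longlongrightarrow> - (0 * (0 * ?v $ 3))) F"
  by (intro tendsto_minus tendsto_mult \<tau>0 v[of 3, unfolded b2_nth])
 then have "((%t. - (\<tau> t ^ 5) / t) \<longlongrightarrow> 0) F" by (simp add: power_numeral_reduce)
 then have v2: "?v $ 2 = 0" using tendsto_unique[OF F v[of 2, unfolded b2_nth]] by blast
 have vi: "?v $ i = 0" if "i \<notin> {1, 2, 3}" for i
  using tendsto_unique[OF F v[of i, unfolded b2_nth(4)[OF that]] ] tendsto_const[of 0 F] by simp
 \<comment> \<open>With the first component of the derivative equal to 0, \<tau>^4 = O(t^2), so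
   (\<tau>^3 / t)^4 = (\<tau>^4)^3 / t^4 = O(t^2), and the third component vanishes too.\<close>
 obtain C where C: "C > 0" "NEAR t. norm (S (b1 t) $ 1 - ?v $ 1 * t ^ 1) \<le> C * \<bar>t\<bar> ^ Suc 1"
  using sym7_expand1[OF assms, of 1] by (rule OtE)
 have "\<forall>\<^sub>F t in F. norm ((\<tau> t ^ 3 / t) ^ 4) \<le> C ^ 3 * t\<^sup>2"
  using FQ at[OF filter_leD[OF at_within_le_nhds C(2)]]
 proof eventually_elim
  case (elim t)
  then have "\<tau> t ^ 4 \<le> C * t\<^sup>2" by (simp add: \<tau> b2_nth v1 power2_eq_square)
  then have "(\<tau> t ^ 4) ^ 3 \<le> (C * t\<^sup>2) ^ 3" by (rule power_mono) simp
  also have "(C * t\<^sup>2) ^ 3 = C ^ 3 * t\<^sup>2 * t ^ 4" by (simp add: power_mult_distrib power_mult[symmetric] power_add[symmetric])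
  finally have "(\<tau> t ^ 4) ^ 3 / t ^ 4 \<le> C ^ 3 * t\<^sup>2" using elim by (simp add: field_simps)
  then show ?case by (simp add: power_divide power_mult[symmetric])
 qed
 moreover have "((%t. C ^ 3 * t\<^sup>2) \<longlongrightarrow> 0) F" by (rule tendsto_eq_intros t0 refl | simp)+
 ultimately have "((%t. (\<tau> t ^ 3 / t) ^ 4) \<longlongrightarrow> 0) F" by (rule Lim_null_comparison)
 moreover have "((%t. (\<tau> t ^ 3 / t) ^ 4) \<longlongrightarrow> ?v $ 3 ^ 4) F" by (rule tendsto_power[OF v[of 3, unfolded b2_nth]])
 ultimately have "?v $ 3 ^ 4 = 0" using tendsto_unique[OF F] by blast
 then have "?v $ 3 = 0" by simp
 with v1 v2 vi have "?v = 0" unfolding vec_eq_iff by (metis insertCI insertE singletonD zero_index)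
 then have "E 2 = 0" using injD[OF S(3), of "E 2" 0] linear_0[OF S(4)] by simp
 then show False by (simp add: axis_eq_0_iff)
qed

text \<open>The inverse T of S preserves B1 near 0. If S (b2 t) lay on B1, then b2 t = T (S (b2 t))
  would lie on B1 as well, which happens only for t = 0.\<close>

lemma sym7_b2_range:
 assumes "sym7 S" shows "NEAR t. S (b2 t) \<in> range b2"
proof -
 note S = sym7D[OF assms]
 obtain T where T: "diffeo_germ_onto T U7 U7" "NEAR x. T (S x) = x"
  using diffeo_germ_inverse[OF assms[unfolded sym7_def]] by metis
 \<comment> \<open>On B1 the second coordinate is the parameter, so \<gamma> t is the parameter of S
   (b2 t) whenever that point lies on B1; its continuity at 0 makes the statement about T
   applicable.\<close>
 define \<gamma> where "\<gamma> t = S (b2 t) $ 2" for t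
 have "smooth_germ (%t. S (b2 t))" by (rule smooth_germ_compose[OF smooth_b2 b_0(2) S(2)])
 then have \<gamma>: "isCont \<gamma> 0" "\<gamma> 0 = 0"
  using smooth_germ_isCont[OF smooth_germ_comp_nth] unfolding \<gamma>_def by (blast, simp add: S(1))
 note c2 = eventually_compose_0[OF smooth_germ_isCont[OF smooth_b2] b_0(2)]
 show ?thesis
  using c2[OF S(5)] c2[OF T(2)] eventually_compose_0[OF \<gamma> sym7_b1_range[OF T(1)[folded sym7_def]]]
 proof eventually_elim
  case (elim t)
  have "b2 t \<in> U7" unfolding U7_branches by blast
  then have "S (b2 t) \<in> U7" using elim by blast
  then consider "S (b2 t) \<in> range b2" | s where "S (b2 t) = b1 s" unfolding U7_branches by blast
  then show ?case
  proof cases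
   case (2 s)
   then have "\<gamma> t = s" by (simp add: \<gamma>_def branch1_def)
   then obtain r where "b1 r = b2 t" using elim 2 by auto
   then have "t = 0" by (rule b1_b2)
   then show ?thesis using rangeI[of b2 0] by (simp add: S(1))
  qed
 qed
qed

text \<open>As S (b2 t) = b2 s with s = O(t), the first three components of S (b2 t) vanish to
  orders 4, 5, 3 and all others vanish identically. Comparison with the coefficients of t^3, t^4,
  t^5 makes the derivative triangular on W: it preserves the lines of \<open>E 2\<close> and
  \<open>E 3\<close> and the plane of \<open>E 1\<close> and \<open>E 3\<close>.\<close>

lemma sym7_derivative:
 assumes "sym7 S"
 obtains a b c d where "a \<noteq> 0" "c \<noteq> 0" "d \<noteq> 0" "dd S 0 (E 1) = a *\<^sub>R E 1 + b *\<^sub>R E 3"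
  "dd S 0 (E 2) = d *\<^sub>R E 2" "dd S 0 (E 3) = c *\<^sub>R E 3"
  and "\<exists>K. NEAR t. \<exists>s. S (b1 t) = b1 s \<and> \<bar>s\<bar> \<le> K * \<bar>t\<bar>"
   "\<exists>K. NEAR t. \<exists>s. S (b2 t) = b2 s \<and> \<bar>s\<bar> \<le> K * \<bar>t\<bar>"
proof -
 note S = sym7D[OF assms]
 let ?D = "dd S 0"
 have Oz: "NEAR t. S (b1 t) $ i = 0" if "i \<noteq> 2" for i
  using sym7_b1_range[OF assms] by eventually_elim (use that in \<open>auto simp: branch1_def\<close>)
 have D2: "?D (E 2) $ i = 0" if "i \<noteq> 2" for i
 proof (rule Ot_coeff_zero)
  have "Ot (Suc 1) (%t. S (b1 t) $ i)" by (rule Ot_cong[OF Ot_zero]) (use Oz[OF that] in eventually_elim, simp)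
  from Ot_diff[OF this sym7_expand1[OF assms, of i]] show "Ot (Suc 1) (%t. ?D (E 2) $ i * t ^ 1)" by simp
 qed
 have "Ot 3 (%t. S (b2 t) - S 0)"
  by (rule Ot_smooth_1[OF S(2) smooth_germ_isCont[OF smooth_b2] b_0(2) Ot_b2])
 then obtain C where C: "C > 0" "NEAR t. norm (S (b2 t)) \<le> C * \<bar>t\<bar> ^ 3"
  unfolding S(1) diff_zero by (rule OtE)
 have K2: "NEAR t. \<exists>s. S (b2 t) = b2 s \<and> \<bar>s\<bar> \<le> root 3 C * \<bar>t\<bar>"
  using sym7_b2_range[OF assms] C(2)
 proof eventually_elim
  case (elim t)
  then obtain s where s: "S (b2 t) = b2 s" by blast
  have "\<bar>s\<bar> ^ 3 \<le> C * \<bar>t\<bar> ^ 3"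
   using component_le_norm_cart[of "b2 s" 3] elim(2) by (simp add: s b2_nth power_abs)
  also have "\<dots> = (root 3 C * \<bar>t\<bar>) ^ 3" by (simp add: power_mult_distrib odd_real_root_pow)
  finally have "\<bar>s\<bar> \<le> root 3 C * \<bar>t\<bar>" by (rule power_le_imp_le_base[of _ 2, simplified]) (use C(1) in auto)
  then show ?case using s by blast
 qed
 \<comment> \<open>The first component of b2 s is s^4; apart from the third, every other one is -
   s^5 or 0.\<close>
 have O2: "Ot k (%t. S (b2 t) $ i)" if "i \<noteq> 3" "k \<le> (if i = 1 then 4 else 5)" for i k
 proof (rule Ot_mono[OF OtI that(2)])
  show "NEAR t. norm (S (b2 t) $ i) \<le> root 3 C ^ (if i = 1 then 4 else 5) * \<bar>t\<bar> ^ (if i = 1 then 4 else 5)"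
   using K2
  proof eventually_elim
   case (elim t)
   then obtain s where s: "S (b2 t) = b2 s" "\<bar>s\<bar> \<le> root 3 C * \<bar>t\<bar>" by blast
   have p: "\<bar>s\<bar> ^ m \<le> root 3 C ^ m * \<bar>t\<bar> ^ m" for m
    using power_mono[OF s(2), of m] by (simp add: power_mult_distrib)
   have "0 \<le> root 3 C ^ 5 * \<bar>t\<bar> ^ 5" using C(1) by simp
   then show ?case using p[of 4] p[of 5] that(1) dist unfolding s(1) by (auto simp: branch2_def power_abs)
  qed
 qed
 have D31: "?D (E 3) $ i = 0" if "i \<noteq> 3" for i
 proof (rule Ot_coeff_zero)
  have "Ot 4 (%t. S (b2 t) $ i)" by (rule O2[OF that]) auto
  from Ot_diff[OF Ot_diff[OF this Ot_mono[OF sym7_expand2[OF assms, of i], of 4]] Ot_diff[OF Ot_power[of 4 4 "?D (E 1) $ i"] Ot_power[of 4 5 "?D (E 2) $ i"]]]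
  show "Ot (Suc 3) (%t. ?D (E 3) $ i * t ^ 3)" by (simp add: eval_nat_numeral(3)[symmetric])
 qed
 have D1: "?D (E 1) $ i = 0" if "i \<noteq> 3" "i \<noteq> 1" for i
 proof (rule Ot_coeff_zero)
  have "Ot 5 (%t. S (b2 t) $ i)" by (rule O2[OF that(1)]) (use that in auto)
  from Ot_add[OF Ot_diff[OF this Ot_mono[OF sym7_expand2[OF assms, of i], of 5]] Ot_power[of 5 5 "?D (E 2) $ i"]]
  show "Ot (Suc 4) (%t. ?D (E 1) $ i * t ^ 4)" by (simp add: D31[OF that(1)])
 qed
 have e2: "?D (E 2) = ?D (E 2) $ 2 *\<^sub>R E 2" unfolding vec_eq_iff using D2 by (auto simp: axis_def)
 have e3: "?D (E 3) = ?D (E 3) $ 3 *\<^sub>R E 3" unfolding vec_eq_iff using D31 by (auto simp: axis_def)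
 have e1: "?D (E 1) = ?D (E 1) $ 1 *\<^sub>R E 1 + ?D (E 1) $ 3 *\<^sub>R E 3" unfolding vec_eq_iff using D1 dist by (auto simp: axis_def)
 have nz: "?D v \<noteq> 0" if "v \<noteq> 0" for v using injD[OF S(3), of v 0] linear_0[OF S(4)] that by auto
 have E0: "E i \<noteq> 0" for i by (simp add: axis_eq_0_iff)
 have n3: "?D (E 3) $ 3 \<noteq> 0" using nz[OF E0, of 3] e3 by auto
 have n2: "?D (E 2) $ 2 \<noteq> 0" using nz[OF E0, of 2] e2 by auto
 have n1: "?D (E 1) $ 1 \<noteq> 0"
 proof
  assume z: "?D (E 1) $ 1 = 0"
  define p q where "p = ?D (E 1) $ 3" and "q = ?D (E 3) $ 3"
  have "?D (q *\<^sub>R E 1 - p *\<^sub>R E 3) = q *\<^sub>R ?D (E 1) - p *\<^sub>R ?D (E 3)"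
   by (simp add: linear_diff[OF S(4)] linear_cmul[OF S(4)])
  also have "?D (E 1) = p *\<^sub>R E 3" using e1 unfolding z p_def[symmetric] by simp
  also have "?D (E 3) = q *\<^sub>R E 3" using e3 unfolding q_def .
  finally have "q *\<^sub>R E 1 - p *\<^sub>R E 3 = 0" using nz[of "q *\<^sub>R E 1 - p *\<^sub>R E 3"] by (auto simp: mult.commute)
  then have "(q *\<^sub>R E 1 - p *\<^sub>R E 3) $ 1 = 0" by simp
  then show False using n3 dist by (simp add: axis_def q_def)
 qed
 obtain C1 where C1: "C1 > 0" "NEAR x. norm (S x - S 0) \<le> C1 * norm x" by (rule smooth_germ_Lipschitz[OF S(2)])
 have K1: "NEAR t. \<exists>s. S (b1 t) = b1 s \<and> \<bar>s\<bar> \<le> C1 * \<bar>t\<bar>"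
  using sym7_b1_range[OF assms] eventually_compose_0[OF smooth_germ_isCont[OF smooth_b1] b_0(1) C1(2)]
  by eventually_elim (auto simp: S(1) b1_eq)
 show ?thesis by (rule that[OF n1 n3 n2 e1 e2 e3]) (use K1 K2 in blast)+
qed

end

section \<open>The relative Poincare lemma and the Darboux--Givental theorem\<close>

context U7_setting begin

text \<open>The contraction uses positive powers of s in all coordinates, with weight 1 outside the
  first three, so that it ends at the point 0. It moves points of U7 inside U7, where \<alpha> = 0,
  so the resulting primitive vanishes on U7.\<close>

lemma relative_poincare:
 fixes \<alpha> :: "'n R2n form2"
 assumes \<alpha>: "form2_germ \<alpha>" "closed_germ \<alpha>" and v: "NEAR x. x \<in> U7 --> (\<forall>u v. \<alpha> x u v = 0)"
 obtains \<beta> where "form1_germ \<beta>" "NEAR x. x \<in> U7 --> (\<forall>u. \<beta> x u = 0)"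
  "NEAR x. \<forall>u v. \<alpha> x u v = ext_d1 \<beta> x u v"
proof -
 define m where "m i = (if i = 1 then 4 else if i = 2 then 5 else if i = 3 then 3 else (1::nat))" for i :: "'n bit0"
 have m123: "m 1 = 4" "m 2 = 5" "m 3 = 3" using dist by (simp_all add: m_def)
 have m0: "0 < m i" for i by (simp add: m_def)
 define \<Lambda> where "\<Lambda> s x = (\<chi> i. s ^ m i * x $ i)" for s and x :: "'n R2n"
 define \<Lambda>' where "\<Lambda>' s x = (\<chi> i. of_nat (m i) * s ^ (m i - 1) * x $ i)" for s and x :: "'n R2n"
 define \<beta> where "\<beta> x v = integral {0..1} (%s. \<alpha> (\<Lambda> s x) (\<Lambda>' s x) (\<Lambda> s v))" for x v
 have lin: "linear (\<Lambda> s)" "linear (\<Lambda>' s)" for s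
  unfolding \<Lambda>_def \<Lambda>'_def by (auto intro!: linearI simp: vec_eq_iff algebra_simps)
 have sm: "smooth_on UNIV (%s. \<Lambda> s x)" "smooth_on UNIV (%s. \<Lambda>' s x)" for x
  unfolding \<Lambda>_def \<Lambda>'_def
  by (rule smooth_on_componentwise, simp, clarsimp simp: Basis_vec_def inner_axis,
    intro smooth_on_mult smooth_on_power smooth_on_const smooth_on_ident open_UNIV)+
 have der: "((%s. \<Lambda> s x) has_vector_derivative \<Lambda>' s x) (at s)" for s x
  unfolding has_vector_derivative_def
 proof (subst has_derivative_componentwise_within, intro ballI)
  fix b :: "'n R2n" assume "b \<in> Basis"
  then obtain i where b: "b = E i" by (auto simp: Basis_vec_def)
  have "((%s. s ^ m i * x $ i) has_derivative (%h. h * (of_nat (m i) * s ^ (m i - 1) * x $ i))) (at s)"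
   by (auto intro!: derivative_eq_intros simp: mult_ac)
  then show "((%s. \<Lambda> s x \<bullet> b) has_derivative (%h. (h *\<^sub>R \<Lambda>' s x) \<bullet> b)) (at s)"
   by (simp add: b inner_axis \<Lambda>_def \<Lambda>'_def)
 qed
 have b: "form1_germ \<beta>" unfolding \<beta>_def[abs_def] by (rule linear_homotopy(1)[OF lin sm der \<alpha>])
 have d: "NEAR x. \<forall>u v. ext_d1 \<beta> x u v = \<alpha> (\<Lambda> 1 x) (\<Lambda> 1 u) (\<Lambda> 1 v) - \<alpha> (\<Lambda> 0 x) (\<Lambda> 0 u) (\<Lambda> 0 v)"
  unfolding \<beta>_def[abs_def] by (rule linear_homotopy(2)[OF lin sm der \<alpha>])
 have L1: "\<Lambda> 1 x = x" and L0: "\<Lambda> 0 x = 0" for x by (simp_all add: \<Lambda>_def vec_eq_iff m0)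
 have bil: "bilinear (\<alpha> 0)" using eventually_nhds_x_imp_x[OF form2_germ_bilinear[OF \<alpha>(1)]] by blast
 have 1: "NEAR x. \<forall>u v. \<alpha> x u v = ext_d1 \<beta> x u v"
  using d by eventually_elim (simp add: L1 L0 bilinear_lzero[OF bil])
 obtain C where C: "C > 0" "!!s x. \<bar>s\<bar> \<le> 2 ==> norm (\<Lambda> s x) \<le> C * norm x"
 proof (rule linear_family_bound[of \<Lambda>])
  show "continuous_on {-2..2} (%s. \<Lambda> s x)" for x by (rule continuous_on_subset[OF smooth_on_imp_continuous[OF sm(1)]]) simp
 qed (use lin that in auto)
 obtain e where e: "e > 0" "!!x. dist x 0 < e ==> x \<in> U7 ==> \<alpha> x u v = 0" for u v
  using v unfolding eventually_nhds_metric by metis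
 have "\<beta> x u = 0" if x: "dist x 0 < e / C" "x \<in> U7" for x u
 proof -
  have z: "\<alpha> (\<Lambda> s x) (\<Lambda>' s x) (\<Lambda> s u) = 0" if s: "s \<in> {0..1}" for s
  proof (rule e(2))
   have "norm (\<Lambda> s x) \<le> C * norm x" by (rule C(2)) (use s in auto)
   also have "\<dots> < e" using x C(1) by (simp add: field_simps)
   finally show "dist (\<Lambda> s x) 0 < e" by simp
   have h: "(s ^ 4 * x $ 1)\<^sup>2 + s ^ 5 * x $ 2 * (s ^ 3 * x $ 3) = s ^ 8 * ((x $ 1)\<^sup>2 + x $ 2 * x $ 3)"
    "s ^ 4 * x $ 1 * (s ^ 5 * x $ 2) + (s ^ 3 * x $ 3) ^ 3 = s ^ 9 * (x $ 1 * x $ 2 + (x $ 3)^3)"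
    by (simp_all add: algebra_simps power_mult_distrib power_add[symmetric] power_mult[symmetric])
   show "\<Lambda> s x \<in> U7" unfolding U7_def mem_Collect_eq \<Lambda>_def vec_lambda_beta m123 h
    using x(2) unfolding U7_def by simp
  qed
  show ?thesis unfolding \<beta>_def using integral_cong[of "{0..1}" _ "%_. 0", OF z] by simp
 qed
 then have "NEAR x. x \<in> U7 --> (\<forall>u. \<beta> x u = 0)"
  unfolding eventually_nhds_metric using divide_pos_pos[OF e(1) C(1)] by blast
 then show ?thesis by (rule that[OF b _ 1])
qed

text \<open>A closed null difference has a primitive vanishing on U7: its part \<alpha> is closed
  and the weighted homotopy gives it such a primitive. The Moser flow fixes the zeros of the total
  primitive, in particular the points of U7.\<close>

lemma darboux_givental:
 fixes \<sigma> \<rho> :: "'n R2n form2"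
 assumes \<sigma>: "form2_germ \<sigma>" "closed_germ \<sigma>" and \<rho>: "form2_germ \<rho>" "closed_germ \<rho>"
  and nd: "!!u. u \<noteq> 0 ==> \<exists>v. \<rho> 0 u v \<noteq> 0" and eq: "!!u v. \<sigma> 0 u v = \<rho> 0 u v"
  and AN: "AN (%x u v. \<sigma> x u v - \<rho> x u v)"
 obtains \<Psi> where "smooth_germ \<Psi>" "\<Psi> 0 = 0" "inj (dd \<Psi> 0)" "NEAR x. x \<in> U7 --> \<Psi> x = x"
  "NEAR x. \<forall>u v. pullback \<Psi> \<sigma> x u v = \<rho> x u v"
proof -
 let ?\<delta> = "%x u v. \<sigma> x u v - \<rho> x u v"
 obtain \<alpha> \<beta>0 where a: "form2_germ \<alpha>" "form1_germ \<beta>0" "NEAR x. x \<in> U7 --> (\<forall>u v. \<alpha> x u v = 0)"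
  "NEAR x. x \<in> U7 --> (\<forall>u. \<beta>0 x u = 0)"
  "NEAR x. \<forall>u v. ?\<delta> x u v = \<alpha> x u v + ext_d1 \<beta>0 x u v"
  by (rule alg_nullE[OF AN]) (rule that)
 have d: "form2_germ ?\<delta>" "closed_germ ?\<delta>"
  by (rule form2_germ_diff[OF \<sigma>(1) \<rho>(1)], rule closed_germ_diff[OF \<sigma>(1) \<rho>(1) \<sigma>(2) \<rho>(2)])
 have "closed_germ (%x u v. ?\<delta> x u v - ext_d1 \<beta>0 x u v)"
  by (rule closed_germ_diff[OF d(1) form2_germ_ext_d1[OF a(2)] d(2) closed_germ_ext_d1[OF a(2)]])
 then have ca: "closed_germ \<alpha>"
  by (rule closed_germ_cong[rotated]) (use a(5) in eventually_elim, simp)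
 obtain \<beta>1 where b: "form1_germ \<beta>1" "NEAR x. x \<in> U7 --> (\<forall>u. \<beta>1 x u = 0)"
  "NEAR x. \<forall>u v. \<alpha> x u v = ext_d1 \<beta>1 x u v"
  by (rule relative_poincare[OF a(1) ca a(3)]) (rule that)
 let ?\<beta> = "%x v. \<beta>0 x v + \<beta>1 x v"
 have fb: "form1_germ ?\<beta>" by (rule form1_germ_add[OF a(2) b(1)])
 have eb: "NEAR x. \<forall>u v. ?\<delta> x u v = ext_d1 ?\<beta> x u v"
  using a(5) b(3) ext_d1_add[OF a(2) b(1)] by eventually_elim simp
 have zb: "NEAR x. x \<in> U7 --> (\<forall>u. ?\<beta> x u = 0)"
  using a(4) b(2) by eventually_elim simp
 have "0 \<in> (U7 :: ('n R2n) set)" by (simp add: U7_def)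
 then have z0: "?\<beta> 0 u = 0" for u using eventually_nhds_x_imp_x[OF zb] by blast
 have d0: "?\<delta> 0 u v = 0" for u v by (simp add: eq)
 obtain \<Psi> where P: "smooth_germ \<Psi>" "\<Psi> 0 = 0" "inj (dd \<Psi> 0)" "NEAR x. (\<forall>u. ?\<beta> x u = 0) --> \<Psi> x = x"
  "NEAR x. \<forall>u v. pullback \<Psi> (%x u v. \<rho> x u v + ?\<delta> x u v) x u v = \<rho> x u v"
  by (rule moser[OF \<rho> d d0 nd fb eb z0]) (assumption, rule that)
 have "NEAR x. x \<in> U7 --> \<Psi> x = x" using P(4) zb by eventually_elim blast
 then show ?thesis by (rule that[OF P(1-3)]) (use P(5) in simp)
qed

end

section \<open>Lagrangian subspaces and Lagrangian germs\<close>

lemma nondegenerate_representation: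
 fixes h :: "'a::euclidean_space => 'a => real"
 assumes b: "bilinear h" and nd: "!!u. u \<noteq> 0 ==> \<exists>v. h u v \<noteq> 0"
 obtains J where "linear J" "bij J" "!!u v. J u \<bullet> v = h u v"
proof
 define J where "J u = (\<Sum>b\<in>Basis. h u b *\<^sub>R b)" for u
 show lin: "linear J" unfolding J_def
  by (rule linearI) (simp_all add: bilinear_ladd[OF b] bilinear_lmul[OF b] scaleR_add_left sum.distrib scaleR_sum_right)
 show J: "J u \<bullet> v = h u v" for u v
 proof -
  have "linear (h u)" using b by (simp add: bilinear_def)
  from linear_expand_real[OF this, of v] show ?thesis
   unfolding J_def inner_sum_left by (simp add: mult.commute inner_commute)
 qed
 have "inj J" unfolding linear_injective_0[OF lin] using nd J by (metis inner_zero_left)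
 then show "bij J" using linear_injective_imp_surjective[OF lin] by (simp add: bij_def)
qed

text \<open>An isotropic set of maximal dimension containing S spans K. Maximality makes K its own
  h-orthogonal, which is the Euclidean orthogonal of J K for the isomorphism J; comparing dimensions
  gives half of the total.\<close>

lemma lagrangian_subspace_exists:
 fixes h :: "'a::euclidean_space => 'a => real"
 assumes b: "bilinear h" and alt: "!!u. h u u = 0" and nd: "!!u. u \<noteq> 0 ==> \<exists>v. h u v \<noteq> 0"
  and S: "!!u v. u \<in> S ==> v \<in> S ==> h u v = 0"
 obtains K where "subspace K" "S \<subseteq> K" "!!u v. u \<in> K ==> v \<in> K ==> h u v = 0"
  "\<forall>v. (\<forall>u\<in>K. h u v = 0) --> v \<in> K" "2 * dim K = DIM('a)"
proof -
 define P where "P K \<longleftrightarrow> S \<subseteq> K \<and> (\<forall>u\<in>K. \<forall>v\<in>K. h u v = 0)" for K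
 have "\<exists>K. P K \<and> (\<forall>L. P L --> dim L \<le> dim K)"
  by (rule ex_has_greatest_nat[of P S dim "Suc (DIM('a))"])
    (use S in \<open>auto simp: P_def less_Suc_eq_le dim_subset_UNIV\<close>)
 then obtain K0 where K0: "P K0" "!!L. P L ==> dim L \<le> dim K0" by blast
 define K where "K = span K0"
 have l: "linear (%u. h u v)" "linear (h u)" for u v using b by (simp_all add: bilinear_def)
 have z0: "h u v = 0" if "u \<in> K" "v \<in> K0" for u v
  by (rule linear_eq_0_on_span[OF l(1) _ that(1)[unfolded K_def]]) (use K0(1) that in \<open>auto simp: P_def\<close>)
 have z: "h u v = 0" if "u \<in> K" "v \<in> K" for u v
  by (rule linear_eq_0_on_span[OF l(2) _ that(2)[unfolded K_def]]) (use z0 that in auto)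
 have sw: "h u v = - h v u" for u v by (rule bilinear_alternating_swap[OF b alt])
 have sub: "subspace K" unfolding K_def by (rule subspace_span)
 have SK: "S \<subseteq> K" using K0(1) span_superset[of K0] by (auto simp: P_def K_def)
 have max: "v \<in> K" if v: "!!u. u \<in> K ==> h u v = 0" for v
 proof (rule ccontr)
  assume n: "v \<notin> K"
  have "h v u = 0" if "u \<in> K" for u using v[OF that] sw[of v u] by simp
  then have "P (insert v K)" using SK z v alt by (auto simp: P_def)
  then have 1: "dim (insert v K) \<le> dim K0" by (rule K0(2))
  have sK: "span K = K" by (rule span_eq_iff[THEN iffD2, OF sub])
  then have "dim (insert v K) = Suc (dim K)" using n by (simp only: dim_insert sK if_False)
  with 1 show False by (simp add: K_def dim_span)
 qed
 obtain J where J: "linear J" "bij J" "!!u v. J u \<bullet> v = h u v" by (rule nondegenerate_representation[OF b nd]) (assumption, rule that)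
 have "K = {y \<in> UNIV. \<forall>x\<in>J ` K. orthogonal x y}" using z max by (auto simp: orthogonal_def J)
 then have "dim K + dim (J ` K) = dim (UNIV :: 'a set)"
  using dim_subspace_orthogonal_to_vectors[of "J ` K" UNIV] linear_subspace_image[OF J(1) sub] subspace_UNIV by auto
 moreover have "dim (J ` K) = dim K"
  by (rule dim_image_eq[OF J(1)]) (use J(2) in \<open>auto simp: bij_def inj_on_def\<close>)
 ultimately have "2 * dim K = DIM('a)" by (simp add: dim_UNIV)
 then show ?thesis using that[OF sub SK z] max by blast
qed

text \<open>The coordinates of y are v \<mapsto> h(f_i, v) for a basis f_i of a Lagrangian subspace
  containing S. Their common kernel is that subspace, and nondegeneracy makes them
  independent.\<close>

lemma lagrangian_projection_exists:
 fixes h :: "'a::euclidean_space => 'a => real"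
 assumes b: "bilinear h" and alt: "!!u. h u u = 0" and nd: "!!u. u \<noteq> 0 ==> \<exists>v. h u v \<noteq> 0"
  and S: "!!u v. u \<in> S ==> v \<in> S ==> h u v = 0" and n: "DIM('a) = 2 * CARD('n::finite)"
 obtains y :: "'a => real ^ 'n" where "linear y" "surj y" "!!u. u \<in> S ==> y u = 0"
  "!!u v. y u = 0 ==> y v = 0 ==> h u v = 0"
proof -
 obtain K where K: "subspace K" "S \<subseteq> K" "!!u v. u \<in> K ==> v \<in> K ==> h u v = 0"
  "\<forall>v. (\<forall>u\<in>K. h u v = 0) --> v \<in> K" "2 * dim K = DIM('a)"
  by (rule lagrangian_subspace_exists[OF b alt nd S]) (assumption | rule that)+
 obtain B where B: "B \<subseteq> K" "independent B" "K \<subseteq> span B" "card B = dim K" by (rule basis_exists)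
 have fB: "finite B" by (rule independent_imp_finite[OF B(2)])
 have "card B = CARD('n)" using B(4) K(5) n by simp
 then obtain f where f: "bij_betw f (UNIV :: 'n set) B" using finite_same_card_bij[OF finite fB] by metis
 define y where "y v = (\<chi> i. h (f i) v)" for v
 have l: "linear (%u. h u v)" "linear (h u)" for u v using b by (simp_all add: bilinear_def)
 have lin: "linear y" unfolding y_def
  by (rule linearI) (simp_all add: vec_eq_iff bilinear_radd[OF b] bilinear_rmul[OF b])
 have fK: "f i \<in> K" for i using f B(1) by (auto simp: bij_betw_def)
 have yK: "v \<in> K" if "y v = 0" for v
 proof (rule K(4)[rule_format])
  fix u assume "u \<in> K"
  then have u: "u \<in> span B" using B(3) by blast
  show "h u v = 0"
  proof (rule linear_eq_0_on_span[OF l(1) _ u])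
   fix x assume "x \<in> B"
   then obtain i where "x = f i" using f by (auto simp: bij_betw_def)
   moreover have "y v $ i = 0" using that by simp
   ultimately show "h x v = 0" by (simp add: y_def)
  qed
 qed
 have "surj y"
 proof (rule ccontr)
  assume ns: "\<not> surj y"
  have sp: "span (range y) = range y" by (rule span_eq_iff[THEN iffD2, OF linear_subspace_image[OF lin subspace_UNIV]])
  have "dim (range y) \<noteq> DIM(real ^ 'n)" unfolding dim_eq_full sp by (rule ns)
  then have "dim (range y) < DIM(real ^ 'n)" using dim_subset_UNIV[of "range y"] by linarith
  then obtain c where c: "c \<noteq> 0" "!!w. w \<in> span (range y) ==> orthogonal c w"
   using orthogonal_to_subspace_exists[of "range y"] by blast
  have "h (\<Sum>i\<in>UNIV. c $ i *\<^sub>R f i) v = 0" for v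
  proof -
   have "h (\<Sum>i\<in>UNIV. c $ i *\<^sub>R f i) v = (\<Sum>i\<in>UNIV. c $ i * h (f i) v)"
    by (simp add: linear_sum[OF l(1)] linear_cmul[OF l(1)])
   also have "\<dots> = c \<bullet> y v" by (simp add: inner_vec_def y_def)
   also have "\<dots> = 0" using c(2)[OF span_base[OF rangeI]] by (simp add: orthogonal_def)
   finally show ?thesis .
  qed
  then have s: "(\<Sum>i\<in>UNIV. c $ i *\<^sub>R f i) = 0" using nd by blast
  define g where "g = inv_into UNIV f"
  have gf: "g (f i) = i" for i unfolding g_def using f by (simp add: bij_betw_def inv_into_f_f)
  have "(\<Sum>x\<in>B. c $ g x *\<^sub>R x) = (\<Sum>i\<in>UNIV. c $ g (f i) *\<^sub>R f i)"
   by (rule sum.reindex_bij_betw[OF f, symmetric])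
  then have "(\<Sum>x\<in>B. c $ g x *\<^sub>R x) = 0" using s by (simp add: gf)
  then have "\<forall>x\<in>B. c $ g x = 0" using B(2) unfolding independent_explicit by (auto simp: fB)
  moreover have "f i \<in> B" for i using f by (auto simp: bij_betw_def)
  ultimately have "c $ i = 0" for i using gf by metis
  then show False using c(1) by (simp add: vec_eq_iff)
 qed
 moreover have "y u = 0" if "u \<in> S" for u unfolding y_def vec_eq_iff using K(3)[OF fK] that K(2) by auto
 moreover have "h u v = 0" if "y u = 0" "y v = 0" for u v using yK that K(3) by blast
 ultimately show ?thesis using that[OF lin] by blast
qed

lemma lagrangian_eqs_iff:
 "lagrangian_eqs \<omega> H \<longleftrightarrow> H 0 = 0 \<and> smooth_germ H \<and> (NEAR x. H x = 0 --> surj (dd H x) \<and>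
   (\<forall>u v. dd H x u = 0 --> dd H x v = 0 --> \<omega> x u v = 0))" (is "_ \<longleftrightarrow> _ \<and> _ \<and> (NEAR x. ?P x)")
proof
 assume "lagrangian_eqs \<omega> H"
 then obtain U where U: "H 0 = 0" "open U" "0 \<in> U" "smooth_on U H" "!!x. x \<in> U ==> ?P x"
  unfolding lagrangian_eqs_def by blast
 have "NEAR x. ?P x" using eventually_nhds_in_open[OF U(2,3)] by (rule eventually_mono) (rule U(5))
 then show "H 0 = 0 \<and> smooth_germ H \<and> (NEAR x. ?P x)" using U smooth_germI by blast
next
 assume a: "H 0 = 0 \<and> smooth_germ H \<and> (NEAR x. ?P x)"
 then obtain U where U: "open U" "0 \<in> U" "smooth_on U H" using smooth_germE by blast
 obtain T where T: "open T" "0 \<in> T" "!!x. x \<in> T ==> ?P x" using a unfolding eventually_nhds by blast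
 have "\<forall>x\<in>U \<inter> T. ?P x" using T(3) by blast
 moreover have "open (U \<inter> T)" "0 \<in> U \<inter> T" "smooth_on (U \<inter> T) H" using U T smooth_on_subset by blast+
 ultimately show "lagrangian_eqs \<omega> H" using a unfolding lagrangian_eqs_def by blast
qed

lemma smooth_germ_bij_dd:
 fixes \<Phi> :: "'a::euclidean_space => 'a"
 assumes "smooth_germ \<Phi>" "inj (dd \<Phi> 0)" shows "NEAR x. bij (dd \<Phi> x)"
proof -
 obtain U where U: "open U" "0 \<in> U" "smooth_on U \<Phi>" using assms(1) by (rule smooth_germE)
 obtain U' where "open U'" "0 \<in> U'" "!!x. x \<in> U' ==> bij (dd \<Phi> x)"
  by (rule smooth_inverse_function[OF U assms(2)]) (rule that)
 then show ?thesis unfolding eventually_nhds by blast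
qed

lemma lagrangian_eqs_pullback:
 assumes \<Phi>: "smooth_germ \<Phi>" "\<Phi> 0 = 0" "inj (dd \<Phi> 0)" and H: "lagrangian_eqs \<omega> H"
  and e: "NEAR x. \<forall>u v. \<sigma> x u v = pullback \<Phi> \<omega> x u v"
 shows "lagrangian_eqs \<sigma> (%x. H (\<Phi> x))"
proof -
 have h: "H 0 = 0" "smooth_germ H" "NEAR x. H x = 0 --> surj (dd H x) \<and>
   (\<forall>u v. dd H x u = 0 --> dd H x v = 0 --> \<omega> x u v = 0)" using H unfolding lagrangian_eqs_iff by blast+
 have "NEAR x. H (\<Phi> x) = 0 --> surj (dd (%x. H (\<Phi> x)) x) \<and>
   (\<forall>u v. dd (%x. H (\<Phi> x)) x u = 0 --> dd (%x. H (\<Phi> x)) x v = 0 --> \<sigma> x u v = 0)"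
  using smooth_germ_chain[OF \<Phi>(1,2) h(2)] eventually_compose_0[OF smooth_germ_isCont[OF \<Phi>(1)] \<Phi>(2) h(3)]
   smooth_germ_bij_dd[OF \<Phi>(1,3)] e
 proof eventually_elim
  case (elim x)
  show ?case
  proof (intro impI conjI allI)
   assume 0: "H (\<Phi> x) = 0"
   then have "surj (dd H (\<Phi> x))" using elim by blast
   from comp_surj[OF bij_is_surj[OF elim(3)] this] show "surj (dd (%x. H (\<Phi> x)) x)" unfolding elim(1) by (simp add: o_def)
   fix u v assume "dd (%x. H (\<Phi> x)) x u = 0" "dd (%x. H (\<Phi> x)) x v = 0"
   then show "\<sigma> x u v = 0" using elim 0 by (simp add: pullback_def)
  qed
 qed
 moreover have "smooth_germ (%x. H (\<Phi> x))" by (rule smooth_germ_compose[OF \<Phi>(1,2) h(2)])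
 ultimately show ?thesis unfolding lagrangian_eqs_iff using h(1) \<Phi>(2) by simp
qed

context U7_setting begin

text \<open>The vectors that represent the first three coordinates through h, corrected by multiples
  of \<open>E 1\<close> and \<open>E 2\<close> to become mutually h-orthogonal; as W is isotropic,
  the corrections do not disturb the pairings with W.\<close>

lemma dual_vectors_exist:
 fixes h :: "'n R2n => 'n R2n => real"
 assumes b: "bilinear h" and alt: "!!u. h u u = 0" and nd: "!!u. u \<noteq> 0 ==> \<exists>v. h u v \<noteq> 0"
  and W: "!!i j. i \<in> {1, 2, 3} ==> j \<in> {1, 2, 3} ==> h (E i) (E j) = 0"
 obtains w1 w2 w3 where "!!j. j \<in> {1, 2, 3} ==> h w1 (E j) = E 1 $ j \<and> h w2 (E j) = E 2 $ j \<and> h w3 (E j) = E 3 $ j"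
  "h w1 w2 = 0" "h w1 w3 = 0" "h w2 w3 = 0"
proof -
 obtain J where J: "linear J" "bij J" "!!u v. J u \<bullet> v = h u v" by (rule nondegenerate_representation[OF b nd]) (assumption, rule that)
 have "\<exists>u. J u = x" for x using bij_is_surj[OF J(2)] by (metis surjD)
 then obtain u1 u2 u3 where u: "J u1 = E 1" "J u2 = E 2" "J u3 = E 3" by metis
 have hu: "h u1 (E j) = E 1 $ j" "h u2 (E j) = E 2 $ j" "h u3 (E j) = E 3 $ j" for j
  unfolding J(3)[symmetric] u by (simp_all add: inner_axis)
 define c where "c = h u1 u2"
 define w2 where "w2 = u2 - c *\<^sub>R E 1"
 define w3 where "w3 = u3 - h u1 u3 *\<^sub>R E 1 - h w2 u3 *\<^sub>R E 2"
 have sw: "h u v = - h v u" for u v by (rule bilinear_alternating_swap[OF b alt])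
 note bl = bilinear_ladd[OF b] bilinear_radd[OF b] bilinear_lsub[OF b] bilinear_rsub[OF b] bilinear_lmul[OF b] bilinear_rmul[OF b]
 have w2: "h w2 (E j) = E 2 $ j" if "j \<in> {1, 2, 3}" for j unfolding w2_def bl using W[OF _ that, of 1] hu by simp
 have w3: "h w3 (E j) = E 3 $ j" if "j \<in> {1, 2, 3}" for j unfolding w3_def bl using W[OF _ that, of 1] W[OF _ that, of 2] hu by simp
 have z: "h u1 w2 = 0" unfolding w2_def bl hu c_def by simp
 have "h w2 (E 1) = 0" "h w2 (E 2) = 1" "h u1 (E 2) = 0" using w2 hu dist by (simp_all add: axis_def)
 then have z2: "h u1 w3 = 0" "h w2 w3 = 0" unfolding w3_def bl hu by simp_all
 show ?thesis by (rule that[OF _ z z2]) (use hu w2 w3 in simp)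
qed

text \<open>With \<open>\<xi>\<^sub>j = h(w\<^sub>j, \<cdot>)\<close>, the fibres of \<open>x \<mapsto> y (x - \<Sum> F\<^sub>j(\<xi>) w\<^sub>j)\<close>, where \<open>ker y\<close> is a Lagrangian subspace containing \<open>W\<close>,
 are Lagrangian for \<open>h - \<Sum> dF\<^sub>j \<and> d\<xi>\<^sub>j\<close>.\<close>

lemma lagrangian_model:
 fixes h :: "'n R2n => 'n R2n => real" and F1 F2 F3 :: "'n R2n => real"
 assumes b: "bilinear h" and alt: "!!u. h u u = 0" and nd: "!!u. u \<noteq> 0 ==> \<exists>v. h u v \<noteq> 0"
  and W: "!!i j. i \<in> {1, 2, 3} ==> j \<in> {1, 2, 3} ==> h (E i) (E j) = 0"
  and F: "smooth_germ F1" "smooth_germ F2" "smooth_germ F3" "F1 0 = 0" "F2 0 = 0" "F3 0 = 0"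
  and dF: "!!z. (F1 has_derivative F1' z) (at z)" "!!z. (F2 has_derivative F2' z) (at z)" "!!z. (F3 has_derivative F3' z) (at z)"
  and \<Theta>: "!!z u v. (F1' z u * v $ 1 - F1' z v * u $ 1) + (F2' z u * v $ 2 - F2' z v * u $ 2) + (F3' z u * v $ 3 - F3' z v * u $ 3)
   = - \<Theta> 0 0 0 a4 a5 a6 a7 z u v"
 obtains \<rho> and H :: "'n R2n => real ^ 'n" and y1 y2 y3 where "form2_germ \<rho>" "closed_germ \<rho>" "!!u v. \<rho> 0 u v = h u v"
  "AN (%x u v. \<rho> x u v - \<Theta> 0 0 0 a4 a5 a6 a7 x u v)" "lagrangian_eqs \<rho> H"
  "!!x. x \<in> U7 ==> H x = - (F1 x *\<^sub>R y1 + F2 x *\<^sub>R y2 + F3 x *\<^sub>R y3)"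
proof -
 let ?\<Theta> = "\<Theta> 0 0 0 a4 a5 a6 a7"
 obtain w1 w2 w3 where w: "!!j. j \<in> {1, 2, 3} ==> h w1 (E j) = E 1 $ j \<and> h w2 (E j) = E 2 $ j \<and> h w3 (E j) = E 3 $ j"
  "h w1 w2 = 0" "h w1 w3 = 0" "h w2 w3 = 0" by (rule dual_vectors_exist[OF b alt nd W]) (assumption | rule that)+
 have sw: "h u v = - h v u" for u v by (rule bilinear_alternating_swap[OF b alt])
 obtain y :: "'n R2n => real ^ 'n" where y: "linear y" "surj y" "!!u. u \<in> {E 1, E 2, E 3} ==> y u = 0"
  "!!u v. y u = 0 ==> y v = 0 ==> h u v = 0"
 proof (rule lagrangian_projection_exists[OF b alt nd, of "{E 1, E 2, E 3}", where ?'n = 'n])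
  show "h u v = 0" if "u \<in> {E 1, E 2, E 3}" "v \<in> {E 1, E 2, E 3}" for u v using that W by blast
  show "DIM('n R2n) = 2 * CARD('n)" by simp
 qed (use that in auto)
 define \<xi> where "\<xi> x = h w1 x *\<^sub>R E 1 + h w2 x *\<^sub>R E 2 + h w3 x *\<^sub>R E 3" for x
 have lx: "linear \<xi>" unfolding \<xi>_def by (rule linearI) (simp_all add: bilinear_radd[OF b] bilinear_rmul[OF b] algebra_simps)
 have x123: "\<xi> x $ 1 = h w1 x" "\<xi> x $ 2 = h w2 x" "\<xi> x $ 3 = h w3 x" for x
  using dist by (simp_all add: \<xi>_def axis_def)
 have xw: "\<xi> w1 = 0" "\<xi> w2 = 0" "\<xi> w3 = 0" using w(2-4) sw[of w2 w1] sw[of w3 w1] sw[of w3 w2] alt by (simp_all add: \<xi>_def)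
 have xE: "\<xi> (E j) = E j" if j: "j \<in> {1, 2, 3}" for j
  unfolding \<xi>_def using w(1)[OF j] j dist by (auto simp: vec_eq_iff axis_def)
 have dx: "dd \<xi> x = \<xi>" for x by (rule dd_eq[OF linear_imp_has_derivative[OF lx]])
 have \<xi>: "smooth_germ \<xi>" "\<xi> 0 = 0" by (rule smooth_germ_linear[OF lx], rule linear_0[OF lx])
 \<comment> \<open>Shows that \<open>?\<Theta>\<close> is exact, hence closed.\<close>
 define \<beta> where "\<beta> x v = (- F1 x) * v $ 1 + (- F2 x) * v $ 2 + (- F3 x) * v $ 3" for x v :: "'n R2n"
 have lk: "linear (%v::'n R2n. v $ k)" for k by (rule bounded_linear.linear[OF bounded_linear_vec_nth])
 have "form1_germ \<beta>" unfolding \<beta>_def by (intro form1_germ_add form1_germ_mult form1_germ_const smooth_germ_minus F lk)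
 moreover have "ext_d1 \<beta> x u v = ?\<Theta> x u v" for x u v
 proof -
  have "((%x. \<beta> x v) has_derivative (%u. - F1' x u * v $ 1 + - F2' x u * v $ 2 + - F3' x u * v $ 3)) (at x)" for x v
   unfolding \<beta>_def by (auto intro!: derivative_eq_intros dF)
  from dd_eq[OF this] show ?thesis using \<Theta>[of x u v] unfolding ext_d1_def by (simp add: algebra_simps)
 qed
 ultimately have c: "closed_germ ?\<Theta>"
  using closed_germ_cong[OF always_eventually closed_germ_ext_d1[of \<beta>], of ?\<Theta>] by simp
 \<comment> \<open>The model form: it equals h at 0, and since h vanishes on W and \<xi> is the
   identity there, its algebraic restriction is that of \<open>?\<Theta>\<close>.\<close>
 define \<rho> where "\<rho> x u v = h u v + pullback \<xi> ?\<Theta> x u v" for x u v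
 have fP: "form2_germ (pullback \<xi> ?\<Theta>)" by (rule form2_germ_pullback[OF \<xi> form2_germ_\<Theta>])
 have fh: "form2_germ (%x::'n R2n. h)" unfolding form2_germ_iff using b alt by (simp add: smooth_germ_const)
 have 1: "form2_germ \<rho>" unfolding \<rho>_def by (rule form2_germ_add[OF fh fP])
 have 2: "closed_germ \<rho>" unfolding \<rho>_def
  by (rule closed_germ_add[OF fh fP closed_germ_const closed_germ_pullback[OF \<xi> form2_germ_\<Theta> c]])
 have 3: "\<rho> 0 u v = h u v" for u v by (simp add: \<rho>_def pullback_def \<xi>(2) \<Theta>_def)
 have r: "\<rho> x (E 1) (E 3) = a4 * \<xi> x $ 3 + a5 * \<xi> x $ 1 + a6 * (\<xi> x $ 3)\<^sup>2 + a7 * (\<xi> x $ 1 * \<xi> x $ 3)"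
  "\<rho> x (E 2) (E 3) = 0" "\<rho> x (E 1) (E 2) = 0" for x
  using dist by (simp_all add: \<rho>_def pullback_def dx xE W \<Theta>_def dxdx_def) (simp_all add: axis_def)
 define k where "k x = \<rho> x (E 1) (E 3) - (a4 * x $ 3 + a5 * x $ 1 + a6 * (x $ 3)\<^sup>2 + a7 * (x $ 1 * x $ 3))" for x
 have xU: "\<xi> x = x" if "x \<in> U7" for x
 proof -
  have "x = x $ 1 *\<^sub>R E 1 + x $ 2 *\<^sub>R E 2 + x $ 3 *\<^sub>R E 3"
   unfolding vec_eq_iff using U7_rest[OF that] dist by (auto simp: axis_def)
  then show ?thesis using xE[of 1] xE[of 2] xE[of 3] linear_add[OF lx] linear_cmul[OF lx] by (metis insertCI)
 qed
 have "smooth_germ k" unfolding k_def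
  by (intro smooth_germ_diff form2_germ_smooth[OF 1] smooth_germ_add smooth_germ_mult smooth_germ_power smooth_germ_const smooth_germ_nth)
 then have "AN (%x u v. k x * A u v)" by (rule AN_vanish) (simp add: k_def r xU)
 from alg_null_add[OF AN_restrict_W[OF 1] this]
 have 4: "AN (%x u v. \<rho> x u v - ?\<Theta> x u v)"
  by (rule alg_null_eqI) (simp add: k_def r \<Theta>_def algebra_simps)
 define H where "H x = y (x - (F1 (\<xi> x) *\<^sub>R w1 + F2 (\<xi> x) *\<^sub>R w2 + F3 (\<xi> x) *\<^sub>R w3))" for x
 define s where "s x v = F1' (\<xi> x) (\<xi> v) *\<^sub>R w1 + F2' (\<xi> x) (\<xi> v) *\<^sub>R w2 + F3' (\<xi> x) (\<xi> v) *\<^sub>R w3" for x v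
 have dH: "dd H x = (%v. y (v - s x v))" for x
 proof -
  have "(\<xi> has_derivative \<xi>) (at x)" by (rule linear_imp_has_derivative[OF lx])
  note d = has_derivative_compose[OF this]
  show ?thesis unfolding H_def[abs_def] s_def
   by (intro dd_eq bounded_linear.has_derivative[OF linear_conv_bounded_linear[THEN iffD1, OF y(1)]] has_derivative_diff
     has_derivative_ident has_derivative_add has_derivative_scaleR_left d dF)
 qed
 have "lagrangian_eqs \<rho> H" unfolding lagrangian_eqs_iff
 proof (intro conjI always_eventually allI impI)
  show "H 0 = 0" by (simp add: H_def \<xi>(2) F linear_0[OF y(1)])
  show "smooth_germ H" unfolding H_def[abs_def]
   by (rule smooth_germ_bounded_linear[OF linear_conv_bounded_linear[THEN iffD1, OF y(1)]],
     intro smooth_germ_diff smooth_germ_add smooth_germ_scaleR smooth_germ_const smooth_germ_ident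
      smooth_germ_compose[OF \<xi> F(1)] smooth_germ_compose[OF \<xi> F(2)] smooth_germ_compose[OF \<xi> F(3)])
  fix x
  show "surj (dd H x)" unfolding surj_def
  proof
   fix z
   obtain v0 where v0: "y v0 = z" using y(2) by (metis surjD)
   \<comment> \<open>\<xi> annihilates w1, w2, w3, so \<open>s x\<close> does not see the shift and
     v0 + s x v0 is a preimage of z.\<close>
   have "\<xi> (v0 + s x v0) = \<xi> v0" unfolding s_def by (simp add: linear_add[OF lx] linear_cmul[OF lx] xw)
   then have "s x (v0 + s x v0) = s x v0" by (simp add: s_def)
   then have "z = dd H x (v0 + s x v0)" by (simp add: dH v0)
   then show "\<exists>v. z = dd H x v" by blast
  qed
  fix u v assume "dd H x u = 0" "dd H x v = 0"
  then have "h (u - s x u) (v - s x v) = 0" unfolding dH by (rule y(4))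
  then have "h u v = (F1' (\<xi> x) (\<xi> u) * \<xi> v $ 1 - F1' (\<xi> x) (\<xi> v) * \<xi> u $ 1) + (F2' (\<xi> x) (\<xi> u) * \<xi> v $ 2 - F2' (\<xi> x) (\<xi> v) * \<xi> u $ 2)
    + (F3' (\<xi> x) (\<xi> u) * \<xi> v $ 3 - F3' (\<xi> x) (\<xi> v) * \<xi> u $ 3)"
   unfolding s_def x123
   by (simp add: bilinear_ladd[OF b] bilinear_radd[OF b] bilinear_lsub[OF b] bilinear_rsub[OF b] bilinear_lmul[OF b] bilinear_rmul[OF b]
     alt w(2-4) sw[of w2 w1] sw[of w3 w1] sw[of w3 w2] sw[of u w1] sw[of u w2] sw[of u w3])
  then show "\<rho> x u v = 0" unfolding \<Theta> by (simp add: \<rho>_def pullback_def dx)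
 qed
 moreover have "H x = - (F1 x *\<^sub>R y w1 + F2 x *\<^sub>R y w2 + F3 x *\<^sub>R y w3)" if x: "x \<in> U7" for x
 proof -
  have "x = x $ 1 *\<^sub>R E 1 + x $ 2 *\<^sub>R E 2 + x $ 3 *\<^sub>R E 3"
   unfolding vec_eq_iff using U7_rest[OF x] dist by (auto simp: axis_def)
  then have "y x = x $ 1 *\<^sub>R y (E 1) + x $ 2 *\<^sub>R y (E 2) + x $ 3 *\<^sub>R y (E 3)"
   using linear_add[OF y(1)] linear_cmul[OF y(1)] by metis
  then have "y x = 0" using y(3) by simp
  then show ?thesis unfolding H_def xU[OF x] by (simp add: linear_diff[OF y(1)] linear_add[OF y(1)] linear_cmul[OF y(1)])
 qed
 ultimately show ?thesis using that[OF 1 2 3 4] by blast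
qed

text \<open>The model form and \<sigma> agree at 0 and have the same algebraic restriction. A
  diffeomorphism fixing U7 pointwise carries the Lagrangian germ of the model to one for \<sigma>,
  with the same values of H on U7.\<close>

lemma lagrangian_exists:
 fixes \<sigma> :: "'n R2n form2" and F1 F2 F3 :: "'n R2n => real"
 assumes \<sigma>: "form2_germ \<sigma>" "closed_germ \<sigma>" and nd: "!!u. u \<noteq> 0 ==> \<exists>v. \<sigma> 0 u v \<noteq> 0"
  and W: "!!i j. i \<in> {1, 2, 3} ==> j \<in> {1, 2, 3} ==> \<sigma> 0 (E i) (E j) = 0"
  and AN: "AN (%x u v. \<sigma> x u v - \<Theta> 0 0 0 a4 a5 a6 a7 x u v)"
  and F: "smooth_germ F1" "smooth_germ F2" "smooth_germ F3" "F1 0 = 0" "F2 0 = 0" "F3 0 = 0"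
  and dF: "!!z. (F1 has_derivative F1' z) (at z)" "!!z. (F2 has_derivative F2' z) (at z)" "!!z. (F3 has_derivative F3' z) (at z)"
  and \<Theta>: "!!z u v. (F1' z u * v $ 1 - F1' z v * u $ 1) + (F2' z u * v $ 2 - F2' z v * u $ 2) + (F3' z u * v $ 3 - F3' z v * u $ 3)
   = - \<Theta> 0 0 0 a4 a5 a6 a7 z u v"
 obtains H :: "'n R2n => real ^ 'n" and y1 y2 y3 where "lagrangian_eqs \<sigma> H"
  "NEAR x. x \<in> U7 --> H x = - (F1 x *\<^sub>R y1 + F2 x *\<^sub>R y2 + F3 x *\<^sub>R y3)"
proof -
 have b: "bilinear (\<sigma> 0)" and alt: "!!u. \<sigma> 0 u u = 0"
  using eventually_nhds_x_imp_x[OF form2_germ_bilinear[OF \<sigma>(1)]] by blast+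
 obtain \<rho> and H :: "'n R2n => real ^ 'n" and y1 y2 y3 where \<rho>: "form2_germ \<rho>" "closed_germ \<rho>" "!!u v. \<rho> 0 u v = \<sigma> 0 u v"
  "AN (%x u v. \<rho> x u v - \<Theta> 0 0 0 a4 a5 a6 a7 x u v)" "lagrangian_eqs \<rho> H"
  and H: "!!x. x \<in> U7 ==> H x = - (F1 x *\<^sub>R y1 + F2 x *\<^sub>R y2 + F3 x *\<^sub>R y3)"
  by (rule lagrangian_model[OF b alt nd W F dF \<Theta>]) (assumption | rule that)+
 have an: "AN (%x u v. \<rho> x u v - \<sigma> x u v)" by (rule alg_null_eqI[OF alg_null_diff[OF \<rho>(4) AN]]) simp
 obtain \<Psi> where P: "smooth_germ \<Psi>" "\<Psi> 0 = 0" "inj (dd \<Psi> 0)" "NEAR x. x \<in> U7 --> \<Psi> x = x"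
  "NEAR x. \<forall>u v. pullback \<Psi> \<rho> x u v = \<sigma> x u v"
  by (rule darboux_givental[OF \<rho>(1,2) \<sigma> nd \<rho>(3) an]) (assumption, rule that)
 have "lagrangian_eqs \<sigma> (%x. H (\<Psi> x))"
  by (rule lagrangian_eqs_pullback[OF P(1-3) \<rho>(5)]) (use P(5) in eventually_elim, simp)
 moreover have "NEAR x. x \<in> U7 --> H (\<Psi> x) = - (F1 x *\<^sub>R y1 + F2 x *\<^sub>R y2 + F3 x *\<^sub>R y3)"
  using P(4) by eventually_elim (simp add: H)
 ultimately show ?thesis by (rule that)
qed

end

section \<open>Primitives that are small along a Lagrangian germ\<close>

lemma form2_germ_bounded:
 fixes \<sigma> :: "'a::euclidean_space form2"
 assumes "form2_germ \<sigma>"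
 obtains M where "M > 0" "NEAR x. \<forall>u v. \<bar>\<sigma> x u v\<bar> \<le> M * norm u * norm v"
proof -
 define M where "M = (\<Sum>c\<in>(Basis::'a set). \<Sum>b\<in>(Basis::'a set). \<bar>\<sigma> 0 b c\<bar> + 1)"
 have "NEAR x. \<bar>\<sigma> x b c\<bar> \<le> \<bar>\<sigma> 0 b c\<bar> + 1" for b c
 proof -
  have "((%x. \<sigma> x b c) \<longlongrightarrow> \<sigma> 0 b c) (nhds 0)"
   using smooth_germ_isCont[OF form2_germ_smooth[OF assms, of b c]] tendsto_at_iff_tendsto_nhds[of "%x. \<sigma> x b c"]
   by (simp add: isCont_def)
  then have "NEAR x. \<bar>\<sigma> x b c - \<sigma> 0 b c\<bar> < 1" unfolding tendsto_iff dist_real_def by simp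
  then show ?thesis by eventually_elim simp
 qed
 then have "NEAR x. \<forall>b\<in>(Basis::'a set). \<forall>c\<in>(Basis::'a set). \<bar>\<sigma> x b c\<bar> \<le> \<bar>\<sigma> 0 b c\<bar> + 1"
  by (intro eventually_ball_finite finite_Basis ballI)
 then have "NEAR x. \<forall>u v. \<bar>\<sigma> x u v\<bar> \<le> M * norm u * norm v"
  using form2_germ_bilinear[OF assms]
 proof eventually_elim
  case (elim x)
  show ?case
  proof (intro allI)
   fix u v
   have l: "linear (\<sigma> x u)" "linear (%u. \<sigma> x u v)" for u v using elim(2) by (simp_all add: bilinear_def)
   have "norm (\<sigma> x u c) \<le> (\<Sum>b\<in>Basis. \<bar>\<sigma> 0 b c\<bar> + 1) * norm u" if "c \<in> Basis" for c
    by (rule linear_norm_le[OF l(2)]) (use elim(1) that in simp)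
   from linear_norm_le[OF l(1) this] show "\<bar>\<sigma> x u v\<bar> \<le> M * norm u * norm v"
    unfolding M_def by (simp add: sum_distrib_right)
  qed
 qed
 moreover have "M > 0" unfolding M_def by (intro sum_pos) auto
 ultimately show ?thesis using that by blast
qed

text \<open>A change of coordinates straightens H to its derivative D. At points of the kernel of D
  the transformed form vanishes on that kernel, so the contraction onto it yields a primitive. The
  integrand contains the velocity P x, which is bounded by |D x|, that is, by |H| in the original
  coordinates.\<close>

lemma lagrangian_primitive:
 fixes H :: "real ^ 'n::finite bit0 => real ^ 'n"
 assumes \<sigma>: "form2_germ \<sigma>" "closed_germ \<sigma>" and L: "lagrangian_eqs \<sigma> H"
 obtains \<beta> where "form1_germ \<beta>" "NEAR x. \<forall>u v. \<sigma> x u v = ext_d1 \<beta> x u v"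
  "!!v. \<exists>C\<ge>0. NEAR x. \<bar>\<beta> x v\<bar> \<le> C * norm (H x)"
proof -
 have H: "H 0 = 0" "smooth_germ H" "NEAR x. H x = 0 --> surj (dd H x) \<and>
   (\<forall>u v. dd H x u = 0 --> dd H x v = 0 --> \<sigma> x u v = 0)" using L unfolding lagrangian_eqs_iff by blast+
 define D where "D = dd H 0"
 have lD: "linear D" unfolding D_def by (rule has_derivative_linear[OF smooth_germ_has_derivative_0[OF H(2)]])
 have "surj D" using eventually_nhds_x_imp_x[OF H(3)] H(1) unfolding D_def by blast
 then obtain r where r: "linear r" "D \<circ> r = id" using linear_surjective_right_inverse[OF lD] by blast
 have Dr: "D (r y) = y" for y using fun_cong[OF r(2), of y] by simp
 define P where "P x = r (D x)" for x
 \<comment> \<open>P is a projection with the kernel of D, so D (G x) = H x, and the derivative of G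
   at 0 is the identity.\<close>
 define G where "G x = x - P x + r (H x)" for x
 have lP: "linear P" unfolding P_def using linear_compose[OF lD r(1)] by (simp add: o_def)
 have DP: "D (P x) = D x" for x by (simp add: P_def Dr)
 have rH: "smooth_germ (%x. r (H x))" by (rule smooth_germ_bounded_linear[OF linear_conv_bounded_linear[THEN iffD1, OF r(1)] H(2)])
 have G: "smooth_germ G" unfolding G_def[abs_def]
  by (intro smooth_germ_add smooth_germ_diff rH smooth_germ_linear[OF linear_ident] smooth_germ_linear[OF lP])
 have G0: "G 0 = 0" by (simp add: G_def H(1) linear_0[OF lP] linear_0[OF r(1)])
 have DG: "D (G x) = H x" for x by (simp add: G_def linear_add[OF lD] linear_diff[OF lD] DP Dr)
 have "(G has_derivative (%v. v - P v + r (D v))) (at 0)" unfolding G_def[abs_def] D_def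
  by (intro has_derivative_add has_derivative_diff has_derivative_ident linear_imp_has_derivative[OF lP]
    bounded_linear.has_derivative[OF linear_conv_bounded_linear[THEN iffD1, OF r(1)]] smooth_germ_has_derivative_0 H(2))
 then have "dd G 0 = (%v. v)" by (subst dd_eq) (simp_all add: P_def)
 then have injG: "inj (dd G 0)" by simp
 obtain \<Psi> where \<Psi>: "smooth_germ \<Psi>" "\<Psi> 0 = 0" "inj (dd \<Psi> 0)" "NEAR x. \<Psi> (G x) = x" "NEAR x. G (\<Psi> x) = x"
  by (rule smooth_germ_inverse[OF G G0 injG]) (rule that)
 define \<tau> where "\<tau> = pullback \<Psi> \<sigma>"
 have \<tau>: "form2_germ \<tau>" "closed_germ \<tau>" unfolding \<tau>_def
  by (rule form2_germ_pullback[OF \<Psi>(1,2) \<sigma>(1)], rule closed_germ_pullback[OF \<Psi>(1,2) \<sigma>])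
 have "lagrangian_eqs \<tau> (%x. H (\<Psi> x))" by (rule lagrangian_eqs_pullback[OF \<Psi>(1-3) L]) (simp add: \<tau>_def)
 then have e1: "NEAR x. H (\<Psi> x) = 0 --> (\<forall>u v. dd (%x. H (\<Psi> x)) x u = 0 --> dd (%x. H (\<Psi> x)) x v = 0 --> \<tau> x u v = 0)"
  unfolding lagrangian_eqs_iff by (elim conjE eventually_mono) blast
 have e2: "NEAR x. H (\<Psi> x) = D x"
  using \<Psi>(5) by eventually_elim (metis DG)
 have tz: "NEAR x. D x = 0 --> (\<forall>u v. D u = 0 --> D v = 0 --> \<tau> x u v = 0)"
  using e1 e2 eventually_dd_cong[OF e2] by eventually_elim (simp add: dd_eq[OF linear_imp_has_derivative[OF lD]])
 define \<Lambda> where "\<Lambda> s x = (x - P x) + s *\<^sub>R P x" for s :: real and x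
 define \<beta> where "\<beta> x v = integral {0..1} (%s. \<tau> (\<Lambda> s x) (P x) (\<Lambda> s v))" for x v
 have ll: "linear (\<Lambda> s)" for s unfolding \<Lambda>_def
  by (rule linearI) (simp_all add: linear_add[OF lP] linear_cmul[OF lP] algebra_simps)
 have sm: "smooth_on UNIV (%s. \<Lambda> s x)" "smooth_on UNIV (%s::real. P x)" for x
  unfolding \<Lambda>_def by (intro smooth_on_add smooth_on_scaleR smooth_on_const smooth_on_ident open_UNIV)+
 have der: "((%s. \<Lambda> s x) has_vector_derivative P x) (at s)" for s x
  unfolding \<Lambda>_def has_vector_derivative_def by (auto intro!: derivative_eq_intros)
 note hom = linear_homotopy[OF ll lP sm der \<tau>, folded \<beta>_def]
 have L0: "\<Lambda> 0 x = x - P x" and L1: "\<Lambda> 1 x = x" and DQ: "D (x - P x) = 0" for x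
  by (simp_all add: \<Lambda>_def linear_diff[OF lD] DP)
 have q0: "0 - P 0 = 0" by (simp add: linear_0[OF lP])
 have cQ: "isCont (%x. x - P x) 0" by (intro continuous_intros linear_continuous_at linear_conv_bounded_linear[THEN iffD1, OF lP])
 have ed: "NEAR x. \<forall>u v. ext_d1 \<beta> x u v = \<tau> x u v"
  using hom(2) eventually_compose_0[OF cQ q0 tz]
  by eventually_elim (simp add: L0 L1 DQ)
 obtain M where M: "M > 0" "NEAR x. \<forall>u v. \<bar>\<tau> x u v\<bar> \<le> M * norm u * norm v" by (rule form2_germ_bounded[OF \<tau>(1)])
 obtain K where K: "K > 0" "!!s x. \<bar>s\<bar> \<le> 2 ==> norm (\<Lambda> s x) \<le> K * norm x"
 proof (rule linear_family_bound[of \<Lambda>])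
  show "continuous_on {-2..2} (%s. \<Lambda> s x)" for x by (rule continuous_on_subset[OF smooth_on_imp_continuous[OF sm(1)]]) simp
 qed (use ll that in auto)
 obtain B where B: "B > 0" "!!y. norm (r y) \<le> norm y * B"
  using bounded_linear.pos_bounded[OF linear_conv_bounded_linear[THEN iffD1, OF r(1)]] by blast
 obtain e where e: "e > 0" "!!x. dist x 0 < e ==> \<forall>u v. \<bar>\<tau> x u v\<bar> \<le> M * norm u * norm v"
  using M(2) unfolding eventually_nhds_metric by blast
 have bb: "\<bar>\<beta> x v\<bar> \<le> M * B * K * norm (D x) * norm v" if x: "dist x 0 < e / K" for x v
 proof -
  have "norm (integral {0..1} (%s. \<tau> (\<Lambda> s x) (P x) (\<Lambda> s v))) \<le> M * (norm (D x) * B) * (K * norm v) * measure lborel (cbox (0::real) 1)"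
  \<comment> \<open>A non-integrable integrand has integral 0 by convention, for which the bound is
    trivial.\<close>
  proof (cases "(%s. \<tau> (\<Lambda> s x) (P x) (\<Lambda> s v)) integrable_on {0..1}")
   case True
   have "norm (\<tau> (\<Lambda> s x) (P x) (\<Lambda> s v)) \<le> M * (norm (D x) * B) * (K * norm v)" if s: "s \<in> cbox 0 1" for s
   proof -
    have "norm (\<Lambda> s x) \<le> K * norm x" by (rule K(2)) (use s in auto)
    also have "\<dots> < e" using x K(1) by (simp add: field_simps)
    finally have "\<bar>\<tau> (\<Lambda> s x) (P x) (\<Lambda> s v)\<bar> \<le> M * norm (P x) * norm (\<Lambda> s v)" using e(2) by simp
    also have "\<dots> \<le> M * (norm (D x) * B) * (K * norm v)"
     by (intro mult_mono mult_left_mono K(2)) (use s B M(1) in \<open>auto simp: P_def\<close>)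
    finally show ?thesis by simp
   qed
   moreover have "((%s. \<tau> (\<Lambda> s x) (P x) (\<Lambda> s v)) has_integral integral {0..1} (%s. \<tau> (\<Lambda> s x) (P x) (\<Lambda> s v))) (cbox 0 1)"
    using integrable_integral[OF True] by simp
   ultimately show ?thesis using M(1) B(1) K(1) by (intro has_integral_bound) simp_all
  next
   case False
   then show ?thesis using M(1) B(1) K(1) by (simp add: not_integrable_integral)
  qed
  then show ?thesis unfolding \<beta>_def by (simp add: mult_ac)
 qed
 have p1: "form1_germ (pullback1 G \<beta>)" by (rule form1_germ_pullback1[OF G G0 hom(1)])
 have p2: "NEAR x. \<forall>u v. \<sigma> x u v = ext_d1 (pullback1 G \<beta>) x u v"
  using ext_d1_pullback1[OF G G0 hom(1)] pullback_cong_form[OF G G0 ed] pullback_compose[OF G G0 \<Psi>(1), of \<sigma>] pullback_id[OF \<Psi>(4), of \<sigma>]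
  by eventually_elim (simp add: \<tau>_def)
 have p3: "\<exists>C\<ge>0. NEAR x. \<bar>pullback1 G \<beta> x v\<bar> \<le> C * norm (H x)" for v
 proof -
  obtain C1 where C1: "C1 > 0" "NEAR x. norm (dd G x v - dd G 0 v) \<le> C1 * norm x"
   by (rule smooth_germ_Lipschitz[OF smooth_germ_dd[OF G]])
  have n1: "NEAR x. dist x 0 < e / K" "\<forall>\<^sub>F x in nhds (0::'n R2n). norm x < 1"
   unfolding eventually_nhds_metric using divide_pos_pos[OF e(1) K(1)] by (blast, auto intro!: exI[of _ 1])
  let ?C = "M * B * K * (C1 + norm (dd G 0 v))"
  have "NEAR x. \<bar>pullback1 G \<beta> x v\<bar> \<le> ?C * norm (H x)"
   using C1(2) n1(2) eventually_compose_0[OF smooth_germ_isCont[OF G] G0 n1(1)]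
  proof eventually_elim
   case (elim x)
   have "norm (dd G x v) \<le> norm (dd G x v - dd G 0 v) + norm (dd G 0 v)" using norm_triangle_sub[of "dd G x v" "dd G 0 v"] by simp
   also have "\<dots> \<le> C1 * 1 + norm (dd G 0 v)"
    using elim(1) mult_left_mono[OF less_imp_le[OF elim(2)] less_imp_le[OF C1(1)]] by linarith
   finally have n: "norm (dd G x v) \<le> C1 + norm (dd G 0 v)" by simp
   have "\<bar>pullback1 G \<beta> x v\<bar> \<le> M * B * K * norm (H x) * norm (dd G x v)"
    unfolding pullback1_def using bb[OF elim(3), of "dd G x v"] by (simp only: DG)
   also have "\<dots> \<le> M * B * K * norm (H x) * (C1 + norm (dd G 0 v))"
    by (rule mult_left_mono[OF n]) (use M(1) B(1) K(1) in auto)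
   finally show ?case by (simp add: mult_ac)
  qed
  then show ?thesis using M(1) B(1) K(1) C1(1) by (intro exI[of _ ?C]) auto
 qed
 show ?thesis by (rule that[OF p1 p2 p3])
qed

section \<open>Taylor expansions along the branches\<close>

lemma Ot_integrate:
 fixes g g' :: "real => real"
 assumes d: "NEAR t. (g has_real_derivative g' t) (at t)" and "g 0 = 0" and O: "Ot k g'"
 shows "Ot (Suc k) g"
proof -
 obtain C where C: "C > 0" "NEAR t. norm (g' t) \<le> C * \<bar>t\<bar> ^ k" using O by (rule OtE)
 obtain e where e: "e > 0" "!!t. dist t 0 < e ==> (g has_real_derivative g' t) (at t) \<and> norm (g' t) \<le> C * \<bar>t\<bar> ^ k"
  using eventually_conj[OF d C(2)] unfolding eventually_nhds_metric by blast
 have "norm (g t) \<le> C * \<bar>t\<bar> ^ Suc k" if t: "dist t 0 < e" for t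
 proof -
  have s: "\<bar>z\<bar> \<le> \<bar>t\<bar>" if "z \<in> closed_segment 0 t" for z using that by (auto simp: closed_segment_eq_real_ivl split: if_splits)
  have "norm (g t - g 0) \<le> C * \<bar>t\<bar> ^ k * norm (t - 0)"
  proof (rule field_differentiable_bound[of "closed_segment 0 t" g g'])
   fix z assume z: "z \<in> closed_segment 0 t"
   then have "dist z 0 < e" using s[OF z] t by (simp add: dist_real_def)
   then show "(g has_field_derivative g' z) (at z within closed_segment 0 t)" using e(2) has_field_derivative_at_within by blast
   have "norm (g' z) \<le> C * \<bar>z\<bar> ^ k" using e(2)[OF \<open>dist z 0 < e\<close>] by blast
   also have "\<dots> \<le> C * \<bar>t\<bar> ^ k" using s[OF z] C(1) by (intro mult_left_mono power_mono) auto
   finally show "norm (g' z) \<le> C * \<bar>t\<bar> ^ k" .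
  qed auto
  then show ?thesis using assms(2) by (simp add: mult_ac)
 qed
 then show ?thesis unfolding Ot_def eventually_nhds_metric using e(1) by blast
qed

text \<open>Each coefficient is isolated in turn: those below it vanish by induction, those above it
  are of higher order.\<close>

lemma Ot_poly_zero:
 assumes "Ot k (%t. \<Sum>i<n. c i * t ^ i)" "j < k" "j < n" shows "c j = (0::real)"
 using assms(2,3)
proof (induction j rule: less_induct)
 case (less j)
 have s: "(\<Sum>i<n. c i * t ^ i) = c j * t ^ j + (\<Sum>i\<in>{j<..<n}. c i * t ^ i)" for t
 proof -
  have e: "{..<j} \<union> {j..<n} = {..<n}" using less.prems by auto
  have "(\<Sum>i\<in>{..<j} \<union> {j..<n}. c i * t ^ i) = (\<Sum>i<j. c i * t ^ i) + (\<Sum>i\<in>{j..<n}. c i * t ^ i)"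
   by (rule sum.union_disjoint) auto
  then have "(\<Sum>i<n. c i * t ^ i) = (\<Sum>i<j. c i * t ^ i) + (\<Sum>i\<in>{j..<n}. c i * t ^ i)" unfolding e .
  also have "(\<Sum>i<j. c i * t ^ i) = 0" by (rule sum.neutral) (use less in auto)
  also have "{j..<n} = insert j {j<..<n}" using less.prems by auto
  finally show ?thesis by simp
 qed
 have "Ot (Suc j) (%t. \<Sum>i\<in>I. c i * t ^ i)" if "finite I" "I \<subseteq> {j<..<n}" for I
  using that by (induction I rule: finite_induct) (auto intro!: Ot_add Ot_power Ot_zero)
 from Ot_diff[OF Ot_mono[OF assms(1), of "Suc j"] this[of "{j<..<n}"]] show ?case
  using less.prems(1) unfolding s by (intro Ot_coeff_zero[of j]) auto
qed

context U7_setting begin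

definition D :: "'n bit0 => ('n R2n => real) => 'n R2n => real" where
 "D i h x = dd h x (E i)"

lemma smooth_D: "smooth_germ h ==> smooth_germ (D i h)"
 unfolding D_def[abs_def] by (rule smooth_germ_dd)

lemma D_commute: "smooth_germ h ==> NEAR x. D i (D j h) x = D j (D i h) x"
 unfolding D_def[abs_def] by (drule smooth_germ_dd_commute) (erule eventually_mono, blast)

lemma D_cong: "NEAR x. f x = g x ==> NEAR x. D i f x = D i g x"
 unfolding D_def by (drule eventually_dd_cong) (erule eventually_mono, simp)

lemma D_commute0: "smooth_germ h ==> D i (D j h) 0 = D j (D i h) 0"
 by (rule eventually_nhds_x_imp_x[OF D_commute])

lemma D_commute00: "smooth_germ h ==> D k (D i (D j h)) 0 = D k (D j (D i h)) 0"
 by (rule eventually_nhds_x_imp_x[OF D_cong[OF D_commute]])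

lemma D_add:
 assumes "smooth_germ g" "smooth_germ q" "smooth_germ r" "NEAR x. f x = g x + q x + r x"
 shows "NEAR x. D i f x = D i g x + D i q x + D i r x"
 using D_cong[OF assms(4), of i] smooth_germ_eventually[OF assms(1)] smooth_germ_eventually[OF assms(2)] smooth_germ_eventually[OF assms(3)]
proof eventually_elim
 case (elim x)
 have "D i (%x. g x + q x + r x) x = D i g x + D i q x + D i r x"
  unfolding D_def using dd_eq[OF has_derivative_add[OF has_derivative_add[OF elim(2,3)] elim(4)]] by simp
 with elim(1) show ?case by simp
qed

lemma b2_derivative:
 assumes "smooth_germ h"
 shows "NEAR t. ((%t. h (b2 t)) has_real_derivative
  3 * t^2 * D 3 h (b2 t) + 4 * t^3 * D 1 h (b2 t) - 5 * t^4 * D 2 h (b2 t)) (at t)"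
 using eventually_compose_0[OF smooth_germ_isCont[OF smooth_b2] b_0(2) smooth_germ_eventually[OF assms]]
proof eventually_elim
 case (elim t)
 have "(b2 has_derivative (%s. (3 * t^2 * s) *\<^sub>R E 3 + (4 * t^3 * s) *\<^sub>R E 1 - (5 * t^4 * s) *\<^sub>R E 2)) (at t)"
  unfolding b2_eq[abs_def] by (auto intro!: derivative_eq_intros simp: algebra_simps)
 note d = has_derivative_compose[OF this elim] and l = has_derivative_linear[OF elim]
 show ?case unfolding has_field_derivative_def D_def
  by (rule has_derivative_eq_rhs[OF d]) (simp add: fun_eq_iff linear_add[OF l] linear_diff[OF l] linear_cmul[OF l] algebra_simps)
qed

lemma b1_derivative:
 assumes "smooth_germ h" shows "NEAR t. ((%t. h (b1 t)) has_real_derivative D 2 h (b1 t)) (at t)"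
 using eventually_compose_0[OF smooth_germ_isCont[OF smooth_b1] b_0(1) smooth_germ_eventually[OF assms]]
proof eventually_elim
 case (elim t)
 have "(b1 has_derivative (%s. s *\<^sub>R E 2)) (at t)"
  unfolding b1_eq[abs_def] by (auto intro!: derivative_eq_intros)
 note d = has_derivative_compose[OF this elim] and l = has_derivative_linear[OF elim]
 show ?case unfolding has_field_derivative_def D_def
  by (rule has_derivative_eq_rhs[OF d]) (simp add: fun_eq_iff linear_cmul[OF l] mult.commute)
qed

text \<open>Along b2 the derivative of h combines the partial derivatives with factors t^2, t^3,
  t^4, so knowing these to order m determines h to order m + 3. R is the claimed expansion; its
  derivative need only agree modulo t^(m+2).\<close>

lemma expand_step:
 assumes h: "smooth_germ h" and P: "Ot m (%t. D 3 h (b2 t) - P3 t)" "Ot m (%t. D 1 h (b2 t) - P1 t)" "Ot m (%t. D 2 h (b2 t) - P2 t)"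
  and R: "!!t. (R has_real_derivative R' t) (at t)" "R 0 = h 0"
  and R': "Ot (2 + m) (%t. (3 * t^2 * P3 t + 4 * t^3 * P1 t - 5 * t^4 * P2 t) - R' t)"
 shows "Ot (3 + m) (%t. h (b2 t) - R t)"
proof -
 have d: "NEAR t. ((%t. h (b2 t) - R t) has_real_derivative
  (3 * t^2 * D 3 h (b2 t) + 4 * t^3 * D 1 h (b2 t) - 5 * t^4 * D 2 h (b2 t)) - R' t) (at t)"
  using b2_derivative[OF h] by eventually_elim (rule DERIV_diff[OF _ R(1)])
 have "Ot (2 + m) (%t. 3 * t^2 * (D 3 h (b2 t) - P3 t) + 4 * t^3 * (D 1 h (b2 t) - P1 t) - 5 * t^4 * (D 2 h (b2 t) - P2 t)
   + ((3 * t^2 * P3 t + 4 * t^3 * P1 t - 5 * t^4 * P2 t) - R' t))"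
  by (intro Ot_add Ot_diff R' Ot_mult P Ot_power) auto
 then have "Ot (2 + m) (%t. (3 * t^2 * D 3 h (b2 t) + 4 * t^3 * D 1 h (b2 t) - 5 * t^4 * D 2 h (b2 t)) - R' t)"
  by (rule Ot_cong) (simp add: algebra_simps)
 from Ot_integrate[OF d _ this] show ?thesis using R(2) by (simp add: numeral_3_eq_3)
qed

lemma expand_3: "smooth_germ h ==> Ot 3 (%t. h (b2 t) - h 0)"
 by (rule Ot_smooth_1[OF _ smooth_germ_isCont[OF smooth_b2] b_0(2) Ot_b2])

lemma expand_6:
 assumes h: "smooth_germ h" shows "Ot 6 (%t. h (b2 t) - (h 0 + D 3 h 0 * t^3 + D 1 h 0 * t^4 - D 2 h 0 * t^5))"
proof -
 have "Ot (3 + 3) (%t. h (b2 t) - (h 0 + D 3 h 0 * t^3 + D 1 h 0 * t^4 - D 2 h 0 * t^5))"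
 proof (rule expand_step[OF h expand_3[OF smooth_D[OF h]] expand_3[OF smooth_D[OF h]] expand_3[OF smooth_D[OF h]]])
  show "((%t. h 0 + D 3 h 0 * t^3 + D 1 h 0 * t^4 - D 2 h 0 * t^5) has_real_derivative 3 * t^2 * D 3 h 0 + 4 * t^3 * D 1 h 0 - 5 * t^4 * D 2 h 0) (at t)" for t
   by (auto intro!: derivative_eq_intros)
 qed (simp_all add: Ot_zero)
 then show ?thesis by simp
qed

lemma expand_9:
 assumes h: "smooth_germ h"
 shows "Ot 9 (%t. h (b2 t) - (h 0 + D 3 h 0 * t^3 + D 1 h 0 * t^4 - D 2 h 0 * t^5 + D 3 (D 3 h) 0 / 2 * t^6 + D 3 (D 1 h) 0 * t^7
   + (D 1 (D 1 h) 0 / 2 - D 3 (D 2 h) 0) * t^8))"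
proof -
 have c: "D 1 (D 3 h) 0 = D 3 (D 1 h) 0" "D 2 (D 3 h) 0 = D 3 (D 2 h) 0" by (rule D_commute0[OF h])+
 let ?c8 = "D 1 (D 1 h) 0 / 2 - D 3 (D 2 h) 0"
 let ?R = "%t. h 0 + D 3 h 0 * t^3 + D 1 h 0 * t^4 - D 2 h 0 * t^5 + D 3 (D 3 h) 0 / 2 * t^6 + D 3 (D 1 h) 0 * t^7 + ?c8 * t^8"
 let ?P = "%h t. h 0 + D 3 h 0 * t^3 + D 1 h 0 * t^4 - D 2 h 0 * t^5"
 let ?R' = "%t. 3 * D 3 h 0 * t^2 + 4 * D 1 h 0 * t^3 - 5 * D 2 h 0 * t^4 + 3 * D 3 (D 3 h) 0 * t^5 + 7 * D 3 (D 1 h) 0 * t^6 + 8 * ?c8 * t^7"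
 have "Ot (3 + 6) (%t. h (b2 t) - ?R t)"
 proof (rule expand_step[OF h expand_6[OF smooth_D[OF h]] expand_6[OF smooth_D[OF h]] expand_6[OF smooth_D[OF h]]])
  show "(?R has_real_derivative ?R' t) (at t)" for t
   by (auto intro!: derivative_eq_intros simp: algebra_simps)
  have "Ot (2 + 6) (%t. (- 4 * D 2 (D 1 h) 0 - 5 * D 1 (D 2 h) 0) * t^8 + 5 * D 2 (D 2 h) 0 * t^9)"
   by (intro Ot_add Ot_power) auto
  then show "Ot (2 + 6) (%t. (3 * t^2 * ?P (D 3 h) t + 4 * t^3 * ?P (D 1 h) t - 5 * t^4 * ?P (D 2 h) t) - ?R' t)"
   by (rule Ot_cong) (simp add: c algebra_simps power_numeral_reduce)
 qed simp
 then show ?thesis by simp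
qed

text \<open>Entry i of the list is the coefficient of t^i, to which exactly the monomials in x1, x2,
  x3 of weight i contribute; mixed partials are reordered to a common form.\<close>

lemma expand_12:
 assumes h: "smooth_germ h"
 shows "Ot 12 (%t. h (b2 t) - (\<Sum>i<12. [h 0, 0, 0, D 3 h 0, D 1 h 0, - D 2 h 0, D 3 (D 3 h) 0 / 2, D 3 (D 1 h) 0,
   D 1 (D 1 h) 0 / 2 - D 3 (D 2 h) 0, D 3 (D 3 (D 3 h)) 0 / 6 - D 2 (D 1 h) 0, D 3 (D 3 (D 1 h)) 0 / 2 + D 2 (D 2 h) 0 / 2,
   D 3 (D 1 (D 1 h)) 0 / 2 - D 3 (D 3 (D 2 h)) 0 / 2] ! i * t ^ i))"
proof -
 have c: "D 1 (D 3 h) 0 = D 3 (D 1 h) 0" "D 2 (D 3 h) 0 = D 3 (D 2 h) 0" "D 1 (D 2 h) 0 = D 2 (D 1 h) 0" by (rule D_commute0[OF h])+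
 have c3: "D 3 (D 1 (D 3 h)) 0 = D 3 (D 3 (D 1 h)) 0" "D 3 (D 2 (D 3 h)) 0 = D 3 (D 3 (D 2 h)) 0" by (rule D_commute00[OF h])+
 have "D 1 (D 1 (D 3 h)) 0 = D 1 (D 3 (D 1 h)) 0" by (rule D_commute00[OF h])
 also have "\<dots> = D 3 (D 1 (D 1 h)) 0" by (rule D_commute0[OF smooth_D[OF h]])
 finally have c4: "D 1 (D 1 (D 3 h)) 0 = D 3 (D 1 (D 1 h)) 0" .
 let ?c9 = "D 3 (D 3 (D 3 h)) 0 / 6 - D 2 (D 1 h) 0" and ?c10 = "D 3 (D 3 (D 1 h)) 0 / 2 + D 2 (D 2 h) 0 / 2"
  and ?c11 = "D 3 (D 1 (D 1 h)) 0 / 2 - D 3 (D 3 (D 2 h)) 0 / 2" and ?c8 = "D 1 (D 1 h) 0 / 2 - D 3 (D 2 h) 0"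
 let ?R = "%t. h 0 + D 3 h 0 * t^3 + D 1 h 0 * t^4 - D 2 h 0 * t^5 + D 3 (D 3 h) 0 / 2 * t^6 + D 3 (D 1 h) 0 * t^7
   + ?c8 * t^8 + ?c9 * t^9 + ?c10 * t^10 + ?c11 * t^11"
 let ?P = "%h t. h 0 + D 3 h 0 * t^3 + D 1 h 0 * t^4 - D 2 h 0 * t^5 + D 3 (D 3 h) 0 / 2 * t^6 + D 3 (D 1 h) 0 * t^7
   + (D 1 (D 1 h) 0 / 2 - D 3 (D 2 h) 0) * t^8"
 let ?R' = "%t. 3 * D 3 h 0 * t^2 + 4 * D 1 h 0 * t^3 - 5 * D 2 h 0 * t^4
    + 3 * D 3 (D 3 h) 0 * t^5 + 7 * D 3 (D 1 h) 0 * t^6 + 8 * ?c8 * t^7 + 9 * ?c9 * t^8 + 10 * ?c10 * t^9 + 11 * ?c11 * t^10"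
 have "Ot (3 + 9) (%t. h (b2 t) - ?R t)"
 proof (rule expand_step[OF h expand_9[OF smooth_D[OF h]] expand_9[OF smooth_D[OF h]] expand_9[OF smooth_D[OF h]]])
  show "(?R has_real_derivative ?R' t) (at t)" for t
   by (auto intro!: derivative_eq_intros simp: algebra_simps)
  have "Ot (2 + 9) (%t. (4 * (D 1 (D 1 (D 1 h)) 0 / 2 - D 3 (D 2 (D 1 h)) 0) - 5 * D 3 (D 1 (D 2 h)) 0) * t^11
    - 5 * (D 1 (D 1 (D 2 h)) 0 / 2 - D 3 (D 2 (D 2 h)) 0) * t^12)"
   by (intro Ot_diff Ot_power) auto
  then show "Ot (2 + 9) (%t. (3 * t^2 * ?P (D 3 h) t + 4 * t^3 * ?P (D 1 h) t - 5 * t^4 * ?P (D 2 h) t) - ?R' t)"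
   by (rule Ot_cong) (simp add: c c3 c4 algebra_simps power_numeral_reduce)
 qed simp
 then show ?thesis by (rule Ot_cong[OF Ot_mono]) (simp_all add: numeral_eq_Suc)
qed

text \<open>Order k annihilates the coefficients of t^i with i < k. The thresholds 6, 8, 9, 11, 12
  thus release those up to t^5, t^7, t^8, t^10, t^11; \<open>min k 12\<close> is due to the length
  of the expansion.\<close>

lemma b2_coefficients:
 assumes h: "smooth_germ h" and O: "Ot k (%t. h (b2 t))"
 shows "6 \<le> k ==> i \<in> {1, 2, 3} ==> D i h 0 = 0" and "8 \<le> k ==> D 3 (D 3 h) 0 = 0 \<and> D 3 (D 1 h) 0 = 0"
  and "9 \<le> k ==> D 1 (D 1 h) 0 = 2 * D 3 (D 2 h) 0"
  and "11 \<le> k ==> D 3 (D 3 (D 3 h)) 0 = 6 * D 2 (D 1 h) 0 \<and> D 3 (D 3 (D 1 h)) 0 = - D 2 (D 2 h) 0"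
  and "12 \<le> k ==> D 3 (D 1 (D 1 h)) 0 = D 3 (D 3 (D 2 h)) 0"
proof -
 let ?c = "%i. [h 0, 0, 0, D 3 h 0, D 1 h 0, - D 2 h 0, D 3 (D 3 h) 0 / 2, D 3 (D 1 h) 0,
   D 1 (D 1 h) 0 / 2 - D 3 (D 2 h) 0, D 3 (D 3 (D 3 h)) 0 / 6 - D 2 (D 1 h) 0, D 3 (D 3 (D 1 h)) 0 / 2 + D 2 (D 2 h) 0 / 2,
   D 3 (D 1 (D 1 h)) 0 / 2 - D 3 (D 3 (D 2 h)) 0 / 2] ! i"
 have "Ot (min k 12) (%t. h (b2 t) - (h (b2 t) - (\<Sum>i<12. ?c i * t ^ i)))"
  by (rule Ot_diff[OF Ot_mono[OF O] Ot_mono[OF expand_12[OF h]]]) auto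
 then have "Ot (min k 12) (%t. \<Sum>i<12. ?c i * t ^ i)" by simp
 note z = Ot_poly_zero[OF this]
 show "D i h 0 = 0" if "6 \<le> k" "i \<in> {1, 2, 3}" using z[of 3] z[of 4] z[of 5] that by auto
 show "D 3 (D 3 h) 0 = 0 \<and> D 3 (D 1 h) 0 = 0" if "8 \<le> k" using z[of 6] z[of 7] that by simp
 show "D 1 (D 1 h) 0 = 2 * D 3 (D 2 h) 0" if "9 \<le> k" using z[of 8] that by simp
 show "D 3 (D 3 (D 3 h)) 0 = 6 * D 2 (D 1 h) 0 \<and> D 3 (D 3 (D 1 h)) 0 = - D 2 (D 2 h) 0" if "11 \<le> k" using z[of 9] z[of 10] that by simp
 show "D 3 (D 1 (D 1 h)) 0 = D 3 (D 3 (D 2 h)) 0" if "12 \<le> k" using z[of 11] that by simp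
qed

lemma b1_coefficient:
 assumes h: "smooth_germ h" and O: "Ot 3 (%t. h (b1 t))" shows "D 2 (D 2 h) 0 = 0"
proof -
 have 1: "Ot 1 (%t. g (b1 t) - g 0)" if "smooth_germ g" for g :: "'n R2n => real"
  by (rule Ot_smooth_1[OF that smooth_germ_isCont[OF smooth_b1] b_0(1) Ot_b1])
 have 2: "Ot 2 (%t. g (b1 t) - (g 0 + D 2 g 0 * t))" if g: "smooth_germ g" for g
 proof -
  have "NEAR t. ((%t. g (b1 t) - (g 0 + D 2 g 0 * t)) has_real_derivative D 2 g (b1 t) - D 2 g 0) (at t)"
   using b1_derivative[OF g] by eventually_elim (auto intro!: derivative_eq_intros)
  from Ot_integrate[OF this _ 1[OF smooth_D[OF g]]] show ?thesis by (simp add: numeral_2_eq_2)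
 qed
 have "NEAR t. ((%t. h (b1 t) - (h 0 + D 2 h 0 * t + D 2 (D 2 h) 0 / 2 * t^2)) has_real_derivative
   D 2 h (b1 t) - (D 2 h 0 + D 2 (D 2 h) 0 * t)) (at t)"
  using b1_derivative[OF h] by eventually_elim (auto intro!: derivative_eq_intros)
 from Ot_integrate[OF this _ 2[OF smooth_D[OF h]]]
 have "Ot 3 (%t. h (b1 t) - (h 0 + D 2 h 0 * t + D 2 (D 2 h) 0 / 2 * t^2))" by (simp add: eval_nat_numeral)
 from Ot_diff[OF O this] have "Ot 3 (%t. \<Sum>i<3. [h 0, D 2 h 0, D 2 (D 2 h) 0 / 2] ! i * t ^ i)"
  by (simp add: numeral_eq_Suc add.assoc)
 from Ot_poly_zero[OF this, of 2] show ?thesis by simp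
qed

end

section \<open>Lagrangian tangency orders\<close>

context U7_setting begin

lemma b_U7: "b1 t \<in> U7" "b2 t \<in> U7"
 unfolding U7_branches by blast+

lemma eventually_b2: "NEAR x. P x ==> NEAR t. P (b2 t)"
 by (rule eventually_compose_0[OF smooth_germ_isCont[OF smooth_b2] b_0(2)])

lemma eventually_b1: "NEAR x. P x ==> NEAR t. P (b1 t)"
 by (rule eventually_compose_0[OF smooth_germ_isCont[OF smooth_b1] b_0(1)])

text \<open>A function vanishing on U7 has every order along b2. This makes the part \<alpha> of a
  null form disappear from the coefficients that are compared.\<close>

lemma D_vanishing:
 assumes "smooth_germ h" "NEAR x. x \<in> U7 --> h x = 0"
 shows "i \<in> {1, 2, 3} ==> D i h 0 = 0" "D 3 (D 3 h) 0 = 0" "D 3 (D 1 h) 0 = 0"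
proof -
 have "Ot 12 (%t. h (b2 t))" by (rule Ot_cong[OF Ot_zero]) (use eventually_b2[OF assms(2)] in eventually_elim, simp add: b_U7)
 note b2_coefficients[OF assms(1) this]
 then show "i \<in> {1, 2, 3} ==> D i h 0 = 0" "D 3 (D 3 h) 0 = 0" "D 3 (D 1 h) 0 = 0" by simp_all
qed

text \<open>Let \<sigma> = d\<mu> with \<mu> of the order of H, and \<sigma> - \<Theta> = \<alpha> +
  d\<beta> with \<alpha> and \<beta> zero on U7. Then d(\<mu> - \<beta>) = \<Theta> + \<alpha>, and
  the components l of \<mu> - \<beta> vanish along the branches to the order of H. This constrains
  their Taylor coefficients at 0, from whose curl the coefficients of \<Theta> are read off. Contact
  3 with B1 makes the second x2-derivatives vanish, which enter the coefficient of t^10 along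
  b2.\<close>

lemma order_bound:
 fixes \<sigma> :: "'n R2n form2"
 assumes \<sigma>: "form2_germ \<sigma>" "closed_germ \<sigma>" and AN: "AN (%x u v. \<sigma> x u v - \<Theta> 0 0 0 a4 a5 a6 a7 x u v)"
  and H: "lagrangian_eqs \<sigma> H" and O2: "Ot k (%t. H (b2 t))"
 shows "8 \<le> k ==> a4 = 0" and "9 \<le> k ==> a5 = 0"
  and "11 \<le> k ==> Ot 3 (%t. H (b1 t)) ==> a6 = 0" and "12 \<le> k ==> Ot 3 (%t. H (b1 t)) ==> a7 = 0"
proof -
 obtain \<alpha> \<beta> where a: "form2_germ \<alpha>" "form1_germ \<beta>" "NEAR x. x \<in> U7 --> (\<forall>u v. \<alpha> x u v = 0)"
  "NEAR x. x \<in> U7 --> (\<forall>u. \<beta> x u = 0)"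
  "NEAR x. \<forall>u v. \<sigma> x u v - \<Theta> 0 0 0 a4 a5 a6 a7 x u v = \<alpha> x u v + ext_d1 \<beta> x u v"
  by (rule alg_nullE[OF AN]) (rule that)
 obtain \<mu> where l: "form1_germ \<mu>" "NEAR x. \<forall>u v. \<sigma> x u v = ext_d1 \<mu> x u v"
  "!!v. \<exists>C\<ge>0. NEAR x. \<bar>\<mu> x v\<bar> \<le> C * norm (H x)"
  by (rule lagrangian_primitive[OF \<sigma> H]) (rule that)
 define l where "l i x = \<mu> x (E i) - \<beta> x (E i)" for i x
 have sl: "smooth_germ (l i)" for i unfolding l_def[abs_def] by (intro smooth_germ_diff form1_germ_smooth l(1) a(2))
 have Ol: "Ot m (%t. l i (b t))" if O: "Ot m (%t. H (b t))" and b: "!!P. NEAR x. P x ==> NEAR t. P (b t)" "!!t. b t \<in> U7"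
  for m i b
 proof -
  obtain C where C: "C \<ge> 0" "NEAR x. \<bar>\<mu> x (E i)\<bar> \<le> C * norm (H x)" using l(3) by blast
  obtain K where K: "NEAR t. norm (H (b t)) \<le> K * \<bar>t\<bar> ^ m" using O unfolding Ot_def by blast
  show ?thesis
  proof (rule OtI[of _ "C * K"])
   show "NEAR t. norm (l i (b t)) \<le> C * K * \<bar>t\<bar> ^ m" using b(1)[OF C(2)] K b(1)[OF a(4)]
   proof eventually_elim
    case (elim t)
    have "C * norm (H (b t)) \<le> C * (K * \<bar>t\<bar> ^ m)" using elim C(1) by (simp add: mult_left_mono)
    then show ?case using elim b(2) by (simp add: l_def mult.assoc)
   qed
  qed
 qed
 have O2l: "Ot k (%t. l i (b2 t))" for i by (rule Ol[OF O2 eventually_b2 b_U7(2)])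
 define \<phi> where "\<phi> i j x = \<alpha> x (E i) (E j)" for i j x
 define Q where "Q i j x = \<Theta> 0 0 0 a4 a5 a6 a7 x (E i) (E j)" for i j x
 have s\<phi>: "smooth_germ (\<phi> i j)" for i j unfolding \<phi>_def[abs_def] by (rule form2_germ_smooth[OF a(1)])
 have sQ: "smooth_germ (Q i j)" for i j unfolding Q_def[abs_def] by (rule form2_germ_smooth[OF form2_germ_\<Theta>])
 have "NEAR x. x \<in> U7 --> \<phi> i j x = 0" for i j using a(3) unfolding \<phi>_def by eventually_elim blast
 note \<phi>0 = D_vanishing[OF s\<phi> this]
 \<comment> \<open>The (i, j) component of d(\<mu> - \<beta>) = \<Theta> + \<alpha>.\<close>
 have R: "NEAR x. D i (l j) x = D j (l i) x + Q i j x + \<phi> i j x" for i j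
  using l(2) a(5) form1_germ_derivative[OF l(1)] form1_germ_derivative[OF a(2)]
 proof eventually_elim
  case (elim x)
  have d: "D i (l j) x = dd (%y. \<mu> y (E j)) x (E i) - dd (%y. \<beta> y (E j)) x (E i)" for i j
   unfolding D_def l_def[abs_def] using dd_eq[OF has_derivative_diff[OF spec[OF elim(3)] spec[OF elim(4)]]] by simp
  have 1: "\<sigma> x (E i) (E j) = ext_d1 \<mu> x (E i) (E j)" using elim(1) by blast
  have 2: "\<sigma> x (E i) (E j) - Q i j x = \<phi> i j x + ext_d1 \<beta> x (E i) (E j)" unfolding Q_def \<phi>_def using elim(2) by blast
  show ?case using 1 2 unfolding d ext_d1_def by linarith
 qed
 note R1 = D_add[OF smooth_D[OF sl] sQ s\<phi> R]
 note R2 = D_add[OF smooth_D[OF smooth_D[OF sl]] smooth_D[OF sQ] smooth_D[OF s\<phi>] R1]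
 note at0 = eventually_nhds_x_imp_x
 have Q: "Q 1 3 = (%x. a4 * x $ 3 + a5 * x $ 1 + a6 * (x $ 3 * x $ 3) + a7 * (x $ 1 * x $ 3))"
  "Q 2 3 = (%x. 0)" "Q 1 2 = (%x. 0)"
  using dist by (auto simp: Q_def \<Theta>_def dxdx_def axis_def power2_eq_square fun_eq_iff)
 note n = has_derivative_nth
 have Qd: "(Q 1 3 has_derivative (%v. a4 * v $ 3 + a5 * v $ 1 + a6 * (x $ 3 * v $ 3 + v $ 3 * x $ 3) + a7 * (x $ 1 * v $ 3 + v $ 1 * x $ 3))) (at x)" for x
  unfolding Q by (intro has_derivative_add has_derivative_mult_right has_derivative_mult n)
 have Q1: "D 3 (Q 1 3) = (%x. a4 + 2 * a6 * x $ 3 + a7 * x $ 1)" "D 1 (Q 1 3) = (%x. a5 + a7 * x $ 3)"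
  unfolding D_def dd_eq[OF Qd] using dist by (auto simp: axis_def)
 have Q2: "D 3 (D 3 (Q 1 3)) 0 = 2 * a6" "D 3 (D 1 (Q 1 3)) 0 = a7"
 proof -
  have "((%x. a4 + 2 * a6 * x $ 3 + a7 * x $ 1) has_derivative (%v. 0 + 2 * a6 * v $ 3 + a7 * v $ 1)) (at (0::'n R2n))"
   "((%x. a5 + a7 * x $ 3) has_derivative (%v. 0 + a7 * v $ 3)) (at (0::'n R2n))"
   by (intro has_derivative_add has_derivative_const has_derivative_mult_right n)+
  from this[THEN dd_eq] show "D 3 (D 3 (Q 1 3)) 0 = 2 * a6" "D 3 (D 1 (Q 1 3)) 0 = a7"
   unfolding Q1 D_def using dist by (auto simp: axis_def)
 qed
 have Q0: "D i (%x. 0) = (%x. 0)" for i unfolding D_def by simp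
 note c = b2_coefficients[OF sl O2l]
 \<comment> \<open>In the x3-derivative of relation (1, 3) both second derivatives of the components
   vanish at order 8, leaving a4.\<close>
 show "a4 = 0" if "8 \<le> k"
  using at0[OF R1[of 3 1 3]] c(2)[OF that, of 3] c(2)[OF that, of 1] \<phi>0(1)[of 3 1 3] by (simp add: Q1)
 \<comment> \<open>Relation (1, 3) is differentiated in x1. Order 9 expresses D1 D1 l3 by D3 D2 l3,
   which relation (2, 3) equates with D3 D3 l2 = 0.\<close>
 show "a5 = 0" if k: "9 \<le> k"
 proof -
  have 8: "8 \<le> k" using k by simp
  have "D 3 (D 2 (l 3)) 0 = 0" using at0[OF R1[of 3 2 3]] c(2)[OF 8, of 2] \<phi>0(1)[of 3 2 3] by (simp add: Q Q0)
  then show ?thesis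
   using at0[OF R1[of 1 1 3]] c(3)[OF k, of 3] D_commute0[OF sl, of 1 3 1] c(2)[OF 8, of 1] \<phi>0(1)[of 1 1 3] by (simp add: Q1)
 qed
 assume O1: "Ot 3 (%t. H (b1 t))"
 have z: "D 2 (D 2 (l i)) 0 = 0" for i by (rule b1_coefficient[OF sl Ol[OF O1 eventually_b1 b_U7(1)]])
 \<comment> \<open>Relation (1, 3), differentiated twice in x3, gives 2 a6 = 0 once D2 D2 l3 and D2
   D1 l1 vanish; the latter follows from the contact with B1 through relations (2, 3) and (1,
   2).\<close>
 show "a6 = 0" if k: "11 \<le> k"
 proof -
  have 9: "9 \<le> k" using k by simp
  have "D 3 (D 2 (l 2)) 0 = 0" using at0[OF R1[of 2 2 3]] z[of 3] D_commute0[OF sl, of 2 3 2] \<phi>0(1)[of 2 2 3] by (simp add: Q Q0)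
  then have "D 2 (D 1 (l 1)) 0 = 0"
   using at0[OF R1[of 1 1 2]] D_commute0[OF sl, of 1 2 1] c(3)[OF 9, of 2] \<phi>0(1)[of 1 1 2] by (simp add: Q Q0)
  then show ?thesis using at0[OF R2[of 3 3 1 3]] c(4)[OF k, of 3] c(4)[OF k, of 1] z[of 3] \<phi>0(2)[of 1 3] by (simp add: Q2)
 qed
 \<comment> \<open>Relation (1, 3) is differentiated in x1 and x3. Order 12 replaces D3 D1 D1 l3 by
   D3 D3 D2 l3, which relation (2, 3) and order 11 reduce to D2 D1 l2, and this vanishes by relation
   (1, 2).\<close>
 show "a7 = 0" if k: "12 \<le> k"
 proof -
  have 11: "11 \<le> k" using k by simp
  have "D 2 (D 1 (l 2)) 0 = 0" using at0[OF R1[of 2 1 2]] z[of 1] \<phi>0(1)[of 2 1 2] by (simp add: Q Q0)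
  then have "D 3 (D 3 (D 2 (l 3))) 0 = 0" using at0[OF R2[of 3 3 2 3]] c(4)[OF 11, of 2] \<phi>0(2)[of 2 3] by (simp add: Q Q0)
  moreover have "D 3 (D 1 (D 3 (l 1))) 0 = 0" using D_commute00[OF sl, of 3 1 3 1] c(4)[OF 11, of 1] z[of 1] by simp
  ultimately show ?thesis using at0[OF R2[of 3 1 1 3]] c(5)[OF k, of 3] \<phi>0(3)[of 1 3] by (simp add: Q2)
 qed
qed

end

section \<open>Vanishing orders as growth bounds\<close>

lemma smooth_germ_deriv:
 fixes g :: "real => real"
 assumes "smooth_germ g"
 shows "NEAR t. (g has_real_derivative deriv g t) (at t)" "smooth_germ (deriv g)"
proof -
 have 1: "NEAR t. (g has_real_derivative dd g t 1) (at t)"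
  using smooth_germ_eventually[OF assms]
 proof eventually_elim
  case (elim t)
  have "dd g t v = dd g t 1 * v" for v
   using linear_cmul[OF has_derivative_linear[OF elim], of v 1] by (simp add: mult.commute)
  then have "dd g t = (*) (dd g t 1)" by (intro ext)
  from has_derivative_eq_rhs[OF elim this] show ?case unfolding has_field_derivative_def .
 qed
 show "NEAR t. (g has_real_derivative deriv g t) (at t)"
  using 1 by eventually_elim (simp add: DERIV_imp_deriv)
 show "smooth_germ (deriv g)"
  by (rule smooth_germ_cong[OF smooth_germ_dd[OF assms, of 1]]) (use 1 in eventually_elim, simp add: DERIV_imp_deriv)
qed

lemma Ot_Taylor:
 fixes g :: "real => real"
 shows "smooth_germ g ==> Ot k (%t. g t - (\<Sum>i<k. (deriv ^^ i) g 0 / fact i * t ^ i))"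
proof (induction k arbitrary: g)
 case 0
 obtain C where "C > 0" and C: "NEAR x. norm (g x - g 0) \<le> C * norm x" by (rule smooth_germ_Lipschitz[OF 0])
 have "Ot 1 (%t. g t - g 0)" by (rule OtI[of _ C]) (use C in simp)
 from Ot_add[OF Ot_mono[OF this, of 0] Ot_power[of 0 0 "g 0"]] show ?case by simp
next
 case (Suc k)
 note d = smooth_germ_deriv[OF Suc.prems]
 let ?c = "%i. (deriv ^^ i) (deriv g) 0"
 have s: "(\<Sum>i<Suc k. (deriv ^^ i) g 0 / fact i * t ^ i) = g 0 + (\<Sum>i<k. ?c i / fact (Suc i) * t ^ Suc i)" for t :: real
  unfolding sum.lessThan_Suc_shift by (simp add: funpow_Suc_right del: funpow.simps)
 have p: "((%t. ?c i / fact (Suc i) * t ^ Suc i) has_real_derivative ?c i / fact i * t ^ i) (at t)" for i and t :: real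
 proof -
  have "?c i / fact (Suc i) * (real (Suc i) * t ^ i) = ?c i / fact i * t ^ i"
   by (simp only: fact_Suc) (simp del: of_nat_Suc)
  moreover have "((%t. t ^ Suc i) has_real_derivative real (Suc i) * t ^ i) (at t)"
   using DERIV_pow[of "Suc i" t UNIV] by simp
  ultimately show ?thesis using DERIV_cmult[of "%t. t ^ Suc i" "real (Suc i) * t ^ i" t UNIV "?c i / fact (Suc i)"] by simp
 qed
 have "NEAR t. ((%t. g t - (g 0 + (\<Sum>i<k. ?c i / fact (Suc i) * t ^ Suc i))) has_real_derivative
   deriv g t - (\<Sum>i<k. ?c i / fact i * t ^ i)) (at t)"
  using d(1)
 proof eventually_elim
  case (elim t)
  have "((%t. g 0 + (\<Sum>i<k. ?c i / fact (Suc i) * t ^ Suc i)) has_real_derivative 0 + (\<Sum>i<k. ?c i / fact i * t ^ i)) (at t)"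
   by (intro DERIV_add DERIV_const DERIV_sum p)
  from DERIV_diff[OF elim this] show ?case by simp
 qed
 from Ot_integrate[OF this _ Suc.IH[OF d(2)]] show ?case unfolding s by simp
qed

text \<open>Taylor's formula translates derivatives at 0 into growth bounds; testing against every
  finite k also covers the value \<infinity>.\<close>

lemma vanishing_order_ge:
 assumes "smooth_germ g" shows "enat k \<le> vanishing_order g \<longleftrightarrow> Ot k g"
proof -
 let ?c = "%i. (deriv ^^ i) g 0 / fact i"
 have "enat k \<le> vanishing_order g \<longleftrightarrow> (\<forall>j. (deriv ^^ j) g 0 \<noteq> 0 --> k \<le> j)"
  unfolding vanishing_order_def le_Inf_iff by auto
 also have "\<dots> \<longleftrightarrow> (\<forall>j<k. ?c j = 0)" by (auto simp: not_less[symmetric])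
 also have "\<dots> \<longleftrightarrow> Ot k g"
 proof
  assume "\<forall>j<k. ?c j = 0"
  then have "(\<Sum>i<k. ?c i * t ^ i) = 0" for t by (intro sum.neutral) auto
  then show "Ot k g" using Ot_Taylor[OF assms, of k] by simp
 next
  assume "Ot k g"
  from Ot_diff[OF this Ot_Taylor[OF assms, of k]] have "Ot k (%t. \<Sum>i<k. ?c i * t ^ i)" by simp
  then show "\<forall>j<k. ?c j = 0" using Ot_poly_zero[of k ?c k] by blast
 qed
 finally show ?thesis .
qed

lemma tangency_order_ge:
 fixes H :: "real ^ 'n::finite bit0 => real ^ 'n"
 assumes "smooth_germ (%t. H (f t))" shows "enat k \<le> tangency_order f H \<longleftrightarrow> Ot k (%t. H (f t))"
proof -
 have "enat k \<le> tangency_order f H \<longleftrightarrow> (\<forall>j. Ot k (%t. H (f t) $ j))"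
  unfolding tangency_order_def
  by (subst Min_ge_iff) (auto simp: vanishing_order_ge[OF smooth_germ_bounded_linear[OF bounded_linear_vec_nth assms]])
 also have "\<dots> \<longleftrightarrow> Ot k (%t. H (f t))"
 proof
  assume a: "\<forall>j. Ot k (%t. H (f t) $ j)"
  have o: "Ot k (%t. H (f t) $ j *\<^sub>R axis j (1::real))" for j
   by (rule Ot_bound[OF spec[OF a, of j], of _ 1]) simp_all
  have "Ot k (%t. \<Sum>j\<in>J. H (f t) $ j *\<^sub>R axis j (1::real))" if "finite J" for J :: "'n set"
   using that
  proof (induction J rule: finite_induct)
   case (insert j J)
   show ?case unfolding sum.insert[OF insert(1,2)] by (rule Ot_add[OF o insert(3)])
  qed (simp add: Ot_zero)
  from this[OF finite[of UNIV]] show "Ot k (%t. H (f t))"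
   by (rule Ot_cong) (simp add: basis_expansion[of "H _", unfolded scalar_mult_eq_scaleR] always_eventually)
 qed (rule allI, rule Ot_nth)
 finally show ?thesis .
qed

section \<open>Lagrangian germs with prescribed contact\<close>

context U7_setting begin

text \<open>Nondegeneracy is asked at 0, the form in which the linear algebra and Moser's method use
  it.\<close>

definition symp :: "'n R2n form2 => bool" where
 "symp \<sigma> \<longleftrightarrow> form2_germ \<sigma> \<and> closed_germ \<sigma> \<and> (\<forall>u. u \<noteq> 0 --> (\<exists>v. \<sigma> 0 u v \<noteq> 0))"

lemma symp_pullback:
 assumes "symp \<sigma>" and \<Phi>: "smooth_germ \<Phi>" "\<Phi> 0 = 0" "inj (dd \<Phi> 0)" shows "symp (pullback \<Phi> \<sigma>)"
proof -
 have s: "form2_germ \<sigma>" "closed_germ \<sigma>" "!!u. u \<noteq> 0 ==> \<exists>v. \<sigma> 0 u v \<noteq> 0" using assms(1) unfolding symp_def by blast+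
 have l: "linear (dd \<Phi> 0)" by (rule has_derivative_linear[OF smooth_germ_has_derivative_0[OF \<Phi>(1)]])
 have "\<exists>v. pullback \<Phi> \<sigma> 0 u v \<noteq> 0" if u: "u \<noteq> 0" for u
 proof -
  have "dd \<Phi> 0 u \<noteq> 0" using injD[OF \<Phi>(3), of u 0] u linear_0[OF l] by auto
  then obtain w where w: "\<sigma> 0 (dd \<Phi> 0 u) w \<noteq> 0" using s(3) by blast
  obtain v where "w = dd \<Phi> 0 v" using linear_injective_imp_surjective[OF l \<Phi>(3)] by (metis surjD)
  with w show ?thesis unfolding pullback_def \<Phi>(2) by blast
 qed
 then show ?thesis unfolding symp_def
  using form2_germ_pullback[OF \<Phi>(1,2) s(1)] closed_germ_pullback[OF \<Phi>(1,2) s(1,2)] by blast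
qed

text \<open>The part \<alpha> vanishes at 0, and d\<beta> at 0 on W consists of first derivatives
  along W of functions vanishing on U7, which are 0.\<close>

lemma AN_at_0:
 assumes "AN \<tau>" "i \<in> {1, 2, 3}" "j \<in> {1, 2, 3}" shows "\<tau> 0 (E i) (E j) = 0"
proof -
 obtain \<alpha> \<beta> where a: "form2_germ \<alpha>" "form1_germ \<beta>" "NEAR x. x \<in> U7 --> (\<forall>u v. \<alpha> x u v = 0)"
  "NEAR x. x \<in> U7 --> (\<forall>u. \<beta> x u = 0)" "NEAR x. \<forall>u v. \<tau> x u v = \<alpha> x u v + ext_d1 \<beta> x u v"
  by (rule alg_nullE[OF assms(1)]) (rule that)
 have "D k (%x. \<beta> x u) 0 = 0" if "k \<in> {1, 2, 3}" for k u
  by (rule D_vanishing(1)[OF form1_germ_smooth[OF a(2)] _ that]) (use a(4) in eventually_elim, blast)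
 then have "ext_d1 \<beta> 0 (E i) (E j) = 0" using assms(2,3) by (simp add: ext_d1_def D_def)
 moreover have "0 \<in> (U7 :: ('n R2n) set)" by (simp add: U7_def)
 then have "\<alpha> 0 (E i) (E j) = 0" using eventually_nhds_x_imp_x[OF a(3)] by blast
 ultimately show ?thesis using eventually_nhds_x_imp_x[OF a(5)] by simp
qed

lemma dxdx_E: "A (E 1) (E 3) = 1" "A (E 2) (E 3) = 0" "A (E 1) (E 2) = 0" "B (E 1) (E 3) = 0" "B (E 2) (E 3) = 1" "B (E 1) (E 2) = 0"
 "C (E 1) (E 3) = 0" "C (E 2) (E 3) = 0" "C (E 1) (E 2) = 1"
 using dist by (simp_all add: dxdx_def) (simp_all add: axis_def)

lemma leading_coefficients:
 assumes "AN (%x u v. \<sigma> x u v - \<Theta> a1 a2 a3 a4 a5 a6 a7 x u v)"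
 shows "\<sigma> 0 (E 1) (E 3) = a1" "\<sigma> 0 (E 2) (E 3) = a2" "\<sigma> 0 (E 1) (E 2) = a3"
 using AN_at_0[OF assms, of 1 3] AN_at_0[OF assms, of 2 3] AN_at_0[OF assms, of 1 2] by (simp_all add: \<Theta>_def dxdx_E)

lemma isotropic_W:
 assumes "symp \<sigma>" "\<sigma> 0 (E 1) (E 3) = 0" "\<sigma> 0 (E 2) (E 3) = 0" "\<sigma> 0 (E 1) (E 2) = 0" "i \<in> {1, 2, 3}" "j \<in> {1, 2, 3}"
 shows "\<sigma> 0 (E i) (E j) = 0"
proof -
 have b: "bilinear (\<sigma> 0)" "!!u. \<sigma> 0 u u = 0"
  using assms(1) eventually_nhds_x_imp_x[OF form2_germ_bilinear] unfolding symp_def by blast+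
 have "\<sigma> 0 v u = - \<sigma> 0 u v" for u v by (rule bilinear_alternating_swap[OF b])
 from this[of "E 3" "E 1"] this[of "E 3" "E 2"] this[of "E 2" "E 1"] show ?thesis using assms(2-) b(2) by auto
qed

text \<open>Up to sign the single function \<open>?F\<close> is the x1-integral of the coefficient
  of \<Theta>, and it is paired with dx3. Its monomials vanish on B1 and have the orders 7, 8, 10,
  11 along b2.\<close>

lemma good_lagrangian:
 assumes \<sigma>: "symp \<sigma>" and AN: "AN (%x u v. \<sigma> x u v - \<Theta> 0 0 0 a4 a5 a6 a7 x u v)"
 obtains H :: "'n R2n => real ^ 'n" and y where "lagrangian_eqs \<sigma> H"
  "NEAR x. x \<in> U7 --> H x = (a4 * x $ 1 * x $ 3 + a5 / 2 * (x $ 1)^2 + a6 * x $ 1 * (x $ 3)^2 + a7 / 2 * (x $ 1)^2 * x $ 3) *\<^sub>R y"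
proof -
 have s: "form2_germ \<sigma>" "closed_germ \<sigma>" "!!u. u \<noteq> 0 ==> \<exists>v. \<sigma> 0 u v \<noteq> 0" using \<sigma> unfolding symp_def by blast+
 note n = has_derivative_nth
 let ?F = "%x::'n R2n. - (a4 * x $ 1 * x $ 3 + a5 / 2 * (x $ 1)^2 + a6 * x $ 1 * (x $ 3)^2 + a7 / 2 * (x $ 1)^2 * x $ 3)"
 let ?F' = "%x v::'n R2n. - (a4 * (x $ 1 * v $ 3 + v $ 1 * x $ 3) + a5 * x $ 1 * v $ 1 + a6 * (v $ 1 * (x $ 3)^2 + 2 * x $ 1 * x $ 3 * v $ 3)
   + a7 / 2 * (2 * x $ 1 * v $ 1 * x $ 3 + (x $ 1)^2 * v $ 3))"
 have dF: "(?F has_derivative ?F' z) (at z)" for z by (auto intro!: derivative_eq_intros n simp: algebra_simps)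
 have sF: "smooth_germ ?F"
  by (intro smooth_germ_minus smooth_germ_add smooth_germ_mult smooth_germ_power smooth_germ_const smooth_germ_nth)
 have d0: "((%x::'n R2n. 0::real) has_derivative (%v. 0)) (at z)" for z by simp
 obtain H :: "'n R2n => real ^ 'n" and y1 y2 y3 where H: "lagrangian_eqs \<sigma> H"
  "NEAR x. x \<in> U7 --> H x = - (0 *\<^sub>R y1 + 0 *\<^sub>R y2 + ?F x *\<^sub>R y3)"
 proof (rule lagrangian_exists[OF s(1,2) s(3) _ AN smooth_germ_const smooth_germ_const sF _ _ _ d0 d0 dF])
  show "\<sigma> 0 (E i) (E j) = 0" if "i \<in> {1, 2, 3}" "j \<in> {1, 2, 3}" for i j
   by (rule isotropic_W[OF \<sigma> leading_coefficients[OF AN] that])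
  show "(0 * v $ 1 - 0 * u $ 1) + (0 * v $ 2 - 0 * u $ 2) + (?F' z u * v $ 3 - ?F' z v * u $ 3) = - \<Theta> 0 0 0 a4 a5 a6 a7 z u v" for z u v
   by (simp add: \<Theta>_def dxdx_def algebra_simps power2_eq_square)
 qed (simp_all add: that)
 show ?thesis by (rule that[OF H(1)]) (use H(2) in \<open>simp only: scaleR_zero_left add_0_left scaleR_minus_left minus_minus\<close>)
qed

text \<open>Contracting \<theta>6 and \<theta>7 with the Euler field of the weights and dividing by
  13 and 14 gives primitives. Adding exact forms, the differentials of multiples of 2 x1^2 x2 + x1
  x3^3 + x2^2 x3 and of x1 x2^2 + x1^2 x3^2 + 2 x2 x3^3, turns their coefficients into combinations
  of f, g and h = x2^2 - x1 x3^2, which vanish on B2. On B1 the function h equals t^2, so only the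
  contact with B2 is controlled.\<close>

lemma lagrangian_through_b2:
 assumes \<sigma>: "symp \<sigma>" and AN: "AN (%x u v. \<sigma> x u v - \<Theta> 0 0 0 0 0 a6 a7 x u v)"
 obtains H :: "'n R2n => real ^ 'n" where "lagrangian_eqs \<sigma> H" "NEAR t. H (b2 t) = 0"
proof -
 have s: "form2_germ \<sigma>" "closed_germ \<sigma>" "!!u. u \<noteq> 0 ==> \<exists>v. \<sigma> 0 u v \<noteq> 0" using \<sigma> unfolding symp_def by blast+
 note n = has_derivative_nth
 let ?f = "%x::'n R2n. (x $ 1)^2 + x $ 2 * x $ 3" and ?f' = "%x v::'n R2n. 2 * x $ 1 * v $ 1 + x $ 3 * v $ 2 + x $ 2 * v $ 3"
 let ?g = "%x::'n R2n. x $ 1 * x $ 2 + (x $ 3)^3" and ?g' = "%x v::'n R2n. x $ 2 * v $ 1 + x $ 1 * v $ 2 + 3 * (x $ 3)^2 * v $ 3"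
 let ?h = "%x::'n R2n. (x $ 2)^2 - x $ 1 * (x $ 3)^2"
  and ?h' = "%x v::'n R2n. 2 * x $ 2 * v $ 2 - (v $ 1 * (x $ 3)^2 + 2 * x $ 1 * x $ 3 * v $ 3)"
 define p q where "p = a6 / 13" and "q = a7 / 14"
 have pq: "a6 = 13 * p" "a7 = 14 * q" by (simp_all add: p_def q_def)
 let ?F1 = "%x. 4 * p * ?g x - q * ?h x" and ?F1' = "%x v. 4 * p * ?g' x v - q * ?h' x v"
 let ?F2 = "%x. 2 * p * ?f x - 2 * q * ?g x" and ?F2' = "%x v. 2 * p * ?f' x v - 2 * q * ?g' x v"
 let ?F3 = "%x. p * ?h x - 6 * q * (x $ 3 * ?f x)" and ?F3' = "%x v. p * ?h' x v - 6 * q * (v $ 3 * ?f x + x $ 3 * ?f' x v)"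
 have dF: "(?F1 has_derivative ?F1' z) (at z)" "(?F2 has_derivative ?F2' z) (at z)" "(?F3 has_derivative ?F3' z) (at z)" for z
  by (auto intro!: derivative_eq_intros n simp: algebra_simps)
 have sF: "smooth_germ ?F1" "smooth_germ ?F2" "smooth_germ ?F3"
  by (intro smooth_germ_diff smooth_germ_add smooth_germ_mult smooth_germ_power smooth_germ_const smooth_germ_nth)+
 obtain H :: "'n R2n => real ^ 'n" and y1 y2 y3 where H: "lagrangian_eqs \<sigma> H"
  "NEAR x. x \<in> U7 --> H x = - (?F1 x *\<^sub>R y1 + ?F2 x *\<^sub>R y2 + ?F3 x *\<^sub>R y3)"
 proof (rule lagrangian_exists[OF s(1,2) s(3) _ AN sF _ _ _ dF])
  show "\<sigma> 0 (E i) (E j) = 0" if "i \<in> {1, 2, 3}" "j \<in> {1, 2, 3}" for i j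
   by (rule isotropic_W[OF \<sigma> leading_coefficients[OF AN] that])
  show "(?F1' z u * v $ 1 - ?F1' z v * u $ 1) + (?F2' z u * v $ 2 - ?F2' z v * u $ 2) + (?F3' z u * v $ 3 - ?F3' z v * u $ 3)
    = - \<Theta> 0 0 0 0 0 a6 a7 z u v" for z u v
   by (simp add: \<Theta>_def dxdx_def pq algebra_simps power2_eq_square)
 qed (simp_all add: that)
 have z: "?f (b2 t) = 0" "?g (b2 t) = 0" "?h (b2 t) = 0" for t
  by (simp_all add: b2_nth power_numeral_reduce)
 have "NEAR t. H (b2 t) = 0" using eventually_b2[OF H(2)]
 proof eventually_elim
  case (elim t)
  then show ?case unfolding z by (simp add: b_U7)
 qed
 then show ?thesis by (rule that[OF H(1)])
qed

text \<open>Existence of a Lagrangian germ with at least a given contact, as opposed to a maximal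
  value: such statements pull back directly under symmetries.\<close>

definition R2 :: "'n R2n form2 => nat => bool" where
 "R2 \<sigma> k \<longleftrightarrow> (\<exists>H. lagrangian_eqs \<sigma> H \<and> Ot k (%t. H (b2 t)))"

definition R12 :: "'n R2n form2 => nat => bool" where
 "R12 \<sigma> k \<longleftrightarrow> (\<exists>H. lagrangian_eqs \<sigma> H \<and> Ot k (%t. H (b1 t)) \<and> Ot k (%t. H (b2 t)))"

lemma good_lagrangian_orders:
 assumes \<sigma>: "symp \<sigma>" and AN: "AN (%x u v. \<sigma> x u v - \<Theta> 0 0 0 a4 a5 a6 a7 x u v)"
 obtains H :: "'n R2n => real ^ 'n" where "lagrangian_eqs \<sigma> H" "!!k. Ot k (%t. H (b1 t))"
  "Ot 7 (%t. H (b2 t))" "a4 = 0 ==> Ot 8 (%t. H (b2 t))" "a4 = 0 ==> a5 = 0 ==> Ot 10 (%t. H (b2 t))"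
  "a4 = 0 ==> a5 = 0 ==> a6 = 0 ==> Ot 11 (%t. H (b2 t))"
  "a4 = 0 ==> a5 = 0 ==> a6 = 0 ==> a7 = 0 ==> NEAR x. x \<in> U7 --> H x = 0"
proof -
 obtain H :: "'n R2n => real ^ 'n" and y where H: "lagrangian_eqs \<sigma> H"
  "NEAR x. x \<in> U7 --> H x = (a4 * x $ 1 * x $ 3 + a5 / 2 * (x $ 1)^2 + a6 * x $ 1 * (x $ 3)^2 + a7 / 2 * (x $ 1)^2 * x $ 3) *\<^sub>R y"
  by (rule good_lagrangian[OF \<sigma> AN]) (rule that)
 have n1: "b1 t $ 1 = 0" "b1 t $ 3 = 0" for t using dist by (simp_all add: branch1_def)
 have 1: "NEAR t. H (b1 t) = 0" using eventually_b1[OF H(2)]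
  by eventually_elim (simp add: b_U7 n1)
 have "NEAR t. H (b2 t) = (a4 * t^7 + a5 / 2 * t^8 + a6 * t^10 + a7 / 2 * t^11) *\<^sub>R y" using eventually_b2[OF H(2)]
  by eventually_elim (simp add: b_U7 b2_nth power_add[symmetric] power_mult[symmetric] mult.assoc)
 then have O: "Ot k (%t. H (b2 t))" if "Ot k (%t. a4 * t^7 + a5 / 2 * t^8 + a6 * t^10 + a7 / 2 * t^11)" for k
  by (intro Ot_cong[OF Ot_bound[OF that, of "%t. (a4 * t^7 + a5 / 2 * t^8 + a6 * t^10 + a7 / 2 * t^11) *\<^sub>R y" "norm y"]])
    (simp_all add: mult.commute eventually_mono)
 show ?thesis
 proof (rule that[OF H(1)])
  show "Ot k (%t. H (b1 t))" for k by (rule Ot_cong[OF Ot_zero]) (use 1 in eventually_elim, simp)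
  show "Ot 7 (%t. H (b2 t))" by (rule O) (intro Ot_add Ot_power, auto)
  show "Ot 8 (%t. H (b2 t))" if "a4 = 0" by (rule O) (simp only: that mult_zero_left add_0_left div_0, intro Ot_add Ot_power, simp_all)
  show "Ot 10 (%t. H (b2 t))" if "a4 = 0" "a5 = 0" by (rule O) (simp only: that mult_zero_left add_0_left div_0, intro Ot_add Ot_power, simp_all)
  show "Ot 11 (%t. H (b2 t))" if "a4 = 0" "a5 = 0" "a6 = 0" by (rule O) (simp only: that mult_zero_left add_0_left div_0, intro Ot_add Ot_power, simp_all)
  show "NEAR x. x \<in> U7 --> H x = 0" if "a4 = 0" "a5 = 0" "a6 = 0" "a7 = 0" using H(2) unfolding that by simp
 qed
qed

text \<open>\<open>order_bound\<close> gives one direction and the explicit germ the other. Order 9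
  on B2 forces a4 = a5 = 0, after which the explicit germ already reaches order 10; hence the value
  9 does not occur.\<close>

lemma R_iff:
 assumes \<sigma>: "symp \<sigma>" and AN: "AN (%x u v. \<sigma> x u v - \<Theta> 0 0 0 a4 a5 a6 a7 x u v)"
 shows "R2 \<sigma> 8 \<longleftrightarrow> a4 = 0" "R2 \<sigma> 9 \<longleftrightarrow> a4 = 0 \<and> a5 = 0" "R12 \<sigma> 11 \<longleftrightarrow> a4 = 0 \<and> a5 = 0 \<and> a6 = 0"
  "R12 \<sigma> 12 \<longleftrightarrow> a4 = 0 \<and> a5 = 0 \<and> a6 = 0 \<and> a7 = 0"
proof -
 have s: "form2_germ \<sigma>" "closed_germ \<sigma>" using \<sigma> unfolding symp_def by blast+
 note ub = order_bound[OF s AN]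
 obtain H :: "'n R2n => real ^ 'n" where H: "lagrangian_eqs \<sigma> H" "!!k. Ot k (%t. H (b1 t))"
  "Ot 7 (%t. H (b2 t))" "a4 = 0 ==> Ot 8 (%t. H (b2 t))" "a4 = 0 ==> a5 = 0 ==> Ot 10 (%t. H (b2 t))"
  "a4 = 0 ==> a5 = 0 ==> a6 = 0 ==> Ot 11 (%t. H (b2 t))"
  "a4 = 0 ==> a5 = 0 ==> a6 = 0 ==> a7 = 0 ==> NEAR x. x \<in> U7 --> H x = 0"
  by (rule good_lagrangian_orders[OF \<sigma> AN]) (rule that)
 show "R2 \<sigma> 8 \<longleftrightarrow> a4 = 0" unfolding R2_def using ub(1)[of _ 8] H(1,4) by auto
 show "R2 \<sigma> 9 \<longleftrightarrow> a4 = 0 \<and> a5 = 0"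
 proof
  show "R2 \<sigma> 9 ==> a4 = 0 \<and> a5 = 0" unfolding R2_def using ub(1,2)[of _ 9] by auto
  assume "a4 = 0 \<and> a5 = 0"
  then show "R2 \<sigma> 9" unfolding R2_def using H(1) Ot_mono[OF H(5), of 9] by (intro exI[of _ H]) auto
 qed
 have 11: "a4 = 0 \<and> a5 = 0 \<and> a6 = 0" if r: "R12 \<sigma> k" "11 \<le> k" for k
 proof -
  obtain G :: "'n R2n => real ^ 'n" where G: "lagrangian_eqs \<sigma> G" "Ot k (%t. G (b1 t))" "Ot k (%t. G (b2 t))" using r(1) unfolding R12_def by blast
  show ?thesis using ub(1-3)[OF G(1,3)] Ot_mono[OF G(2), of 3] r(2) by simp
 qed
 show "R12 \<sigma> 11 \<longleftrightarrow> a4 = 0 \<and> a5 = 0 \<and> a6 = 0"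
  using 11[of 11] H(1,2,6) unfolding R12_def by auto
 show "R12 \<sigma> 12 \<longleftrightarrow> a4 = 0 \<and> a5 = 0 \<and> a6 = 0 \<and> a7 = 0"
 proof
  assume r: "R12 \<sigma> 12"
  then obtain G :: "'n R2n => real ^ 'n" where G: "lagrangian_eqs \<sigma> G" "Ot 12 (%t. G (b1 t))" "Ot 12 (%t. G (b2 t))" unfolding R12_def by blast
  show "a4 = 0 \<and> a5 = 0 \<and> a6 = 0 \<and> a7 = 0" using 11[OF r] ub(4)[OF G(1,3)] Ot_mono[OF G(2), of 3] by simp
 next
  assume "a4 = 0 \<and> a5 = 0 \<and> a6 = 0 \<and> a7 = 0"
  then have z: "NEAR x. x \<in> U7 --> H x = 0" using H(7) by blast
  have "Ot 12 (%t. H (b2 t))" by (rule Ot_cong[OF Ot_zero]) (use eventually_b2[OF z] in eventually_elim, simp add: b_U7)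
  then show "R12 \<sigma> 12" unfolding R12_def using H(1,2) by blast
 qed
qed

end

context U7_setting begin

lemma smooth_along_branches: "lagrangian_eqs \<sigma> H ==> smooth_germ (%t. H (b1 t))" "lagrangian_eqs \<sigma> H ==> smooth_germ (%t. H (b2 t))"
 unfolding lagrangian_eqs_iff using smooth_germ_compose[OF smooth_b1 b_0(1)] smooth_germ_compose[OF smooth_b2 b_0(2)] by blast+

lemma tangency_b:
 assumes "lagrangian_eqs \<sigma> H"
 shows "enat k \<le> tangency_order b1 H \<longleftrightarrow> Ot k (%t. H (b1 t))" "enat k \<le> tangency_order b2 H \<longleftrightarrow> Ot k (%t. H (b2 t))"
 by (rule tangency_order_ge, rule smooth_along_branches[OF assms])+

lemma enat_le_iff_not: "x \<le> enat k \<longleftrightarrow> \<not> enat (Suc k) \<le> x"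
 by (cases x) auto

lemma enat_eqI: assumes "!!k. enat k \<le> a \<longleftrightarrow> enat k \<le> b" shows "a = b"
proof -
 have "x \<le> y" if "!!k. enat k \<le> x ==> enat k \<le> y" for x y
 proof (rule ccontr)
  assume n: "\<not> x \<le> y"
  then obtain m where m: "y = enat m" by (cases y) auto
  then have "enat (Suc m) \<le> x" using n by (simp add: Suc_ile_eq)
  from that[OF this] show False by (simp add: m)
 qed
 then show ?thesis using assms by (intro antisym) blast+
qed

lemma is_max_unique: "is_max S k ==> is_max S l ==> k = l"
 unfolding is_max_def by (meson antisym)

lemma L2_finite:
 assumes "\<not> R2 \<sigma> (Suc k)" "lagrangian_eqs \<sigma> H" "Ot k (%t. H (b2 t))"
 shows "L2_eq \<sigma> b2 (enat k)"
proof -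
 have "tangency_order b2 G \<le> enat k" if "lagrangian_eqs \<sigma> G" for G
  unfolding enat_le_iff_not tangency_b[OF that] using assms(1) that unfolding R2_def by blast
 moreover have "enat k \<le> tangency_order b2 H" unfolding tangency_b[OF assms(2)] by (rule assms(3))
 ultimately show ?thesis unfolding L2_eq_def is_max_def using assms(2) antisym by blast
qed

lemma Lt_finite:
 assumes "\<not> R12 \<sigma> (Suc k)" "lagrangian_eqs \<sigma> H" "Ot k (%t. H (b1 t))" "Ot k (%t. H (b2 t))"
 shows "Lt_eq \<sigma> b1 b2 (enat k)"
proof -
 have "min (tangency_order b1 G) (tangency_order b2 G) \<le> enat k" if "lagrangian_eqs \<sigma> G" for G
  unfolding enat_le_iff_not min.bounded_iff tangency_b[OF that] using assms(1) that unfolding R12_def by blast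
 moreover have "enat k \<le> min (tangency_order b1 H) (tangency_order b2 H)"
  unfolding min.bounded_iff tangency_b[OF assms(2)] using assms(3,4) by blast
 ultimately show ?thesis unfolding Lt_eq_def is_max_def using assms(2) antisym by blast
qed

lemma order_infinity:
 assumes "lagrangian_eqs \<sigma> H"
 shows "NEAR t. H (b1 t) = 0 ==> tangency_order b1 H = \<infinity>" "NEAR t. H (b2 t) = 0 ==> tangency_order b2 H = \<infinity>"
proof -
 have "Ot k (%t. f t)" if "NEAR t. f t = 0" for k and f :: "real => real ^ 'n"
  by (rule Ot_cong[OF Ot_zero]) (use that in eventually_elim, simp)
 then show "NEAR t. H (b1 t) = 0 ==> tangency_order b1 H = \<infinity>" "NEAR t. H (b2 t) = 0 ==> tangency_order b2 H = \<infinity>"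
  using tangency_b[OF assms] by (auto intro!: enat_eqI)
qed

text \<open>The five levels produce five different values 7, 8, 10, 11, \<infinity> of Lt. As a
  maximum is unique, the implications from the level to the invariants can be reversed.\<close>

lemma tangency_level:
 fixes \<sigma> :: "'n R2n form2"
 assumes \<sigma>: "symp \<sigma>" and AN: "AN (%x u v. \<sigma> x u v - \<Theta> 0 0 0 a4 a5 a6 a7 x u v)"
 defines "l \<equiv> level 0 0 0 a4 a5 a6 a7"
 shows "Lt_eq \<sigma> b1 b2 7 \<and> L2_eq \<sigma> b2 7 \<longleftrightarrow> l = 3" "Lt_eq \<sigma> b1 b2 8 \<and> L2_eq \<sigma> b2 8 \<longleftrightarrow> l = 4"
  "Lt_eq \<sigma> b1 b2 10 \<and> L2_eq \<sigma> b2 \<infinity> \<longleftrightarrow> l = 5" "Lt_eq \<sigma> b1 b2 11 \<and> L2_eq \<sigma> b2 \<infinity> \<longleftrightarrow> l = 6" "in_lagrangian \<sigma> U7 \<longleftrightarrow> l = 7"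
proof -
 note R = R_iff[OF \<sigma> AN]
 obtain H :: "'n R2n => real ^ 'n" where H: "lagrangian_eqs \<sigma> H" "!!k. Ot k (%t. H (b1 t))"
  "Ot 7 (%t. H (b2 t))" "a4 = 0 ==> Ot 8 (%t. H (b2 t))" "a4 = 0 ==> a5 = 0 ==> Ot 10 (%t. H (b2 t))"
  "a4 = 0 ==> a5 = 0 ==> a6 = 0 ==> Ot 11 (%t. H (b2 t))"
  "a4 = 0 ==> a5 = 0 ==> a6 = 0 ==> a7 = 0 ==> NEAR x. x \<in> U7 --> H x = 0"
  by (rule good_lagrangian_orders[OF \<sigma> AN]) (rule that)
 have R12_R2: "R12 \<sigma> k ==> R2 \<sigma> k" for k unfolding R12_def R2_def by blast
 have 3: "Lt_eq \<sigma> b1 b2 (enat 7) \<and> L2_eq \<sigma> b2 (enat 7)" if "l = 3"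
 proof -
  have "\<not> R2 \<sigma> (Suc 7)" using R(1) that unfolding l_def level_def by (auto split: if_splits)
  then show ?thesis using L2_finite[OF _ H(1,3)] Lt_finite[OF _ H(1,2,3)] R12_R2 by blast
 qed
 have 4: "Lt_eq \<sigma> b1 b2 (enat 8) \<and> L2_eq \<sigma> b2 (enat 8)" if "l = 4"
 proof -
  have a: "a4 = 0" "a5 \<noteq> 0" using that unfolding l_def level_def by (auto split: if_splits)
  then have "\<not> R2 \<sigma> (Suc 8)" using R(2) by simp
  then show ?thesis using L2_finite[OF _ H(1) H(4)[OF a(1)]] Lt_finite[OF _ H(1,2) H(4)[OF a(1)]] R12_R2 by blast
 qed
 have inf: "L2_eq \<sigma> b2 \<infinity>" if a: "a4 = 0" "a5 = 0"
 proof -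
  obtain G :: "'n R2n => real ^ 'n" where G: "lagrangian_eqs \<sigma> G" "NEAR t. G (b2 t) = 0"
   by (rule lagrangian_through_b2[OF \<sigma> AN[unfolded a]]) (rule that)
  from order_infinity(2)[OF this] show ?thesis unfolding L2_eq_def is_max_def using G(1) by (auto intro!: exI[of _ G])
 qed
 have 5: "Lt_eq \<sigma> b1 b2 (enat 10) \<and> L2_eq \<sigma> b2 \<infinity>" if "l = 5"
 proof -
  have a: "a4 = 0" "a5 = 0" "a6 \<noteq> 0" using that unfolding l_def level_def by (auto split: if_splits)
  then have "\<not> R12 \<sigma> (Suc 10)" using R(3) by simp
  then show ?thesis using Lt_finite[OF _ H(1,2) H(5)[OF a(1,2)]] inf a by blast
 qed
 have 6: "Lt_eq \<sigma> b1 b2 (enat 11) \<and> L2_eq \<sigma> b2 \<infinity>" if "l = 6"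
 proof -
  have a: "a4 = 0" "a5 = 0" "a6 = 0" "a7 \<noteq> 0" using that unfolding l_def level_def by (auto split: if_splits)
  then have "\<not> R12 \<sigma> (Suc 11)" using R(4) by simp
  then show ?thesis using Lt_finite[OF _ H(1,2) H(6)[OF a(1-3)]] inf a by blast
 qed
 have z7: "NEAR x. x \<in> U7 --> H x = 0" if "l = 7"
  using that H(7) unfolding l_def level_def by (auto split: if_splits)
 \<comment> \<open>Level 7 gets its value of Lt as well, to be told apart from the others in the
   converse directions.\<close>
 have 7: "Lt_eq \<sigma> b1 b2 \<infinity>" if "l = 7"
 proof -
  have "NEAR t. H (b1 t) = 0" "NEAR t. H (b2 t) = 0"
   using eventually_b1[OF z7[OF that]] eventually_b2[OF z7[OF that]] by (simp_all add: b_U7)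
  from order_infinity[OF H(1)] this
  have "min (tangency_order b1 H) (tangency_order b2 H) = \<infinity>" by simp
  then show ?thesis unfolding Lt_eq_def is_max_def using H(1) by (auto intro!: exI[of _ H])
 qed
 have l: "l = 3 \<or> l = 4 \<or> l = 5 \<or> l = 6 \<or> l = 7" unfolding l_def level_def by simp
 have u: "k = m" if "Lt_eq \<sigma> b1 b2 k" "Lt_eq \<sigma> b1 b2 m" for k m using that unfolding Lt_eq_def by (rule is_max_unique)
 note e = numeral_eq_enat
 show "Lt_eq \<sigma> b1 b2 7 \<and> L2_eq \<sigma> b2 7 \<longleftrightarrow> l = 3" using l 3 4 5 6 7 u[of 7] unfolding e by fastforce
 show "Lt_eq \<sigma> b1 b2 8 \<and> L2_eq \<sigma> b2 8 \<longleftrightarrow> l = 4" using l 3 4 5 6 7 u[of 8] unfolding e by fastforce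
 show "Lt_eq \<sigma> b1 b2 10 \<and> L2_eq \<sigma> b2 \<infinity> \<longleftrightarrow> l = 5" using l 3 4 5 6 7 u[of 10] unfolding e by fastforce
 show "Lt_eq \<sigma> b1 b2 11 \<and> L2_eq \<sigma> b2 \<infinity> \<longleftrightarrow> l = 6" using l 3 4 5 6 7 u[of 11] unfolding e by fastforce
 show "in_lagrangian \<sigma> U7 \<longleftrightarrow> l = 7"
 proof
  assume "in_lagrangian \<sigma> U7"
  then obtain G where G: "lagrangian_eqs \<sigma> G" "NEAR x. x \<in> U7 --> G x = 0" unfolding in_lagrangian_def by blast
  have "NEAR t. G (b1 t) = 0" "NEAR t. G (b2 t) = 0"
   using eventually_b1[OF G(2)] eventually_b2[OF G(2)] by (simp_all add: b_U7)
  from order_infinity[OF G(1)] this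
  \<comment> \<open>Order 12 is the bound that detects all four coefficients.\<close>
  have "enat 12 \<le> tangency_order b1 G" "enat 12 \<le> tangency_order b2 G" by simp_all
  then have "R12 \<sigma> 12" unfolding tangency_b[OF G(1)] R12_def using G(1) by blast
  then show "l = 7" unfolding R(4) l_def level_def by simp
 next
  assume "l = 7"
  then show "in_lagrangian \<sigma> U7" unfolding in_lagrangian_def using H(1) z7 by blast
 qed
qed

text \<open>s may depend on t in an arbitrary way: for a growth bound |s| <= K |t| is
  enough.\<close>

lemma Ot_reparametrize:
 fixes g :: "real => 'b::real_normed_vector"
 assumes K: "NEAR t. \<exists>s. f t = g s \<and> \<bar>s\<bar> \<le> K * \<bar>t\<bar>" and O: "Ot k g" shows "Ot k f"
proof -
 obtain C where C: "C > 0" "NEAR t. norm (g t) \<le> C * \<bar>t\<bar> ^ k" using O by (rule OtE)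
 obtain e where e: "e > 0" "!!t. dist t 0 < e ==> norm (g t) \<le> C * \<bar>t\<bar> ^ k" using C(2) unfolding eventually_nhds_metric by blast
 have "\<forall>\<^sub>F t in nhds (0::real). dist t 0 < e / (\<bar>K\<bar> + 1)"
  unfolding eventually_nhds_metric using e(1) by (intro exI[of _ "e / (\<bar>K\<bar> + 1)"]) (auto intro: divide_pos_pos)
 with K have "NEAR t. norm (f t) \<le> C * (\<bar>K\<bar> + 1) ^ k * \<bar>t\<bar> ^ k"
 proof eventually_elim
  case (elim t)
  then obtain s where s: "f t = g s" "\<bar>s\<bar> \<le> K * \<bar>t\<bar>" by blast
  have "K * \<bar>t\<bar> \<le> (\<bar>K\<bar> + 1) * \<bar>t\<bar>" by (intro mult_right_mono) auto
  then have s': "\<bar>s\<bar> \<le> (\<bar>K\<bar> + 1) * \<bar>t\<bar>" using s(2) by linarith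
  have "(\<bar>K\<bar> + 1) * \<bar>t\<bar> < e" using elim(2) by (simp add: field_simps)
  then have "norm (g s) \<le> C * \<bar>s\<bar> ^ k" using s' by (intro e(2)) simp
  also have "\<dots> \<le> C * ((\<bar>K\<bar> + 1) * \<bar>t\<bar>) ^ k" using C(1) s' by (intro mult_left_mono power_mono) auto
  finally show ?case unfolding s(1) by (simp add: power_mult_distrib mult.assoc)
 qed
 then show ?thesis by (rule OtI)
qed

text \<open>S maps each branch to itself with a controlled change of parameter, so contact orders
  are carried along, while a1, a2, a3 transform by the triangular derivative of S. The primes keep
  the coefficients apart from the branches \<open>b1\<close> and \<open>b2\<close>.\<close>

lemma level_le:
 fixes \<sigma> :: "'n R2n form2"
 assumes \<sigma>: "symp \<sigma>" and a: "AN (%x u v. \<sigma> x u v - \<Theta> a1 a2 a3 a4 a5 a6 a7 x u v)"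
  and S: "sym7 S" and b: "AN (%x u v. pullback S \<sigma> x u v - \<Theta> b1' b2' b3 b4 b5 b6 b7 x u v)"
 shows "level a1 a2 a3 a4 a5 a6 a7 \<le> level b1' b2' b3 b4 b5 b6 b7" "a1 = 0 ==> b1' = 0" "a2 = 0 ==> b2' = 0"
proof -
 note Sd = sym7D[OF S]
 obtain p q r s where d: "dd S 0 (E 1) = p *\<^sub>R E 1 + q *\<^sub>R E 3" "dd S 0 (E 2) = s *\<^sub>R E 2" "dd S 0 (E 3) = r *\<^sub>R E 3"
  and K: "\<exists>K. NEAR t. \<exists>s. S (b1 t) = b1 s \<and> \<bar>s\<bar> \<le> K * \<bar>t\<bar>"
   "\<exists>K. NEAR t. \<exists>s. S (b2 t) = b2 s \<and> \<bar>s\<bar> \<le> K * \<bar>t\<bar>"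
  by (rule sym7_derivative[OF S]) (rule that)
 have bl: "bilinear (\<sigma> 0)" "!!u. \<sigma> 0 u u = 0"
  using \<sigma> eventually_nhds_x_imp_x[OF form2_germ_bilinear] unfolding symp_def by blast+
 have sw: "\<sigma> 0 u v = - \<sigma> 0 v u" for u v by (rule bilinear_alternating_swap[OF bl])
 have "pullback S \<sigma> 0 (E 1) (E 3) = p * r * a1" "pullback S \<sigma> 0 (E 2) (E 3) = s * r * a2"
  "pullback S \<sigma> 0 (E 1) (E 2) = p * s * a3 - q * s * a2"
  unfolding pullback_def Sd(1) d leading_coefficients[OF a, symmetric]
  by (simp_all add: bilinear_ladd[OF bl(1)] bilinear_radd[OF bl(1)] bilinear_lmul[OF bl(1)] bilinear_rmul[OF bl(1)] bl(2) sw[of "E 3" "E 2"] algebra_simps)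
 then have b123: "b1' = p * r * a1" "b2' = s * r * a2" "b3 = p * s * a3 - q * s * a2" unfolding leading_coefficients[OF b] by simp_all
 then show "a1 = 0 ==> b1' = 0" "a2 = 0 ==> b2' = 0" by simp_all
 have O: "Ot k (%t. H (S (b t)))"
  if K: "\<exists>K. NEAR t. \<exists>s. S (b t) = b s \<and> \<bar>s\<bar> \<le> K * \<bar>t\<bar>" and O: "Ot k (%t. H (b t))"
  for b k and H :: "'n R2n => real ^ 'n"
 proof -
  obtain K where "NEAR t. \<exists>s. S (b t) = b s \<and> \<bar>s\<bar> \<le> K * \<bar>t\<bar>" using K by blast
  then have "NEAR t. \<exists>s. H (S (b t)) = H (b s) \<and> \<bar>s\<bar> \<le> K * \<bar>t\<bar>" by eventually_elim metis
  then show ?thesis by (rule Ot_reparametrize[OF _ O])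
 qed
 note O = O[OF K(1)] O[OF K(2)]
 have L: "lagrangian_eqs (pullback S \<sigma>) (%x. H (S x))" if "lagrangian_eqs \<sigma> H" for H
  by (rule lagrangian_eqs_pullback[OF Sd(2,1,3) that]) simp
 have R2: "R2 \<sigma> k ==> R2 (pullback S \<sigma>) k" for k unfolding R2_def using L O by blast
 have R12: "R12 \<sigma> k ==> R12 (pullback S \<sigma>) k" for k unfolding R12_def using L O by blast
 have sS: "symp (pullback S \<sigma>)" by (rule symp_pullback[OF \<sigma> Sd(2,1,3)])
 have z3: "a1 = 0 --> b1' = 0" "a2 = 0 --> b2' = 0" "a2 = 0 \<and> a3 = 0 --> b3 = 0" using b123 by simp_all
 have "(a4 = 0 --> b4 = 0) \<and> (a4 = 0 \<and> a5 = 0 --> b5 = 0) \<and> (a4 = 0 \<and> a5 = 0 \<and> a6 = 0 --> b6 = 0) \<and>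
   (a4 = 0 \<and> a5 = 0 \<and> a6 = 0 \<and> a7 = 0 --> b7 = 0)" if z: "a1 = 0" "a2 = 0" "a3 = 0"
 proof -
  have "b1' = 0" "b2' = 0" "b3 = 0" using b123 z by simp_all
  note Ra = R_iff[OF \<sigma> a[unfolded z]] and Rb = R_iff[OF sS b[unfolded this]]
  show ?thesis using Ra Rb R2[of 8] R2[of 9] R12[of 11] R12[of 12] by blast
 qed
 note z4 = this
 show "level a1 a2 a3 a4 a5 a6 a7 \<le> level b1' b2' b3 b4 b5 b6 b7"
 proof (cases "a1 = 0 \<and> a2 = 0 \<and> a3 = 0")
  case True
  then have "b1' = 0" "b2' = 0" "b3 = 0" using z3 by blast+
  moreover have "a1 = 0" "a2 = 0" "a3 = 0" using True by blast+
  ultimately show ?thesis using z4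
   by (cases "a4 = 0"; cases "a5 = 0"; cases "a6 = 0"; cases "a7 = 0"; simp add: level_def)
 next
  case False
  then consider "a1 \<noteq> 0" | "a1 = 0" "a2 \<noteq> 0" | "a1 = 0" "a2 = 0" "a3 \<noteq> 0" by blast
  then show ?thesis by cases (use z3(1,2) in \<open>simp_all add: level_def\<close>)
 qed
qed

text \<open>S and its inverse give the two inequalities.\<close>

lemma level_invariant:
 fixes \<sigma> :: "'n R2n form2"
 assumes \<sigma>: "symp \<sigma>" and a: "AN (%x u v. \<sigma> x u v - \<Theta> a1 a2 a3 a4 a5 a6 a7 x u v)" and e: "equivT \<sigma> (\<Theta> b1' b2' b3 b4 b5 b6 b7)"
 shows "level a1 a2 a3 a4 a5 a6 a7 = level b1' b2' b3 b4 b5 b6 b7" "a1 = 0 \<longleftrightarrow> b1' = 0" "a2 = 0 \<longleftrightarrow> b2' = 0"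
proof -
 obtain S where S: "sym7 S" and b: "AN (%x u v. pullback S \<sigma> x u v - \<Theta> b1' b2' b3 b4 b5 b6 b7 x u v)" using e unfolding equivT_def by blast
 obtain T where T: "diffeo_germ_onto T U7 U7" "NEAR x. S (T x) = x"
  using diffeo_germ_inverse[OF S[unfolded sym7_def]] by metis
 note Sd = sym7D[OF S] and Td = sym7D[OF T(1)[folded sym7_def]]
 have "NEAR x. \<forall>u v. pullback T (pullback S \<sigma>) x u v = \<sigma> x u v"
  using pullback_compose[OF Td(2,1) Sd(2), of \<sigma>] pullback_id[OF T(2), of \<sigma>] by eventually_elim simp
 then have a': "AN (%x u v. pullback T (pullback S \<sigma>) x u v - \<Theta> a1 a2 a3 a4 a5 a6 a7 x u v)"
  by (intro alg_null_cong[OF _ a]) (erule eventually_mono, simp)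
 have sS: "symp (pullback S \<sigma>)" by (rule symp_pullback[OF \<sigma> Sd(2,1,3)])
 note x = level_le[OF \<sigma> a S b] and y = level_le[OF sS b T(1)[folded sym7_def] a']
 show "level a1 a2 a3 a4 a5 a6 a7 = level b1' b2' b3 b4 b5 b6 b7" "a1 = 0 \<longleftrightarrow> b1' = 0" "a2 = 0 \<longleftrightarrow> b2' = 0"
  using x y by (blast intro: antisym)+
qed

end

section \<open>The theorem\<close>

lemma zero_on_span:
 fixes h :: "'a::euclidean_space => 'a => real"
 assumes "bilinear h"
 shows "(\<forall>u\<in>span S. \<forall>v\<in>span S. h u v = 0) \<longleftrightarrow> (\<forall>u\<in>S. \<forall>v\<in>S. h u v = 0)"
proof
 assume a: "\<forall>u\<in>S. \<forall>v\<in>S. h u v = 0"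
 have l: "linear (%u. h u v)" "linear (h u)" for u v using assms by (simp_all add: bilinear_def)
 have "h u v = 0" if "u \<in> S" "v \<in> span S" for u v
  by (rule linear_eq_0_on_span[OF l(2) _ that(2)]) (use a that(1) in blast)
 then show "\<forall>u\<in>span S. \<forall>v\<in>span S. h u v = 0" using linear_eq_0_on_span[OF l(1)] by blast
qed (use span_base in blast)

context U7_setting begin

text \<open>With h(E 1, E 3) = 0 the form on W is given by two numbers: h(E 2, E 3) = 0 puts
  \<open>E 3\<close> into the kernel, and h(E 1, E 2) \<noteq> 0 keeps the kernel from being all of
  W.\<close>

lemma kernel_eq_l2_iff:
 fixes h :: "'n R2n => 'n R2n => real"
 assumes b: "bilinear h" "!!u. h u u = 0" and z: "h (E 1) (E 3) = 0"
 shows "{u \<in> span {E 1, E 2, E 3}. \<forall>v\<in>span {E 1, E 2, E 3}. h u v = 0} = span {E 3} \<longleftrightarrow> h (E 2) (E 3) = 0 \<and> h (E 1) (E 2) \<noteq> 0"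
  (is "?K = _ \<longleftrightarrow> _")
proof -
 have l: "linear (%u. h u v)" "linear (h u)" for u v using b by (simp_all add: bilinear_def)
 have sw: "h u v = - h v u" for u v by (rule bilinear_alternating_swap[OF b])
 have E: "E i \<in> span {E 1, E 2, E 3}" if "i \<in> {1, 2, 3}" for i using that by (auto intro: span_base)
 have K: "u \<in> ?K" if "u \<in> span {E 1, E 2, E 3}" "h u (E 1) = 0" "h u (E 2) = 0" "h u (E 3) = 0" for u
  using that linear_eq_0_on_span[OF l(2), of "{E 1, E 2, E 3}" u] by auto
 show ?thesis
 proof
  assume e: "?K = span {E 3}"
  have "E 3 \<in> ?K" unfolding e by (simp add: span_base)
  then have 1: "h (E 2) (E 3) = 0" using E[of 2] sw[of "E 2" "E 3"] by auto
  have "h (E 1) (E 2) \<noteq> 0"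
  proof
   assume "h (E 1) (E 2) = 0"
   then have "E 1 \<in> ?K" by (intro K E) (simp_all add: b z)
   then obtain k where "E 1 = k *\<^sub>R E 3" unfolding e span_singleton by blast
   then have "E 1 $ 1 = (k *\<^sub>R E 3) $ 1" by simp
   then show False using dist by (simp add: axis_def)
  qed
  with 1 show "h (E 2) (E 3) = 0 \<and> h (E 1) (E 2) \<noteq> 0" ..
 next
  assume a: "h (E 2) (E 3) = 0 \<and> h (E 1) (E 2) \<noteq> 0"
  have "E 3 \<in> ?K" by (intro K E) (use a z sw[of "E 3"] b(2) in auto)
  then have "k *\<^sub>R E 3 \<in> ?K" for k by (auto simp: span_scale bilinear_lmul[OF b(1)])
  moreover have "u \<in> span {E 3}" if u: "u \<in> ?K" for u
  proof -
   have "u \<in> span {E 1, E 2, E 3}" using u by blast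
   then obtain x y w where x: "u - x *\<^sub>R E 1 - y *\<^sub>R E 2 = w *\<^sub>R E 3" unfolding span_breakdown_eq by auto
   then have ue: "u = x *\<^sub>R E 1 + y *\<^sub>R E 2 + w *\<^sub>R E 3" by (simp add: algebra_simps)
   have "h u (E 1) = 0" "h u (E 2) = 0" using u E by auto
   then have "x = 0" "y = 0"
    using a z b(2) sw[of "E 3" "E 1"] sw[of "E 3" "E 2"] sw[of "E 2" "E 1"] unfolding ue
    by (simp_all add: bilinear_ladd[OF b(1)] bilinear_lmul[OF b(1)])
   then show ?thesis unfolding ue by (simp add: span_scale span_base)
  qed
  ultimately show "?K = span {E 3}" unfolding span_singleton by blast
 qed
qed

lemma symplectic_symp: "symplectic_germ \<omega> ==> symp \<omega>"
 unfolding symplectic_germ_def symp_def closed_germ_def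
 by (auto dest: eventually_nhds_x_imp_x elim: eventually_mono)

text \<open>Two diffeomorphism germs from U7 onto N differ by a symmetry of U7, so any fixed \<Phi>
  may be used to move the question to U7.\<close>

lemma germs_of_iff:
 assumes \<Phi>: "diffeo_germ_onto \<Phi> U7 N"
 shows "N \<in> U7_germs_of \<omega> F \<longleftrightarrow> (\<exists>\<theta>\<in>F. equivT (pullback \<Phi> \<omega>) \<theta>)"
proof -
 obtain \<Psi> where \<Psi>: "diffeo_germ_onto \<Psi> N U7" "NEAR x. \<Psi> (\<Phi> x) = x" "NEAR x. \<Phi> (\<Psi> x) = x"
  by (rule diffeo_germ_inverse[OF \<Phi>]) (rule that)
 have f: "\<Phi> 0 = 0" "smooth_germ \<Phi>" using \<Phi> unfolding diffeo_germ_onto_iff by blast+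
 have 1: "AN (%x u v. pullback (%x. \<Phi> (S x)) \<omega> x u v - \<theta> x u v) \<longleftrightarrow> AN (%x u v. pullback S (pullback \<Phi> \<omega>) x u v - \<theta> x u v)"
  if "sym7 S" for S \<theta>
 proof -
  have e: "NEAR x. \<forall>u v. pullback (%x. \<Phi> (S x)) \<omega> x u v = pullback S (pullback \<Phi> \<omega>) x u v"
   by (rule pullback_compose[OF sym7D(2,1)[OF that] f(2)])
  show ?thesis
   by (rule iffI; erule alg_null_cong[rotated]; use e in eventually_elim, simp)
 qed
 have "diffeo_alg_restr \<omega> N \<theta> U7 \<longleftrightarrow> equivT (pullback \<Phi> \<omega>) \<theta>" for \<theta>
 proof
  assume "diffeo_alg_restr \<omega> N \<theta> U7"
  then obtain P where P: "diffeo_germ_onto P U7 N" "AN (%x u v. pullback P \<omega> x u v - \<theta> x u v)"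
   unfolding diffeo_alg_restr_def same_alg_restr_iff by blast
  have p: "P 0 = 0" "smooth_germ P" using P(1) unfolding diffeo_germ_onto_iff by blast+
  have S: "sym7 (%x. \<Psi> (P x))" using diffeo_germ_compose[OF P(1) \<Psi>(1)] unfolding sym7_def .
  have e: "NEAR x. P x = \<Phi> (\<Psi> (P x))"
   using eventually_compose_0[OF smooth_germ_isCont[OF p(2)] p(1) \<Psi>(3)] by eventually_elim simp
  have "AN (%x u v. pullback (%x. \<Phi> (\<Psi> (P x))) \<omega> x u v - \<theta> x u v)"
   by (rule alg_null_cong[OF _ P(2)]) (use e eventually_dd_cong[OF e] in eventually_elim, simp add: pullback_def)
  then show "equivT (pullback \<Phi> \<omega>) \<theta>" unfolding 1[OF S] equivT_def using S by blast
 next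
  assume "equivT (pullback \<Phi> \<omega>) \<theta>"
  then obtain S where S: "sym7 S" "AN (%x u v. pullback S (pullback \<Phi> \<omega>) x u v - \<theta> x u v)" unfolding equivT_def by blast
  have "diffeo_germ_onto (%x. \<Phi> (S x)) U7 N" by (rule diffeo_germ_compose[OF S(1)[unfolded sym7_def] \<Phi>])
  then show "diffeo_alg_restr \<omega> N \<theta> U7" using S(2) unfolding 1[OF S(1), symmetric] diffeo_alg_restr_def same_alg_restr_iff by blast
 qed
 then show ?thesis using \<Phi> unfolding U7_germs_of_def U7_germs_def by blast
qed

text \<open>Composition with \<Phi> and with its inverse exchanges the Lagrangian germs of \<omega>
  and of its pullback and keeps contact orders. G o \<Psi> o \<Phi> agrees with G only near 0, so
  orders are compared through growth bounds rather than by equality of functions.\<close>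

lemma tangency_transfer:
 fixes \<omega> :: "'n R2n form2"
 assumes \<Phi>: "diffeo_germ_onto \<Phi> U7 N"
 shows "Lt_eq \<omega> (\<Phi> \<circ> b1) (\<Phi> \<circ> b2) = Lt_eq (pullback \<Phi> \<omega>) b1 b2" "L2_eq \<omega> (\<Phi> \<circ> b2) = L2_eq (pullback \<Phi> \<omega>) b2"
  "in_lagrangian \<omega> N \<longleftrightarrow> in_lagrangian (pullback \<Phi> \<omega>) U7"
proof -
 obtain \<Psi> where \<Psi>: "diffeo_germ_onto \<Psi> N U7" "NEAR x. \<Psi> (\<Phi> x) = x" "NEAR x. \<Phi> (\<Psi> x) = x"
  by (rule diffeo_germ_inverse[OF \<Phi>]) (rule that)
 have f: "smooth_germ \<Phi>" "\<Phi> 0 = 0" "inj (dd \<Phi> 0)" and fU: "NEAR x. x \<in> U7 \<longleftrightarrow> \<Phi> x \<in> N" using \<Phi> unfolding diffeo_germ_onto_iff by blast+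
 have p: "smooth_germ \<Psi>" "\<Psi> 0 = 0" "inj (dd \<Psi> 0)" and pU: "NEAR x. x \<in> N \<longleftrightarrow> \<Psi> x \<in> U7" using \<Psi>(1) unfolding diffeo_germ_onto_iff by blast+
 have T: "tangency_order (\<Phi> \<circ> b) H = tangency_order b (%x. H (\<Phi> x))" for b and H :: "'n R2n => real ^ 'n"
  by (simp add: tangency_order_def)
 have L1: "lagrangian_eqs (pullback \<Phi> \<omega>) (%x. H (\<Phi> x))" if "lagrangian_eqs \<omega> H" for H
  by (rule lagrangian_eqs_pullback[OF f that]) simp
 have e: "NEAR x. \<forall>u v. \<omega> x u v = pullback \<Psi> (pullback \<Phi> \<omega>) x u v"
  using pullback_compose[OF p(1,2) f(1), of \<omega>] pullback_id[OF \<Psi>(3), of \<omega>] by eventually_elim simp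
 have L2: "lagrangian_eqs \<omega> (%x. G (\<Psi> x))" if "lagrangian_eqs (pullback \<Phi> \<omega>) G" for G
  by (rule lagrangian_eqs_pullback[OF p that e])
 have T2: "tangency_order b1 (%x. G (\<Psi> (\<Phi> x))) = tangency_order b1 G" "tangency_order b2 (%x. G (\<Psi> (\<Phi> x))) = tangency_order b2 G"
  if G: "lagrangian_eqs (pullback \<Phi> \<omega>) G" for G
 proof -
  note L = L1[OF L2[OF G]]
  have c: "Ot k (%t. G (\<Psi> (\<Phi> (b t)))) \<longleftrightarrow> Ot k (%t. G (b t))" if "NEAR t. \<Psi> (\<Phi> (b t)) = b t" for k and b :: "real => 'n R2n"
   by (rule iffI; erule Ot_cong; use that in eventually_elim, simp)
  show "tangency_order b1 (%x. G (\<Psi> (\<Phi> x))) = tangency_order b1 G"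
   by (rule enat_eqI) (simp only: tangency_b[OF L] tangency_b[OF G] c[OF eventually_b1[OF \<Psi>(2)]])
  show "tangency_order b2 (%x. G (\<Psi> (\<Phi> x))) = tangency_order b2 G"
   by (rule enat_eqI) (simp only: tangency_b[OF L] tangency_b[OF G] c[OF eventually_b2[OF \<Psi>(2)]])
 qed
 have e: "{f (tangency_order (\<Phi> \<circ> b1) H) (tangency_order (\<Phi> \<circ> b2) H) |H. lagrangian_eqs \<omega> H}
   = {f (tangency_order b1 H) (tangency_order b2 H) |H. lagrangian_eqs (pullback \<Phi> \<omega>) H}" (is "?X = ?Y") for f :: "enat => enat => enat"
 proof
  show "?X \<subseteq> ?Y" unfolding T using L1 by blast
  show "?Y \<subseteq> ?X" unfolding T
  proof clarify
   fix G :: "'n R2n => real ^ 'n" assume G: "lagrangian_eqs (pullback \<Phi> \<omega>) G"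
   show "\<exists>H. f (tangency_order b1 G) (tangency_order b2 G) = f (tangency_order b1 (%x. H (\<Phi> x))) (tangency_order b2 (%x. H (\<Phi> x))) \<and> lagrangian_eqs \<omega> H"
    by (rule exI[of _ "%x. G (\<Psi> x)"]) (simp add: T2[OF G] L2[OF G])
  qed
 qed
 show "Lt_eq \<omega> (\<Phi> \<circ> b1) (\<Phi> \<circ> b2) = Lt_eq (pullback \<Phi> \<omega>) b1 b2" "L2_eq \<omega> (\<Phi> \<circ> b2) = L2_eq (pullback \<Phi> \<omega>) b2"
  using e[of min] e[of "%_ y. y"] unfolding Lt_eq_def L2_eq_def by simp_all
 show "in_lagrangian \<omega> N \<longleftrightarrow> in_lagrangian (pullback \<Phi> \<omega>) U7"
 proof
  assume "in_lagrangian \<omega> N"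
  then obtain H where H: "lagrangian_eqs \<omega> H" "NEAR x. x \<in> N --> H x = 0" unfolding in_lagrangian_def by blast
  have "NEAR x. x \<in> U7 --> H (\<Phi> x) = 0"
   using fU eventually_compose_0[OF smooth_germ_isCont[OF f(1)] f(2) H(2)] by eventually_elim blast
  then show "in_lagrangian (pullback \<Phi> \<omega>) U7" unfolding in_lagrangian_def using L1[OF H(1)] by blast
 next
  assume "in_lagrangian (pullback \<Phi> \<omega>) U7"
  then obtain G where G: "lagrangian_eqs (pullback \<Phi> \<omega>) G" "NEAR x. x \<in> U7 --> G x = 0" unfolding in_lagrangian_def by blast
  have "NEAR x. x \<in> N --> G (\<Psi> x) = 0"
   using pU eventually_compose_0[OF smooth_germ_isCont[OF p(1)] p(2) G(2)] by eventually_elim blast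
  then show "in_lagrangian \<omega> N" unfolding in_lagrangian_def using L2[OF G(1)] by blast
 qed
qed

end

theorem theorem3p3:
  fixes \<omega> :: "(real ^ 'n::finite bit0) form2"
    and N W l1 l2 V :: "(real ^ 'n bit0) set"
    and f1 f2 :: "real \<Rightarrow> real ^ 'n bit0"
  assumes "CARD('n) \<ge> 2"
    and "symplectic_germ \<omega>"
    and "N \<in> U7_germs"
    and "U7_data N W l1 l2 V f1 f2"
  shows
    "(N \<in> U7_class \<omega> 0 \<longleftrightarrow> \<not> zero_on \<omega> V) \<and>
     (N \<in> U7_germs_of \<omega> {nf0 c1 c2 | c1 c2. c1 \<noteq> 0} \<longleftrightarrow>
        \<not> zero_on \<omega> V \<and> \<not> zero_on \<omega> {u + v | u v. u \<in> l1 \<and> v \<in> l2}) \<and>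
     (N \<in> U7_germs_of \<omega> {nf0 0 c2 | c2. True} \<longleftrightarrow>
        \<not> zero_on \<omega> V \<and> zero_on \<omega> {u + v | u v. u \<in> l1 \<and> v \<in> l2}) \<and>
     (N \<in> U7_class \<omega> 1 \<longleftrightarrow>
        \<not> zero_on \<omega> W \<and> zero_on \<omega> V \<and> kernel_on \<omega> W \<noteq> l2) \<and>
     (N \<in> U7_class \<omega> 2 \<longleftrightarrow> zero_on \<omega> V \<and> kernel_on \<omega> W = l2) \<and>
     (N \<in> U7_class \<omega> 3 \<longleftrightarrow> zero_on \<omega> W \<and> Lt_eq \<omega> f1 f2 7 \<and> L2_eq \<omega> f2 7) \<and>
     (N \<in> U7_class \<omega> 4 \<longleftrightarrow> zero_on \<omega> W \<and> Lt_eq \<omega> f1 f2 8 \<and> L2_eq \<omega> f2 8) \<and>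
     (N \<in> U7_class \<omega> 5 \<longleftrightarrow> zero_on \<omega> W \<and> Lt_eq \<omega> f1 f2 10 \<and> L2_eq \<omega> f2 \<infinity>) \<and>
     (N \<in> U7_class \<omega> 6 \<longleftrightarrow> zero_on \<omega> W \<and> Lt_eq \<omega> f1 f2 11 \<and> L2_eq \<omega> f2 \<infinity>) \<and>
     (N \<in> U7_class \<omega> 7 \<longleftrightarrow> zero_on \<omega> W \<and> in_lagrangian \<omega> N)"
proof -
 interpret U7_setting "TYPE('n)" by unfold_locales (rule assms(1))
 obtain \<Phi> where \<Phi>: "diffeo_germ_onto \<Phi> U7 N" and WV: "W = dd \<Phi> 0 ` span {E 1, E 2, E 3}" "l1 = dd \<Phi> 0 ` span {E 2}"
  "l2 = dd \<Phi> 0 ` span {E 3}" "V = dd \<Phi> 0 ` span {E 1, E 3}" and f12: "f1 = \<Phi> \<circ> b1" "f2 = \<Phi> \<circ> b2"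
  using assms(4) unfolding U7_data_def by blast
 have f: "smooth_germ \<Phi>" "\<Phi> 0 = 0" "inj (dd \<Phi> 0)" using \<Phi> unfolding diffeo_germ_onto_iff by blast+
 have lD: "linear (dd \<Phi> 0)" by (rule has_derivative_linear[OF smooth_germ_has_derivative_0[OF f(1)]])
 \<comment> \<open>From here on every condition is expressed on U7 through the coefficients a1, ...,
   a7 of the restriction of \<sigma>.\<close>
 define \<sigma> where "\<sigma> = pullback \<Phi> \<omega>"
 have sy: "symp \<sigma>" unfolding \<sigma>_def by (rule symp_pullback[OF symplectic_symp[OF assms(2)] f])
 then have s: "form2_germ \<sigma>" "closed_germ \<sigma>" unfolding symp_def by blast+
 have b: "bilinear (\<sigma> 0)" "!!u. \<sigma> 0 u u = 0" using eventually_nhds_x_imp_x[OF form2_germ_bilinear[OF s(1)]] by blast+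
 have sw: "\<sigma> 0 u v = - \<sigma> 0 v u" for u v by (rule bilinear_alternating_swap[OF b])
 have s0: "\<omega> 0 (dd \<Phi> 0 u) (dd \<Phi> 0 v) = \<sigma> 0 u v" for u v by (simp add: \<sigma>_def pullback_def f(2))
 obtain a1 a2 a3 a4 a5 a6 a7 where a: "AN (%x u v. \<sigma> x u v - \<Theta> a1 a2 a3 a4 a5 a6 a7 x u v)"
  by (rule closed_algebraic_restriction[OF s]) (rule that)
 note a123 = leading_coefficients[OF a]
 let ?l = "level a1 a2 a3 a4 a5 a6 a7"
 have zs: "zero_on \<omega> (dd \<Phi> 0 ` span S) \<longleftrightarrow> (\<forall>u\<in>S. \<forall>v\<in>S. \<sigma> 0 u v = 0)" for S
  unfolding zero_on_def using zero_on_span[OF b(1), of S] by (simp add: s0)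
 have zV: "zero_on \<omega> V \<longleftrightarrow> a1 = 0" unfolding WV(4) zs using b(2) sw[of "E 3" "E 1"] a123 by auto
 have zW: "zero_on \<omega> W \<longleftrightarrow> a1 = 0 \<and> a2 = 0 \<and> a3 = 0"
  unfolding WV(1) zs using b(2) sw[of "E 3" "E 1"] sw[of "E 3" "E 2"] sw[of "E 2" "E 1"] a123 by auto
 have ll: "{u + v |u v. u \<in> l1 \<and> v \<in> l2} = dd \<Phi> 0 ` span {E 2, E 3}"
 proof -
  have "span {E 2, E 3} = {u + v |u v. u \<in> span {E 2} \<and> v \<in> span {E 3}}" using span_Un[of "{E 2}" "{E 3}"] by (simp add: insert_commute)
  then show ?thesis unfolding WV using linear_add[OF lD] by (simp add: image_def) (safe, metis+)
 qed
 have zl: "zero_on \<omega> {u + v |u v. u \<in> l1 \<and> v \<in> l2} \<longleftrightarrow> a2 = 0" unfolding ll zs using b(2) sw[of "E 3" "E 2"] a123 by auto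
 have "kernel_on \<omega> W = dd \<Phi> 0 ` {u \<in> span {E 1, E 2, E 3}. \<forall>v\<in>span {E 1, E 2, E 3}. \<sigma> 0 u v = 0}"
  unfolding kernel_on_def WV by (auto simp: s0)
 then have k: "kernel_on \<omega> W = l2 \<longleftrightarrow> a2 = 0 \<and> a3 \<noteq> 0" if "a1 = 0"
  using kernel_eq_l2_iff[OF b] that a123 unfolding WV by (simp add: inj_image_eq_iff[OF f(3)])
 \<comment> \<open>Every normal form of class i has level i, every form of level i is equivalent to
   one of them, and the level is invariant.\<close>
 have C: "N \<in> U7_class \<omega> i \<longleftrightarrow> ?l = i" if i: "i \<le> 7" for i
 proof
  assume "N \<in> U7_class \<omega> i"
  then obtain \<theta> where t: "\<theta> \<in> normal_forms ! i" "equivT \<sigma> \<theta>" unfolding U7_class_def germs_of_iff[OF \<Phi>] \<sigma>_def by blast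
  obtain c1 c2 c3 c4 c5 c6 c7 where c: "\<theta> = \<Theta> c1 c2 c3 c4 c5 c6 c7" "level c1 c2 c3 c4 c5 c6 c7 = i"
   by (rule normal_form_level[OF i t(1)]) (rule that)
  show "?l = i" using level_invariant(1)[OF sy a t(2)[unfolded c(1)]] c(2) by simp
 next
  assume "?l = i"
  then obtain \<theta> where "\<theta> \<in> normal_forms ! i" "equivT (\<Theta> a1 a2 a3 a4 a5 a6 a7) \<theta>"
   using normal_form_exists[of a1 a2 a3 a4 a5 a6 a7] by blast
  then show "N \<in> U7_class \<omega> i"
   unfolding U7_class_def germs_of_iff[OF \<Phi>] using equivT_trans[OF equivT_AN[OF a]] unfolding \<sigma>_def by blast
 qed
 have nf: "nf0 c1 c2 = \<Theta> 1 c1 c2 0 0 0 0" for c1 c2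
  by (intro ext) (simp add: \<Theta>_def nf0_def \<theta>1_def \<theta>2_def \<theta>3_def)
 \<comment> \<open>One argument for both parts of class 0: the condition P on c1 depends only on
   whether c1 = 0, and equivalence preserves whether the second coefficient vanishes.\<close>
 have C0: "N \<in> U7_germs_of \<omega> {nf0 c1 c2 |c1 c2. P c1} \<longleftrightarrow> a1 \<noteq> 0 \<and> P' " if P: "!!c1. (c1 = 0 \<longleftrightarrow> a2 = 0) ==> P c1 \<longleftrightarrow> P'" for P P'
 proof
  assume "N \<in> U7_germs_of \<omega> {nf0 c1 c2 |c1 c2. P c1}"
  then obtain c1 c2 where c: "P c1" "equivT \<sigma> (nf0 c1 c2)" unfolding germs_of_iff[OF \<Phi>] \<sigma>_def by blast
  then show "a1 \<noteq> 0 \<and> P'" using level_invariant(2,3)[OF sy a c(2)[unfolded nf]] P[of c1] by simp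
 next
  assume q: "a1 \<noteq> 0 \<and> P'"
  obtain c1 c2 where c: "equivT (\<Theta> a1 a2 a3 a4 a5 a6 a7) (nf0 c1 c2)" "c1 = 0 \<longleftrightarrow> a2 = 0"
   by (rule normal_form_0[OF conjunct1[OF q]]) (rule that)
  have "equivT \<sigma> (nf0 c1 c2)" by (rule equivT_trans[OF equivT_AN[OF a] c(1)])
  moreover have "P c1" using P[OF c(2)] q by blast
  ultimately show "N \<in> U7_germs_of \<omega> {nf0 c1 c2 |c1 c2. P c1}" unfolding germs_of_iff[OF \<Phi>] \<sigma>_def by blast
 qed
 have e: "{nf0 0 c2 |c2. True} = {nf0 c1 c2 |c1 c2. c1 = 0}" by blast
 have C0': "N \<in> U7_germs_of \<omega> {nf0 c1 c2 |c1 c2. c1 \<noteq> 0} \<longleftrightarrow> a1 \<noteq> 0 \<and> a2 \<noteq> 0"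
  "N \<in> U7_germs_of \<omega> {nf0 0 c2 |c2. True} \<longleftrightarrow> a1 \<noteq> 0 \<and> a2 = 0"
  unfolding e by (rule C0, simp)+
 note TT = tangency_transfer[OF \<Phi>, of \<omega>, folded \<sigma>_def f12]
 have T: "(zero_on \<omega> W \<and> Lt_eq \<omega> f1 f2 7 \<and> L2_eq \<omega> f2 7 \<longleftrightarrow> ?l = 3) \<and> (zero_on \<omega> W \<and> Lt_eq \<omega> f1 f2 8 \<and> L2_eq \<omega> f2 8 \<longleftrightarrow> ?l = 4) \<and>
   (zero_on \<omega> W \<and> Lt_eq \<omega> f1 f2 10 \<and> L2_eq \<omega> f2 \<infinity> \<longleftrightarrow> ?l = 5) \<and> (zero_on \<omega> W \<and> Lt_eq \<omega> f1 f2 11 \<and> L2_eq \<omega> f2 \<infinity> \<longleftrightarrow> ?l = 6) \<and>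
   (zero_on \<omega> W \<and> in_lagrangian \<omega> N \<longleftrightarrow> ?l = 7)"
 proof (cases "a1 = 0 \<and> a2 = 0 \<and> a3 = 0")
  case True
  then have z: "a1 = 0" "a2 = 0" "a3 = 0" by blast+
  show ?thesis unfolding TT zW using tangency_level[OF sy a[unfolded z]] by (simp add: z)
 next
  case False
  then show ?thesis unfolding zW level_def by auto
 qed
 have l: "?l = 0 \<longleftrightarrow> a1 \<noteq> 0" "?l = 1 \<longleftrightarrow> a1 = 0 \<and> a2 \<noteq> 0" "?l = 2 \<longleftrightarrow> a1 = 0 \<and> a2 = 0 \<and> a3 \<noteq> 0"
  unfolding level_def by simp_all
 \<comment> \<open>\<open>k\<close> presupposes a1 = 0, which is what the vanishing of \<omega> on V
   provides.\<close>
 have c1: "\<not> zero_on \<omega> W \<and> zero_on \<omega> V \<and> kernel_on \<omega> W \<noteq> l2 \<longleftrightarrow> ?l = 1" unfolding l zW zV using k by blast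
 have c2: "zero_on \<omega> V \<and> kernel_on \<omega> W = l2 \<longleftrightarrow> ?l = 2" unfolding l zV using k by blast
 show ?thesis
  using C[of 0] C[of 1] C[of 2] C[of 3] C[of 4] C[of 5] C[of 6] C[of 7] C0' T c1 c2 l(1) zV zl by simp
qed

end
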